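(* Let $a_1,a_2:\mathbf{R}^d\to\mathbf{R}^d$ be differentiable and suppose there are constants $c_1,c_2,c_3>0$ such that for $i=1,2$ and all $x,y\in\mathbf{R}^d$: $(a_i(x)-a_i(y))\cdot(x-y)\ge c_1|x-y|^2$, $|a_i(x)-a_i(y)|\le c_2|x-y|$, $|\partial a_i(x)-\partial a_i(y)|\le c_3|x-y|$. Let $a,b\ge0$ and consider the cost function $J(\Omega):=a\int_{\mathsf{D}}(u-u_d)^2\,dx+b\int_{\mathsf{D}}|\nabla(u-u_d)|^2\,dx$, where $u$ solves the state equation for $\Omega$. Let $u_0,p_0$ be the state and adjoint state for $\Omega$ as in the context, and assume $u_0\in C^{1,\alpha}(\overline{B_\delta(0)})$ and $p_0\in C^1(\overline{B_\delta(0)})$ for some $\delta>0$, $0<\alpha<1$, and $\nabla p_0\in L_\infty(\mathsf{D})^d$. Put $U_0:=\nabla u_0(0)$, $P_0:=\nabla p_0(0)$, and let $K$ be as in the context. Then the topological derivative of $J$ at $\Omega$ at the point $z=0$ exists and $$dJ(\Omega)(z)=\partial_\ell G(0,u_0,p_0)+R(u_0,p_0),$$ where $\partial_\ell G(0,u_0,p_0)=(a_1(U_0)-a_2(U_0))\cdot P_0$ and $$R(u_0,p_0)=\frac1{|\omega|}\int_{\mathbf{R}^d}\int_0^1\big(\partial_u\mathcal{A}_\omega(x,s\nabla K+U_0)(\nabla K)-\partial_u\mathcal{A}_\omega(x,U_0)(\nabla K)\big)\cdot P_0\,ds\,dx$$ $$\qquad+\frac1{|\omega|}\int_\omega(\partial_ua_1(U_0)-\partial_ua_2(U_0))(\nabla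 K)\cdot P_0\,dx+\frac{b}{|\omega|}\int_{\mathbf{R}^d}|\nabla K|^2\,dx.$$
   Context: Let $\mathsf{D}\subset\mathbf{R}^d$ be open and bounded, $f\in L_2(\mathsf{D})$, $u_d\in H^1_0(\mathsf{D})$, $\Omega\Subset\mathsf{D}$ open with $z:=0\in\mathsf{D}\setminus\overline\Omega$, and $\omega\subset\mathbf{R}^d$ open and bounded with $0\in\omega$. Put $\omega_\varepsilon:=\varepsilon\omega$ and let $\tau>0$ be such that $\omega_\varepsilon\Subset\mathsf{D}\setminus\overline\Omega$ for all $\varepsilon\in[0,\tau]$. The topological derivative at $z=0$ is $dJ(\Omega)(z):=\lim_{\varepsilon\searrow0}\frac{J(\Omega\cup\omega_\varepsilon)-J(\Omega)}{|\omega_\varepsilon|}$. For measurable $\Omega\subset\mathsf{D}$: $\mathcal{A}_\Omega(x,y):=a_1(y)$ for $x\in\Omega$ and $a_2(y)$ for $x\in\mathsf{D}\setminus\Omega$; the state equation for $\Omega$ is: find $u\in H^1_0(\mathsf{D})$ with $\int_{\mathsf{D}}\mathcal{A}_\Omega(x,\nabla u)\cdot\nabla\varphi\,dx=\int_{\mathsf{D}}f\varphi\,dx$ for all $\varphi\in H^1_0(\mathsf{D})$ (uniquely solvable). $\partial a_i=\partial_ua_i$ is the Jacobian of $a_i$, and $\partial_u\mathcal{A}(x,y)(v)$ is the derivative in the second argument at $(x,y)$ in direction $v$. $u_0$ is the state for $\Omega$, and $p_0\in H^1_0(\mathsf{D})$ is the unique solution of $\int_{\mathsf{D}}\partial_u\mathcal{A}_\Omega(x,\nabla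 u_0)(\nabla\varphi)\cdot\nabla p_0\,dx=-2a\int_{\mathsf{D}}(u_0-u_d)\varphi\,dx-2b\int_{\mathsf{D}}\nabla(u_0-u_d)\cdot\nabla\varphi\,dx$ for all $\varphi\in H^1_0(\mathsf{D})$. With $\Omega_\varepsilon:=\Omega\cup\omega_\varepsilon$ for $\varepsilon\in(0,\tau]$, $\Omega_0:=\Omega$, and $\ell(\varepsilon):=|\omega_\varepsilon|$, the Lagrangian is $G(\varepsilon,u,p):=a\int_{\mathsf{D}}(u-u_d)^2dx+b\int_{\mathsf{D}}|\nabla(u-u_d)|^2dx+\int_{\mathsf{D}}\mathcal{A}_{\Omega_\varepsilon}(x,\nabla u)\cdot\nabla p\,dx-\int_{\mathsf{D}}fp\,dx$ for $u,p\in H^1_0(\mathsf{D})$, and $\partial_\ell G(0,u_0,p_0):=\lim_{\varepsilon\searrow0}\frac{G(\varepsilon,u_0,p_0)-G(0,u_0,p_0)}{\ell(\varepsilon)}$. Let $u_\varepsilon$ be the state for $\Omega_\varepsilon$ and let the averaged adjoint state $p_\varepsilon\in H^1_0(\mathsf{D})$ be the unique solution of $\int_0^1\partial_uG(\varepsilon,su_\varepsilon+(1-s)u_0,p_\varepsilon)(\varphi)\,ds=0$ for all $\varphi\in H^1_0(\mathsf{D})$ ($\partial_uG$ being the derivative in the second argument); then $R(u_0,p_0):=\lim_{\varepsilon\searrow0}\frac{G(\varepsilon,u_0,p_\varepsilon)-G(\varepsilon,u_0,p_0)}{\ell(\varepsilon)}$. $\mathcal{A}_\omega(x,y):=a_1(y)\chi_\omega(x)+a_2(y)\chi_{\mathbf{R}^d\setminus\omega}(x)$.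 $BL(\mathbf{R}^d):=\{u\in H^1_{\mathrm{loc}}(\mathbf{R}^d):\nabla u\in L_2(\mathbf{R}^d)^d\}$, $\dot{BL}(\mathbf{R}^d):=BL(\mathbf{R}^d)/\mathbf{R}$ (quotient by constants). $K\in\dot{BL}(\mathbf{R}^d)$ is the unique solution of $\int_{\mathbf{R}^d}(\mathcal{A}_\omega(x,\nabla K+U_0)-\mathcal{A}_\omega(x,U_0))\cdot\nabla\varphi\,dx=-\int_\omega(a_1(U_0)-a_2(U_0))\cdot\nabla\varphi\,dx$ for all $\varphi\in BL(\mathbf{R}^d)$. *)

theory Defs
  imports "HOL-Analysis.Analysis"
begin

text \<open>Elements of the spaces below are functions, not classes modulo equality almost everywhere.
  A function that belongs to a space over \<open>D\<close> may take arbitrary values outside \<open>D\<close>.\<close>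

definition L2 :: "'a::euclidean_space set \<Rightarrow> ('a \<Rightarrow> 'b::euclidean_space) set" where
  "L2 D = {f. f \<in> borel_measurable (lebesgue_on D) \<and>
              integrable (lebesgue_on D) (\<lambda>x. (norm (f x))\<^sup>2)}"

definition L2_loc :: "'a::euclidean_space set \<Rightarrow> ('a \<Rightarrow> 'b::euclidean_space) set" where
  "L2_loc D = {f. \<forall>C. compact C \<longrightarrow> C \<subseteq> D \<longrightarrow> f \<in> L2 C}"

definition L1_loc :: "'a::euclidean_space set \<Rightarrow> ('a \<Rightarrow> 'b::euclidean_space) set" where
  "L1_loc D = {f. \<forall>C. compact C \<longrightarrow> C \<subseteq> D \<longrightarrow> integrable (lebesgue_on C) f}"

definition Linf :: "'a::euclidean_space set \<Rightarrow> ('a \<Rightarrow> 'b::euclidean_space) set" where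
  "Linf D = {f. f \<in> borel_measurable (lebesgue_on D) \<and>
                (\<exists>M. AE x in lebesgue_on D. norm (f x) \<le> M)}"

primrec Ck :: "nat \<Rightarrow> ('a::euclidean_space \<Rightarrow> real) \<Rightarrow> bool" where
  "Ck 0 f \<longleftrightarrow> continuous_on UNIV f"
| "Ck (Suc k) f \<longleftrightarrow> (\<forall>x. f differentiable (at x)) \<and>
                    (\<forall>i\<in>Basis. Ck k (\<lambda>x. frechet_derivative f (at x) i))"

definition test_functions :: "'a::euclidean_space set \<Rightarrow> ('a \<Rightarrow> real) set" where
  "test_functions D = {\<phi>. (\<forall>k. Ck k \<phi>) \<and> compact (closure {x. \<phi> x \<noteq> 0}) \<and>
                           closure {x. \<phi> x \<noteq> 0} \<subseteq> D}"

definition grad :: "('a::euclidean_space \<Rightarrow> real) \<Rightarrow> 'a \<Rightarrow> 'a" where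
  "grad u x = (\<Sum>i\<in>Basis. frechet_derivative u (at x) i *\<^sub>R i)"

definition is_weak_gradient ::
  "'a::euclidean_space set \<Rightarrow> ('a \<Rightarrow> real) \<Rightarrow> ('a \<Rightarrow> 'a) \<Rightarrow> bool" where
  "is_weak_gradient D u g \<longleftrightarrow> u \<in> L1_loc D \<and> g \<in> L1_loc D \<and>
     (\<forall>\<phi>\<in>test_functions D.
        (LINT x|lebesgue_on D. u x *\<^sub>R grad \<phi> x) = - (LINT x|lebesgue_on D. \<phi> x *\<^sub>R g x))"

text \<open>For open \<open>D\<close> a weak gradient is unique up to null sets of \<open>D\<close>, so the choice made
  here does not affect any of the integrals below.\<close>

definition wgrad :: "'a::euclidean_space set \<Rightarrow> ('a \<Rightarrow> real) \<Rightarrow> 'a \<Rightarrow> 'a" where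
  "wgrad D u = (SOME g. is_weak_gradient D u g)"

definition H1 :: "'a::euclidean_space set \<Rightarrow> ('a \<Rightarrow> real) set" where
  "H1 D = {u \<in> L2 D. \<exists>g\<in>L2 D. is_weak_gradient D u g}"

definition H1_norm :: "'a::euclidean_space set \<Rightarrow> ('a \<Rightarrow> real) \<Rightarrow> real" where
  "H1_norm D u = sqrt ((LINT x|lebesgue_on D. (u x)\<^sup>2) +
                       (LINT x|lebesgue_on D. (norm (wgrad D u x))\<^sup>2))"

definition H1_0 :: "'a::euclidean_space set \<Rightarrow> ('a \<Rightarrow> real) set" where
  "H1_0 D = {u \<in> H1 D. \<exists>\<phi>::nat \<Rightarrow> 'a \<Rightarrow> real. (\<forall>n. \<phi> n \<in> test_functions D) \<and>
                         (\<lambda>n. H1_norm D (\<lambda>x. u x - \<phi> n x)) \<longlonglongrightarrow> 0}"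

definition H1_loc :: "'a::euclidean_space set \<Rightarrow> ('a \<Rightarrow> real) set" where
  "H1_loc D = {u \<in> L2_loc D. \<exists>g\<in>L2_loc D. is_weak_gradient D u g}"

text \<open>Elements of the quotient of \<open>BL\<close> by the constants are represented by functions in
  \<open>BL\<close>; only their gradients are used.\<close>

definition BL :: "('a::euclidean_space \<Rightarrow> real) set" where
  "BL = {u \<in> H1_loc UNIV. wgrad UNIV u \<in> L2 UNIV}"

text \<open>For open \<open>S\<close>: the spaces \<open>C\<^sup>1\<close> and \<open>C\<^sup>1\<^sup>,\<^sup>\<alpha>\<close> of the closure of \<open>S\<close>, consisting of
  functions that together with their classical gradients on \<open>S\<close> extend continuously
  (Hoelder continuously for the gradient) to the closure.\<close>

definition C1_closure :: "'a::euclidean_space set \<Rightarrow> ('a \<Rightarrow> real) set" where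
  "C1_closure S = {u. continuous_on (closure S) u \<and>
     (\<exists>g. continuous_on (closure S) g \<and> (\<forall>x\<in>S. GDERIV u x :> g x))}"

definition C1_Hoelder_closure :: "real \<Rightarrow> 'a::euclidean_space set \<Rightarrow> ('a \<Rightarrow> real) set" where
  "C1_Hoelder_closure \<alpha> S = {u. continuous_on (closure S) u \<and>
     (\<exists>g. continuous_on (closure S) g \<and> (\<forall>x\<in>S. GDERIV u x :> g x) \<and>
          (\<exists>C. \<forall>x\<in>closure S. \<forall>y\<in>closure S. norm (g x - g y) \<le> C * norm (x - y) powr \<alpha>))}"

definition compactly_contained :: "'a::euclidean_space set \<Rightarrow> 'a set \<Rightarrow> bool" where
  "compactly_contained U V \<longleftrightarrow> compact (closure U) \<and> closure U \<subseteq> V"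

definition admissible_flux ::
  "real \<Rightarrow> real \<Rightarrow> real \<Rightarrow> ('a::euclidean_space \<Rightarrow> 'a) \<Rightarrow> bool" where
  "admissible_flux c1 c2 c3 a \<longleftrightarrow>
     (\<forall>x. a differentiable (at x)) \<and>
     (\<forall>x y. (a x - a y) \<bullet> (x - y) \<ge> c1 * (norm (x - y))\<^sup>2) \<and>
     (\<forall>x y. norm (a x - a y) \<le> c2 * norm (x - y)) \<and>
     (\<forall>x y. onorm (\<lambda>v. frechet_derivative a (at x) v - frechet_derivative a (at y) v)
              \<le> c3 * norm (x - y))"

text \<open>\<open>flux a1 a2 A\<close> serves both as \<open>\<A>\<^sub>\<Omega>\<close> (with \<open>A = \<Omega>\<close>) and as \<open>\<A>\<^sub>\<omega>\<close> (with \<open>A = \<omega>\<close>).\<close>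

definition flux ::
  "('a::euclidean_space \<Rightarrow> 'a) \<Rightarrow> ('a \<Rightarrow> 'a) \<Rightarrow> 'a set \<Rightarrow> 'a \<Rightarrow> 'a \<Rightarrow> 'a" where
  "flux a1 a2 A x y = (if x \<in> A then a1 y else a2 y)"

definition flux_deriv ::
  "('a::euclidean_space \<Rightarrow> 'a) \<Rightarrow> ('a \<Rightarrow> 'a) \<Rightarrow> 'a set \<Rightarrow> 'a \<Rightarrow> 'a \<Rightarrow> 'a \<Rightarrow> 'a" where
  "flux_deriv a1 a2 A x y v = frechet_derivative (\<lambda>y. flux a1 a2 A x y) (at y) v"

definition is_state ::
  "'a::euclidean_space set \<Rightarrow> ('a \<Rightarrow> real) \<Rightarrow> ('a \<Rightarrow> 'a) \<Rightarrow> ('a \<Rightarrow> 'a) \<Rightarrow> 'a set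
     \<Rightarrow> ('a \<Rightarrow> real) \<Rightarrow> bool" where
  "is_state D f a1 a2 \<Omega> u \<longleftrightarrow> u \<in> H1_0 D \<and>
     (\<forall>\<phi>\<in>H1_0 D. (LINT x|lebesgue_on D. flux a1 a2 \<Omega> x (wgrad D u x) \<bullet> wgrad D \<phi> x)
                  = (LINT x|lebesgue_on D. f x * \<phi> x))"

definition is_adjoint_state ::
  "'a::euclidean_space set \<Rightarrow> ('a \<Rightarrow> real) \<Rightarrow> real \<Rightarrow> real \<Rightarrow> ('a \<Rightarrow> 'a) \<Rightarrow> ('a \<Rightarrow> 'a) \<Rightarrow> 'a set
     \<Rightarrow> ('a \<Rightarrow> real) \<Rightarrow> ('a \<Rightarrow> real) \<Rightarrow> bool" where
  "is_adjoint_state D ud a b a1 a2 \<Omega> u0 p \<longleftrightarrow> p \<in> H1_0 D \<and>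
     (\<forall>\<phi>\<in>H1_0 D.
        (LINT x|lebesgue_on D. flux_deriv a1 a2 \<Omega> x (wgrad D u0 x) (wgrad D \<phi> x) \<bullet> wgrad D p x)
        = - 2 * a * (LINT x|lebesgue_on D. (u0 x - ud x) * \<phi> x)
          - 2 * b * (LINT x|lebesgue_on D. wgrad D (\<lambda>x. u0 x - ud x) x \<bullet> wgrad D \<phi> x))"

definition cost ::
  "'a::euclidean_space set \<Rightarrow> ('a \<Rightarrow> real) \<Rightarrow> real \<Rightarrow> real \<Rightarrow> ('a \<Rightarrow> real) \<Rightarrow> real" where
  "cost D ud a b u = a * (LINT x|lebesgue_on D. (u x - ud x)\<^sup>2)
     + b * (LINT x|lebesgue_on D. (norm (wgrad D (\<lambda>x. u x - ud x) x))\<^sup>2)"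

text \<open>The state is unique up to null sets of \<open>D\<close>, so the value does not depend on the choice.\<close>

definition shape_cost ::
  "'a::euclidean_space set \<Rightarrow> ('a \<Rightarrow> real) \<Rightarrow> ('a \<Rightarrow> real) \<Rightarrow> real \<Rightarrow> real
     \<Rightarrow> ('a \<Rightarrow> 'a) \<Rightarrow> ('a \<Rightarrow> 'a) \<Rightarrow> 'a set \<Rightarrow> real" where
  "shape_cost D f ud a b a1 a2 \<Omega> = cost D ud a b (SOME u. is_state D f a1 a2 \<Omega> u)"

definition scaled :: "'a::euclidean_space set \<Rightarrow> real \<Rightarrow> 'a set" where
  "scaled \<omega> \<epsilon> = (\<lambda>x. \<epsilon> *\<^sub>R x) ` \<omega>"

definition perturbed :: "'a::euclidean_space set \<Rightarrow> 'a set \<Rightarrow> real \<Rightarrow> 'a set" where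
  "perturbed \<Omega> \<omega> \<epsilon> = (if \<epsilon> = 0 then \<Omega> else \<Omega> \<union> scaled \<omega> \<epsilon>)"

definition vol :: "'a::euclidean_space set \<Rightarrow> real \<Rightarrow> real" where
  "vol \<omega> \<epsilon> = measure lebesgue (scaled \<omega> \<epsilon>)"

definition has_topological_derivative ::
  "('a::euclidean_space set \<Rightarrow> real) \<Rightarrow> 'a set \<Rightarrow> 'a set \<Rightarrow> real \<Rightarrow> bool" where
  "has_topological_derivative J \<Omega> \<omega> L \<longleftrightarrow>
     ((\<lambda>\<epsilon>. (J (\<Omega> \<union> scaled \<omega> \<epsilon>) - J \<Omega>) / measure lebesgue (scaled \<omega> \<epsilon>)) \<longlongrightarrow> L) (at_right 0)"

definition Lagrangian ::
  "'a::euclidean_space set \<Rightarrow> ('a \<Rightarrow> real) \<Rightarrow> ('a \<Rightarrow> real) \<Rightarrow> real \<Rightarrow> real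
     \<Rightarrow> ('a \<Rightarrow> 'a) \<Rightarrow> ('a \<Rightarrow> 'a) \<Rightarrow> 'a set \<Rightarrow> 'a set
     \<Rightarrow> real \<Rightarrow> ('a \<Rightarrow> real) \<Rightarrow> ('a \<Rightarrow> real) \<Rightarrow> real" where
  "Lagrangian D f ud a b a1 a2 \<Omega> \<omega> \<epsilon> u p =
     a * (LINT x|lebesgue_on D. (u x - ud x)\<^sup>2)
     + b * (LINT x|lebesgue_on D. (norm (wgrad D (\<lambda>x. u x - ud x) x))\<^sup>2)
     + (LINT x|lebesgue_on D. flux a1 a2 (perturbed \<Omega> \<omega> \<epsilon>) x (wgrad D u x) \<bullet> wgrad D p x)
     - (LINT x|lebesgue_on D. f x * p x)"

text \<open>The derivative in the second argument, at \<open>u\<close> in direction \<open>\<phi>\<close>, as a Gateaux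
  derivative; \<open>G\<close> stands for \<open>G(\<epsilon>, \<cdot>, p)\<close>.\<close>

definition dir_deriv :: "(('a \<Rightarrow> real) \<Rightarrow> real) \<Rightarrow> ('a \<Rightarrow> real) \<Rightarrow> ('a \<Rightarrow> real) \<Rightarrow> real" where
  "dir_deriv G u \<phi> = deriv (\<lambda>t. G (\<lambda>x. u x + t * \<phi> x)) 0"

definition is_averaged_adjoint ::
  "'a::euclidean_space set \<Rightarrow> (real \<Rightarrow> ('a \<Rightarrow> real) \<Rightarrow> ('a \<Rightarrow> real) \<Rightarrow> real)
     \<Rightarrow> real \<Rightarrow> ('a \<Rightarrow> real) \<Rightarrow> ('a \<Rightarrow> real) \<Rightarrow> ('a \<Rightarrow> real) \<Rightarrow> bool" where
  "is_averaged_adjoint D G \<epsilon> u0 u p \<longleftrightarrow> p \<in> H1_0 D \<and>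
     (\<forall>\<phi>\<in>H1_0 D. (LINT s|lebesgue_on {0..1}.
        dir_deriv (\<lambda>v. G \<epsilon> v p) (\<lambda>x. s * u x + (1 - s) * u0 x) \<phi>) = 0)"

definition is_corrector ::
  "('a::euclidean_space \<Rightarrow> 'a) \<Rightarrow> ('a \<Rightarrow> 'a) \<Rightarrow> 'a set \<Rightarrow> 'a \<Rightarrow> ('a \<Rightarrow> real) \<Rightarrow> bool" where
  "is_corrector a1 a2 \<omega> U0 K \<longleftrightarrow> K \<in> BL \<and>
     (\<forall>\<phi>\<in>BL. (LINT x|lebesgue. (flux a1 a2 \<omega> x (wgrad UNIV K x + U0) - flux a1 a2 \<omega> x U0)
                                 \<bullet> wgrad UNIV \<phi> x)
              = - (LINT x|lebesgue_on \<omega>. (a1 U0 - a2 U0) \<bullet> wgrad UNIV \<phi> x))"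

end

theory Submission
  imports Defs
begin

text \<open>Let \<open>w\<close> be the difference of the states for \<open>\<Omega> \<union> \<epsilon>\<omega>\<close> and \<open>\<Omega>\<close>. The averaged adjoint equation
  tested with \<open>w\<close> gives \<open>G \<epsilon> u0 p\<^sub>\<epsilon> = G \<epsilon> u\<^sub>\<epsilon> p\<^sub>\<epsilon> = J(\<Omega> \<union> \<epsilon>\<omega>) = G \<epsilon> u\<^sub>\<epsilon> p0\<close>, so the quotient defining
  \<open>R\<close> involves only \<open>w\<close> and the unperturbed adjoint \<open>p0\<close>. The adjoint equation cancels its terms linear
  in \<open>w\<close>, apart from the jump of the flux derivative on \<open>\<epsilon>\<omega>\<close>, and what remains is quadratic in \<open>\<nabla>w\<close>.
  The limit therefore follows from the strong convergence of \<open>y \<mapsto> \<nabla>w(\<epsilon>y)\<close> to \<open>\<nabla>K\<close> in \<open>L2\<close> and from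
  \<open>\<integral>w\<^sup>2 = o(\<epsilon>\<^sup>d)\<close>. Both are consequences of strong monotonicity: \<open>\<nabla>K\<close> is approximated by \<open>\<nabla>\<psi>\<close> with a test
  function \<open>\<psi>\<close>, and the state equations and the rescaled corrector equation are tested with
  \<open>w - \<epsilon>\<psi>(\<cdot>/\<epsilon>)\<close>. The approximation exists in every dimension because a curl free and weakly
  divergence free field in \<open>L2\<close> vanishes.\<close>

subsection \<open>Smooth functions\<close>

text \<open>The corrector is controlled only through \<open>\<nabla>K\<close> in \<open>L2\<close>:
  \<open>K\<close> itself need be neither square integrable nor zero near the boundary of
  \<open>D\<close>, so its rescaling cannot be inserted into the state equation. A compactly
  supported \<open>\<psi>\<close> can, once \<open>\<epsilon>\<close> is small, and
  \<open>\<epsilon>\<psi>(\<cdot>/\<epsilon>)\<close> has \<open>L2\<close> norm of order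
  \<open>\<epsilon>\<close> times that of its gradient; with the Poincare inequality this yields the
  smallness of \<open>w\<close>. Cutting \<open>K\<close> off at infinity would require growth
  estimates that depend on the dimension. Minimising the distance to gradients of test functions
  avoids them and leaves a Liouville statement for \<open>L2\<close> fields, proved with explicit
  radial test functions: the averages against them obey a scalar differential equation in the radius
  parameter, and \<open>L2\<close> integrability on growing balls forces them to vanish. The
  quadratic remainders are merely in \<open>L1\<close>, so they can be paired with
  \<open>\<nabla>p0\<close> only because this is bounded. Values at \<open>0\<close> make sense
  after \<open>wgrad\<close>, determined only up to null sets, has been exchanged near the origin
  for the classical gradient.\<close>

lemma Ck_SucI:
  fixes f :: "'a::euclidean_space \<Rightarrow> real"
  assumes "\<And>x. (f has_derivative f' x) (at x)" "\<And>i. i \<in> Basis \<Longrightarrow> Ck k (\<lambda>x. f' x i)"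
  shows "Ck (Suc k) f"
proof -
  have "frechet_derivative f (at x) = f' x" for x
    using frechet_derivative_at[OF assms(1)] by simp
  with assms show ?thesis by (auto simp: differentiable_def)
qed

lemma Ck_Suc_has_derivative:
  fixes f :: "'a::euclidean_space \<Rightarrow> real"
  shows "Ck (Suc k) f \<Longrightarrow> (f has_derivative frechet_derivative f (at x)) (at x)"
  by (simp add: frechet_derivative_works)

lemma Ck_Suc_partial:
  "Ck (Suc k) f \<Longrightarrow> i \<in> Basis \<Longrightarrow> Ck k (\<lambda>x. frechet_derivative f (at x) i)"
  by simp

lemma Ck_mono_Suc: "Ck (Suc k) f \<Longrightarrow> Ck k f"
proof (induction k arbitrary: f)
  case 0
  then show ?case
    by (auto intro!: continuous_at_imp_continuous_on differentiable_imp_continuous_within)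
next
  case (Suc k)
  show ?case
    by (rule Ck_SucI[OF Ck_Suc_has_derivative[OF Suc.prems]])
       (rule Suc.IH[OF Ck_Suc_partial[OF Suc.prems]])
qed

lemma Ck_const: "Ck k (\<lambda>x::'a::euclidean_space. c)"
proof (induction k arbitrary: c)
  case (Suc k)
  show ?case by (rule Ck_SucI[where f'="\<lambda>_ _. 0"]) (auto intro: Suc)
qed auto

lemma Ck_inner: "Ck k (\<lambda>x::'a::euclidean_space. x \<bullet> b)"
proof (cases k)
  case (Suc k')
  show ?thesis unfolding Suc
    by (rule Ck_SucI[where f'="\<lambda>_ h. h \<bullet> b"]) (auto intro!: derivative_eq_intros Ck_const)
qed (auto intro!: continuous_intros)

lemma Ck_add: "Ck k f \<Longrightarrow> Ck k g \<Longrightarrow> Ck k (\<lambda>x. f x + g x)"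
proof (induction k arbitrary: f g)
  case (Suc k)
  note d = Ck_Suc_has_derivative[OF Suc.prems(1)] Ck_Suc_has_derivative[OF Suc.prems(2)]
  show ?case
    by (rule Ck_SucI[OF has_derivative_add[OF d]])
       (intro Suc.IH Ck_Suc_partial Suc.prems)
qed (auto intro!: continuous_intros)

lemma Ck_mult: "Ck k f \<Longrightarrow> Ck k g \<Longrightarrow> Ck k (\<lambda>x. f x * g x)"
proof (induction k arbitrary: f g)
  case (Suc k)
  note d = Ck_Suc_has_derivative[OF Suc.prems(1)] Ck_Suc_has_derivative[OF Suc.prems(2)]
  show ?case
    by (rule Ck_SucI[OF has_derivative_mult[OF d]])
       (intro Ck_add Suc.IH Ck_Suc_partial Suc.prems Ck_mono_Suc[OF Suc.prems(1)] Ck_mono_Suc[OF Suc.prems(2)])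
qed (auto intro!: continuous_intros)

lemma Ck_cmult: "Ck k f \<Longrightarrow> Ck k (\<lambda>x. c * f x)"
  by (intro Ck_mult Ck_const)

lemma Ck_diff: "Ck k f \<Longrightarrow> Ck k g \<Longrightarrow> Ck k (\<lambda>x. f x - g x)"
  using Ck_add[of k f "\<lambda>x. (-1) * g x"] Ck_cmult[of k g "-1"] by simp

lemma Ck_sum: "(\<And>i. i \<in> I \<Longrightarrow> Ck k (f i)) \<Longrightarrow> Ck k (\<lambda>x. \<Sum>i\<in>I. f i x)"
  by (induction I rule: infinite_finite_induct) (auto intro: Ck_const Ck_add)

lemma Ck_dist_square: "Ck k (\<lambda>x::'a::euclidean_space. (norm (x - x0))\<^sup>2)"
proof -
  have eq: "(\<lambda>x::'a. (norm (x - x0))\<^sup>2) = (\<lambda>x. \<Sum>i\<in>Basis. (x \<bullet> i - x0 \<bullet> i) * (x \<bullet> i - x0 \<bullet> i))"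
    by (rule ext, subst power2_norm_eq_inner, subst euclidean_inner) (simp add: inner_diff_left)
  show ?thesis unfolding eq
    by (intro Ck_sum Ck_mult Ck_diff Ck_inner Ck_const)
qed

lemma Ck_scale: "Ck k f \<Longrightarrow> Ck k (\<lambda>x. f (c *\<^sub>R x))"
proof (induction k arbitrary: f)
  case 0
  then show ?case
    by (auto intro!: continuous_intros continuous_on_compose2[of UNIV f])
next
  case (Suc k)
  show ?case
  proof (rule Ck_SucI[where f'="\<lambda>x h. c * frechet_derivative f (at (c *\<^sub>R x)) h"])
    fix x
    have "((\<lambda>x. f (c *\<^sub>R x)) has_derivative (\<lambda>h. frechet_derivative f (at (c *\<^sub>R x)) (c *\<^sub>R h))) (at x)"
      by (rule has_derivative_compose[OF _ Ck_Suc_has_derivative[OF Suc.prems]])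
         (auto intro!: derivative_eq_intros)
    moreover have "linear (frechet_derivative f (at (c *\<^sub>R x)))"
      by (rule has_derivative_linear[OF Ck_Suc_has_derivative[OF Suc.prems]])
    ultimately show "((\<lambda>x. f (c *\<^sub>R x)) has_derivative (\<lambda>h. c * frechet_derivative f (at (c *\<^sub>R x)) h)) (at x)"
      by (simp add: linear_cmul)
  qed (intro Ck_cmult Suc.IH Ck_Suc_partial Suc.prems)
qed

text \<open>The case \<open>n = 0\<close> is the classical smooth cutoff
  \<open>exp (- 1 / t)\<close>. The power of \<open>t\<close> in the denominator is carried along
  because it closes the family under differentiation up to linear combinations, so smoothness
  becomes an induction inside the family.\<close>

definition bump :: "nat \<Rightarrow> real \<Rightarrow> real" where
  "bump n t = (if t > 0 then exp (- 1 / t) / t ^ n else 0)"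

text \<open>Since \<open>bump n 0 = 0\<close>, this is the difference quotient at the origin, the
  one point that the calculus rules on the two half lines do not reach. With
  \<open>s = 1 / t\<close> it becomes \<open>s ^ (n + 1) / exp s\<close> for
  \<open>t > 0\<close>.\<close>

lemma bump_over_tendsto_0: "((\<lambda>t. bump n t / t) \<longlongrightarrow> 0) (at 0)"
proof -
  have "((\<lambda>t::real. (inverse t) ^ Suc n / exp (inverse t)) \<longlongrightarrow> 0) (at_right 0)"
    by (rule filterlim_compose[OF tendsto_power_div_exp_0 filterlim_inverse_at_top_right])
  moreover have "eventually (\<lambda>t. (inverse t) ^ Suc n / exp (inverse t) = bump n t / t) (at_right 0)"
    using eventually_at_right_less[of "0::real"]
    by eventually_elim (simp add: bump_def exp_minus field_simps)
  ultimately have "((\<lambda>t. bump n t / t) \<longlongrightarrow> 0) (at_right 0)"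
    by (rule Lim_transform_eventually)
  moreover have "eventually (\<lambda>t. 0 = bump n t / t) (at_left 0)"
    by (auto simp: eventually_at_filter bump_def)
  then have "((\<lambda>t. bump n t / t) \<longlongrightarrow> 0) (at_left 0)"
    by (rule Lim_transform_eventually[OF tendsto_const])
  ultimately show ?thesis
    by (simp add: filterlim_at_split)
qed

lemma bump_deriv:
  "(bump n has_real_derivative (bump (n + 2) t - n * bump (n + 1) t)) (at t)"
proof -
  consider "t > 0" | "t < 0" | "t = 0" by linarith
  then show ?thesis
  proof cases
    case 1
    have "((\<lambda>t. exp (- 1 / t) / t ^ n) has_real_derivative (bump (n + 2) t - n * bump (n + 1) t)) (at t)"
    proof -
      \<comment> \<open>At \<open>n = 0\<close> the subtraction truncates to the exponent
        \<open>0\<close>; the factor \<open>real n\<close> makes both sides vanish there.\<close>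
      have key: "real n * t ^ (n - Suc 0) = real n * t ^ n / t"
        using 1 by (cases n) auto
      have "((\<lambda>t. exp (- 1 / t) / t ^ n) has_real_derivative
          (exp (- 1 / t) * (1 / t\<^sup>2) * t ^ n - exp (- 1 / t) * (real n * t ^ (n - Suc 0))) / (t ^ n * t ^ n)) (at t)"
        using 1 by (auto intro!: derivative_eq_intros simp: power2_eq_square)
      then show ?thesis
        unfolding key by (rule DERIV_cong) (use 1 in \<open>simp add: bump_def field_simps power2_eq_square\<close>)
    qed
    then show ?thesis
      by (rule DERIV_cong_ev[OF refl _ refl, THEN iffD1, rotated])
         (use 1 eventually_nhds_in_open[of "{0<..}" t] in \<open>auto elim!: eventually_mono simp: bump_def\<close>)
  next
    case 2
    have "((\<lambda>t. 0) has_real_derivative (bump (n + 2) t - n * bump (n + 1) t)) (at t)"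
      using 2 by (simp add: bump_def)
    then show ?thesis
      by (rule DERIV_cong_ev[OF refl _ refl, THEN iffD1, rotated])
         (use 2 eventually_nhds_in_open[of "{..<0}" t] in \<open>auto elim!: eventually_mono simp: bump_def\<close>)
  next
    case 3
    then show ?thesis
      using bump_over_tendsto_0[of n] by (simp add: DERIV_def bump_def)
  qed
qed

text \<open>The induction on \<open>k\<close> has to range over all \<open>n\<close>, because each
  partial derivative is a combination of bumps with larger exponents, multiplied by a partial
  derivative of \<open>q\<close>.\<close>

lemma Ck_bump:
  assumes "\<And>k. Ck k q"
  shows "Ck k (\<lambda>x. bump n (q x))"
proof (induction k arbitrary: n)
  have q: "(q has_derivative frechet_derivative q (at x)) (at x)" for x
    using Ck_Suc_has_derivative[of 0 q] assms by blast
  have der: "((\<lambda>x. bump n (q x)) has_derivative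
      (\<lambda>h. (bump (n + 2) (q x) - n * bump (n + 1) (q x)) * frechet_derivative q (at x) h)) (at x)" for x n
    using has_derivative_compose[OF q bump_deriv[unfolded has_field_derivative_def]] by simp
  {
    case 0
    then show ?case
      using der by (auto intro!: continuous_at_imp_continuous_on has_derivative_continuous)
  next
    case (Suc k)
    show ?case
      by (rule Ck_SucI[OF der])
         (intro Ck_mult Ck_diff Ck_cmult Suc Ck_Suc_partial assms)
  }
qed

subsection \<open>Test functions\<close>

lemma test_functions_has_derivative:
  "\<phi> \<in> test_functions D \<Longrightarrow> (\<phi> has_derivative frechet_derivative \<phi> (at x)) (at x)"
  using Ck_Suc_has_derivative[of 0] unfolding test_functions_def by blast

lemma test_functionsI:
  assumes "\<And>k. Ck k \<phi>" "\<And>x. x \<notin> S \<Longrightarrow> \<phi> x = 0" "compact S" "S \<subseteq> D"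
  shows "\<phi> \<in> test_functions D"
proof -
  have "closure {x. \<phi> x \<noteq> 0} \<subseteq> S"
    using assms by (intro closure_minimal) (auto dest: compact_imp_closed)
  then have "compact (closure {x. \<phi> x \<noteq> 0})"
    by (meson assms(3) closed_closure compact_closure compact_imp_bounded bounded_subset
        closure_subset bounded_closure compact_eq_bounded_closed)
  with \<open>closure {x. \<phi> x \<noteq> 0} \<subseteq> S\<close> assms show ?thesis
    by (auto simp: test_functions_def)
qed

lemma frechet_derivative_eq_0:
  fixes \<phi> :: "'a::euclidean_space \<Rightarrow> real"
  assumes "closed S" "\<And>x. x \<notin> S \<Longrightarrow> \<phi> x = 0" "x \<notin> S"
  shows "frechet_derivative \<phi> (at x) = (\<lambda>_. 0)"
proof -
  have "(\<phi> has_derivative (\<lambda>_. 0)) (at x)"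
    by (rule has_derivative_transform_within_open[of "\<lambda>_. 0" _ x UNIV "- S"])
       (use assms in \<open>auto simp: open_Compl\<close>)
  from frechet_derivative_at[OF this] show ?thesis by simp
qed

lemma test_functionsE:
  assumes "\<phi> \<in> test_functions D"
  obtains S where "compact S" "S \<subseteq> D" "\<And>x. x \<notin> S \<Longrightarrow> \<phi> x = 0"
    "\<And>x h. x \<notin> S \<Longrightarrow> frechet_derivative \<phi> (at x) h = 0"
proof -
  define S where "S = closure {x. \<phi> x \<noteq> 0}"
  have 1: "compact S" "S \<subseteq> D"
    using assms by (auto simp: test_functions_def S_def)
  have "{x. \<phi> x \<noteq> 0} \<subseteq> S"
    unfolding S_def by (rule closure_subset)
  then have 2: "\<phi> x = 0" if "x \<notin> S" for x
    using that by blast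
  have 3: "frechet_derivative \<phi> (at x) h = 0" if "x \<notin> S" for x h
    using frechet_derivative_eq_0[OF compact_imp_closed[OF 1(1)] 2 that] by simp
  show thesis
    by (rule that[OF 1 2 3])
qed

lemma test_functions_mono: "D \<subseteq> E \<Longrightarrow> test_functions D \<subseteq> test_functions E"
  by (auto simp: test_functions_def)

lemma test_functions_partial:
  assumes "\<phi> \<in> test_functions D" "i \<in> Basis"
  shows "(\<lambda>x. frechet_derivative \<phi> (at x) i) \<in> test_functions D"
proof -
  obtain S where S: "compact S" "S \<subseteq> D" "\<And>x h. x \<notin> S \<Longrightarrow> frechet_derivative \<phi> (at x) h = 0"
    by (rule test_functionsE[OF assms(1)]) blast
  have "Ck k (\<lambda>x. frechet_derivative \<phi> (at x) i)" for k
    using assms Ck.simps(2)[of k \<phi>] unfolding test_functions_def by blast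
  with S show ?thesis by (intro test_functionsI[of _ S])
qed

lemma test_functions_mult:
  assumes "\<phi> \<in> test_functions D" "\<And>k. Ck k g"
  shows "(\<lambda>x. g x * \<phi> x) \<in> test_functions D"
proof -
  obtain S where "compact S" "S \<subseteq> D" "\<And>x. x \<notin> S \<Longrightarrow> \<phi> x = 0"
    by (rule test_functionsE[OF assms(1)]) blast
  with assms show ?thesis
    by (intro test_functionsI[of _ S] Ck_mult) (auto simp: test_functions_def)
qed

lemma test_functions_add:
  assumes "\<phi> \<in> test_functions D" "\<psi> \<in> test_functions D"
  shows "(\<lambda>x. \<phi> x + \<psi> x) \<in> test_functions D"
proof -
  obtain S where S: "compact S" "S \<subseteq> D" "\<And>x. x \<notin> S \<Longrightarrow> \<phi> x = 0"
    by (rule test_functionsE[OF assms(1)]) blast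
  obtain T where T: "compact T" "T \<subseteq> D" "\<And>x. x \<notin> T \<Longrightarrow> \<psi> x = 0"
    by (rule test_functionsE[OF assms(2)]) blast
  show ?thesis
    by (rule test_functionsI[of _ "S \<union> T"])
       (use S T assms in \<open>auto intro!: Ck_add simp: test_functions_def\<close>)
qed

lemma test_functions_scale:
  assumes "\<phi> \<in> test_functions D" "c \<noteq> 0"
  shows "(\<lambda>x. \<phi> (c *\<^sub>R x)) \<in> test_functions ((\<lambda>x. inverse c *\<^sub>R x) ` D)"
proof -
  obtain S where S: "compact S" "S \<subseteq> D" "\<And>x. x \<notin> S \<Longrightarrow> \<phi> x = 0"
    by (rule test_functionsE[OF assms(1)]) blast
  have "\<phi> (c *\<^sub>R x) = 0" if "x \<notin> (\<lambda>x. inverse c *\<^sub>R x) ` S" for x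
  proof (rule S(3), rule notI)
    assume "c *\<^sub>R x \<in> S"
    then have "inverse c *\<^sub>R (c *\<^sub>R x) \<in> (\<lambda>x. inverse c *\<^sub>R x) ` S" by blast
    with that assms(2) show False by simp
  qed
  with S assms show ?thesis
    by (intro test_functionsI[of _ "(\<lambda>x. inverse c *\<^sub>R x) ` S"])
       (auto intro!: Ck_scale compact_scaling simp: test_functions_def)
qed

lemma grad_inner: "i \<in> Basis \<Longrightarrow> grad \<phi> x \<bullet> i = frechet_derivative \<phi> (at x) i"
  by (simp add: grad_def inner_sum_left_Basis)

lemma frechet_eq_grad:
  assumes "\<phi> differentiable (at x)"
  shows "frechet_derivative \<phi> (at x) h = grad \<phi> x \<bullet> h"
proof -
  have lin: "linear (frechet_derivative \<phi> (at x))"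
    by (rule linear_frechet_derivative[OF assms])
  have "frechet_derivative \<phi> (at x) h = frechet_derivative \<phi> (at x) (\<Sum>i\<in>Basis. (h \<bullet> i) *\<^sub>R i)"
    by (simp add: euclidean_representation)
  also have "\<dots> = (\<Sum>i\<in>Basis. (h \<bullet> i) * frechet_derivative \<phi> (at x) i)"
    by (simp add: linear_sum[OF lin] linear_cmul[OF lin])
  also have "\<dots> = grad \<phi> x \<bullet> h"
    unfolding grad_def inner_sum_left inner_scaleR_left
    by (intro sum.cong refl) (simp add: inner_commute mult.commute)
  finally show ?thesis .
qed

lemma grad_eqI:
  assumes "(\<phi> has_derivative (\<lambda>h. g \<bullet> h)) (at x)"
  shows "grad \<phi> x = g"
proof -
  have "frechet_derivative \<phi> (at x) i = g \<bullet> i" for i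
    using frechet_derivative_at[OF assms] by metis
  then show ?thesis by (simp add: grad_def euclidean_representation)
qed

lemma test_functions_has_grad:
  "\<phi> \<in> test_functions D \<Longrightarrow> (\<phi> has_derivative (\<lambda>h. grad \<phi> x \<bullet> h)) (at x)"
proof -
  assume "\<phi> \<in> test_functions D"
  note d = test_functions_has_derivative[OF this]
  have "frechet_derivative \<phi> (at x) = (\<lambda>h. grad \<phi> x \<bullet> h)"
    using frechet_eq_grad[OF differentiableI[OF d]] by (rule ext)
  with d[of x] show ?thesis by simp
qed

lemma continuous_on_test_function: "\<phi> \<in> test_functions D \<Longrightarrow> continuous_on S \<phi>"
  by (meson continuous_at_imp_continuous_on has_derivative_continuous test_functions_has_derivative)

lemma continuous_on_grad_test: "\<phi> \<in> test_functions D \<Longrightarrow> continuous_on S (grad \<phi>)"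
  unfolding grad_def
  by (intro continuous_intros continuous_on_test_function[OF test_functions_partial])

lemma grad_test_support:
  assumes "\<phi> \<in> test_functions D"
  obtains S where "compact S" "S \<subseteq> D" "\<And>x. x \<notin> S \<Longrightarrow> \<phi> x = 0" "\<And>x. x \<notin> S \<Longrightarrow> grad \<phi> x = 0"
proof -
  obtain S where "compact S" "S \<subseteq> D" "\<And>x. x \<notin> S \<Longrightarrow> \<phi> x = 0"
    "\<And>x h. x \<notin> S \<Longrightarrow> frechet_derivative \<phi> (at x) h = 0"
    using test_functionsE[OF assms] by blast
  then show thesis by (intro that[of S]) (simp_all add: grad_def)
qed

subsection \<open>Lebesgue integrals\<close>

lemma lebesgue_affine_density:
  fixes t :: "'a::euclidean_space"
  assumes "c \<noteq> 0"
  shows "lebesgue = density (distr lebesgue lebesgue (\<lambda>x. t + c *\<^sub>R x)) (\<lambda>_. ennreal (\<bar>c\<bar> ^ DIM('a)))"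
  using lebesgue_affine_euclidean[where c="\<lambda>_::'a. c" and t=t] assms
  unfolding scaleR_scaleR[symmetric] scaleR_sum_right[symmetric] euclidean_representation prod_constant by simp

lemma measurable_lebesgue_affine:
  fixes t :: "'a::euclidean_space"
  assumes "c \<noteq> 0"
  shows "(\<lambda>x. t + c *\<^sub>R x) \<in> lebesgue \<rightarrow>\<^sub>M lebesgue"
  using lebesgue_affine_measurable[where c="\<lambda>_::'a. c" and t=t] assms
  unfolding scaleR_scaleR[symmetric] scaleR_sum_right[symmetric] euclidean_representation by simp

lemma borel_measurable_affine:
  fixes t :: "'a::euclidean_space"
  assumes "c \<noteq> 0" "f \<in> borel_measurable lebesgue"
  shows "(\<lambda>x. f (t + c *\<^sub>R x)) \<in> borel_measurable lebesgue"
  using measurable_compose[OF measurable_lebesgue_affine[OF assms(1)] assms(2)] .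

text \<open>The single change of variables of the development: \<open>c = 1\<close> gives
  translation invariance, \<open>t = 0\<close> the blow up and blow down by
  \<open>\<epsilon>\<close>.\<close>

lemma has_bochner_integral_affine:
  fixes t :: "'a::euclidean_space" and f :: "'a \<Rightarrow> 'b::euclidean_space"
  assumes "c \<noteq> 0" "integrable lebesgue f"
  shows "has_bochner_integral lebesgue (\<lambda>x. f (t + c *\<^sub>R x)) (integral\<^sup>L lebesgue f /\<^sub>R \<bar>c\<bar> ^ DIM('a))"
proof -
  let ?T = "\<lambda>x. t + c *\<^sub>R x" and ?k = "\<bar>c\<bar> ^ DIM('a)"
  have T: "?T \<in> lebesgue \<rightarrow>\<^sub>M lebesgue"
    by (rule measurable_lebesgue_affine[OF assms(1)])
  have f: "f \<in> borel_measurable lebesgue"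
    using assms by auto
  have f': "f \<in> borel_measurable (distr lebesgue lebesgue ?T)"
    using f by simp
  have k: "?k > 0"
    using assms by simp
  have 1: "integrable (density (distr lebesgue lebesgue ?T) (\<lambda>_. ennreal ?k)) f"
    using assms(2) lebesgue_affine_density[OF assms(1), of t] by simp
  then have "integrable (distr lebesgue lebesgue ?T) (\<lambda>x. ?k *\<^sub>R f x)"
    by (subst (asm) integrable_density) (use f k in auto)
  then have i: "integrable lebesgue (\<lambda>x. f (?T x))"
    using k integrable_scaleR_right[of "inverse ?k" lebesgue "\<lambda>x. ?k *\<^sub>R f (?T x)"]
    by (subst (asm) integrable_distr_eq[OF T]) (use f in simp_all)
  have "integral\<^sup>L lebesgue f = integral\<^sup>L (density (distr lebesgue lebesgue ?T) (\<lambda>_. ennreal ?k)) f"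
    using lebesgue_affine_density[OF assms(1), of t] by simp
  also have "\<dots> = ?k *\<^sub>R (LINT x|distr lebesgue lebesgue ?T. f x)"
    by (subst integral_density) (use f k in auto)
  also have "(LINT x|distr lebesgue lebesgue ?T. f x) = (LINT x|lebesgue. f (?T x))"
    by (rule integral_distr[OF T f])
  finally show ?thesis
    using i k by (simp add: has_bochner_integral_iff)
qed

lemma AE_lebesgue_affine:
  fixes t :: "'a::euclidean_space"
  assumes "c \<noteq> 0" "AE x in lebesgue. P x"
  shows "AE x in lebesgue. P (t + c *\<^sub>R x)"
proof -
  let ?T = "\<lambda>x. t + c *\<^sub>R x" and ?k = "\<bar>c\<bar> ^ DIM('a)"
  have "AE x in density (distr lebesgue lebesgue ?T) (\<lambda>_. ennreal ?k). P x"
    using assms(2) by (simp only: lebesgue_affine_density[OF assms(1), of t, symmetric])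
  then have "AE x in distr lebesgue lebesgue ?T. P x"
    using assms(1) by (subst (asm) AE_density) auto
  then show ?thesis
    by (rule AE_distrD[OF measurable_lebesgue_affine[OF assms(1)]])
qed

lemma integrable_continuous_compact_support:
  fixes f :: "'a::euclidean_space \<Rightarrow> 'b::euclidean_space"
  assumes "continuous_on UNIV f" "compact S" "\<And>x. x \<notin> S \<Longrightarrow> f x = 0"
  shows "integrable lebesgue f"
proof -
  have "integrable lborel (\<lambda>x. indicator S x *\<^sub>R f x)"
    by (rule borel_integrable_compact) (use assms in \<open>auto intro: continuous_on_subset\<close>)
  moreover have "(\<lambda>x. indicator S x *\<^sub>R f x) = f"
    using assms by (auto simp: indicator_def)
  ultimately show ?thesis
    using borel_measurable_continuous_onI[OF assms(1)] by (simp add: integrable_completion)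
qed

text \<open>Difference quotients in direction \<open>i\<close> integrate to zero by translation
  invariance. The mean value theorem bounds them by the maximum of the partial derivative on a
  slightly larger ball, so dominated convergence passes to the derivative without iterated
  integrals.\<close>

lemma integral_partial_eq_0:
  fixes F :: "'a::euclidean_space \<Rightarrow> real"
  assumes der: "\<And>x. (F has_derivative F' x) (at x)"
    and i: "i \<in> Basis"
    and cont: "continuous_on UNIV (\<lambda>x. F' x i)"
    and supp: "compact S" "\<And>x. x \<notin> S \<Longrightarrow> F x = 0"
  shows "integrable lebesgue (\<lambda>x. F' x i)" "(LINT x|lebesgue. F' x i) = 0"
proof -
  have F'0: "F' x h = 0" if "x \<notin> S" for x h
    using frechet_derivative_eq_0[OF compact_imp_closed[OF supp(1)] supp(2) that]
      frechet_derivative_at[OF der[of x]] by simp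
  show int: "integrable lebesgue (\<lambda>x. F' x i)"
    by (rule integrable_continuous_compact_support[OF cont supp(1)]) (rule F'0)
  have contF: "continuous_on UNIV F"
    by (meson continuous_at_imp_continuous_on has_derivative_continuous der)
  have intF: "integrable lebesgue F"
    by (rule integrable_continuous_compact_support[OF contF supp])
  obtain R where R: "\<And>x. x \<in> S \<Longrightarrow> norm x \<le> R"
    using compact_imp_bounded[OF supp(1)] unfolding bounded_iff by blast
  have "bounded ((\<lambda>x. F' x i) ` S)"
    by (intro compact_imp_bounded compact_continuous_image continuous_on_subset[OF cont] supp) auto
  then obtain M where M: "\<And>x. x \<in> S \<Longrightarrow> \<bar>F' x i\<bar> \<le> M"
    unfolding bounded_iff by auto
  have M': "\<bar>F' x i\<bar> \<le> \<bar>M\<bar>" for x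
    by (cases "x \<in> S") (use M[of x] F'0 in auto)
  have line: "((\<lambda>t. F (x + t *\<^sub>R i)) has_real_derivative F' (x + t *\<^sub>R i) i) (at t)" for x t
  proof -
    have "((\<lambda>t. F (x + t *\<^sub>R i)) has_derivative (\<lambda>s. F' (x + t *\<^sub>R i) (s *\<^sub>R i))) (at t)"
      by (rule has_derivative_compose[OF _ der]) (auto intro!: derivative_eq_intros)
    then show ?thesis
      using linear_cmul[OF has_derivative_linear[OF der]]
      by (simp add: has_field_derivative_def mult_commute_abs)
  qed
  \<comment> \<open>Steps of length at most \<open>1\<close> keep the supports of all difference
    quotients in the ball of radius \<open>R + 1\<close>.\<close>
  define h where "h n = inverse (real (Suc n))" for n
  have h: "h n > 0" "h n \<le> 1" for n
    by (simp_all add: h_def inverse_le_1_iff)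
  have h0: "h \<longlonglongrightarrow> 0"
    unfolding h_def by (rule LIMSEQ_inverse_real_of_nat)
  \<comment> \<open>The spelling \<open>1 *\<^sub>R x\<close> matches the affine change of variables
    with \<open>c = 1\<close>.\<close>
  define q where "q n x = (F (h n *\<^sub>R i + 1 *\<^sub>R x) - F x) / h n" for n x
  have q_int: "has_bochner_integral lebesgue (q n) 0" for n
  proof -
    have "has_bochner_integral lebesgue (\<lambda>x. F (h n *\<^sub>R i + 1 *\<^sub>R x) - F x) (integral\<^sup>L lebesgue F - integral\<^sup>L lebesgue F)"
      using has_bochner_integral_affine[of 1 F "h n *\<^sub>R i"] intF
      by (intro has_bochner_integral_diff) (auto simp: has_bochner_integral_integrable)
    then have "has_bochner_integral lebesgue (\<lambda>x. (F (h n *\<^sub>R i + 1 *\<^sub>R x) - F x) / h n) (0 / h n)"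
      by (intro has_bochner_integral_divide_zero) simp
    then show ?thesis by (simp add: q_def[abs_def])
  qed
  have q_lim: "(\<lambda>n. q n x) \<longlonglongrightarrow> F' x i" for x
  proof -
    have "((\<lambda>t. (F (x + t *\<^sub>R i) - F x) / t) \<longlongrightarrow> F' x i) (at 0)"
      using line[of x 0] by (simp add: DERIV_def)
    moreover have "filterlim h (at 0) sequentially"
      using h0 h by (auto simp: filterlim_at intro!: always_eventually) (metis less_irrefl)
    ultimately have "(\<lambda>n. (F (x + h n *\<^sub>R i) - F x) / h n) \<longlonglongrightarrow> F' x i"
      by (rule filterlim_compose)
    then show ?thesis by (simp add: q_def add.commute)
  qed
  have q_bound: "norm (q n x) \<le> indicator (cball 0 (R + 1)) x * \<bar>M\<bar>" for n x
  proof (cases "x \<in> cball 0 (R + 1)")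
    case True
    obtain z where "F (x + h n *\<^sub>R i) - F (x + 0 *\<^sub>R i) = (h n - 0) * F' (x + z *\<^sub>R i) i"
      using MVT2[OF h(1)[of n], of "\<lambda>t. F (x + t *\<^sub>R i)" "\<lambda>t. F' (x + t *\<^sub>R i) i"] line by blast
    then have "q n x = F' (x + z *\<^sub>R i) i"
      using h(1)[of n] by (simp add: q_def add.commute)
    with M' True show ?thesis by simp
  next
    case False
    have "norm x \<le> norm (x + h n *\<^sub>R i) + norm (h n *\<^sub>R i)"
      using norm_triangle_ineq4[of "x + h n *\<^sub>R i" "h n *\<^sub>R i"] by simp
    then have "norm (x + h n *\<^sub>R i) > R"
      using False h[of n] i by (simp add: dist_norm)
    then have "x + h n *\<^sub>R i \<notin> S"
      using R[of "x + h n *\<^sub>R i"] by linarith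
    moreover have "x \<notin> S"
      using False R[of x] by auto
    ultimately show ?thesis
      using supp(2) False by (simp add: q_def add.commute)
  qed
  have w_int: "integrable lebesgue (\<lambda>x::'a. indicator (cball 0 (R + 1)) x * \<bar>M\<bar>)"
    using emeasure_bounded_finite[OF bounded_cball[of "0::'a" "R + 1"]]
    by (intro integrable_mult_left integrable_real_indicator) auto
  have "(\<lambda>n. integral\<^sup>L lebesgue (q n)) \<longlonglongrightarrow> (LINT x|lebesgue. F' x i)"
    by (rule integral_dominated_convergence[OF _ _ w_int])
       (use int q_int q_lim q_bound in \<open>auto simp: has_bochner_integral_iff\<close>)
  moreover have "integral\<^sup>L lebesgue (q n) = 0" for n
    using q_int[of n] by (simp add: has_bochner_integral_iff)
  ultimately show "(LINT x|lebesgue. F' x i) = 0"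
    using LIMSEQ_unique[OF tendsto_const] by force
qed

text \<open>The product of \<open>u\<close> and \<open>\<theta>\<close>, unlike \<open>u\<close>
  itself, is differentiable on the whole space: off the support of \<open>\<theta>\<close> it is
  zero whatever \<open>u\<close> does outside \<open>D\<close>. Each of its partial derivatives
  therefore integrates to zero.\<close>

lemma weak_gradient_classical:
  fixes u \<theta> :: "'a::euclidean_space \<Rightarrow> real"
  assumes D: "open D"
    and u: "\<And>x. x \<in> D \<Longrightarrow> (u has_derivative (\<lambda>h. g x \<bullet> h)) (at x)" "continuous_on D g"
    and \<theta>: "\<theta> \<in> test_functions D"
  shows "(LINT x|lebesgue. (u x *\<^sub>R grad \<theta> x)) = - (LINT x|lebesgue. \<theta> x *\<^sub>R g x)"
proof -
  obtain S where S: "compact S" "S \<subseteq> D" "\<And>x. x \<notin> S \<Longrightarrow> \<theta> x = 0" "\<And>x. x \<notin> S \<Longrightarrow> grad \<theta> x = 0"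
    by (rule grad_test_support[OF \<theta>]) blast
  note th = test_functions_has_grad[OF \<theta>]
  note cth = continuous_on_test_function[OF \<theta>] continuous_on_grad_test[OF \<theta>]
  \<comment> \<open>Gluing along the two open sets \<open>D\<close> and \<open>- S\<close>, which
    cover the space because \<open>S\<close> lies in \<open>D\<close>.\<close>
  have ext: "continuous_on UNIV f" if "continuous_on D f" "\<And>x. x \<notin> S \<Longrightarrow> f x = 0" for f :: "'a \<Rightarrow> 'a"
  proof -
    have "continuous_on (- S) f"
      using continuous_on_cong[of "- S" "- S" f "\<lambda>_. 0"] that by auto
    then have "continuous_on (D \<union> - S) f"
      using that D S by (intro continuous_on_open_Un open_Compl compact_imp_closed) auto
    moreover have "D \<union> - S = UNIV" using S by auto
    ultimately show ?thesis by simp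
  qed
  have cu: "continuous_on D u"
    using u(1) by (meson continuous_at_imp_continuous_on has_derivative_continuous)
  have c1: "continuous_on UNIV (\<lambda>x. u x *\<^sub>R grad \<theta> x)"
    by (rule ext) (auto intro!: continuous_intros cu cth simp: S)
  have c2: "continuous_on UNIV (\<lambda>x. \<theta> x *\<^sub>R g x)"
    by (rule ext) (auto intro!: continuous_intros u cth simp: S)
  have i1: "integrable lebesgue (\<lambda>x. u x *\<^sub>R grad \<theta> x)"
    by (rule integrable_continuous_compact_support[OF c1 S(1)]) (simp add: S)
  have i2: "integrable lebesgue (\<lambda>x. \<theta> x *\<^sub>R g x)"
    by (rule integrable_continuous_compact_support[OF c2 S(1)]) (simp add: S)
  have der: "((\<lambda>x. u x * \<theta> x) has_derivative (\<lambda>h. (u x *\<^sub>R grad \<theta> x + \<theta> x *\<^sub>R g x) \<bullet> h)) (at x)" for x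
  proof (cases "x \<in> D")
    case True
    show ?thesis
      by (rule has_derivative_eq_rhs[OF has_derivative_mult[OF u(1)[OF True] th]])
         (auto simp: inner_add_left)
  next
    case False
    then have x: "x \<in> - S" using S by auto
    have "((\<lambda>x. u x * \<theta> x) has_derivative (\<lambda>_. 0)) (at x)"
      by (rule has_derivative_transform_within_open[of "\<lambda>_. 0" _ x UNIV "- S"])
         (use x S compact_imp_closed[OF S(1)] in \<open>auto simp: open_Compl\<close>)
    then show ?thesis using x S by simp
  qed
  have "(LINT x|lebesgue. (u x *\<^sub>R grad \<theta> x + \<theta> x *\<^sub>R g x) \<bullet> i) = 0" if i: "i \<in> Basis" for i
    by (rule integral_partial_eq_0(2)[OF der i _ S(1)])
       (auto intro!: continuous_intros c1 c2 simp: S)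
  then have "(LINT x|lebesgue. u x *\<^sub>R grad \<theta> x + \<theta> x *\<^sub>R g x) \<bullet> i = 0" if i: "i \<in> Basis" for i
    using i by (subst integral_inner_left[symmetric]) (use i1 i2 in auto)
  then have "(LINT x|lebesgue. u x *\<^sub>R grad \<theta> x + \<theta> x *\<^sub>R g x) = 0"
    by (rule euclidean_all_zero_iff[THEN iffD1, rule_format])
  then show ?thesis
    using i1 i2 by (simp add: eq_neg_iff_add_eq_0)
qed

lemma weak_gradient_test:
  assumes "\<phi> \<in> test_functions UNIV" "\<theta> \<in> test_functions UNIV"
  shows "(LINT x|lebesgue. (\<phi> x *\<^sub>R grad \<theta> x)) = - (LINT x|lebesgue. \<theta> x *\<^sub>R grad \<phi> x)"
  by (rule weak_gradient_classical[OF open_UNIV])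
     (use assms test_functions_has_grad continuous_on_grad_test in blast)+

subsection \<open>The fundamental lemma\<close>

text \<open>Every point of an open set has arbitrarily small closed balls around it inside the set,
  so the Vitali covering theorem exhausts \<open>U\<close> up to a null set. This is what reduces
  the fundamental lemma to integrals over balls.\<close>

lemma Vitali_open:
  fixes U :: "'a::euclidean_space set"
  assumes "open U"
  obtains C where "countable C" "\<And>x r. (x, r) \<in> C \<Longrightarrow> 0 < r \<and> cball x r \<subseteq> U"
    "pairwise (\<lambda>i j. disjnt (ball (fst i) (snd i)) (ball (fst j) (snd j))) C"
    "negligible (U - (\<Union>i\<in>C. ball (fst i) (snd i)))"
proof -
  let ?K = "{(x, r). 0 < r \<and> cball x r \<subseteq> U}"
  have K: "\<exists>i. i \<in> ?K \<and> x \<in> ball (fst i) (snd i) \<and> snd i < d" if x: "x \<in> U" "0 < d" for x d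
  proof -
    obtain e where e: "e > 0" "cball x e \<subseteq> U"
      using assms x open_contains_cball by blast
    have "(x, min e (d/2)) \<in> ?K"
      using e x by auto
    then show ?thesis
      using e x by (intro exI[of _ "(x, min e (d/2))"]) auto
  qed
  obtain C where "countable C" "C \<subseteq> ?K"
     "pairwise (\<lambda>i j. disjnt (ball (fst i) (snd i)) (ball (fst j) (snd j))) C"
     "negligible (U - (\<Union>i\<in>C. ball (fst i) (snd i)))"
    by (rule Vitali_covering_theorem_balls[where S=U and K="?K" and a=fst and r=snd, OF K]) (assumption | erule that)+
  then show thesis
    by (intro that[of C]) (assumption | blast)+
qed

lemma integral_open_eq_0:
  fixes g :: "'a::euclidean_space \<Rightarrow> 'b::euclidean_space"
  assumes g: "integrable lebesgue g"
    and balls: "\<And>x r. 0 < r \<Longrightarrow> cball x r \<subseteq> U \<Longrightarrow> (LINT y:ball x r|lebesgue. g y) = 0"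
    and U: "open U"
  shows "(LINT y:U|lebesgue. g y) = 0"
proof -
  obtain C where C: "countable C" "\<And>x r. (x, r) \<in> C \<Longrightarrow> 0 < r \<and> cball x r \<subseteq> U"
    "pairwise (\<lambda>i j. disjnt (ball (fst i) (snd i)) (ball (fst j) (snd j))) C"
    "negligible (U - (\<Union>i\<in>C. ball (fst i) (snd i)))"
    by (rule Vitali_open[OF U]) (assumption | erule that)+
  let ?B = "\<lambda>i::'a \<times> real. ball (fst i) (snd i)"
  \<comment> \<open>The family may be finite; indices that enumerate no ball are padded with the
    empty set, so that countable additivity over \<open>nat\<close> applies.\<close>
  define A where "A n = (if n \<in> to_nat_on C ` C then ?B (from_nat_into C n) else {})" for n
  have Bz: "(LINT y:?B i|lebesgue. g y) = 0" if "i \<in> C" for i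
    using balls[of "snd i" "fst i"] C(2)[of "fst i" "snd i"] that by simp
  have UA: "(\<Union>n. A n) = (\<Union>i\<in>C. ?B i)"
    using C(1) by (auto simp: A_def split: if_splits) 
  have sA: "A n \<in> sets lebesgue" for n
    by (auto simp: A_def)
  have dA: "A m \<inter> A n = {}" if "m \<noteq> n" for m n
  proof (cases "m \<in> to_nat_on C ` C \<and> n \<in> to_nat_on C ` C")
    case True
    then obtain i j where ij: "i \<in> C" "j \<in> C" "m = to_nat_on C i" "n = to_nat_on C j" by blast
    then have "i \<noteq> j" using that by auto
    then have "disjnt (?B i) (?B j)"
      using C(3) ij by (auto simp: pairwise_def)
    then show ?thesis
      using ij C(1) by (simp add: A_def disjnt_def)
  qed (auto simp: A_def)
  have "(LINT y:(\<Union>n. A n)|lebesgue. g y) = (\<Sum>n. LINT y:A n|lebesgue. g y)"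
    by (rule lebesgue_integral_countable_add[OF sA dA])
       (use sA in \<open>auto simp: set_integrable_def intro!: integrable_mult_indicator g\<close>)
  also have "\<dots> = (\<Sum>n::nat. 0)"
    by (rule suminf_cong) (use Bz C(1) in \<open>auto simp: A_def set_lebesgue_integral_def[of _ "{}"]\<close>)
  finally have "(LINT y:(\<Union>i\<in>C. ?B i)|lebesgue. g y) = 0"
    by (simp add: UA)
  moreover have "(LINT y:U|lebesgue. g y) = (LINT y:(\<Union>i\<in>C. ?B i)|lebesgue. g y)"
  proof -
    define W where "W = (\<Union>i\<in>C. ?B i)"
    have "U - W \<in> null_sets lebesgue"
      using C(4) by (simp add: W_def negligible_iff_null_sets)
    then have "AE y in lebesgue. y \<notin> U - W"
      by (rule AE_not_in)
    moreover have "W \<subseteq> U"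
      unfolding W_def using C(2) ball_subset_cball by fastforce
    ultimately have "AE y in lebesgue. indicator U y *\<^sub>R g y = indicator W y *\<^sub>R g y"
      by (auto elim!: eventually_mono simp: indicator_def)
    then have "AE y in lebesgue. indicator U y *\<^sub>R g y = indicator (\<Union>i\<in>C. ?B i) y *\<^sub>R g y"
      by (simp add: W_def)
    moreover have "(\<Union>i\<in>C. ?B i) \<in> sets lebesgue"
      using sA unfolding UA[symmetric] by blast
    moreover have "U \<in> sets lebesgue"
      using U by (intro sets_completionI_sets) simp
    ultimately show ?thesis
      unfolding set_lebesgue_integral_def
      by (intro integral_cong_AE borel_measurable_scaleR borel_measurable_indicator
          borel_measurable_integrable[OF g])
  qed
  ultimately show ?thesis by simp
qed

lemma sigma_finite_lebesgue: "sigma_finite_measure (lebesgue :: 'a::euclidean_space measure)"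
proof
  obtain A :: "'a set set" where A: "countable A" "A \<subseteq> sets lborel" "\<Union>A = space lborel"
    "\<forall>a\<in>A. emeasure lborel a \<noteq> \<infinity>"
    using lborel.sigma_finite_countable by blast
  have "A \<subseteq> sets lebesgue"
    using A(2) by auto
  moreover have "\<forall>a\<in>A. emeasure lebesgue a \<noteq> \<infinity>"
    using A(2,4) by (auto simp: subset_iff)
  ultimately show "\<exists>A::'a set set. countable A \<and> A \<subseteq> sets lebesgue \<and> \<Union>A = space lebesgue \<and>
      (\<forall>a\<in>A. emeasure lebesgue a \<noteq> \<infinity>)"
    using A(1,3) by (intro exI[of _ A]) simp
qed

text \<open>Up to a null set every measurable set is a countable intersection of open sets, hence a
  decreasing limit of open sets. Dominated convergence extends the hypothesis to all measurable
  sets, and uniqueness of densities concludes.\<close>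

lemma AE_eq_0_if_open_integrals_eq_0:
  fixes g :: "'a::euclidean_space \<Rightarrow> 'b::euclidean_space"
  assumes g: "integrable lebesgue g"
    and opens: "\<And>U. open U \<Longrightarrow> (LINT y:U|lebesgue. g y) = 0"
  shows "AE x in lebesgue. g x = 0"
proof -
  have "(LINT x:A|lebesgue. g x) = 0" if A: "A \<in> sets lebesgue" for A
  proof -
  obtain G T where GT: "gdelta G" "T \<in> null_sets lebesgue" "A \<union> T = G"
    by (rule lebesgue_set_almost_gdelta[OF A]) blast
  obtain F :: "nat \<Rightarrow> 'a set" where F: "\<And>n. open (F n)" "G = (\<Inter>n. F n)"
    using GT(1) by (auto elim!: gdelta.cases)
  define V where "V n = (\<Inter>k\<le>n. F k)" for n
  have V: "open (V n)" for n
    unfolding V_def by (intro open_INT) (auto simp: F)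
  have lim: "(\<lambda>n. indicator (V n) x *\<^sub>R g x) \<longlonglongrightarrow> indicator G x *\<^sub>R g x" for x
  proof (cases "x \<in> G")
    case True
    then have "x \<in> V n" for n by (auto simp: V_def F)
    with True show ?thesis by simp
  next
    case False
    then obtain k where "x \<notin> F k" by (auto simp: F)
    then have "\<And>n. n \<ge> k \<Longrightarrow> x \<notin> V n" by (auto simp: V_def)
    then have "eventually (\<lambda>n. 0 = indicator (V n) x *\<^sub>R g x) sequentially"
      unfolding eventually_sequentially by (intro exI[of _ k]) auto
    with False show ?thesis
      using Lim_transform_eventually[OF tendsto_const[of 0], of "\<lambda>n. indicator (V n) x *\<^sub>R g x"] by simp
  qed
  have Gm: "G \<in> sets lebesgue"
    using GT A by (metis null_setsD2 sets.Un)
  have "(\<lambda>n. LINT x|lebesgue. indicator (V n) x *\<^sub>R g x) \<longlonglongrightarrow> (LINT x|lebesgue. indicator G x *\<^sub>R g x)"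
  proof (rule integral_dominated_convergence[where w="\<lambda>x. norm (g x)"])
    show "(\<lambda>x. indicator G x *\<^sub>R g x) \<in> borel_measurable lebesgue"
      by (intro borel_measurable_scaleR borel_measurable_indicator borel_measurable_integrable[OF g] Gm)
    show "(\<lambda>x. indicator (V n) x *\<^sub>R g x) \<in> borel_measurable lebesgue" for n
      using V by (intro borel_measurable_scaleR borel_measurable_indicator borel_measurable_integrable[OF g]
          sets_completionI_sets) simp
    show "AE x in lebesgue. norm (indicator (V n) x *\<^sub>R g x) \<le> norm (g x)" for n
      by (intro AE_I2) (simp add: indicator_def)
  qed (use g lim in simp_all)
  then have "(LINT x|lebesgue. indicator G x *\<^sub>R g x) = 0"
    using opens[OF V] unfolding set_lebesgue_integral_def by (simp add: LIMSEQ_const_iff)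
  moreover have "(LINT x|lebesgue. indicator A x *\<^sub>R g x) = (LINT x|lebesgue. indicator G x *\<^sub>R g x)"
  proof (rule integral_cong_AE)
    show "AE x in lebesgue. indicator A x *\<^sub>R g x = indicator G x *\<^sub>R g x"
      using AE_not_in[OF GT(2)] by eventually_elim (use GT(3) in \<open>auto simp: indicator_def\<close>)
  qed (intro borel_measurable_scaleR borel_measurable_indicator borel_measurable_integrable[OF g] A Gm)+
  ultimately show ?thesis
    by (simp add: set_lebesgue_integral_def)
  qed
  then show ?thesis
    using sigma_finite_measure.density_unique_banach[OF sigma_finite_lebesgue g, of "\<lambda>_. 0"]
    by (simp add: set_lebesgue_integral_def)
qed

text \<open>Local integrability yields an integrable function only after truncation to a ball; there
  the criterion with open sets applies, and countably many such balls fill \<open>D\<close> up to a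
  null set. Balls are convenient test sets because steep radial bumps converge to their
  indicators.\<close>

lemma AE_eq_0_if_ball_integrals_eq_0:
  fixes g :: "'a::euclidean_space \<Rightarrow> 'b::euclidean_space"
  assumes D: "open D"
    and g: "g \<in> L1_loc D"
    and balls: "\<And>x r. 0 < r \<Longrightarrow> cball x r \<subseteq> D \<Longrightarrow> (LINT y|lebesgue_on (ball x r). g y) = 0"
  shows "AE x in lebesgue_on D. g x = 0"
proof -
  have loc: "AE y in lebesgue. y \<in> ball x r \<longrightarrow> g y = 0" if xr: "0 < r" "cball x r \<subseteq> D" for x r
  proof -
    let ?g = "\<lambda>y. if y \<in> ball x r then g y else 0"
    have "integrable (lebesgue_on (cball x r)) g"
      using g xr by (auto simp: L1_loc_def)
    then have "integrable lebesgue (\<lambda>y. if y \<in> cball x r then g y else 0)"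
      by (rule Lebesgue_Measure.integrable_restrict_UNIV[THEN iffD2, rotated]) (simp add: sets_completionI_sets)
    then have "integrable lebesgue (\<lambda>y. indicator (ball x r) y *\<^sub>R (if y \<in> cball x r then g y else 0))"
      by (intro integrable_mult_indicator) auto
    moreover have "(\<lambda>y. indicator (ball x r) y *\<^sub>R (if y \<in> cball x r then g y else 0)) = ?g"
      using ball_subset_cball[of x r] by (auto simp: indicator_def fun_eq_iff)
    ultimately have int: "integrable lebesgue ?g" by simp
    have "AE y in lebesgue. ?g y = 0"
    proof (rule AE_eq_0_if_open_integrals_eq_0[OF int])
      fix U :: "'a set" assume U: "open U"
      have "(LINT y:U \<inter> ball x r|lebesgue. ?g y) = 0"
      proof (rule integral_open_eq_0[OF int])
        fix z s assume zs: "0 < s" "cball z s \<subseteq> U \<inter> ball x r"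
        have sub: "ball z s \<subseteq> ball x r"
          using zs ball_subset_cball by blast
        have "(LINT y:ball z s|lebesgue. ?g y) = (LINT y|lebesgue. (if y \<in> ball z s then g y else 0))"
          unfolding set_lebesgue_integral_def
          by (rule Bochner_Integration.integral_cong) (use sub in \<open>auto simp: indicator_def\<close>)
        also have "\<dots> = (LINT y|lebesgue_on (ball z s). g y)"
          by (rule Lebesgue_Measure.integral_restrict_UNIV) auto
        also have "\<dots> = 0"
          using balls[OF zs(1)] zs xr ball_subset_cball[of x r] by blast
        finally show "(LINT y:ball z s|lebesgue. ?g y) = 0" .
      qed (use U in auto)
      moreover have "(\<lambda>y. indicator (U \<inter> ball x r) y *\<^sub>R ?g y) = (\<lambda>y. indicator U y *\<^sub>R ?g y)"
        by (auto simp: indicator_def)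
      ultimately show "(LINT y:U|lebesgue. ?g y) = 0"
        by (simp add: set_lebesgue_integral_def)
    qed
    then show ?thesis by eventually_elim (auto split: if_splits)
  qed
  obtain C where C: "countable C" "\<And>x r. (x, r) \<in> C \<Longrightarrow> 0 < r \<and> cball x r \<subseteq> D"
    "negligible (D - (\<Union>i\<in>C. ball (fst i) (snd i)))"
    by (rule Vitali_open[OF D]) (assumption | erule that)+
  have "AE y in lebesgue. \<forall>i\<in>C. y \<in> ball (fst i) (snd i) \<longrightarrow> g y = 0"
    using C(2) loc by (subst AE_ball_countable[OF C(1)]) force
  moreover have "AE y in lebesgue. y \<notin> D - (\<Union>i\<in>C. ball (fst i) (snd i))"
    using C(3) by (intro AE_not_in) (simp add: negligible_iff_null_sets)
  ultimately have "AE y in lebesgue. y \<in> D \<longrightarrow> g y = 0"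
    by eventually_elim blast
  then show ?thesis
    using D by (subst AE_restrict_space_iff) auto
qed

text \<open>Here \<open>t\<close> is the inverse square of the radius, which later is the variable
  of a differential equation, and \<open>m\<close> is a steepness that is sent to infinity to reach
  indicators of balls.\<close>

lemma radial_test_function:
  assumes "m > 0" "t > 0" "cball x0 (1 / sqrt t) \<subseteq> D"
  shows "(\<lambda>x. bump n (m * (1 - t * (norm (x - x0))\<^sup>2))) \<in> test_functions D"
proof (rule test_functionsI[of _ "cball x0 (1 / sqrt t)"])
  show "Ck k (\<lambda>x. bump n (m * (1 - t * (norm (x - x0))\<^sup>2)))" for k
    by (intro Ck_bump Ck_cmult Ck_diff Ck_const Ck_dist_square)
  show "bump n (m * (1 - t * (norm (x - x0))\<^sup>2)) = 0" if "x \<notin> cball x0 (1 / sqrt t)" for x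
  proof -
    have "1 / sqrt t < norm (x - x0)"
      using that by (simp add: dist_norm norm_minus_commute)
    then have "(1 / sqrt t)\<^sup>2 < (norm (x - x0))\<^sup>2"
      using assms by (intro power_strict_mono) auto
    then have "1 < t * (norm (x - x0))\<^sup>2"
      using assms by (simp add: power_divide field_simps)
    then show ?thesis
      using assms by (auto simp: bump_def zero_less_mult_iff)
  qed
qed (use assms in auto)

text \<open>Inside the ball the argument tends to infinity, where \<open>exp (- 1 / s)\<close> tends
  to \<open>1\<close>; elsewhere it is nonpositive for every \<open>m\<close>, so the bump is
  exactly zero.\<close>

lemma bump0_tendsto_indicator:
  assumes "r > 0"
  shows "(\<lambda>m. bump 0 (real (Suc m) * (1 - (1 / r\<^sup>2) * (norm (x - x0))\<^sup>2))) \<longlonglongrightarrow> indicator (ball x0 r) x"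
proof (cases "x \<in> ball x0 r")
  case True
  let ?c = "1 - (1 / r\<^sup>2) * (norm (x - x0))\<^sup>2"
  have "(norm (x - x0))\<^sup>2 < r\<^sup>2"
    using True by (intro power_strict_mono) (auto simp: dist_norm norm_minus_commute)
  then have c: "?c > 0" using assms by (simp add: field_simps)
  have "(\<lambda>m. - (1 / ?c) * inverse (real (Suc m))) \<longlonglongrightarrow> - (1 / ?c) * 0"
    by (intro tendsto_mult tendsto_const LIMSEQ_inverse_real_of_nat)
  then have "(\<lambda>m. exp (- (1 / ?c) * inverse (real (Suc m)))) \<longlonglongrightarrow> exp 0"
    by (intro tendsto_exp) simp
  moreover have "exp (- (1 / ?c) * inverse (real (Suc m))) = bump 0 (real (Suc m) * ?c)" for m
    using c by (simp add: bump_def divide_simps del: of_nat_Suc)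
  ultimately show ?thesis using True by simp
next
  case False
  have "r\<^sup>2 \<le> (norm (x - x0))\<^sup>2"
    using False assms by (intro power_mono) (auto simp: dist_norm norm_minus_commute)
  then have "1 - (1 / r\<^sup>2) * (norm (x - x0))\<^sup>2 \<le> 0" using assms by (simp add: field_simps)
  then have "bump 0 (real (Suc m) * (1 - (1 / r\<^sup>2) * (norm (x - x0))\<^sup>2)) = 0" for m
    by (simp add: bump_def zero_less_mult_iff not_less del: of_nat_Suc)
  then show ?thesis using False by simp
qed

lemma bump0_bounds: "0 \<le> bump 0 t" "bump 0 t \<le> 1"
  by (auto simp: bump_def)

lemma borel_measurable_lebesgue_continuous:
  fixes f :: "'a::euclidean_space \<Rightarrow> 'b::euclidean_space"
  assumes "continuous_on UNIV f"
  shows "f \<in> borel_measurable lebesgue"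
  using borel_measurable_continuous_onI[OF assms] by (intro measurable_completion) simp

text \<open>Radial bumps with values in the unit interval converge to the indicator of the open
  ball, so dominated convergence turns the hypothesis into vanishing integrals over balls.\<close>

theorem fundamental_lemma:
  fixes g :: "'a::euclidean_space \<Rightarrow> 'b::euclidean_space"
  assumes D: "open D"
    and g: "g \<in> L1_loc D"
    and test: "\<And>\<phi>. \<phi> \<in> test_functions D \<Longrightarrow> (LINT x|lebesgue_on D. \<phi> x *\<^sub>R g x) = 0"
  shows "AE x in lebesgue_on D. g x = 0"
proof (rule AE_eq_0_if_ball_integrals_eq_0[OF D g])
  fix x0 and r :: real assume r: "0 < r" "cball x0 r \<subseteq> D"
  define \<phi> where "\<phi> m x = bump 0 (real (Suc m) * (1 - (1 / r\<^sup>2) * (norm (x - x0))\<^sup>2))" for m x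
  have \<phi>: "\<phi> m \<in> test_functions (cball x0 r)" for m
    unfolding \<phi>_def[abs_def] by (rule radial_test_function) (use r in \<open>auto simp: real_sqrt_divide\<close>)
  have supp: "\<phi> m x = 0" if "x \<notin> cball x0 r" for m x
    using \<phi>[of m] that by (auto elim!: test_functionsE)
  let ?g = "\<lambda>y. if y \<in> cball x0 r then g y else 0"
  have "integrable (lebesgue_on (cball x0 r)) g"
    using g r by (auto simp: L1_loc_def)
  then have int: "integrable lebesgue ?g"
    by (rule Lebesgue_Measure.integrable_restrict_UNIV[THEN iffD2, rotated]) (simp add: sets_completionI_sets)
  have zero: "(LINT x|lebesgue. \<phi> m x *\<^sub>R ?g x) = 0" for m
  proof -
    have "(LINT x|lebesgue. \<phi> m x *\<^sub>R ?g x) = (LINT x|lebesgue. (if x \<in> D then \<phi> m x *\<^sub>R g x else 0))"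
      using supp r by (intro Bochner_Integration.integral_cong) auto
    also have "\<dots> = 0"
      using D test[OF subsetD[OF test_functions_mono[OF r(2)] \<phi>]] by (simp add: Lebesgue_Measure.integral_restrict_UNIV)
    finally show ?thesis .
  qed
  have m\<phi>: "\<phi> m \<in> borel_measurable lebesgue" for m
    by (rule borel_measurable_lebesgue_continuous[OF continuous_on_test_function[OF \<phi>]])
  have "(\<lambda>m. LINT x|lebesgue. \<phi> m x *\<^sub>R ?g x) \<longlonglongrightarrow> (LINT x|lebesgue. indicator (ball x0 r) x *\<^sub>R ?g x)"
  proof (rule integral_dominated_convergence[where w="\<lambda>x. norm (?g x)"])
    show "AE x in lebesgue. (\<lambda>m. \<phi> m x *\<^sub>R ?g x) \<longlonglongrightarrow> indicator (ball x0 r) x *\<^sub>R ?g x"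
      using bump0_tendsto_indicator[OF r(1)] by (intro AE_I2 tendsto_scaleR tendsto_const) (simp add: \<phi>_def)
    show "AE x in lebesgue. norm (\<phi> m x *\<^sub>R ?g x) \<le> norm (?g x)" for m
      using bump0_bounds by (intro AE_I2) (auto simp: \<phi>_def intro!: mult_left_le_one_le)
    show "(\<lambda>x. indicator (ball x0 r) x *\<^sub>R ?g x) \<in> borel_measurable lebesgue"
      by (intro borel_measurable_scaleR borel_measurable_indicator sets_completionI_sets
          borel_measurable_integrable[OF int]) simp
    show "(\<lambda>x. \<phi> m x *\<^sub>R ?g x) \<in> borel_measurable lebesgue" for m
      by (intro borel_measurable_scaleR m\<phi> borel_measurable_integrable[OF int])
  qed (use int in auto)
  then have "(LINT x|lebesgue. indicator (ball x0 r) x *\<^sub>R ?g x) = 0"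
    unfolding zero by (simp add: LIMSEQ_const_iff)
  moreover have "(\<lambda>x. indicator (ball x0 r) x *\<^sub>R ?g x) = (\<lambda>x. if x \<in> ball x0 r then g x else 0)"
    by (auto simp: indicator_def)
  ultimately show "(LINT y|lebesgue_on (ball x0 r). g y) = 0"
    by (simp add: Lebesgue_Measure.integral_restrict_UNIV del: mem_ball mem_cball)
qed

subsection \<open>Square integrable functions\<close>

text \<open>Formulated for an arbitrary measure, so that \<open>lebesgue\<close> and
  \<open>lebesgue_on D\<close> share one Hilbert space calculus.\<close>

definition sq_int :: "'a measure \<Rightarrow> ('a \<Rightarrow> 'b::euclidean_space) \<Rightarrow> bool" where
  "sq_int M f \<longleftrightarrow> f \<in> borel_measurable M \<and> integrable M (\<lambda>x. (norm (f x))\<^sup>2)"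

definition l2 :: "'a measure \<Rightarrow> ('a \<Rightarrow> 'b::euclidean_space) \<Rightarrow> real" where
  "l2 M f = sqrt (LINT x|M. (norm (f x))\<^sup>2)"

lemma sq_intD: "sq_int M f \<Longrightarrow> f \<in> borel_measurable M" "sq_int M f \<Longrightarrow> integrable M (\<lambda>x. (norm (f x))\<^sup>2)"
  by (auto simp: sq_int_def)

lemma L2_iff: "f \<in> L2 D \<longleftrightarrow> sq_int (lebesgue_on D) f"
  by (simp add: L2_def sq_int_def)

lemma l2_nonneg [simp]: "0 \<le> l2 M f"
  by (simp add: l2_def integral_nonneg_AE)

lemma l2_square: "(l2 M f)\<^sup>2 = (LINT x|M. (norm (f x))\<^sup>2)"
  by (simp add: l2_def integral_nonneg_AE)

lemma sq_int_bound:
  assumes "sq_int M f" "g \<in> borel_measurable M" "AE x in M. norm (g x) \<le> C * norm (f x)"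
  shows "sq_int M g"
proof -
  have i: "integrable M (\<lambda>x. C\<^sup>2 * (norm (f x))\<^sup>2)"
    using sq_intD(2)[OF assms(1)] by simp
  have ae: "AE x in M. norm ((norm (g x))\<^sup>2) \<le> norm (C\<^sup>2 * (norm (f x))\<^sup>2)"
    using assms(3)
  proof eventually_elim
    case (elim x)
    then have "(norm (g x))\<^sup>2 \<le> (C * norm (f x))\<^sup>2" by (intro power_mono) auto
    then show ?case by (simp add: power_mult_distrib)
  qed
  have "integrable M (\<lambda>x. (norm (g x))\<^sup>2)"
    by (rule Bochner_Integration.integrable_bound[OF i _ ae]) (use assms(2) in measurable)
  with assms show ?thesis by (simp add: sq_int_def)
qed

lemma sq_int_norm: "sq_int M f \<Longrightarrow> sq_int M (\<lambda>x. norm (f x))"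
  by (auto simp: sq_int_def)

lemma l2_norm [simp]: "l2 M (\<lambda>x. norm (f x)) = l2 M f"
  by (simp add: l2_def)

lemma sq_int_scaleR: "sq_int M f \<Longrightarrow> sq_int M (\<lambda>x. c *\<^sub>R f x)"
  by (rule sq_int_bound[where C="\<bar>c\<bar>"]) (auto simp: sq_int_def)

lemma sq_int_add:
  assumes "sq_int M f" "sq_int M g"
  shows "sq_int M (\<lambda>x. f x + g x)"
proof -
  have i: "integrable M (\<lambda>x. 2 * (norm (f x))\<^sup>2 + 2 * (norm (g x))\<^sup>2)"
    using assms by (auto simp: sq_int_def)
  have b: "norm ((norm (f x + g x))\<^sup>2) \<le> norm (2 * (norm (f x))\<^sup>2 + 2 * (norm (g x))\<^sup>2)" for x
  proof -
    have "(norm (f x + g x))\<^sup>2 \<le> (norm (f x) + norm (g x))\<^sup>2"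
      by (intro power_mono norm_triangle_ineq) auto
    also have "\<dots> \<le> 2 * (norm (f x))\<^sup>2 + 2 * (norm (g x))\<^sup>2"
      using sum_squares_bound[of "norm (f x)" "norm (g x)"] by (simp add: power2_sum)
    finally show ?thesis by simp
  qed
  have m [measurable]: "f \<in> borel_measurable M" "g \<in> borel_measurable M"
    using assms by (auto simp: sq_int_def)
  have "integrable M (\<lambda>x. (norm (f x + g x))\<^sup>2)"
    by (rule Bochner_Integration.integrable_bound[OF i _ AE_I2[OF b]]) measurable
  with assms show ?thesis by (simp add: sq_int_def)
qed

lemma sq_int_diff: "sq_int M f \<Longrightarrow> sq_int M g \<Longrightarrow> sq_int M (\<lambda>x. f x - g x)"
  using sq_int_add[of M f "\<lambda>x. (-1) *\<^sub>R g x"] sq_int_scaleR[of M g "-1"] by simp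

lemma sq_int_0 [simp]: "sq_int M (\<lambda>_. 0)"
  by (simp add: sq_int_def)

lemma integrable_norm_mult:
  assumes "sq_int M f" "sq_int M g"
  shows "integrable M (\<lambda>x. norm (f x) * norm (g x))"
proof -
  have i: "integrable M (\<lambda>x. (norm (f x))\<^sup>2 + (norm (g x))\<^sup>2)"
    using assms by (auto simp: sq_int_def)
  have m [measurable]: "f \<in> borel_measurable M" "g \<in> borel_measurable M"
    using assms by (auto simp: sq_int_def)
  from i show ?thesis
  proof (rule Bochner_Integration.integrable_bound)
    show "AE x in M. norm (norm (f x) * norm (g x)) \<le> norm ((norm (f x))\<^sup>2 + (norm (g x))\<^sup>2)"
    proof (rule AE_I2)
      fix x
      have "2 * (norm (f x) * norm (g x)) \<le> (norm (f x))\<^sup>2 + (norm (g x))\<^sup>2"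
        using sum_squares_bound[of "norm (f x)" "norm (g x)"] by simp
      moreover have "0 \<le> norm (f x) * norm (g x)" by simp
      ultimately have "norm (f x) * norm (g x) \<le> (norm (f x))\<^sup>2 + (norm (g x))\<^sup>2" by linarith
      then show "norm (norm (f x) * norm (g x)) \<le> norm ((norm (f x))\<^sup>2 + (norm (g x))\<^sup>2)" by simp
    qed
  qed measurable
qed

text \<open>Serves twice: for the Cauchy-Schwarz inequality, and for near minimisers of a quadratic
  functional, where \<open>b\<close> is the defect from minimality.\<close>

lemma quadratic_nonneg_discriminant:
  fixes a b c :: real
  assumes q: "\<And>t. 0 \<le> a * t\<^sup>2 + 2 * c * t + b" and a: "0 \<le> a" and b: "0 \<le> b"
  shows "\<bar>c\<bar> \<le> sqrt a * sqrt b"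
proof -
  have "c\<^sup>2 \<le> a * b"
  proof (cases "a = 0")
    case True
    have "c = 0"
    proof (rule ccontr)
      assume "c \<noteq> 0"
      \<comment> \<open>With \<open>a = 0\<close> the polynomial is affine, and at this point its
        value is \<open>-1\<close>.\<close>
      then show False using q[of "- (b + 1) / (2 * c)"] True b by (simp add: field_simps)
    qed
    then show ?thesis using a b by simp
  next
    case False
    then have "a > 0" using a by simp
    then show ?thesis using q[of "- c / a"] by (simp add: field_simps power2_eq_square)
  qed
  then have "\<bar>c\<bar> \<le> sqrt (a * b)" by (intro real_le_rsqrt) simp
  then show ?thesis by (simp add: real_sqrt_mult)
qed

lemma integral_norm_mult_le:
  assumes f: "sq_int M f" and g: "sq_int M g"
  shows "(LINT x|M. norm (f x) * norm (g x)) \<le> l2 M f * l2 M g"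
proof -
  define a b c where "a = (LINT x|M. (norm (f x))\<^sup>2)" and "b = (LINT x|M. (norm (g x))\<^sup>2)"
    and "c = (LINT x|M. norm (f x) * norm (g x))"
  note int = sq_intD(2)[OF f] sq_intD(2)[OF g] integrable_norm_mult[OF f g]
  have nn: "0 \<le> a" "0 \<le> b" "0 \<le> c"
    by (auto simp: a_def b_def c_def intro!: integral_nonneg_AE)
  have q: "0 \<le> a * t\<^sup>2 + 2 * (- c) * t + b" for t
  proof -
    have "0 \<le> (LINT x|M. (t * norm (f x) - norm (g x))\<^sup>2)"
      by (intro integral_nonneg_AE) auto
    also have "(\<lambda>x. (t * norm (f x) - norm (g x))\<^sup>2) =
        (\<lambda>x. t\<^sup>2 * (norm (f x))\<^sup>2 - 2 * t * (norm (f x) * norm (g x)) + (norm (g x))\<^sup>2)"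
      by (auto simp: power2_eq_square algebra_simps)
    also have "(LINT x|M. t\<^sup>2 * (norm (f x))\<^sup>2 - 2 * t * (norm (f x) * norm (g x)) + (norm (g x))\<^sup>2)
        = t\<^sup>2 * a - 2 * t * c + b"
      unfolding a_def b_def c_def using int by simp
    finally show ?thesis by (simp add: algebra_simps)
  qed
  from quadratic_nonneg_discriminant[OF this nn(1,2)] show ?thesis
    by (simp add: l2_def a_def b_def c_def)
qed

lemma integrable_inner_sq_int:
  assumes "sq_int M f" "sq_int M g"
  shows "integrable M (\<lambda>x. f x \<bullet> g x)"
proof (rule Bochner_Integration.integrable_bound[OF integrable_norm_mult[OF assms]])
  show "AE x in M. norm (f x \<bullet> g x) \<le> norm (norm (f x) * norm (g x))"
    by (intro AE_I2) (simp add: Cauchy_Schwarz_ineq2)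
qed (intro borel_measurable_inner sq_intD assms)

lemma abs_integral_inner_le:
  assumes f: "sq_int M f" and g: "sq_int M g"
  shows "\<bar>LINT x|M. f x \<bullet> g x\<bar> \<le> l2 M f * l2 M g"
proof -
  have "\<bar>LINT x|M. f x \<bullet> g x\<bar> \<le> (LINT x|M. \<bar>f x \<bullet> g x\<bar>)"
    by (rule integral_abs_bound)
  also have "\<dots> \<le> (LINT x|M. norm (f x) * norm (g x))"
    by (intro integral_mono integrable_abs integrable_inner_sq_int integrable_norm_mult f g Cauchy_Schwarz_ineq2)
  also have "\<dots> \<le> l2 M f * l2 M g"
    by (rule integral_norm_mult_le[OF f g])
  finally show ?thesis .
qed

lemma l2_square_add:
  assumes f: "sq_int M f" and g: "sq_int M g"
  shows "(l2 M (\<lambda>x. f x + g x))\<^sup>2 = (l2 M f)\<^sup>2 + 2 * (LINT x|M. f x \<bullet> g x) + (l2 M g)\<^sup>2"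
proof -
  have "(\<lambda>x. (norm (f x + g x))\<^sup>2) = (\<lambda>x. (norm (f x))\<^sup>2 + 2 * (f x \<bullet> g x) + (norm (g x))\<^sup>2)"
    by (auto simp: power2_norm_eq_inner inner_add_left inner_add_right inner_commute)
  then show ?thesis
    unfolding l2_square using integrable_inner_sq_int[OF f g] sq_intD(2)[OF f] sq_intD(2)[OF g] by simp
qed

lemma l2_mono:
  assumes "sq_int M g" "f \<in> borel_measurable M" "AE x in M. norm (f x) \<le> norm (g x)"
  shows "l2 M f \<le> l2 M g"
  unfolding l2_def
proof (intro real_sqrt_le_mono integral_mono_AE)
  have "sq_int M f" by (rule sq_int_bound[where C=1]) (use assms in auto)
  then show "integrable M (\<lambda>x. (norm (f x))\<^sup>2)" by (rule sq_intD)
  show "AE x in M. (norm (f x))\<^sup>2 \<le> (norm (g x))\<^sup>2"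
    using assms(3) by eventually_elim (auto intro: power_mono)
qed (use assms in \<open>simp add: sq_int_def\<close>)

lemma l2_triangle:
  assumes f: "sq_int M f" and g: "sq_int M g"
  shows "l2 M (\<lambda>x. f x + g x) \<le> l2 M f + l2 M g"
proof (rule power2_le_imp_le)
  have "(l2 M (\<lambda>x. f x + g x))\<^sup>2 \<le> (l2 M f)\<^sup>2 + 2 * (l2 M f * l2 M g) + (l2 M g)\<^sup>2"
    unfolding l2_square_add[OF f g] using abs_integral_inner_le[OF f g] by simp
  then show "(l2 M (\<lambda>x. f x + g x))\<^sup>2 \<le> (l2 M f + l2 M g)\<^sup>2"
    by (simp add: power2_sum)
qed simp

lemma l2_scaleR [simp]: "l2 M (\<lambda>x. c *\<^sub>R f x) = \<bar>c\<bar> * l2 M f"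
  by (simp add: l2_def power_mult_distrib real_sqrt_mult)

lemma l2_minus_commute: "l2 M (\<lambda>x. f x - g x) = l2 M (\<lambda>x. g x - f x)"
  by (simp add: l2_def norm_minus_commute)

lemma l2_triangle_diff:
  assumes f: "sq_int M f" and g: "sq_int M g"
  shows "l2 M (\<lambda>x. f x - g x) \<le> l2 M f + l2 M g"
  using l2_triangle[OF f sq_int_scaleR[OF g, of "-1"]] l2_scaleR[of M "-1" g] by simp

lemma l2_triangle_sub:
  assumes f: "sq_int M f" and g: "sq_int M g"
  shows "l2 M f \<le> l2 M g + l2 M (\<lambda>x. f x - g x)"
  using l2_triangle[OF g sq_int_diff[OF f g]] by simp

lemma l2_cong_AE:
  assumes "f \<in> borel_measurable M" "g \<in> borel_measurable M" "AE x in M. f x = g x"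
  shows "l2 M f = l2 M g"
  unfolding l2_def
  by (intro arg_cong[where f=sqrt] integral_cong_AE) (use assms in \<open>auto elim!: eventually_mono\<close>)

lemma tendsto_zero_bound:
  fixes a :: "nat \<Rightarrow> real"
  assumes "\<And>n. norm (a n) \<le> b n" "b \<longlonglongrightarrow> 0"
  shows "a \<longlonglongrightarrow> 0"
  by (rule Lim_null_comparison[OF _ assms(2)]) (rule always_eventually[OF allI[OF assms(1)]])

lemma tendsto_integral_inner:
  assumes f: "\<And>n. sq_int M (f n)" "sq_int M f'" "(\<lambda>n. l2 M (\<lambda>x. f n x - f' x)) \<longlonglongrightarrow> 0"
    and g: "sq_int M g"
  shows "(\<lambda>n. LINT x|M. f n x \<bullet> g x) \<longlonglongrightarrow> (LINT x|M. f' x \<bullet> g x)"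
proof -
  have "norm ((LINT x|M. f n x \<bullet> g x) - (LINT x|M. f' x \<bullet> g x)) \<le> l2 M (\<lambda>x. f n x - f' x) * l2 M g" for n
  proof -
    have "(LINT x|M. f n x \<bullet> g x) - (LINT x|M. f' x \<bullet> g x) = (LINT x|M. (f n x - f' x) \<bullet> g x)"
      using f g by (simp add: inner_diff_left integrable_inner_sq_int)
    then show ?thesis
      using abs_integral_inner_le[OF sq_int_diff[OF f(1,2)] g] by simp
  qed
  moreover have "(\<lambda>n. l2 M (\<lambda>x. f n x - f' x) * l2 M g) \<longlonglongrightarrow> 0 * l2 M g"
    by (intro tendsto_mult f tendsto_const)
  ultimately have "(\<lambda>n. (LINT x|M. f n x \<bullet> g x) - (LINT x|M. f' x \<bullet> g x)) \<longlonglongrightarrow> 0"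
    unfolding mult_zero_left by (rule tendsto_zero_bound)
  then show ?thesis by (rule LIM_zero_cancel)
qed

lemma tendsto_l2:
  assumes f: "\<And>n. sq_int M (f n)" "sq_int M f'" "(\<lambda>n. l2 M (\<lambda>x. f n x - f' x)) \<longlonglongrightarrow> 0"
  shows "(\<lambda>n. l2 M (f n)) \<longlonglongrightarrow> l2 M f'"
proof -
  have "norm (l2 M (f n) - l2 M f') \<le> l2 M (\<lambda>x. f n x - f' x)" for n
    using l2_triangle_sub[OF f(1)[of n] f(2)] l2_triangle_sub[OF f(2) f(1)[of n]]
    by (simp add: l2_minus_commute[of M f' "f n"] abs_le_iff)
  then have "(\<lambda>n. l2 M (f n) - l2 M f') \<longlonglongrightarrow> 0"
    using f(3) by (rule tendsto_zero_bound)
  then show ?thesis by (rule LIM_zero_cancel)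
qed

lemma summable_norm_diff_imp_convergent:
  fixes f :: "nat \<Rightarrow> 'b::banach"
  assumes "summable (\<lambda>n. norm (f (Suc n) - f n))"
  shows "convergent f"
proof -
  have "summable (\<lambda>n. f (Suc n) - f n)"
    using assms by (rule summable_norm_cancel)
  then have "convergent (\<lambda>n. \<Sum>k<n. f (Suc k) - f k)"
    by (simp add: summable_iff_convergent)
  then have "convergent (\<lambda>n. (f n - f 0) + f 0)"
    by (intro convergent_add convergent_const) (simp add: sum_lessThan_telescope)
  then show ?thesis by simp
qed

text \<open>The Riesz-Fischer argument: a subsequence with differences of norm at most
  \<open>(1/2) ^ k\<close> converges almost everywhere, and Fatou's lemma, applied with one index
  kept fixed, gives norm convergence of the whole sequence.\<close>

theorem l2_complete:
  fixes f :: "nat \<Rightarrow> 'a \<Rightarrow> 'b::euclidean_space"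
  assumes f: "\<And>n. sq_int M (f n)"
    and cauchy: "\<And>e. e > 0 \<Longrightarrow> \<exists>N. \<forall>m\<ge>N. \<forall>n\<ge>N. l2 M (\<lambda>x. f m x - f n x) \<le> e"
  obtains g where "sq_int M g" "(\<lambda>n. l2 M (\<lambda>x. f n x - g x)) \<longlonglongrightarrow> 0"
proof -
  note mf [measurable] = sq_intD(1)[OF f]
  have "\<forall>k. \<exists>N. \<forall>m\<ge>N. \<forall>n\<ge>N. l2 M (\<lambda>x. f m x - f n x) \<le> (1/2) ^ k"
    by (intro allI cauchy) simp
  then obtain N where N: "\<And>k m n. m \<ge> N k \<Longrightarrow> n \<ge> N k \<Longrightarrow> l2 M (\<lambda>x. f m x - f n x) \<le> (1/2) ^ k"
    unfolding choice_iff by blast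
  \<comment> \<open>Partial sums dominate every single \<open>N k\<close> and are monotone in
    \<open>k\<close>, so one sequence of indices meets all the requirements.\<close>
  define r where "r k = (\<Sum>i\<le>k. N i)" for k
  have rN: "r k \<ge> N k" for k
    unfolding r_def by (rule member_le_sum) auto
  have rN': "r (Suc k) \<ge> N k" for k
    using rN[of k] by (simp add: r_def)
  define d where "d k x = f (r (Suc k)) x - f (r k) x" for k x
  have d: "sq_int M (d k)" "l2 M (d k) \<le> (1/2) ^ k" for k
    unfolding d_def[abs_def] using N[OF rN' rN] by (auto intro: sq_int_diff f)
  note md [measurable] = sq_intD(1)[OF d(1)]
  have nnd: "(\<integral>\<^sup>+ x. ennreal (2 ^ k * (norm (d k x))\<^sup>2) \<partial>M) \<le> ennreal ((1/2) ^ k)" for k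
  proof -
    have "(\<integral>\<^sup>+ x. ennreal (2 ^ k * (norm (d k x))\<^sup>2) \<partial>M) = ennreal (2 ^ k * (l2 M (d k))\<^sup>2)"
      unfolding l2_square using sq_intD(2)[OF d(1)] by (subst nn_integral_eq_integral) auto
    also have "\<dots> \<le> ennreal (2 ^ k * ((1/2) ^ k)\<^sup>2)"
      by (intro ennreal_leI mult_left_mono power_mono d) auto
    also have "2 ^ k * ((1/2) ^ k)\<^sup>2 = (1/2 :: real) ^ k"
      by (simp add: power2_eq_square power_divide field_simps)
    finally show ?thesis .
  qed
  have "(\<integral>\<^sup>+ x. (\<Sum>k. ennreal (2 ^ k * (norm (d k x))\<^sup>2)) \<partial>M) = (\<Sum>k. \<integral>\<^sup>+ x. ennreal (2 ^ k * (norm (d k x))\<^sup>2) \<partial>M)"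
    by (rule nn_integral_suminf) measurable
  also have "\<dots> \<le> (\<Sum>k. ennreal ((1/2) ^ k))"
    by (intro suminf_le nnd) auto
  finally have le: "(\<integral>\<^sup>+ x. (\<Sum>k. ennreal (2 ^ k * (norm (d k x))\<^sup>2)) \<partial>M) \<le> (\<Sum>k. ennreal ((1/2) ^ k))" .
  have "(\<Sum>k. ennreal ((1/2) ^ k)) \<noteq> top"
    by (rule ennreal_suminf_neq_top) (simp_all add: summable_geometric)
  with le have fin: "(\<integral>\<^sup>+ x. (\<Sum>k. ennreal (2 ^ k * (norm (d k x))\<^sup>2)) \<partial>M) \<noteq> \<infinity>"
    by (metis infinity_ennreal_def neq_top_trans)
  have "(\<lambda>x. \<Sum>k. ennreal (2 ^ k * (norm (d k x))\<^sup>2)) \<in> borel_measurable M"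
    by measurable
  then have "AE x in M. (\<Sum>k. ennreal (2 ^ k * (norm (d k x))\<^sup>2)) \<noteq> \<infinity>"
    using fin by (rule nn_integral_PInf_AE)
  then have conv: "AE x in M. convergent (\<lambda>k. f (r k) x)"
  proof eventually_elim
    case (elim x)
    have "summable (\<lambda>k. 2 ^ k * (norm (d k x))\<^sup>2)"
      by (rule summable_suminf_not_top) (use elim in simp_all)
    moreover have "summable (\<lambda>k. (1/2 :: real) ^ k)" by simp
    ultimately have "summable (\<lambda>k. 2 ^ k * (norm (d k x))\<^sup>2 + (1/2) ^ k)" by (rule summable_add)
    \<comment> \<open>Either the norm is already below \<open>(1/2) ^ k\<close>, or the weight
      \<open>2 ^ k\<close> makes the weighted square dominate it. The weight is still small enough
      for the integrals of the weighted squares to be summable.\<close>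
    moreover have "norm (norm (d k x)) \<le> 2 ^ k * (norm (d k x))\<^sup>2 + (1/2) ^ k" for k
    proof (cases "norm (d k x) \<le> (1/2) ^ k")
      case True
      then show ?thesis by (simp add: add_increasing)
    next
      case False
      then have "1 \<le> 2 ^ k * norm (d k x)" by (simp add: field_simps power_divide)
      then have "1 * norm (d k x) \<le> 2 ^ k * norm (d k x) * norm (d k x)" by (intro mult_right_mono) auto
      then show ?thesis by (simp add: power2_eq_square mult.assoc add_increasing2)
    qed
    ultimately have "summable (\<lambda>k. norm (d k x))"
      by (intro summable_comparison_test'[where N=0 and f="\<lambda>k. norm (d k x)"])
    then show ?case
      unfolding d_def by (rule summable_norm_diff_imp_convergent)
  qed
  define g where "g x = lim (\<lambda>k. f (r k) x)" for x
  have mg [measurable]: "g \<in> borel_measurable M"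
    unfolding g_def[abs_def] by (rule borel_measurable_lim_metric) measurable
  have lim: "AE x in M. (\<lambda>k. f (r k) x) \<longlonglongrightarrow> g x"
    using conv by eventually_elim (simp add: g_def convergent_LIMSEQ_iff)
  have fatou: "(\<integral>\<^sup>+ x. ennreal ((norm (f n x - g x))\<^sup>2) \<partial>M) \<le> ennreal (((1/2) ^ k)\<^sup>2)" if "n \<ge> N k" for n k
  proof -
    have "(\<integral>\<^sup>+ x. ennreal ((norm (f n x - g x))\<^sup>2) \<partial>M)
        = (\<integral>\<^sup>+ x. liminf (\<lambda>j. ennreal ((norm (f n x - f (r j) x))\<^sup>2)) \<partial>M)"
    proof (rule nn_integral_cong_AE)
      show "AE x in M. ennreal ((norm (f n x - g x))\<^sup>2) = liminf (\<lambda>j. ennreal ((norm (f n x - f (r j) x))\<^sup>2))"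
        using lim
      proof eventually_elim
        case (elim x)
        have "(\<lambda>j. ennreal ((norm (f n x - f (r j) x))\<^sup>2)) \<longlonglongrightarrow> ennreal ((norm (f n x - g x))\<^sup>2)"
          by (intro tendsto_ennrealI tendsto_intros elim)
        then show ?case
          by (rule lim_imp_Liminf[OF sequentially_bot, symmetric])
      qed
    qed
    also have "\<dots> \<le> liminf (\<lambda>j. \<integral>\<^sup>+ x. ennreal ((norm (f n x - f (r j) x))\<^sup>2) \<partial>M)"
      by (rule nn_integral_liminf) measurable
    also have "\<dots> \<le> ennreal (((1/2) ^ k)\<^sup>2)"
    proof (rule Liminf_le)
      show "eventually (\<lambda>j. (\<integral>\<^sup>+ x. ennreal ((norm (f n x - f (r j) x))\<^sup>2) \<partial>M) \<le> ennreal (((1/2) ^ k)\<^sup>2)) sequentially"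
      proof (rule eventually_sequentiallyI[of k])
        fix j assume "j \<ge> k"
        then have "r j \<ge> r k" unfolding r_def by (intro sum_mono2) auto
        then have "l2 M (\<lambda>x. f n x - f (r j) x) \<le> (1/2) ^ k"
          using N[OF that] rN[of k] by simp
        moreover have "(\<integral>\<^sup>+ x. ennreal ((norm (f n x - f (r j) x))\<^sup>2) \<partial>M) = ennreal ((l2 M (\<lambda>x. f n x - f (r j) x))\<^sup>2)"
          unfolding l2_square using sq_intD(2)[OF sq_int_diff[OF f f]] by (intro nn_integral_eq_integral) auto
        ultimately show "(\<integral>\<^sup>+ x. ennreal ((norm (f n x - f (r j) x))\<^sup>2) \<partial>M) \<le> ennreal (((1/2) ^ k)\<^sup>2)"
          by (auto intro!: ennreal_leI power_mono)
      qed
    qed simp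
    finally show ?thesis .
  qed
  have diff: "sq_int M (\<lambda>x. f n x - g x)" "l2 M (\<lambda>x. f n x - g x) \<le> (1/2) ^ k" if "n \<ge> N k" for n k
  proof -
    have "(\<integral>\<^sup>+ x. ennreal (norm ((norm (f n x - g x))\<^sup>2)) \<partial>M) < \<infinity>"
      using order.strict_trans1[OF fatou[OF that] ennreal_less_top] by simp
    then have i: "integrable M (\<lambda>x. (norm (f n x - g x))\<^sup>2)"
      by (intro integrableI_bounded) auto
    then show "sq_int M (\<lambda>x. f n x - g x)"
      by (simp add: sq_int_def)
    have "ennreal ((l2 M (\<lambda>x. f n x - g x))\<^sup>2) \<le> ennreal (((1/2) ^ k)\<^sup>2)"
      using fatou[OF that] i unfolding l2_square by (subst (asm) nn_integral_eq_integral) auto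
    then show "l2 M (\<lambda>x. f n x - g x) \<le> (1/2) ^ k"
      by (subst (asm) ennreal_le_iff) (auto intro: power2_le_imp_le)
  qed
  have "sq_int M (\<lambda>x. f (N 0) x - (f (N 0) x - g x))"
    by (intro sq_int_diff f diff(1)) auto
  then have "sq_int M g" by simp
  moreover have "(\<lambda>n. l2 M (\<lambda>x. f n x - g x)) \<longlonglongrightarrow> 0"
  proof (rule LIMSEQ_I)
    fix e :: real assume "e > 0"
    then obtain k where k: "(1/2 :: real) ^ k < e"
      using real_arch_pow_inv[of e "1/2"] by auto
    show "\<exists>no. \<forall>n\<ge>no. norm (l2 M (\<lambda>x. f n x - g x) - 0) < e"
      using diff(2) k by (intro exI[of _ "N k"]) (auto intro: le_less_trans)
  qed
  ultimately show thesis by (rule that)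
qed

subsection \<open>Weak gradients\<close>

lemma open_in_lebesgue: "open D \<Longrightarrow> D \<in> sets lebesgue"
  by (intro sets_completionI_sets) simp

lemma compact_in_lebesgue: "compact C \<Longrightarrow> C \<in> sets lebesgue"
  by (intro sets_completionI_sets) (simp add: compact_imp_closed)

lemma sq_int_on_iff:
  assumes "D \<in> sets lebesgue"
  shows "sq_int (lebesgue_on D) f \<longleftrightarrow> sq_int lebesgue (\<lambda>x. if x \<in> D then f x else 0)"
proof -
  have "(\<lambda>x. (norm (if x \<in> D then f x else 0))\<^sup>2) = (\<lambda>x. if x \<in> D then (norm (f x))\<^sup>2 else 0)"
    by auto
  then show ?thesis
    by (simp add: sq_int_def borel_measurable_if[OF assms] Lebesgue_Measure.integrable_restrict_UNIV[OF assms])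
qed

lemma l2_on_eq:
  assumes "D \<in> sets lebesgue"
  shows "l2 (lebesgue_on D) f = l2 lebesgue (\<lambda>x. if x \<in> D then f x else 0)"
proof -
  have "(\<lambda>x. (norm (if x \<in> D then f x else 0))\<^sup>2) = (\<lambda>x. if x \<in> D then (norm (f x))\<^sup>2 else 0)"
    by auto
  then show ?thesis
    by (simp add: l2_def Lebesgue_Measure.integral_restrict_UNIV[OF assms])
qed

lemma sq_int_restrict:
  assumes "sq_int lebesgue f" "D \<in> sets lebesgue"
  shows "sq_int (lebesgue_on D) f"
proof -
  have m: "(\<lambda>x. if x \<in> D then f x else 0) \<in> borel_measurable lebesgue"
    using assms by (intro borel_measurable_if_I measurable_restrict_space1) (auto simp: sq_int_def)
  have "sq_int lebesgue (\<lambda>x. if x \<in> D then f x else 0)"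
    by (rule sq_int_bound[OF assms(1) m, of 1]) auto
  then show ?thesis by (simp add: sq_int_on_iff[OF assms(2)])
qed

lemma sq_int_subset:
  assumes "sq_int (lebesgue_on D) f" "D \<in> sets lebesgue" "C \<in> sets lebesgue" "C \<subseteq> D"
  shows "sq_int (lebesgue_on C) f"
proof -
  have "sq_int (lebesgue_on C) (\<lambda>x. if x \<in> D then f x else 0)"
    using assms by (intro sq_int_restrict) (simp add: sq_int_on_iff)
  moreover have "(\<lambda>x. if x \<in> C then (if x \<in> D then f x else 0) else 0) = (\<lambda>x. if x \<in> C then f x else 0)"
    using assms(4) by (auto simp: fun_eq_iff)
  ultimately show ?thesis
    by (simp add: sq_int_on_iff[OF assms(3)])
qed

lemma sq_int_const_on:
  assumes "bounded C" "C \<in> sets lebesgue"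
  shows "sq_int (lebesgue_on C) (\<lambda>_. c)"
proof -
  have "C \<in> lmeasurable"
    using assms by (rule bounded_set_imp_lmeasurable)
  then have "emeasure lebesgue C < \<infinity>"
    by (simp add: fmeasurable_def del: emeasure_completion)
  then have "finite_measure (lebesgue_on C)"
    using assms(2) by (intro finite_measureI) (simp add: emeasure_restrict_space del: emeasure_completion)
  then show ?thesis
    using finite_measure.integrable_const by (auto simp: sq_int_def)
qed

lemma sq_int_imp_integrable:
  fixes f :: "'a::euclidean_space \<Rightarrow> 'b::euclidean_space"
  assumes "sq_int (lebesgue_on C) f" "bounded C" "C \<in> sets lebesgue"
  shows "integrable (lebesgue_on C) f"
proof -
  have "integrable (lebesgue_on C) (\<lambda>x. norm (1::real) * norm (f x))"
    by (rule integrable_norm_mult[OF sq_int_const_on[OF assms(2,3)] assms(1)])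
  then have "integrable (lebesgue_on C) (\<lambda>x. norm (f x))" by simp
  then show ?thesis
    by (rule integrable_norm_cancel) (rule sq_intD[OF assms(1)])
qed

lemma sq_int_imp_L1_loc:
  assumes "sq_int (lebesgue_on D) f" "D \<in> sets lebesgue"
  shows "f \<in> L1_loc D"
  unfolding L1_loc_def
proof (intro CollectI allI impI)
  fix C assume C: "compact C" "C \<subseteq> D"
  show "integrable (lebesgue_on C) f"
    by (rule sq_int_imp_integrable[OF sq_int_subset[OF assms compact_in_lebesgue[OF C(1)] C(2)]])
       (use C compact_imp_bounded compact_in_lebesgue in blast)+
qed

text \<open>Along a compact exhaustion of \<open>D\<close> the truncations of \<open>f\<close> are
  measurable and at every point eventually constant, so \<open>f\<close> extended by zero is their
  pointwise limit.\<close>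

lemma L1_loc_measurable:
  fixes f :: "'a::euclidean_space \<Rightarrow> 'b::euclidean_space"
  assumes "open D" "f \<in> L1_loc D"
  shows "f \<in> borel_measurable (lebesgue_on D)"
proof -
  obtain C :: "nat \<Rightarrow> 'a set" where C: "\<And>n. compact (C n)" "\<And>n. C n \<subseteq> D"
    "\<And>K. \<lbrakk>compact K; K \<subseteq> D\<rbrakk> \<Longrightarrow> \<exists>N. \<forall>n\<ge>N. K \<subseteq> C n"
  proof (rule open_Union_compact_subsets[OF assms(1)])
    fix C :: "nat \<Rightarrow> 'a set"
    assume 1: "\<And>n. compact (C n)" and 2: "\<And>n. C n \<subseteq> D"
      and 3: "\<And>K. \<lbrakk>compact K; K \<subseteq> D\<rbrakk> \<Longrightarrow> \<exists>N. \<forall>n\<ge>N. K \<subseteq> C n"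
    show thesis by (rule that[OF 1 2 3])
  qed
  have "(\<lambda>x. if x \<in> D then f x else 0) \<in> borel_measurable lebesgue"
  proof (rule borel_measurable_LIMSEQ_metric)
    show "(\<lambda>x. if x \<in> C n then f x else 0) \<in> borel_measurable lebesgue" for n
    proof (rule borel_measurable_if_I)
      have "integrable (lebesgue_on (C n)) f"
        using assms(2) C(1,2) unfolding L1_loc_def by blast
      then show "f \<in> borel_measurable (lebesgue_on (C n))" by (rule borel_measurable_integrable)
    qed (rule compact_in_lebesgue[OF C(1)])
    show "(\<lambda>n. if x \<in> C n then f x else 0) \<longlonglongrightarrow> (if x \<in> D then f x else 0)" for x
    proof (cases "x \<in> D")
      case True
      then obtain N where "\<And>n. n \<ge> N \<Longrightarrow> x \<in> C n"
        using C(3)[of "{x}"] by auto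
      then have "eventually (\<lambda>n. (if x \<in> C n then f x else 0) = (if x \<in> D then f x else 0)) sequentially"
        using True by (intro eventually_sequentiallyI[of N]) simp
      then show ?thesis by (rule tendsto_eventually)
    next
      case False
      then have "x \<notin> C n" for n using C(2) by blast
      then show ?thesis using False by simp
    qed
  qed
  then show ?thesis by (rule borel_measurable_if_D)
qed

lemma L1_loc_lincomb:
  fixes f g :: "'a::euclidean_space \<Rightarrow> 'b::euclidean_space"
  assumes "f \<in> L1_loc D" "g \<in> L1_loc D"
  shows "(\<lambda>x. \<alpha> *\<^sub>R f x + \<beta> *\<^sub>R g x) \<in> L1_loc D"
  unfolding L1_loc_def
proof (intro CollectI allI impI)
  fix C assume "compact C" "C \<subseteq> D"
  then have "integrable (lebesgue_on C) f" "integrable (lebesgue_on C) g"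
    using assms unfolding L1_loc_def by blast+
  then show "integrable (lebesgue_on C) (\<lambda>x. \<alpha> *\<^sub>R f x + \<beta> *\<^sub>R g x)"
    by (intro Bochner_Integration.integrable_add integrable_scaleR_right)
qed

lemma integrable_test_mult:
  fixes f :: "'a::euclidean_space \<Rightarrow> 'b::euclidean_space"
  assumes D: "open D" and f: "f \<in> L1_loc D" and \<phi>: "\<phi> \<in> test_functions D"
  shows "integrable (lebesgue_on D) (\<lambda>x. \<phi> x *\<^sub>R f x)"
proof -
  obtain S where S: "compact S" "S \<subseteq> D" "\<And>x. x \<notin> S \<Longrightarrow> \<phi> x = 0"
    by (rule test_functionsE[OF \<phi>]) blast
  have c: "continuous_on UNIV \<phi>" by (rule continuous_on_test_function[OF \<phi>])
  have "bounded (\<phi> ` S)"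
    by (intro compact_imp_bounded compact_continuous_image continuous_on_subset[OF c] S(1)) simp
  then obtain M where M: "\<And>x. x \<in> S \<Longrightarrow> \<bar>\<phi> x\<bar> \<le> M"
    unfolding bounded_iff by auto
  let ?f = "\<lambda>x. if x \<in> S then f x else 0"
  have "integrable (lebesgue_on S) f"
    using f S unfolding L1_loc_def by blast
  then have i: "integrable lebesgue ?f"
    by (rule Lebesgue_Measure.integrable_restrict_UNIV[OF compact_in_lebesgue[OF S(1)], THEN iffD2])
  have "integrable lebesgue (\<lambda>x. \<phi> x *\<^sub>R ?f x)"
  proof (rule Bochner_Integration.integrable_bound[where f="\<lambda>x. M *\<^sub>R ?f x"])
    show "integrable lebesgue (\<lambda>x. M *\<^sub>R ?f x)" using i by (rule integrable_scaleR_right)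
    show "(\<lambda>x. \<phi> x *\<^sub>R ?f x) \<in> borel_measurable lebesgue"
      by (intro borel_measurable_scaleR borel_measurable_lebesgue_continuous c borel_measurable_integrable i)
    show "AE x in lebesgue. norm (\<phi> x *\<^sub>R ?f x) \<le> norm (M *\<^sub>R ?f x)"
    proof (rule AE_I2)
      fix x
      show "norm (\<phi> x *\<^sub>R ?f x) \<le> norm (M *\<^sub>R ?f x)"
        using order_trans[OF M[of x] abs_ge_self[of M]] by (auto intro: mult_right_mono)
    qed
  qed
  moreover have "(\<lambda>x. \<phi> x *\<^sub>R ?f x) = (\<lambda>x. if x \<in> D then \<phi> x *\<^sub>R f x else 0)"
  proof
    fix x show "\<phi> x *\<^sub>R ?f x = (if x \<in> D then \<phi> x *\<^sub>R f x else 0)"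
      using S(2) S(3)[of x] by (cases "x \<in> S") auto
  qed
  ultimately show ?thesis
    using Lebesgue_Measure.integrable_restrict_UNIV[OF open_in_lebesgue[OF D], of "\<lambda>x. \<phi> x *\<^sub>R f x"] by simp
qed

lemma scaleR_grad: "c *\<^sub>R grad \<phi> x = (\<Sum>i\<in>Basis. (frechet_derivative \<phi> (at x) i *\<^sub>R c) *\<^sub>R i)"
  by (simp add: grad_def scaleR_sum_right mult.commute)

lemma integrable_mult_grad_test:
  fixes u :: "'a::euclidean_space \<Rightarrow> real"
  assumes "open D" "u \<in> L1_loc D" "\<phi> \<in> test_functions D"
  shows "integrable (lebesgue_on D) (\<lambda>x. u x *\<^sub>R grad \<phi> x)"
  unfolding scaleR_grad
  by (intro Bochner_Integration.integrable_sum integrable_scaleR_left integrable_test_mult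
      test_functions_partial assms)

lemma is_weak_gradient_lincomb:
  fixes u v :: "'a::euclidean_space \<Rightarrow> real"
  assumes D: "open D" and u: "is_weak_gradient D u g" and v: "is_weak_gradient D v h"
  shows "is_weak_gradient D (\<lambda>x. \<alpha> * u x + \<beta> * v x) (\<lambda>x. \<alpha> *\<^sub>R g x + \<beta> *\<^sub>R h x)"
  unfolding is_weak_gradient_def
proof (intro conjI ballI)
  have loc: "u \<in> L1_loc D" "g \<in> L1_loc D" "v \<in> L1_loc D" "h \<in> L1_loc D"
    using u v by (auto simp: is_weak_gradient_def)
  show "(\<lambda>x. \<alpha> * u x + \<beta> * v x) \<in> L1_loc D"
    using L1_loc_lincomb[OF loc(1,3)] by simp
  show "(\<lambda>x. \<alpha> *\<^sub>R g x + \<beta> *\<^sub>R h x) \<in> L1_loc D"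
    by (rule L1_loc_lincomb[OF loc(2,4)])
  fix \<phi> assume \<phi>: "\<phi> \<in> test_functions D"
  note i = integrable_mult_grad_test[OF D loc(1) \<phi>] integrable_mult_grad_test[OF D loc(3) \<phi>]
    integrable_test_mult[OF D loc(2) \<phi>] integrable_test_mult[OF D loc(4) \<phi>]
  have "(LINT x|lebesgue_on D. (\<alpha> * u x + \<beta> * v x) *\<^sub>R grad \<phi> x)
      = (LINT x|lebesgue_on D. \<alpha> *\<^sub>R (u x *\<^sub>R grad \<phi> x) + \<beta> *\<^sub>R (v x *\<^sub>R grad \<phi> x))"
    by (simp add: scaleR_add_left)
  also have "\<dots> = \<alpha> *\<^sub>R (LINT x|lebesgue_on D. u x *\<^sub>R grad \<phi> x) + \<beta> *\<^sub>R (LINT x|lebesgue_on D. v x *\<^sub>R grad \<phi> x)"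
    by (subst Bochner_Integration.integral_add) (intro integrable_scaleR_right i | simp del: scaleR_scaleR)+
  also have "\<dots> = - (\<alpha> *\<^sub>R (LINT x|lebesgue_on D. \<phi> x *\<^sub>R g x) + \<beta> *\<^sub>R (LINT x|lebesgue_on D. \<phi> x *\<^sub>R h x))"
    using u v \<phi> by (simp add: is_weak_gradient_def)
  also have "\<alpha> *\<^sub>R (LINT x|lebesgue_on D. \<phi> x *\<^sub>R g x) + \<beta> *\<^sub>R (LINT x|lebesgue_on D. \<phi> x *\<^sub>R h x)
      = (LINT x|lebesgue_on D. \<alpha> *\<^sub>R (\<phi> x *\<^sub>R g x) + \<beta> *\<^sub>R (\<phi> x *\<^sub>R h x))"
    by (subst Bochner_Integration.integral_add) (intro integrable_scaleR_right i | simp del: scaleR_scaleR)+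
  also have "\<dots> = (LINT x|lebesgue_on D. \<phi> x *\<^sub>R (\<alpha> *\<^sub>R g x + \<beta> *\<^sub>R h x))"
    by (simp add: scaleR_add_right mult.commute)
  finally show "(LINT x|lebesgue_on D. (\<alpha> * u x + \<beta> * v x) *\<^sub>R grad \<phi> x)
      = - (LINT x|lebesgue_on D. \<phi> x *\<^sub>R (\<alpha> *\<^sub>R g x + \<beta> *\<^sub>R h x))" .
qed

lemma is_weak_gradient_unique:
  fixes u v :: "'a::euclidean_space \<Rightarrow> real"
  assumes D: "open D" and u: "is_weak_gradient D u g" and v: "is_weak_gradient D v h"
    and eq: "AE x in lebesgue_on D. u x = v x"
  shows "AE x in lebesgue_on D. g x = h x"
proof -
  have loc: "u \<in> L1_loc D" "g \<in> L1_loc D" "v \<in> L1_loc D" "h \<in> L1_loc D"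
    using u v by (auto simp: is_weak_gradient_def)
  have "AE x in lebesgue_on D. g x - h x = 0"
  proof (rule fundamental_lemma[OF D])
    show "(\<lambda>x. g x - h x) \<in> L1_loc D"
      using L1_loc_lincomb[OF loc(2,4), of 1 "-1"] by simp
    fix \<phi> assume \<phi>: "\<phi> \<in> test_functions D"
    note i = integrable_mult_grad_test[OF D loc(1) \<phi>] integrable_mult_grad_test[OF D loc(3) \<phi>]
      integrable_test_mult[OF D loc(2) \<phi>] integrable_test_mult[OF D loc(4) \<phi>]
    have "(LINT x|lebesgue_on D. \<phi> x *\<^sub>R (g x - h x))
        = (LINT x|lebesgue_on D. \<phi> x *\<^sub>R g x) - (LINT x|lebesgue_on D. \<phi> x *\<^sub>R h x)"
      using i by (simp add: scaleR_diff_right)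
    moreover have "(LINT x|lebesgue_on D. u x *\<^sub>R grad \<phi> x) = (LINT x|lebesgue_on D. v x *\<^sub>R grad \<phi> x)"
    proof (rule integral_cong_AE)
      show "AE x in lebesgue_on D. u x *\<^sub>R grad \<phi> x = v x *\<^sub>R grad \<phi> x"
        using eq by eventually_elim simp
    qed (intro borel_measurable_integrable i)+
    moreover have "(LINT x|lebesgue_on D. u x *\<^sub>R grad \<phi> x) = - (LINT x|lebesgue_on D. \<phi> x *\<^sub>R g x)"
      "(LINT x|lebesgue_on D. v x *\<^sub>R grad \<phi> x) = - (LINT x|lebesgue_on D. \<phi> x *\<^sub>R h x)"
      using u v \<phi> by (auto simp: is_weak_gradient_def)
    ultimately show "(LINT x|lebesgue_on D. \<phi> x *\<^sub>R (g x - h x)) = 0" by simp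
  qed
  then show ?thesis by eventually_elim simp
qed

lemma is_weak_gradient_wgrad: "is_weak_gradient D u g \<Longrightarrow> is_weak_gradient D u (wgrad D u)"
  unfolding wgrad_def by (rule someI[of "is_weak_gradient D u" g])

text \<open>Makes the choice inside \<open>wgrad\<close> harmless: under an integral it may be
  exchanged for any explicit representative.\<close>

lemma wgrad_AE_eq:
  "open D \<Longrightarrow> is_weak_gradient D u g \<Longrightarrow> AE x in lebesgue_on D. wgrad D u x = g x"
  by (rule is_weak_gradient_unique[OF _ is_weak_gradient_wgrad]) auto

lemma integral_on_support:
  fixes f :: "'a::euclidean_space \<Rightarrow> 'b::euclidean_space"
  assumes "S \<subseteq> D" "D \<in> sets lebesgue" "\<And>x. x \<notin> S \<Longrightarrow> f x = 0"
  shows "(LINT x|lebesgue_on D. f x) = (LINT x|lebesgue. f x)"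
proof -
  have "(\<lambda>x. if x \<in> D then f x else 0) = f"
  proof
    fix x show "(if x \<in> D then f x else 0) = f x"
      using assms(1) assms(3)[of x] by (cases "x \<in> S") auto
  qed
  then show ?thesis
    using Lebesgue_Measure.integral_restrict_UNIV[OF assms(2), of f] by simp
qed

lemma is_weak_gradient_classical:
  fixes u :: "'a::euclidean_space \<Rightarrow> real"
  assumes D: "open D" "bounded D" and u: "\<And>x. x \<in> D \<Longrightarrow> (u has_derivative (\<lambda>h. g x \<bullet> h)) (at x)"
    and g: "continuous_on D g"
  shows "is_weak_gradient D u g"
  unfolding is_weak_gradient_def
proof (intro conjI ballI)
  have cont: "continuous_on D u"
    using u by (meson continuous_at_imp_continuous_on has_derivative_continuous)
  have loc: "f \<in> L1_loc D" if f: "continuous_on D f" for f :: "'a \<Rightarrow> 'b::euclidean_space"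
    unfolding L1_loc_def
  proof (intro CollectI allI impI)
    fix C assume C: "compact C" "C \<subseteq> D"
    have "integrable lborel (\<lambda>x. indicator C x *\<^sub>R f x)"
      by (rule borel_integrable_compact[OF C(1) continuous_on_subset[OF f C(2)]])
    then have "integrable lebesgue (\<lambda>x. indicator C x *\<^sub>R f x)"
      using integrable_completion[OF borel_measurable_integrable] by blast
    moreover have "(\<lambda>x. indicator C x *\<^sub>R f x) = (\<lambda>x. if x \<in> C then f x else 0)"
      by (auto simp: indicator_def)
    ultimately show "integrable (lebesgue_on C) f"
      using Lebesgue_Measure.integrable_restrict_UNIV[OF compact_in_lebesgue[OF C(1)], of f] by simp
  qed
  show "u \<in> L1_loc D" "g \<in> L1_loc D"
    by (rule loc[OF cont], rule loc[OF g])
  fix \<phi> assume \<phi>: "\<phi> \<in> test_functions D"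
  obtain S where S: "S \<subseteq> D" "\<And>x. x \<notin> S \<Longrightarrow> \<phi> x = 0" "\<And>x. x \<notin> S \<Longrightarrow> grad \<phi> x = 0"
    by (rule grad_test_support[OF \<phi>]) blast
  have "(LINT x|lebesgue_on D. u x *\<^sub>R grad \<phi> x) = (LINT x|lebesgue. u x *\<^sub>R grad \<phi> x)"
    by (rule integral_on_support[OF S(1) open_in_lebesgue[OF D(1)]]) (simp add: S(3))
  moreover have "(LINT x|lebesgue_on D. \<phi> x *\<^sub>R g x) = (LINT x|lebesgue. \<phi> x *\<^sub>R g x)"
    by (rule integral_on_support[OF S(1) open_in_lebesgue[OF D(1)]]) (simp add: S(2))
  ultimately show "(LINT x|lebesgue_on D. u x *\<^sub>R grad \<phi> x) = - (LINT x|lebesgue_on D. \<phi> x *\<^sub>R g x)"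
    using weak_gradient_classical[OF D(1) u g \<phi>] by simp
qed

lemma is_weak_gradient_subset:
  assumes D: "open D" "open B" "B \<subseteq> D" and u: "is_weak_gradient D u g"
  shows "is_weak_gradient B u g"
  unfolding is_weak_gradient_def
proof (intro conjI ballI)
  show "u \<in> L1_loc B" "g \<in> L1_loc B"
    using u D(3) unfolding is_weak_gradient_def L1_loc_def by blast+
  fix \<phi> assume \<phi>: "\<phi> \<in> test_functions B"
  then have \<phi>': "\<phi> \<in> test_functions D" using test_functions_mono[OF D(3)] by blast
  obtain S where S: "S \<subseteq> B" "\<And>x. x \<notin> S \<Longrightarrow> \<phi> x = 0" "\<And>x. x \<notin> S \<Longrightarrow> grad \<phi> x = 0"
    by (rule grad_test_support[OF \<phi>]) blast
  have S': "S \<subseteq> D" using S(1) D(3) by blast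
  note m = open_in_lebesgue[OF D(1)] open_in_lebesgue[OF D(2)]
  have "(LINT x|lebesgue_on B. u x *\<^sub>R grad \<phi> x) = (LINT x|lebesgue. u x *\<^sub>R grad \<phi> x)"
    "(LINT x|lebesgue_on D. u x *\<^sub>R grad \<phi> x) = (LINT x|lebesgue. u x *\<^sub>R grad \<phi> x)"
    by (rule integral_on_support[OF S(1) m(2)], simp add: S(3), rule integral_on_support[OF S' m(1)], simp add: S(3))
  moreover have "(LINT x|lebesgue_on B. \<phi> x *\<^sub>R g x) = (LINT x|lebesgue. \<phi> x *\<^sub>R g x)"
    "(LINT x|lebesgue_on D. \<phi> x *\<^sub>R g x) = (LINT x|lebesgue. \<phi> x *\<^sub>R g x)"
    by (rule integral_on_support[OF S(1) m(2)], simp add: S(2), rule integral_on_support[OF S' m(1)], simp add: S(2))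
  ultimately show "(LINT x|lebesgue_on B. u x *\<^sub>R grad \<phi> x) = - (LINT x|lebesgue_on B. \<phi> x *\<^sub>R g x)"
    using u \<phi>' by (simp add: is_weak_gradient_def)
qed

lemma sq_int_continuous_compact_support:
  fixes f :: "'a::euclidean_space \<Rightarrow> 'b::euclidean_space"
  assumes "continuous_on UNIV f" "compact S" "\<And>x. x \<notin> S \<Longrightarrow> f x = 0"
  shows "sq_int lebesgue f"
  unfolding sq_int_def
proof
  show "integrable lebesgue (\<lambda>x. (norm (f x))\<^sup>2)"
    by (rule integrable_continuous_compact_support[OF _ assms(2)])
       (auto intro!: continuous_intros assms(1) simp: assms(3))
qed (rule borel_measurable_lebesgue_continuous[OF assms(1)])

lemma sq_int_test:
  assumes "\<phi> \<in> test_functions D"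
  shows "sq_int lebesgue \<phi>" "sq_int lebesgue (grad \<phi>)"
proof -
  obtain S where S: "compact S" "\<And>x. x \<notin> S \<Longrightarrow> \<phi> x = 0" "\<And>x. x \<notin> S \<Longrightarrow> grad \<phi> x = 0"
    by (rule grad_test_support[OF assms]) blast
  show "sq_int lebesgue \<phi>" "sq_int lebesgue (grad \<phi>)"
    by (rule sq_int_continuous_compact_support[OF continuous_on_test_function[OF assms] S(1,2)],
        assumption, rule sq_int_continuous_compact_support[OF continuous_on_grad_test[OF assms] S(1,3)], assumption)
qed

subsection \<open>Functions with zero boundary values\<close>

text \<open>A description of \<open>H1_0\<close> that carries the weak gradient along.\<close>

definition zero_trace :: "'a::euclidean_space set \<Rightarrow> ('a \<Rightarrow> real) \<Rightarrow> ('a \<Rightarrow> 'a) \<Rightarrow> bool" where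
  "zero_trace D u g \<longleftrightarrow> sq_int (lebesgue_on D) u \<and> sq_int (lebesgue_on D) g \<and>
     (\<exists>\<phi>::nat \<Rightarrow> 'a \<Rightarrow> real. (\<forall>n. \<phi> n \<in> test_functions D) \<and>
        (\<lambda>n. l2 (lebesgue_on D) (\<lambda>x. u x - \<phi> n x)) \<longlonglongrightarrow> 0 \<and>
        (\<lambda>n. l2 (lebesgue_on D) (\<lambda>x. g x - grad (\<phi> n) x)) \<longlonglongrightarrow> 0)"

lemma zero_traceE:
  assumes "zero_trace D u g"
  obtains \<phi> :: "nat \<Rightarrow> 'a::euclidean_space \<Rightarrow> real" where "\<And>n. \<phi> n \<in> test_functions D"
    "(\<lambda>n. l2 (lebesgue_on D) (\<lambda>x. u x - \<phi> n x)) \<longlonglongrightarrow> 0"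
    "(\<lambda>n. l2 (lebesgue_on D) (\<lambda>x. g x - grad (\<phi> n) x)) \<longlonglongrightarrow> 0"
  using assms unfolding zero_trace_def by blast

lemma zero_trace_sq_int:
  "zero_trace D u g \<Longrightarrow> sq_int (lebesgue_on D) u"
  "zero_trace D u g \<Longrightarrow> sq_int (lebesgue_on D) g"
  by (simp_all add: zero_trace_def)

lemma zero_trace_test:
  assumes "D \<in> sets lebesgue" "\<phi> \<in> test_functions D"
  shows "zero_trace D \<phi> (grad \<phi>)"
  unfolding zero_trace_def
proof (intro conjI exI allI)
  show "sq_int (lebesgue_on D) \<phi>" "sq_int (lebesgue_on D) (grad \<phi>)"
    by (rule sq_int_restrict[OF sq_int_test(1)[OF assms(2)] assms(1)],
        rule sq_int_restrict[OF sq_int_test(2)[OF assms(2)] assms(1)])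
  show "\<phi> \<in> test_functions D" by (rule assms)
qed (simp_all add: l2_def)

text \<open>Permits a change of representative of the gradient, in particular to one that has a
  meaningful value at the origin.\<close>

lemma zero_trace_cong:
  assumes u: "zero_trace D u g" and m: "g' \<in> borel_measurable (lebesgue_on D)"
    and ae: "AE x in lebesgue_on D. g x = g' x"
  shows "zero_trace D u g'"
proof -
  obtain \<phi> where \<phi>: "\<And>n. \<phi> n \<in> test_functions D"
    "(\<lambda>n. l2 (lebesgue_on D) (\<lambda>x. u x - \<phi> n x)) \<longlonglongrightarrow> 0"
    "(\<lambda>n. l2 (lebesgue_on D) (\<lambda>x. g x - grad (\<phi> n) x)) \<longlonglongrightarrow> 0"
    by (rule zero_traceE[OF u]) blast
  have g': "sq_int (lebesgue_on D) g'"
    by (rule sq_int_bound[OF zero_trace_sq_int(2)[OF u] m, of 1]) (use ae in eventually_elim, simp)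
  have mg: "grad (\<phi> n) \<in> borel_measurable (lebesgue_on D)" for n
    by (intro measurable_restrict_space1 sq_intD(1)[OF sq_int_test(2)[OF \<phi>(1)]])
  have "l2 (lebesgue_on D) (\<lambda>x. g x - grad (\<phi> n) x) = l2 (lebesgue_on D) (\<lambda>x. g' x - grad (\<phi> n) x)" for n
  proof (rule l2_cong_AE)
    show "AE x in lebesgue_on D. g x - grad (\<phi> n) x = g' x - grad (\<phi> n) x"
      using ae by eventually_elim simp
  qed (intro borel_measurable_diff mg m sq_intD(1)[OF zero_trace_sq_int(2)[OF u]])+
  then show ?thesis
    using \<phi> g' zero_trace_sq_int(1)[OF u] unfolding zero_trace_def by auto
qed

lemma zero_trace_lincomb:
  assumes D: "D \<in> sets lebesgue" and u: "zero_trace D u g" and v: "zero_trace D v h"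
  shows "zero_trace D (\<lambda>x. \<alpha> * u x + \<beta> * v x) (\<lambda>x. \<alpha> *\<^sub>R g x + \<beta> *\<^sub>R h x)"
proof -
  obtain \<phi> where \<phi>: "\<And>n. \<phi> n \<in> test_functions D"
    "(\<lambda>n. l2 (lebesgue_on D) (\<lambda>x. u x - \<phi> n x)) \<longlonglongrightarrow> 0"
    "(\<lambda>n. l2 (lebesgue_on D) (\<lambda>x. g x - grad (\<phi> n) x)) \<longlonglongrightarrow> 0"
    by (rule zero_traceE[OF u]) blast
  obtain \<psi> where \<psi>: "\<And>n. \<psi> n \<in> test_functions D"
    "(\<lambda>n. l2 (lebesgue_on D) (\<lambda>x. v x - \<psi> n x)) \<longlonglongrightarrow> 0"
    "(\<lambda>n. l2 (lebesgue_on D) (\<lambda>x. h x - grad (\<psi> n) x)) \<longlonglongrightarrow> 0"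
    by (rule zero_traceE[OF v]) blast
  note s = zero_trace_sq_int[OF u] zero_trace_sq_int[OF v]
  note st = sq_int_restrict[OF sq_int_test(1)[OF \<phi>(1)] D] sq_int_restrict[OF sq_int_test(2)[OF \<phi>(1)] D]
    sq_int_restrict[OF sq_int_test(1)[OF \<psi>(1)] D] sq_int_restrict[OF sq_int_test(2)[OF \<psi>(1)] D]
  define \<xi> where "\<xi> n x = \<alpha> * \<phi> n x + \<beta> * \<psi> n x" for n x
  have \<xi>: "\<xi> n \<in> test_functions D" for n
    unfolding \<xi>_def[abs_def] by (intro test_functions_add test_functions_mult \<phi> \<psi> Ck_const)
  have gr: "grad (\<xi> n) x = \<alpha> *\<^sub>R grad (\<phi> n) x + \<beta> *\<^sub>R grad (\<psi> n) x" for n x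
  proof (rule grad_eqI)
    show "(\<xi> n has_derivative (\<lambda>k. (\<alpha> *\<^sub>R grad (\<phi> n) x + \<beta> *\<^sub>R grad (\<psi> n) x) \<bullet> k)) (at x)"
      unfolding \<xi>_def[abs_def] inner_add_left inner_scaleR_left
      by (intro has_derivative_add has_derivative_mult_right test_functions_has_grad[OF \<phi>(1)]
          test_functions_has_grad[OF \<psi>(1)])
  qed
  have lim: "(\<lambda>n. \<bar>\<alpha>\<bar> * a n + \<bar>\<beta>\<bar> * b n) \<longlonglongrightarrow> 0" if "a \<longlonglongrightarrow> 0" "b \<longlonglongrightarrow> 0" for a b :: "nat \<Rightarrow> real"
    using tendsto_add[OF tendsto_mult[OF tendsto_const[of "\<bar>\<alpha>\<bar>"] that(1)] tendsto_mult[OF tendsto_const[of "\<bar>\<beta>\<bar>"] that(2)]]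
    by simp
  have 1: "norm (l2 (lebesgue_on D) (\<lambda>x. (\<alpha> * u x + \<beta> * v x) - \<xi> n x))
      \<le> \<bar>\<alpha>\<bar> * l2 (lebesgue_on D) (\<lambda>x. u x - \<phi> n x) + \<bar>\<beta>\<bar> * l2 (lebesgue_on D) (\<lambda>x. v x - \<psi> n x)" for n
  proof -
    have "(\<lambda>x. (\<alpha> * u x + \<beta> * v x) - \<xi> n x) = (\<lambda>x. \<alpha> *\<^sub>R (u x - \<phi> n x) + \<beta> *\<^sub>R (v x - \<psi> n x))"
      by (simp add: \<xi>_def algebra_simps)
    then show ?thesis
      using l2_triangle[OF sq_int_scaleR[OF sq_int_diff[OF s(1) st(1)[of n]], of \<alpha>]
          sq_int_scaleR[OF sq_int_diff[OF s(3) st(3)[of n]], of \<beta>]]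
      unfolding l2_scaleR by simp
  qed
  have 2: "norm (l2 (lebesgue_on D) (\<lambda>x. (\<alpha> *\<^sub>R g x + \<beta> *\<^sub>R h x) - grad (\<xi> n) x))
      \<le> \<bar>\<alpha>\<bar> * l2 (lebesgue_on D) (\<lambda>x. g x - grad (\<phi> n) x) + \<bar>\<beta>\<bar> * l2 (lebesgue_on D) (\<lambda>x. h x - grad (\<psi> n) x)" for n
  proof -
    have "(\<lambda>x. (\<alpha> *\<^sub>R g x + \<beta> *\<^sub>R h x) - grad (\<xi> n) x)
        = (\<lambda>x. \<alpha> *\<^sub>R (g x - grad (\<phi> n) x) + \<beta> *\<^sub>R (h x - grad (\<psi> n) x))"
      by (simp add: gr algebra_simps)
    then show ?thesis
      using l2_triangle[OF sq_int_scaleR[OF sq_int_diff[OF s(2) st(2)[of n]], of \<alpha>]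
          sq_int_scaleR[OF sq_int_diff[OF s(4) st(4)[of n]], of \<beta>]]
      unfolding l2_scaleR by simp
  qed
  show ?thesis
    unfolding zero_trace_def
  proof (intro conjI exI allI)
    show "sq_int (lebesgue_on D) (\<lambda>x. \<alpha> * u x + \<beta> * v x)"
      using sq_int_add[OF sq_int_scaleR[OF s(1), of \<alpha>] sq_int_scaleR[OF s(3), of \<beta>]] by simp
    show "sq_int (lebesgue_on D) (\<lambda>x. \<alpha> *\<^sub>R g x + \<beta> *\<^sub>R h x)"
      by (rule sq_int_add[OF sq_int_scaleR[OF s(2)] sq_int_scaleR[OF s(4)]])
    show "\<xi> n \<in> test_functions D" for n by (rule \<xi>)
    show "(\<lambda>n. l2 (lebesgue_on D) (\<lambda>x. (\<alpha> * u x + \<beta> * v x) - \<xi> n x)) \<longlonglongrightarrow> 0"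
      by (rule tendsto_zero_bound[OF 1 lim[OF \<phi>(2) \<psi>(2)]])
    show "(\<lambda>n. l2 (lebesgue_on D) (\<lambda>x. (\<alpha> *\<^sub>R g x + \<beta> *\<^sub>R h x) - grad (\<xi> n) x)) \<longlonglongrightarrow> 0"
      by (rule tendsto_zero_bound[OF 2 lim[OF \<phi>(3) \<psi>(3)]])
  qed
qed

text \<open>Integration by parts holds for the approximating test functions. Paired with one fixed
  coordinate both sides are \<open>L2\<close> inner products, hence continuous under the two
  convergences.\<close>

lemma zero_trace_weak_gradient:
  fixes u :: "'a::euclidean_space \<Rightarrow> real"
  assumes D: "open D" and u: "zero_trace D u g"
  shows "is_weak_gradient D u g"
  unfolding is_weak_gradient_def
proof (intro conjI ballI)
  note mD = open_in_lebesgue[OF D]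
  note s = zero_trace_sq_int[OF u]
  obtain \<phi> where \<phi>: "\<And>n. \<phi> n \<in> test_functions D"
    "(\<lambda>n. l2 (lebesgue_on D) (\<lambda>x. u x - \<phi> n x)) \<longlonglongrightarrow> 0"
    "(\<lambda>n. l2 (lebesgue_on D) (\<lambda>x. g x - grad (\<phi> n) x)) \<longlonglongrightarrow> 0"
    by (rule zero_traceE[OF u]) blast
  note st = sq_int_restrict[OF sq_int_test(1)[OF \<phi>(1)] mD] sq_int_restrict[OF sq_int_test(2)[OF \<phi>(1)] mD]
  show loc: "u \<in> L1_loc D" "g \<in> L1_loc D"
    by (rule sq_int_imp_L1_loc[OF s(1) mD], rule sq_int_imp_L1_loc[OF s(2) mD])
  fix \<theta> assume \<theta>: "\<theta> \<in> test_functions D"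
  obtain S where S: "S \<subseteq> D" "\<And>x. x \<notin> S \<Longrightarrow> \<theta> x = 0" "\<And>x. x \<notin> S \<Longrightarrow> grad \<theta> x = 0"
    by (rule grad_test_support[OF \<theta>]) blast
  note U = subsetD[OF test_functions_mono[OF subset_UNIV]]
  note s\<theta> = sq_int_restrict[OF sq_int_test(1)[OF \<theta>] mD] sq_int_restrict[OF sq_int_test(2)[OF \<theta>] mD]
  have eq: "(LINT x|lebesgue_on D. \<phi> n x *\<^sub>R grad \<theta> x) = - (LINT x|lebesgue_on D. \<theta> x *\<^sub>R grad (\<phi> n) x)" for n
    using weak_gradient_test[OF U[OF \<phi>(1)] U[OF \<theta>]] integral_on_support[OF S(1) mD, of "\<lambda>x. \<phi> n x *\<^sub>R grad \<theta> x"]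
      integral_on_support[OF S(1) mD, of "\<lambda>x. \<theta> x *\<^sub>R grad (\<phi> n) x"] S by simp
  have i\<phi>: "integrable (lebesgue_on D) (\<lambda>x. \<phi> n x *\<^sub>R grad \<theta> x)"
    "integrable (lebesgue_on D) (\<lambda>x. \<theta> x *\<^sub>R grad (\<phi> n) x)" for n
    by (rule integrable_mult_grad_test[OF D sq_int_imp_L1_loc[OF st(1) mD] \<theta>],
        rule integrable_test_mult[OF D sq_int_imp_L1_loc[OF st(2) mD] \<theta>])
  note iu = integrable_mult_grad_test[OF D loc(1) \<theta>] integrable_test_mult[OF D loc(2) \<theta>]
  show "(LINT x|lebesgue_on D. u x *\<^sub>R grad \<theta> x) = - (LINT x|lebesgue_on D. \<theta> x *\<^sub>R g x)"
  proof (rule euclidean_eqI)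
    fix i :: 'a assume i: "i \<in> Basis"
    have si: "sq_int (lebesgue_on D) (\<lambda>x. grad \<theta> x \<bullet> i)"
      by (rule sq_int_bound[OF s\<theta>(2), of _ 1])
         (use i sq_intD(1)[OF s\<theta>(2)] in \<open>auto intro!: AE_I2 Basis_le_norm\<close>)
    have si': "sq_int (lebesgue_on D) (\<lambda>x. \<theta> x *\<^sub>R i)"
      by (rule sq_int_bound[OF s\<theta>(1), of _ 1])
         (use i sq_intD(1)[OF s\<theta>(1)] in auto)
    have l1: "(\<lambda>n. LINT x|lebesgue_on D. \<phi> n x \<bullet> (grad \<theta> x \<bullet> i)) \<longlonglongrightarrow> (LINT x|lebesgue_on D. u x \<bullet> (grad \<theta> x \<bullet> i))"
      by (rule tendsto_integral_inner[OF st(1) s(1) _ si]) (subst l2_minus_commute, rule \<phi>(2))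
    have l2: "(\<lambda>n. LINT x|lebesgue_on D. grad (\<phi> n) x \<bullet> (\<theta> x *\<^sub>R i)) \<longlonglongrightarrow> (LINT x|lebesgue_on D. g x \<bullet> (\<theta> x *\<^sub>R i))"
      by (rule tendsto_integral_inner[OF st(2) s(2) _ si']) (subst l2_minus_commute, rule \<phi>(3))
    have e: "(LINT x|lebesgue_on D. \<phi> n x \<bullet> (grad \<theta> x \<bullet> i)) = - (LINT x|lebesgue_on D. grad (\<phi> n) x \<bullet> (\<theta> x *\<^sub>R i))" for n
      using arg_cong[OF eq[of n], of "\<lambda>v. v \<bullet> i"] integral_inner_left[of i "lebesgue_on D", OF i\<phi>(1)[of n]]
        integral_inner_left[of i "lebesgue_on D", OF i\<phi>(2)[of n]] by simp
    have "(LINT x|lebesgue_on D. u x \<bullet> (grad \<theta> x \<bullet> i)) = - (LINT x|lebesgue_on D. g x \<bullet> (\<theta> x *\<^sub>R i))"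
      by (rule LIMSEQ_unique[OF l1[unfolded e] tendsto_minus[OF l2]])
    then show "(LINT x|lebesgue_on D. u x *\<^sub>R grad \<theta> x) \<bullet> i = - (LINT x|lebesgue_on D. \<theta> x *\<^sub>R g x) \<bullet> i"
      using integral_inner_left[of i "lebesgue_on D", OF iu(1)] integral_inner_left[of i "lebesgue_on D", OF iu(2)] by simp
  qed
qed

lemma H1_norm_eq:
  fixes u :: "'a::euclidean_space \<Rightarrow> real"
  assumes D: "open D" and w: "is_weak_gradient D u g"
  shows "H1_norm D u = sqrt ((l2 (lebesgue_on D) u)\<^sup>2 + (l2 (lebesgue_on D) g)\<^sup>2)"
proof -
  have m: "wgrad D u \<in> borel_measurable (lebesgue_on D)" "g \<in> borel_measurable (lebesgue_on D)"
    using L1_loc_measurable[OF D] is_weak_gradient_wgrad[OF w] w by (auto simp: is_weak_gradient_def)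
  have "l2 (lebesgue_on D) (wgrad D u) = l2 (lebesgue_on D) g"
    by (rule l2_cong_AE[OF m wgrad_AE_eq[OF D w]])
  then show ?thesis
    unfolding H1_norm_def using l2_square[of "lebesgue_on D" u] l2_square[of "lebesgue_on D" "wgrad D u"] by simp
qed

text \<open>The norm in \<open>H1_0\<close> involves \<open>wgrad\<close> of a difference, whereas
  \<open>zero_trace\<close> compares with the classical \<open>grad\<close> of the test function.
  Linearity and uniqueness of weak gradients identify the two almost everywhere.\<close>

lemma H1_0_iff_zero_trace:
  fixes u :: "'a::euclidean_space \<Rightarrow> real"
  assumes D: "open D"
  shows "u \<in> H1_0 D \<longleftrightarrow> zero_trace D u (wgrad D u)" (is "?A \<longleftrightarrow> ?B")
proof -
  note mD = open_in_lebesgue[OF D]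
  have diff: "is_weak_gradient D (\<lambda>x. u x - \<phi> x) (\<lambda>x. wgrad D u x - grad \<phi> x)"
    if "is_weak_gradient D u (wgrad D u)" "\<phi> \<in> test_functions D" for \<phi>
    using is_weak_gradient_lincomb[OF D that(1) zero_trace_weak_gradient[OF D zero_trace_test[OF mD that(2)]], of 1 "-1"]
    by simp
  show ?thesis
  proof
    assume ?A
    then obtain g where "u \<in> L2 D" "g \<in> L2 D" and w0: "is_weak_gradient D u g"
      unfolding H1_0_def H1_def by blast
    then have g: "sq_int (lebesgue_on D) u" "sq_int (lebesgue_on D) g" "is_weak_gradient D u g"
      by (simp_all add: L2_iff)
    obtain \<phi> where \<phi>: "\<And>n::nat. \<phi> n \<in> test_functions D" "(\<lambda>n. H1_norm D (\<lambda>x. u x - \<phi> n x)) \<longlonglongrightarrow> 0"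
      using \<open>?A\<close> unfolding H1_0_def by blast
    note w = is_weak_gradient_wgrad[OF g(3)]
    have "wgrad D u \<in> borel_measurable (lebesgue_on D)"
      using L1_loc_measurable[OF D] w by (auto simp: is_weak_gradient_def)
    then have sw: "sq_int (lebesgue_on D) (wgrad D u)"
    proof (rule sq_int_bound[OF g(2), of _ 1])
      show "AE x in lebesgue_on D. norm (wgrad D u x) \<le> 1 * norm (g x)"
        using wgrad_AE_eq[OF D g(3)] by eventually_elim simp
    qed
    have le: "l2 (lebesgue_on D) (\<lambda>x. u x - \<phi> n x) \<le> H1_norm D (\<lambda>x. u x - \<phi> n x)"
      "l2 (lebesgue_on D) (\<lambda>x. wgrad D u x - grad (\<phi> n) x) \<le> H1_norm D (\<lambda>x. u x - \<phi> n x)" for n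
      unfolding H1_norm_eq[OF D diff[OF w \<phi>(1)]] by (rule real_le_rsqrt, simp)+
    show ?B
      unfolding zero_trace_def
    proof (intro conjI exI allI)
      show "(\<lambda>n. l2 (lebesgue_on D) (\<lambda>x. u x - \<phi> n x)) \<longlonglongrightarrow> 0"
        by (rule tendsto_zero_bound[OF _ \<phi>(2)]) (simp add: le)
      show "(\<lambda>n. l2 (lebesgue_on D) (\<lambda>x. wgrad D u x - grad (\<phi> n) x)) \<longlonglongrightarrow> 0"
        by (rule tendsto_zero_bound[OF _ \<phi>(2)]) (simp add: le)
    qed (rule g sw \<phi>)+
  next
    assume B: ?B
    then obtain \<phi> where \<phi>: "\<And>n. \<phi> n \<in> test_functions D"
      "(\<lambda>n. l2 (lebesgue_on D) (\<lambda>x. u x - \<phi> n x)) \<longlonglongrightarrow> 0"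
      "(\<lambda>n. l2 (lebesgue_on D) (\<lambda>x. wgrad D u x - grad (\<phi> n) x)) \<longlonglongrightarrow> 0"
      by (rule zero_traceE) blast
    note w = zero_trace_weak_gradient[OF D B]
    have "(\<lambda>n. sqrt ((l2 (lebesgue_on D) (\<lambda>x. u x - \<phi> n x))\<^sup>2 + (l2 (lebesgue_on D) (\<lambda>x. wgrad D u x - grad (\<phi> n) x))\<^sup>2))
        \<longlonglongrightarrow> sqrt (0\<^sup>2 + 0\<^sup>2)"
      by (intro tendsto_intros \<phi>)
    then have "(\<lambda>n. H1_norm D (\<lambda>x. u x - \<phi> n x)) \<longlonglongrightarrow> 0"
      unfolding H1_norm_eq[OF D diff[OF w \<phi>(1)]] by simp
    moreover have "u \<in> L2 D" "wgrad D u \<in> L2 D"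
      using zero_trace_sq_int[OF B] by (simp_all add: L2_iff)
    ultimately show ?A
      unfolding H1_0_def H1_def using w \<phi>(1) by blast
  qed
qed

lemma zero_traceD:
  assumes D: "open D" and u: "zero_trace D u g"
  shows "u \<in> H1_0 D" "AE x in lebesgue_on D. wgrad D u x = g x"
proof -
  note w = zero_trace_weak_gradient[OF D u]
  show ae: "AE x in lebesgue_on D. wgrad D u x = g x"
    by (rule wgrad_AE_eq[OF D w])
  have "zero_trace D u (wgrad D u)"
  proof (rule zero_trace_cong[OF u])
    show "wgrad D u \<in> borel_measurable (lebesgue_on D)"
      using L1_loc_measurable[OF D] is_weak_gradient_wgrad[OF w] by (auto simp: is_weak_gradient_def)
    show "AE x in lebesgue_on D. g x = wgrad D u x"
      using ae by eventually_elim simp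
  qed
  then show "u \<in> H1_0 D" by (simp add: H1_0_iff_zero_trace[OF D])
qed

text \<open>Test functions of \<open>D\<close> vanish outside \<open>D\<close> together with their
  gradients, so the same approximating sequence works on the whole space.\<close>

lemma zero_trace_extend:
  fixes u :: "'a::euclidean_space \<Rightarrow> real"
  assumes D: "open D" and u: "zero_trace D u g"
  shows "zero_trace UNIV (\<lambda>x. if x \<in> D then u x else 0) (\<lambda>x. if x \<in> D then g x else 0)"
proof -
  note mD = open_in_lebesgue[OF D]
  obtain \<phi> where \<phi>: "\<And>n. \<phi> n \<in> test_functions D"
    "(\<lambda>n. l2 (lebesgue_on D) (\<lambda>x. u x - \<phi> n x)) \<longlonglongrightarrow> 0"
    "(\<lambda>n. l2 (lebesgue_on D) (\<lambda>x. g x - grad (\<phi> n) x)) \<longlonglongrightarrow> 0"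
    by (rule zero_traceE[OF u]) blast
  have off: "\<phi> n x = 0" "grad (\<phi> n) x = 0" if "x \<notin> D" for n x
  proof -
    obtain S where "S \<subseteq> D" "\<And>x. x \<notin> S \<Longrightarrow> \<phi> n x = 0" "\<And>x. x \<notin> S \<Longrightarrow> grad (\<phi> n) x = 0"
      by (rule grad_test_support[OF \<phi>(1)[of n]]) blast
    then show "\<phi> n x = 0" "grad (\<phi> n) x = 0" using that by blast+
  qed
  have e1: "(\<lambda>x. (if x \<in> D then u x else 0) - \<phi> n x) = (\<lambda>x. if x \<in> D then u x - \<phi> n x else 0)" for n
    by (simp add: fun_eq_iff off)
  have e2: "(\<lambda>x. (if x \<in> D then g x else 0) - grad (\<phi> n) x) = (\<lambda>x. if x \<in> D then g x - grad (\<phi> n) x else 0)" for n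
    by (simp add: fun_eq_iff off)
  show ?thesis
    unfolding zero_trace_def lebesgue_on_UNIV_eq
  proof (intro conjI exI allI)
    show "sq_int lebesgue (\<lambda>x. if x \<in> D then u x else 0)" "sq_int lebesgue (\<lambda>x. if x \<in> D then g x else 0)"
      using zero_trace_sq_int[OF u] by (simp_all add: sq_int_on_iff[OF mD])
    show "\<phi> n \<in> test_functions UNIV" for n
      using \<phi>(1) test_functions_mono[OF subset_UNIV] by blast
    show "(\<lambda>n. l2 lebesgue (\<lambda>x. (if x \<in> D then u x else 0) - \<phi> n x)) \<longlonglongrightarrow> 0"
      using \<phi>(2) unfolding e1 l2_on_eq[OF mD] .
    show "(\<lambda>n. l2 lebesgue (\<lambda>x. (if x \<in> D then g x else 0) - grad (\<phi> n) x)) \<longlonglongrightarrow> 0"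
      using \<phi>(3) unfolding e2 l2_on_eq[OF mD] .
  qed
qed

lemma l2_scale:
  fixes f :: "'a::euclidean_space \<Rightarrow> 'b::euclidean_space"
  assumes c: "c > 0" and f: "sq_int lebesgue f"
  shows "sq_int lebesgue (\<lambda>x. f (c *\<^sub>R x))"
    "(l2 lebesgue (\<lambda>x. f (c *\<^sub>R x)))\<^sup>2 = (l2 lebesgue f)\<^sup>2 / c ^ DIM('a)"
proof -
  have h: "has_bochner_integral lebesgue (\<lambda>x. (norm (f (c *\<^sub>R x)))\<^sup>2) ((LINT x|lebesgue. (norm (f x))\<^sup>2) / c ^ DIM('a))"
    using has_bochner_integral_affine[of c "\<lambda>x. (norm (f x))\<^sup>2" 0] c sq_intD(2)[OF f] by (simp add: divide_inverse mult.commute)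
  show "sq_int lebesgue (\<lambda>x. f (c *\<^sub>R x))"
    using borel_measurable_affine[of c f 0] sq_intD(1)[OF f] c h by (simp add: sq_int_def has_bochner_integral_iff)
  show "(l2 lebesgue (\<lambda>x. f (c *\<^sub>R x)))\<^sup>2 = (l2 lebesgue f)\<^sup>2 / c ^ DIM('a)"
    unfolding l2_square using h by (simp add: has_bochner_integral_iff)
qed

lemma l2_scale_tendsto_0:
  fixes f :: "nat \<Rightarrow> 'a::euclidean_space \<Rightarrow> 'b::euclidean_space"
  assumes c: "c > 0" and f: "\<And>n. sq_int lebesgue (f n)" "(\<lambda>n. l2 lebesgue (f n)) \<longlonglongrightarrow> 0"
  shows "(\<lambda>n. l2 lebesgue (\<lambda>x. f n (c *\<^sub>R x))) \<longlonglongrightarrow> 0"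
proof -
  have "l2 lebesgue (\<lambda>x. f n (c *\<^sub>R x)) = sqrt ((l2 lebesgue (f n))\<^sup>2 / c ^ DIM('a))" for n
    using l2_scale(2)[OF c f(1)[of n]] by (metis l2_nonneg real_sqrt_unique)
  moreover have "(\<lambda>n. sqrt ((l2 lebesgue (f n))\<^sup>2 / c ^ DIM('a))) \<longlonglongrightarrow> sqrt (0\<^sup>2 / c ^ DIM('a))"
    by (intro tendsto_intros f(2)) (use c in simp)
  ultimately show ?thesis by simp
qed

text \<open>The prefactor cancels the factor from the chain rule. In this normalisation gradients
  are merely evaluated at the rescaled point, which is the scaling of the corrector problem.\<close>

lemma grad_scale:
  fixes \<phi> :: "'a::euclidean_space \<Rightarrow> real"
  assumes c: "c \<noteq> 0" and \<phi>: "\<phi> \<in> test_functions UNIV"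
  shows "(\<lambda>x. inverse c * \<phi> (c *\<^sub>R x)) \<in> test_functions UNIV"
    "grad (\<lambda>x. inverse c * \<phi> (c *\<^sub>R x)) x = grad \<phi> (c *\<^sub>R x)"
proof -
  have "(\<lambda>x. \<phi> (c *\<^sub>R x)) \<in> test_functions UNIV"
    using test_functions_scale[OF \<phi> c] test_functions_mono[OF subset_UNIV] by blast
  then show "(\<lambda>x. inverse c * \<phi> (c *\<^sub>R x)) \<in> test_functions UNIV"
    by (rule test_functions_mult) (rule Ck_const)
  show "grad (\<lambda>x. inverse c * \<phi> (c *\<^sub>R x)) x = grad \<phi> (c *\<^sub>R x)"
  proof (rule grad_eqI)
    have "((\<lambda>x. \<phi> (c *\<^sub>R x)) has_derivative (\<lambda>h. grad \<phi> (c *\<^sub>R x) \<bullet> (c *\<^sub>R h))) (at x)"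
      by (rule has_derivative_compose[OF _ test_functions_has_grad[OF \<phi>]]) (auto intro!: derivative_eq_intros)
    then have "((\<lambda>x. inverse c * \<phi> (c *\<^sub>R x)) has_derivative (\<lambda>h. inverse c * (grad \<phi> (c *\<^sub>R x) \<bullet> (c *\<^sub>R h)))) (at x)"
      by (rule has_derivative_mult_right)
    then show "((\<lambda>x. inverse c * \<phi> (c *\<^sub>R x)) has_derivative (\<lambda>h. grad \<phi> (c *\<^sub>R x) \<bullet> h)) (at x)"
      by (rule has_derivative_eq_rhs) (use c in \<open>simp add: fun_eq_iff\<close>)
  qed
qed

lemma zero_trace_scale:
  fixes u :: "'a::euclidean_space \<Rightarrow> real"
  assumes u: "zero_trace UNIV u g" and c: "c > 0"
  shows "zero_trace UNIV (\<lambda>x. inverse c * u (c *\<^sub>R x)) (\<lambda>x. g (c *\<^sub>R x))"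
proof -
  obtain \<phi> where \<phi>: "\<And>n. \<phi> n \<in> test_functions UNIV"
    "(\<lambda>n. l2 lebesgue (\<lambda>x. u x - \<phi> n x)) \<longlonglongrightarrow> 0"
    "(\<lambda>n. l2 lebesgue (\<lambda>x. g x - grad (\<phi> n) x)) \<longlonglongrightarrow> 0"
    using zero_traceE[OF u] unfolding lebesgue_on_UNIV_eq by blast
  have c0: "c \<noteq> 0" using c by simp
  note s = zero_trace_sq_int[OF u, unfolded lebesgue_on_UNIV_eq]
  show ?thesis
    unfolding zero_trace_def lebesgue_on_UNIV_eq
  proof (intro conjI exI allI)
    show "sq_int lebesgue (\<lambda>x. inverse c * u (c *\<^sub>R x))"
      using sq_int_scaleR[OF l2_scale(1)[OF c s(1)], of "inverse c"] by simp
    show "sq_int lebesgue (\<lambda>x. g (c *\<^sub>R x))"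
      by (rule l2_scale(1)[OF c s(2)])
    show "(\<lambda>x. inverse c * \<phi> n (c *\<^sub>R x)) \<in> test_functions UNIV" for n
      by (rule grad_scale(1)[OF c0 \<phi>(1)])
    have "(\<lambda>n. inverse c * l2 lebesgue (\<lambda>x. u (c *\<^sub>R x) - \<phi> n (c *\<^sub>R x))) \<longlonglongrightarrow> inverse c * 0"
      by (intro tendsto_mult tendsto_const l2_scale_tendsto_0[OF c _ \<phi>(2)] sq_int_diff s sq_int_test[OF \<phi>(1)])
    moreover have "inverse c * l2 lebesgue (\<lambda>x. u (c *\<^sub>R x) - \<phi> n (c *\<^sub>R x))
        = l2 lebesgue (\<lambda>x. inverse c * u (c *\<^sub>R x) - inverse c * \<phi> n (c *\<^sub>R x))" for n
      using l2_scaleR[of lebesgue "inverse c" "\<lambda>x. u (c *\<^sub>R x) - \<phi> n (c *\<^sub>R x)"] c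
      by (simp add: right_diff_distrib)
    ultimately show "(\<lambda>n. l2 lebesgue (\<lambda>x. inverse c * u (c *\<^sub>R x) - inverse c * \<phi> n (c *\<^sub>R x))) \<longlonglongrightarrow> 0"
      by simp
    show "(\<lambda>n. l2 lebesgue (\<lambda>x. g (c *\<^sub>R x) - grad (\<lambda>x. inverse c * \<phi> n (c *\<^sub>R x)) x)) \<longlonglongrightarrow> 0"
      unfolding grad_scale(2)[OF c0 \<phi>(1)]
      by (rule l2_scale_tendsto_0[OF c _ \<phi>(3)]) (intro sq_int_diff s sq_int_test[OF \<phi>(1)])
  qed
qed

lemma sq_int_imp_L2_loc: "sq_int lebesgue f \<Longrightarrow> f \<in> L2_loc UNIV"
  unfolding L2_loc_def L2_iff using sq_int_restrict compact_in_lebesgue by blast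

text \<open>Through extension and rescaling this makes functions with zero boundary values on
  \<open>D\<close> admissible in the corrector equation.\<close>

lemma zero_trace_BL:
  assumes u: "zero_trace UNIV u g"
  shows "u \<in> BL" "AE x in lebesgue. wgrad UNIV u x = g x"
proof -
  note w = zero_trace_weak_gradient[OF open_UNIV u]
  show "AE x in lebesgue. wgrad UNIV u x = g x"
    using wgrad_AE_eq[OF open_UNIV w] unfolding lebesgue_on_UNIV_eq .
  have "zero_trace UNIV u (wgrad UNIV u)"
    using zero_traceD(1)[OF open_UNIV u] unfolding H1_0_iff_zero_trace[OF open_UNIV] .
  then have s: "sq_int lebesgue u" "sq_int lebesgue (wgrad UNIV u)" "is_weak_gradient UNIV u (wgrad UNIV u)"
    using zero_trace_sq_int[of UNIV u "wgrad UNIV u"] zero_trace_weak_gradient[OF open_UNIV]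
    unfolding lebesgue_on_UNIV_eq by blast+
  have "u \<in> L2_loc UNIV" "wgrad UNIV u \<in> L2_loc UNIV" "wgrad UNIV u \<in> L2 UNIV"
    using sq_int_imp_L2_loc[OF s(1)] sq_int_imp_L2_loc[OF s(2)] s(2)
    unfolding L2_iff lebesgue_on_UNIV_eq by blast+
  with s(3) show "u \<in> BL"
    unfolding BL_def H1_loc_def by blast
qed

lemma BLD:
  assumes "u \<in> BL"
  shows "is_weak_gradient UNIV u (wgrad UNIV u)" "sq_int lebesgue (wgrad UNIV u)"
proof -
  obtain g where "is_weak_gradient UNIV u g"
    using assms unfolding BL_def H1_loc_def by blast
  then show "is_weak_gradient UNIV u (wgrad UNIV u)" by (rule is_weak_gradient_wgrad)
  have "wgrad UNIV u \<in> L2 UNIV"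
    using assms unfolding BL_def by blast
  then show "sq_int lebesgue (wgrad UNIV u)"
    by (simp add: L2_iff lebesgue_on_UNIV_eq)
qed

subsection \<open>The Poincare inequality\<close>

text \<open>The partial derivative in direction \<open>i\<close> of
  \<open>(x \<bullet> i) * (\<phi> x)\<^sup>2\<close> integrates to zero. This expresses the
  integral of the square of \<open>\<phi>\<close> through \<open>\<phi>\<close> times its gradient,
  with a weight of size at most \<open>2 * R\<close>; Cauchy-Schwarz and cancelling one norm of
  \<open>\<phi>\<close> finish.\<close>

lemma Poincare_test:
  fixes \<phi> :: "'a::euclidean_space \<Rightarrow> real"
  assumes D: "D \<subseteq> cball 0 R" and \<phi>: "\<phi> \<in> test_functions D"
  shows "l2 lebesgue \<phi> \<le> 2 * R * l2 lebesgue (grad \<phi>)"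
proof -
  obtain S where S: "compact S" "S \<subseteq> D" "\<And>x. x \<notin> S \<Longrightarrow> \<phi> x = 0" "\<And>x. x \<notin> S \<Longrightarrow> grad \<phi> x = 0"
    by (rule grad_test_support[OF \<phi>]) blast
  obtain i :: 'a where i: "i \<in> Basis" using nonempty_Basis by blast
  note c = continuous_on_test_function[OF \<phi>] continuous_on_grad_test[OF \<phi>]
  note s = sq_int_test[OF \<phi>]
  define F' where "F' x h = (h \<bullet> i) * (\<phi> x)\<^sup>2 + (x \<bullet> i) * (2 * \<phi> x * (grad \<phi> x \<bullet> h))" for x h
  have der: "((\<lambda>x. (x \<bullet> i) * (\<phi> x)\<^sup>2) has_derivative F' x) (at x)" for x
    unfolding F'_def[abs_def]
    by (rule has_derivative_eq_rhs, (rule derivative_intros test_functions_has_grad[OF \<phi>])+)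
       (simp add: fun_eq_iff algebra_simps)
  have int0: "integrable lebesgue (\<lambda>x. F' x i)" "(LINT x|lebesgue. F' x i) = 0"
    by (rule integral_partial_eq_0[OF der i _ S(1)],
        (auto intro!: continuous_intros c simp: F'_def S)[2],
        rule integral_partial_eq_0[OF der i _ S(1)],
        (auto intro!: continuous_intros c simp: F'_def S)[2])
  have F'i: "F' x i = (\<phi> x)\<^sup>2 + 2 * (x \<bullet> i) * \<phi> x * (grad \<phi> x \<bullet> i)" for x
    using i by (simp add: F'_def)
  have i2: "integrable lebesgue (\<lambda>x. (\<phi> x)\<^sup>2)"
    using sq_intD(2)[OF s(1)] by simp
  have i3: "integrable lebesgue (\<lambda>x. 2 * R * (norm (\<phi> x) * norm (grad \<phi> x)))"
    by (intro integrable_mult_right integrable_norm_mult s)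
  have "(\<phi> x)\<^sup>2 - F' x i \<le> 2 * R * (norm (\<phi> x) * norm (grad \<phi> x))" for x
  proof (cases "x \<in> S")
    case True
    then have "norm x \<le> R" using S(2) D by auto
    then have "\<bar>x \<bullet> i\<bar> \<le> R" "\<bar>grad \<phi> x \<bullet> i\<bar> \<le> norm (grad \<phi> x)"
      using Basis_le_norm[OF i, of x] Basis_le_norm[OF i, of "grad \<phi> x"] by auto
    then have "\<bar>x \<bullet> i\<bar> * \<bar>grad \<phi> x \<bullet> i\<bar> \<le> R * norm (grad \<phi> x)"
      by (intro mult_mono) (auto intro: order_trans[OF abs_ge_zero])
    then have 1: "\<bar>\<phi> x\<bar> * (\<bar>x \<bullet> i\<bar> * \<bar>grad \<phi> x \<bullet> i\<bar>) \<le> \<bar>\<phi> x\<bar> * (R * norm (grad \<phi> x))"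
      by (intro mult_left_mono) auto
    have 2: "- ((x \<bullet> i) * \<phi> x * (grad \<phi> x \<bullet> i)) \<le> \<bar>\<phi> x\<bar> * (\<bar>x \<bullet> i\<bar> * \<bar>grad \<phi> x \<bullet> i\<bar>)"
      using abs_ge_minus_self[of "(x \<bullet> i) * \<phi> x * (grad \<phi> x \<bullet> i)"]
      by (simp only: abs_mult mult.assoc mult.commute mult.left_commute)
    have "(\<phi> x)\<^sup>2 - F' x i = 2 * - ((x \<bullet> i) * \<phi> x * (grad \<phi> x \<bullet> i))"
      by (simp add: F'i)
    also have "\<dots> \<le> 2 * (\<bar>\<phi> x\<bar> * (R * norm (grad \<phi> x)))"
      using order_trans[OF 2 1] by (rule mult_left_mono) simp
    also have "\<dots> = 2 * R * (norm (\<phi> x) * norm (grad \<phi> x))"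
      by simp
    finally show ?thesis .
  next
    case False
    then show ?thesis by (simp add: F'i S)
  qed
  then have "(LINT x|lebesgue. (\<phi> x)\<^sup>2 - F' x i) \<le> (LINT x|lebesgue. 2 * R * (norm (\<phi> x) * norm (grad \<phi> x)))"
    by (intro integral_mono Bochner_Integration.integrable_diff i2 i3 int0)
  also have "\<dots> = 2 * R * (LINT x|lebesgue. norm (\<phi> x) * norm (grad \<phi> x))"
    by simp
  finally have le: "(l2 lebesgue \<phi>)\<^sup>2 \<le> 2 * R * (LINT x|lebesgue. norm (\<phi> x) * norm (grad \<phi> x))"
    using i2 int0 by (simp add: l2_square)
  show ?thesis
  \<comment> \<open>A point of the support forces \<open>R\<close> to be nonnegative, which the
    multiplication by \<open>2 * R\<close> requires; with empty support both norms vanish.\<close>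
  proof (cases "S = {}")
    case True
    then have "\<phi> = (\<lambda>_. 0)" "grad \<phi> = (\<lambda>_. 0)" using S by auto
    then show ?thesis by (simp add: l2_def)
  next
    case False
    then obtain x where "x \<in> S" by blast
    then have "norm x \<le> R" using S(2) D by auto
    then have R: "0 \<le> R" by (rule order_trans[OF norm_ge_zero])
    have "(l2 lebesgue \<phi>)\<^sup>2 \<le> 2 * R * (l2 lebesgue \<phi> * l2 lebesgue (grad \<phi>))"
      by (rule order_trans[OF le]) (intro mult_left_mono integral_norm_mult_le s, use R in simp)
    then have "l2 lebesgue \<phi> * l2 lebesgue \<phi> \<le> l2 lebesgue \<phi> * (2 * R * l2 lebesgue (grad \<phi>))"
      by (simp add: power2_eq_square algebra_simps)
    then show ?thesis
    proof (cases "l2 lebesgue \<phi> = 0")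
      case False
      then have "0 < l2 lebesgue \<phi>" using l2_nonneg[of lebesgue \<phi>] by linarith
      then show ?thesis
        using \<open>l2 lebesgue \<phi> * l2 lebesgue \<phi> \<le> _\<close> by (simp only: mult_le_cancel_left_pos)
    qed (use R in simp)
  qed
qed

theorem Poincare:
  fixes u :: "'a::euclidean_space \<Rightarrow> real"
  assumes D: "open D" "D \<subseteq> cball 0 R" and u: "zero_trace D u g"
  shows "l2 (lebesgue_on D) u \<le> 2 * R * l2 (lebesgue_on D) g"
proof -
  note mD = open_in_lebesgue[OF D(1)]
  obtain \<phi> where \<phi>: "\<And>n. \<phi> n \<in> test_functions D"
    "(\<lambda>n. l2 (lebesgue_on D) (\<lambda>x. u x - \<phi> n x)) \<longlonglongrightarrow> 0"
    "(\<lambda>n. l2 (lebesgue_on D) (\<lambda>x. g x - grad (\<phi> n) x)) \<longlonglongrightarrow> 0"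
    by (rule zero_traceE[OF u]) blast
  note st = sq_int_restrict[OF sq_int_test(1)[OF \<phi>(1)] mD] sq_int_restrict[OF sq_int_test(2)[OF \<phi>(1)] mD]
  note s = zero_trace_sq_int[OF u]
  have "l2 (lebesgue_on D) (\<phi> n) \<le> 2 * R * l2 (lebesgue_on D) (grad (\<phi> n))" for n
  proof -
    obtain S where S: "S \<subseteq> D" "\<And>x. x \<notin> S \<Longrightarrow> \<phi> n x = 0" "\<And>x. x \<notin> S \<Longrightarrow> grad (\<phi> n) x = 0"
      by (rule grad_test_support[OF \<phi>(1)[of n]]) blast
    have "l2 (lebesgue_on D) (\<phi> n) = l2 lebesgue (\<phi> n)"
      unfolding l2_def using integral_on_support[OF S(1) mD, of "\<lambda>x. (norm (\<phi> n x))\<^sup>2"] S(2) by simp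
    moreover have "l2 (lebesgue_on D) (grad (\<phi> n)) = l2 lebesgue (grad (\<phi> n))"
      unfolding l2_def using integral_on_support[OF S(1) mD, of "\<lambda>x. (norm (grad (\<phi> n) x))\<^sup>2"] S(3) by simp
    ultimately show ?thesis using Poincare_test[OF D(2) \<phi>(1)] by simp
  qed
  moreover have "(\<lambda>n. l2 (lebesgue_on D) (\<phi> n)) \<longlonglongrightarrow> l2 (lebesgue_on D) u"
    by (rule tendsto_l2[OF st(1) s(1)]) (subst l2_minus_commute, rule \<phi>(2))
  moreover have "(\<lambda>n. 2 * R * l2 (lebesgue_on D) (grad (\<phi> n))) \<longlonglongrightarrow> 2 * R * l2 (lebesgue_on D) g"
    by (intro tendsto_mult tendsto_const tendsto_l2[OF st(2) s(2)]) (subst l2_minus_commute, rule \<phi>(3))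
  ultimately show ?thesis
    by (intro LIMSEQ_le) auto
qed

subsection \<open>Differentiation under the integral sign\<close>

text \<open>Dominated convergence for a real parameter, reduced to sequences that avoid
  \<open>s0\<close>. The bound is asked only away from \<open>s0\<close>, as is natural for
  difference quotients.\<close>

lemma integral_tendsto_at:
  fixes h :: "real \<Rightarrow> 'a \<Rightarrow> 'b::euclidean_space"
  assumes S: "open S" "s0 \<in> S"
    and m: "\<And>s. s \<in> S \<Longrightarrow> h s \<in> borel_measurable M" "k \<in> borel_measurable M"
    and B: "integrable M B" "\<And>s x. s \<in> S \<Longrightarrow> s \<noteq> s0 \<Longrightarrow> x \<in> space M \<Longrightarrow> norm (h s x) \<le> B x"
    and lim: "\<And>x. x \<in> space M \<Longrightarrow> ((\<lambda>s. h s x) \<longlongrightarrow> k x) (at s0)"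
  shows "((\<lambda>s. LINT x|M. h s x) \<longlongrightarrow> (LINT x|M. k x)) (at s0)"
proof -
  have "((\<lambda>s. LINT x|M. h s x) \<longlongrightarrow> (LINT x|M. k x)) (at s0 within S)"
    unfolding tendsto_at_iff_sequentially comp_def
  proof (intro allI impI)
    fix X :: "nat \<Rightarrow> real" assume X: "\<forall>i. X i \<in> S - {s0}" "X \<longlonglongrightarrow> s0"
    show "(\<lambda>n. LINT x|M. h (X n) x) \<longlonglongrightarrow> (LINT x|M. k x)"
    proof (rule integral_dominated_convergence[OF m(2) _ B(1)])
      show "h (X i) \<in> borel_measurable M" for i using m(1) X(1) by blast
      show "AE x in M. norm (h (X i) x) \<le> B x" for i
        using B(2)[of "X i"] X(1) by (intro AE_I2) blast
      show "AE x in M. (\<lambda>i. h (X i) x) \<longlonglongrightarrow> k x"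
      proof (rule AE_I2)
        fix x assume "x \<in> space M"
        have "filterlim X (at s0) sequentially"
          using X by (simp add: filterlim_at eventually_sequentially)
        then show "(\<lambda>i. h (X i) x) \<longlonglongrightarrow> k x"
          by (rule filterlim_compose[OF lim[OF \<open>x \<in> space M\<close>]])
      qed
    qed
  qed
  then show ?thesis
    using at_within_open[OF S(2,1)] by simp
qed

lemma has_real_derivative_integral:
  fixes h :: "real \<Rightarrow> 'a \<Rightarrow> real"
  assumes S: "open S" "convex S" "s0 \<in> S"
    and i: "\<And>s. s \<in> S \<Longrightarrow> integrable M (h s)" and m: "h' s0 \<in> borel_measurable M"
    and der: "\<And>s x. s \<in> S \<Longrightarrow> x \<in> space M \<Longrightarrow> ((\<lambda>s. h s x) has_real_derivative h' s x) (at s)"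
    and B: "integrable M B" "\<And>s x. s \<in> S \<Longrightarrow> x \<in> space M \<Longrightarrow> \<bar>h' s x\<bar> \<le> B x"
  shows "((\<lambda>s. LINT x|M. h s x) has_real_derivative (LINT x|M. h' s0 x)) (at s0)"
proof -
  have bound: "norm ((h s x - h s0 x) / (s - s0)) \<le> B x" if s: "s \<in> S" "s \<noteq> s0" and x: "x \<in> space M" for s x
  proof -
    have "\<bar>h s x - h s0 x\<bar> \<le> B x * \<bar>s - s0\<bar>"
    proof (rule field_differentiable_bound[OF S(2), of "\<lambda>s. h s x" "\<lambda>s. h' s x", unfolded real_norm_def])
      show "((\<lambda>s. h s x) has_field_derivative h' z x) (at z within S)" if "z \<in> S" for z
        using der[OF that x] by (rule has_field_derivative_at_within)
    qed (use B x s S in auto)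
    then show ?thesis using s by (simp add: field_simps)
  qed
  have "((\<lambda>s. LINT x|M. (h s x - h s0 x) / (s - s0)) \<longlongrightarrow> (LINT x|M. h' s0 x)) (at s0)"
  proof (rule integral_tendsto_at[OF S(1,3) _ m B(1) bound])
    show "(\<lambda>x. (h s x - h s0 x) / (s - s0)) \<in> borel_measurable M" if "s \<in> S" for s
      using borel_measurable_integrable[OF i[OF that]] borel_measurable_integrable[OF i[OF S(3)]] by measurable
    show "((\<lambda>s. (h s x - h s0 x) / (s - s0)) \<longlongrightarrow> h' s0 x) (at s0)" if "x \<in> space M" for x
      using der[OF S(3) that] by (simp add: has_field_derivative_iff)
  qed
  moreover have "eventually (\<lambda>s. (LINT x|M. (h s x - h s0 x) / (s - s0)) =
      ((LINT x|M. h s x) - (LINT x|M. h s0 x)) / (s - s0)) (at s0)"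
    using eventually_at_in_open[OF S(1,3)]
  proof eventually_elim
    case (elim s)
    have "(LINT x|M. (h s x - h s0 x) / (s - s0)) = (LINT x|M. h s x - h s0 x) / (s - s0)"
      by simp
    then show ?case
      using i elim S(3) by simp
  qed
  ultimately show ?thesis
    unfolding has_field_derivative_iff by (rule Lim_transform_eventually)
qed

subsection \<open>Density of gradients of test functions\<close>

text \<open>The second difference of \<open>f\<close> over a small square, evaluated by the mean
  value theorem in the two orders, gives the two mixed derivatives at points that tend to
  \<open>x\<close>; both mixed derivatives are continuous.\<close>

lemma mixed_partials_symmetric:
  fixes f :: "'a::euclidean_space \<Rightarrow> real"
  assumes f: "f \<in> test_functions D" and i: "i \<in> Basis" and j: "j \<in> Basis"
  shows "frechet_derivative (\<lambda>y. frechet_derivative f (at y) i) (at x) j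
       = frechet_derivative (\<lambda>y. frechet_derivative f (at y) j) (at x) i"
proof -
  have line: "((\<lambda>t. g (z + t *\<^sub>R v)) has_real_derivative frechet_derivative g (at (z + t *\<^sub>R v)) v) (at t)"
    if "g \<in> test_functions D" for g :: "'a \<Rightarrow> real" and z v t
  proof -
    have "((\<lambda>t. g (z + t *\<^sub>R v)) has_derivative (\<lambda>s. frechet_derivative g (at (z + t *\<^sub>R v)) (s *\<^sub>R v))) (at t)"
      by (rule has_derivative_compose[OF _ test_functions_has_derivative[OF that]]) (auto intro!: derivative_eq_intros)
    then show ?thesis
      using linear_cmul[OF has_derivative_linear[OF test_functions_has_derivative[OF that]]]
      by (simp add: has_field_derivative_def mult_commute_abs)
  qed
  have *: "\<exists>\<xi> \<eta>. 0 < \<xi> \<and> \<xi> < h \<and> 0 < \<eta> \<and> \<eta> < h \<and>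
      f (x + h *\<^sub>R v + h *\<^sub>R w) - f (x + h *\<^sub>R v) - f (x + h *\<^sub>R w) + f x
      = h * (h * frechet_derivative (\<lambda>y. frechet_derivative f (at y) v) (at (x + \<xi> *\<^sub>R v + \<eta> *\<^sub>R w)) w)"
    if h: "0 < h" and v: "v \<in> Basis" for v w h
  proof -
    let ?p = "\<lambda>s. f (x + h *\<^sub>R w + s *\<^sub>R v) - f (x + s *\<^sub>R v)"
    let ?p' = "\<lambda>s. frechet_derivative f (at (x + h *\<^sub>R w + s *\<^sub>R v)) v - frechet_derivative f (at (x + s *\<^sub>R v)) v"
    have "(?p has_real_derivative ?p' s) (at s)" for s
      by (intro DERIV_diff line f)
    then obtain \<xi> where \<xi>: "0 < \<xi>" "\<xi> < h" "?p h - ?p 0 = (h - 0) * ?p' \<xi>"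
      using MVT2[OF h, of ?p ?p'] by blast
    let ?q = "\<lambda>t. frechet_derivative f (at (x + \<xi> *\<^sub>R v + t *\<^sub>R w)) v"
    let ?q' = "\<lambda>t. frechet_derivative (\<lambda>y. frechet_derivative f (at y) v) (at (x + \<xi> *\<^sub>R v + t *\<^sub>R w)) w"
    have "(?q has_real_derivative ?q' t) (at t)" for t
      by (rule line[OF test_functions_partial[OF f v]])
    then obtain \<eta> where \<eta>: "0 < \<eta>" "\<eta> < h" "?q h - ?q 0 = (h - 0) * ?q' \<eta>"
      using MVT2[OF h, of ?q ?q'] by blast
    have "?p' \<xi> = ?q h - ?q 0"
      by (simp add: add.commute add.left_commute)
    with \<xi> \<eta> have "?p h - ?p 0 = h * (h * ?q' \<eta>)" by simp
    moreover have "?p h - ?p 0 = f (x + h *\<^sub>R v + h *\<^sub>R w) - f (x + h *\<^sub>R v) - f (x + h *\<^sub>R w) + f x"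
      by (simp add: add.commute add.left_commute)
    ultimately show ?thesis using \<xi> \<eta> by (intro exI[of _ \<xi>] exI[of _ \<eta>]) simp
  qed
  define h where "h n = inverse (real (Suc n))" for n
  have h: "h n > 0" for n by (simp add: h_def)
  have h0: "h \<longlonglongrightarrow> 0" unfolding h_def by (rule LIMSEQ_inverse_real_of_nat)
  let ?A = "\<lambda>y. frechet_derivative (\<lambda>y. frechet_derivative f (at y) i) (at y) j"
  let ?B = "\<lambda>y. frechet_derivative (\<lambda>y. frechet_derivative f (at y) j) (at y) i"
  have "\<forall>n. \<exists>\<xi> \<eta>. 0 < \<xi> \<and> \<xi> < h n \<and> 0 < \<eta> \<and> \<eta> < h n \<and>
      f (x + h n *\<^sub>R i + h n *\<^sub>R j) - f (x + h n *\<^sub>R i) - f (x + h n *\<^sub>R j) + f x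
      = h n * (h n * ?A (x + \<xi> *\<^sub>R i + \<eta> *\<^sub>R j))"
    using *[OF h i] by blast
  then obtain a b where ab: "\<And>n. 0 < a n" "\<And>n. a n < h n" "\<And>n. 0 < b n" "\<And>n. b n < h n"
    "\<And>n. f (x + h n *\<^sub>R i + h n *\<^sub>R j) - f (x + h n *\<^sub>R i) - f (x + h n *\<^sub>R j) + f x
      = h n * (h n * ?A (x + a n *\<^sub>R i + b n *\<^sub>R j))"
    unfolding choice_iff by blast
  have "\<forall>n. \<exists>\<xi> \<eta>. 0 < \<xi> \<and> \<xi> < h n \<and> 0 < \<eta> \<and> \<eta> < h n \<and>
      f (x + h n *\<^sub>R j + h n *\<^sub>R i) - f (x + h n *\<^sub>R j) - f (x + h n *\<^sub>R i) + f x
      = h n * (h n * ?B (x + \<xi> *\<^sub>R j + \<eta> *\<^sub>R i))"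
    using *[OF h j] by blast
  then obtain c d where cd: "\<And>n. 0 < c n" "\<And>n. c n < h n" "\<And>n. 0 < d n" "\<And>n. d n < h n"
    "\<And>n. f (x + h n *\<^sub>R j + h n *\<^sub>R i) - f (x + h n *\<^sub>R j) - f (x + h n *\<^sub>R i) + f x
      = h n * (h n * ?B (x + c n *\<^sub>R j + d n *\<^sub>R i))"
    unfolding choice_iff by blast
  have eq: "?A (x + a n *\<^sub>R i + b n *\<^sub>R j) = ?B (x + c n *\<^sub>R j + d n *\<^sub>R i)" for n
  proof -
    have "h n * (h n * ?A (x + a n *\<^sub>R i + b n *\<^sub>R j)) = h n * (h n * ?B (x + c n *\<^sub>R j + d n *\<^sub>R i))"
    proof -
      have "x + h n *\<^sub>R i + h n *\<^sub>R j = x + h n *\<^sub>R j + h n *\<^sub>R i"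
        by (simp add: add.commute add.left_commute)
      from ab(5)[of n, unfolded this] cd(5)[of n] show ?thesis by linarith
    qed
    then show ?thesis using h[of n] by simp
  qed
  have z: "e \<longlonglongrightarrow> 0" if "\<And>n. 0 < e n" "\<And>n. e n < h n" for e :: "nat \<Rightarrow> real"
    by (rule tendsto_zero_bound[OF _ h0]) (use that in \<open>simp add: less_imp_le\<close>)
  have cA: "isCont ?A y" for y
    using continuous_on_test_function[OF test_functions_partial[OF test_functions_partial[OF f i] j], of UNIV]
    by (simp add: continuous_on_eq_continuous_at)
  have cB: "isCont ?B y" for y
    using continuous_on_test_function[OF test_functions_partial[OF test_functions_partial[OF f j] i], of UNIV]
    by (simp add: continuous_on_eq_continuous_at)
  have "(\<lambda>n. x + a n *\<^sub>R i + b n *\<^sub>R j) \<longlonglongrightarrow> x + 0 *\<^sub>R i + 0 *\<^sub>R j"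
    by (intro tendsto_intros z ab)
  then have 1: "(\<lambda>n. ?A (x + a n *\<^sub>R i + b n *\<^sub>R j)) \<longlonglongrightarrow> ?A x"
    using isCont_tendsto_compose[OF cA] by simp
  have "(\<lambda>n. x + c n *\<^sub>R j + d n *\<^sub>R i) \<longlonglongrightarrow> x + 0 *\<^sub>R j + 0 *\<^sub>R i"
    by (intro tendsto_intros z cd)
  then have 2: "(\<lambda>n. ?B (x + c n *\<^sub>R j + d n *\<^sub>R i)) \<longlonglongrightarrow> ?B x"
    using isCont_tendsto_compose[OF cB] by simp
  show ?thesis
    by (rule LIMSEQ_unique[OF 1 2[folded eq]])
qed

text \<open>The distributional symmetry of the Jacobian of \<open>g\<close>. Only pairings with
  fixed test functions occur, so the property survives limits in \<open>L2\<close>.\<close>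

definition curl_free :: "('a::euclidean_space \<Rightarrow> 'a) \<Rightarrow> bool" where
  "curl_free g \<longleftrightarrow> (\<forall>\<theta>\<in>test_functions UNIV. \<forall>i\<in>Basis. \<forall>j\<in>Basis.
     (LINT x|lebesgue. (g x \<bullet> i) * frechet_derivative \<theta> (at x) j)
     = (LINT x|lebesgue. (g x \<bullet> j) * frechet_derivative \<theta> (at x) i))"

lemma weak_gradient_curl_free:
  fixes u :: "'a::euclidean_space \<Rightarrow> real"
  assumes u: "is_weak_gradient UNIV u g"
  shows "curl_free g"
  unfolding curl_free_def
proof (intro ballI)
  fix \<theta> :: "'a \<Rightarrow> real" and i j :: 'a assume \<theta>: "\<theta> \<in> test_functions UNIV" and i: "i \<in> Basis" and j: "j \<in> Basis"
  have loc: "u \<in> L1_loc UNIV" "g \<in> L1_loc UNIV"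
    using u by (auto simp: is_weak_gradient_def)
  have *: "(LINT x|lebesgue. (g x \<bullet> k) * \<phi> x) = - (LINT x|lebesgue. u x * frechet_derivative \<phi> (at x) k)"
    if \<phi>: "\<phi> \<in> test_functions UNIV" and k: "k \<in> Basis" for \<phi> k
  proof -
    note i1 = integrable_mult_grad_test[OF open_UNIV loc(1) \<phi>, unfolded lebesgue_on_UNIV_eq]
    note i2 = integrable_test_mult[OF open_UNIV loc(2) \<phi>, unfolded lebesgue_on_UNIV_eq]
    have "(LINT x|lebesgue. u x *\<^sub>R grad \<phi> x) \<bullet> k = - (LINT x|lebesgue. \<phi> x *\<^sub>R g x) \<bullet> k"
      using u \<phi> by (simp add: is_weak_gradient_def lebesgue_on_UNIV_eq)
    then show ?thesis
      using integral_inner_left[of k lebesgue, OF i1] integral_inner_left[of k lebesgue, OF i2]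
      by (simp add: grad_inner[OF k] mult.commute)
  qed
  show "(LINT x|lebesgue. (g x \<bullet> i) * frechet_derivative \<theta> (at x) j)
     = (LINT x|lebesgue. (g x \<bullet> j) * frechet_derivative \<theta> (at x) i)"
    using *[OF test_functions_partial[OF \<theta> j] i] *[OF test_functions_partial[OF \<theta> i] j]
      mixed_partials_symmetric[OF \<theta> i j] by simp
qed

section \<open>A Liouville argument for curl free and weakly divergence free fields\<close>

lemma sq_int_inner_Basis:
  assumes "sq_int M g" "i \<in> Basis"
  shows "sq_int M (\<lambda>x. g x \<bullet> i)"
  by (rule sq_int_bound[OF assms(1), of _ 1])
     (use assms sq_intD(1)[OF assms(1)] in \<open>auto intro!: AE_I2 Basis_le_norm\<close>)

text \<open>Curl freeness replaces the pairing of component \<open>i\<close> with a pure second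
  derivative in \<open>j\<close> by the pairing of component \<open>j\<close> with a mixed one. The
  sum over \<open>j\<close> is then the pairing of \<open>g\<close> with the gradient of the
  \<open>i\<close>-th partial derivative of \<open>\<Psi>\<close>, which vanishes. So every
  component annihilates Laplacians of test functions.\<close>

lemma weakly_harmonic:
  fixes g :: "'a::euclidean_space \<Rightarrow> 'a"
  assumes g: "sq_int lebesgue g" "curl_free g"
    and div: "\<And>\<theta>. \<theta> \<in> test_functions UNIV \<Longrightarrow> (LINT x|lebesgue. g x \<bullet> grad \<theta> x) = 0"
    and \<Psi>: "\<Psi> \<in> test_functions UNIV" and i: "i \<in> Basis"
  shows "(LINT x|lebesgue. (g x \<bullet> i) *
     (\<Sum>j\<in>Basis. frechet_derivative (\<lambda>y. frechet_derivative \<Psi> (at y) j) (at x) j)) = 0"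
proof -
  note t = test_functions_partial[OF \<Psi>]
  note t2 = test_functions_partial[OF t]
  have int: "integrable lebesgue (\<lambda>x. (g x \<bullet> k) * frechet_derivative (\<lambda>y. frechet_derivative \<Psi> (at y) j) (at x) l)"
    if "j \<in> Basis" "k \<in> Basis" "l \<in> Basis" for j k l
    using integrable_inner_sq_int[OF sq_int_inner_Basis[OF g(1) that(2)] sq_int_test(1)[OF t2[OF that(1,3)]]] by simp
  have "(LINT x|lebesgue. (g x \<bullet> i) * (\<Sum>j\<in>Basis. frechet_derivative (\<lambda>y. frechet_derivative \<Psi> (at y) j) (at x) j))
      = (\<Sum>j\<in>Basis. LINT x|lebesgue. (g x \<bullet> i) * frechet_derivative (\<lambda>y. frechet_derivative \<Psi> (at y) j) (at x) j)"
    unfolding sum_distrib_left by (rule Bochner_Integration.integral_sum) (intro int i)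
  also have "\<dots> = (\<Sum>j\<in>Basis. LINT x|lebesgue. (g x \<bullet> j) * frechet_derivative (\<lambda>y. frechet_derivative \<Psi> (at y) i) (at x) j)"
  proof (rule sum.cong[OF refl])
    fix j :: 'a assume j: "j \<in> Basis"
    have "(LINT x|lebesgue. (g x \<bullet> i) * frechet_derivative (\<lambda>y. frechet_derivative \<Psi> (at y) j) (at x) j)
        = (LINT x|lebesgue. (g x \<bullet> j) * frechet_derivative (\<lambda>y. frechet_derivative \<Psi> (at y) j) (at x) i)"
      using g(2) t[OF j] i j unfolding curl_free_def by blast
    then show "(LINT x|lebesgue. (g x \<bullet> i) * frechet_derivative (\<lambda>y. frechet_derivative \<Psi> (at y) j) (at x) j)
        = (LINT x|lebesgue. (g x \<bullet> j) * frechet_derivative (\<lambda>y. frechet_derivative \<Psi> (at y) i) (at x) j)"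
      by (simp add: mixed_partials_symmetric[OF \<Psi> j i])
  qed
  also have "\<dots> = (LINT x|lebesgue. (\<Sum>j\<in>Basis. (g x \<bullet> j) * frechet_derivative (\<lambda>y. frechet_derivative \<Psi> (at y) i) (at x) j))"
    by (rule Bochner_Integration.integral_sum[symmetric]) (intro int i)
  also have "\<dots> = (LINT x|lebesgue. g x \<bullet> grad (\<lambda>y. frechet_derivative \<Psi> (at y) i) x)"
    by (simp add: grad_def inner_sum_right mult.commute)
  also have "\<dots> = 0"
    by (rule div[OF t[OF i]])
  finally show ?thesis .
qed

text \<open>Explains the radial profile \<open>bump 0 + bump 1\<close>: it has the explicit
  antiderivative \<open>s * bump 0 s\<close>, from which a compactly supported radial potential is
  built.\<close>

lemma bump_primitive_deriv: "((\<lambda>s. s * bump 0 s) has_real_derivative bump 0 s + bump 1 s) (at s)"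
proof -
  have "s * bump (Suc (Suc 0)) s = bump (Suc 0) s"
    by (simp add: bump_def)
  then show ?thesis
    using DERIV_mult[OF DERIV_ident bump_deriv[of 0 s]] by (simp add: add.commute mult.commute)
qed

text \<open>The two contributions of \<open>bump 2\<close> cancel.\<close>

lemma bump_sum_deriv: "((\<lambda>s. bump 0 s + bump 1 s) has_real_derivative bump 3 s) (at s)"
  using DERIV_add[OF bump_deriv[of 0 s] bump_deriv[of 1 s]] by (simp add: numeral_3_eq_3 numeral_2_eq_2)

lemma bump_sum_bounds: "0 \<le> bump 0 s + bump 1 s" "bump 0 s + bump 1 s \<le> 1"
proof -
  show "bump 0 s + bump 1 s \<le> 1"
  proof (cases "s > 0")
    case True
    have "exp (- (1 / s)) * (1 + 1 / s) \<le> exp (- (1 / s)) * exp (1 / s)"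
      by (intro mult_left_mono exp_ge_add_one_self) simp
    also have "\<dots> = 1" by (simp flip: exp_add)
    finally show ?thesis using True by (simp add: bump_def algebra_simps)
  qed (simp add: bump_def)
qed (simp add: bump_def)

lemma bump_sum_tendsto_indicator:
  assumes "r > 0"
  shows "(\<lambda>k. bump 0 (real (Suc k) * (1 - (1 / r\<^sup>2) * (norm (x - x0))\<^sup>2)) + bump 1 (real (Suc k) * (1 - (1 / r\<^sup>2) * (norm (x - x0))\<^sup>2)))
    \<longlonglongrightarrow> indicator (ball x0 r) x"
proof -
  let ?c = "1 - (1 / r\<^sup>2) * (norm (x - x0))\<^sup>2"
  have "(\<lambda>k. bump 1 (real (Suc k) * ?c)) \<longlonglongrightarrow> 0"
  proof (rule tendsto_zero_bound)
    show "norm (bump 1 (real (Suc k) * ?c)) \<le> inverse (real (Suc k)) * (if ?c > 0 then 1 / ?c else 0)" for k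
    proof (cases "?c > 0")
      case True
      then have p: "0 < real (Suc k) * ?c" by (intro mult_pos_pos) simp_all
      have "bump 1 (real (Suc k) * ?c) \<le> 1 / (real (Suc k) * ?c)"
        using p by (simp add: bump_def divide_right_mono del: of_nat_Suc)
      moreover have "0 \<le> bump 1 (real (Suc k) * ?c)"
        using p by (simp add: bump_def)
      moreover have "1 / (real (Suc k) * ?c) = inverse (real (Suc k)) * (if ?c > 0 then 1 / ?c else 0)"
        using True by (simp add: divide_inverse del: of_nat_Suc)
      ultimately show ?thesis by simp
    next
      case False
      then have "\<not> 0 < real (Suc k) * ?c" by (simp add: zero_less_mult_iff del: of_nat_Suc)
      then show ?thesis using False by (simp add: bump_def del: of_nat_Suc)
    qed
    show "(\<lambda>k. inverse (real (Suc k)) * (if ?c > 0 then 1 / ?c else 0)) \<longlonglongrightarrow> 0"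
      by (rule tendsto_mult_left_zero[OF LIMSEQ_inverse_real_of_nat])
  qed
  from tendsto_add[OF bump0_tendsto_indicator[OF assms, of x x0] this] show ?thesis
    by simp
qed

lemma sq_int_indicator:
  assumes "bounded C" "C \<in> sets lebesgue"
  shows "sq_int lebesgue (\<lambda>x. if x \<in> C then c else 0)"
  using sq_int_const_on[OF assms, of c] by (simp add: sq_int_on_iff[OF assms(2)])

text \<open>Let \<open>M t\<close> be the average of component \<open>i\<close> against the profile
  \<open>F t\<close>, which lives on the ball of radius \<open>1 / sqrt t\<close>. The potential
  \<open>\<Psi>\<close> has gradient \<open>F t x\<close> times \<open>x - x0\<close>, hence
  Laplacian \<open>d * F t + 2 * t * F' t\<close> with \<open>d\<close> the dimension and
  \<open>F'\<close> the derivative in \<open>t\<close>. Weak harmonicity gives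
  \<open>d * M t + 2 * t * M' t = 0\<close>, so that \<open>M t\<close> squared times
  \<open>t ^ d\<close> is constant. By Cauchy-Schwarz and the volume of the ball this constant is at
  most a multiple of \<open>sqrt t ^ d\<close>, and \<open>t\<close> tending to \<open>0\<close>,
  that is a growing ball, shows that it is zero.\<close>

lemma radial_average_eq_0:
  fixes g :: "'a::euclidean_space \<Rightarrow> 'a"
  assumes g: "sq_int lebesgue g" "curl_free g"
    and div: "\<And>\<theta>. \<theta> \<in> test_functions UNIV \<Longrightarrow> (LINT x|lebesgue. g x \<bullet> grad \<theta> x) = 0"
    and i: "i \<in> Basis" and m: "m > 0" and t1: "t1 > 0"
  shows "(LINT x|lebesgue. (g x \<bullet> i) * (bump 0 (m * (1 - t1 * (norm (x - x0))\<^sup>2)) + bump 1 (m * (1 - t1 * (norm (x - x0))\<^sup>2)))) = 0"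
proof -
  define q where "q t x = m * (1 - t * (norm (x - x0))\<^sup>2)" for t and x :: 'a
  define F where "F t x = bump 0 (q t x) + bump 1 (q t x)" for t x
  define F' where "F' t x = - (m * (norm (x - x0))\<^sup>2) * bump 3 (q t x)" for t x
  define M where "M t = (LINT x|lebesgue. (g x \<bullet> i) * F t x)" for t
  define M' where "M' t = (LINT x|lebesgue. (g x \<bullet> i) * F' t x)" for t
  note gi = sq_int_inner_Basis[OF g(1) i]
  have test: "(\<lambda>x. bump n (q t x)) \<in> test_functions UNIV" if "t > 0" for n t
    unfolding q_def by (rule radial_test_function[OF m that]) simp
  have Ft: "F t \<in> test_functions UNIV" if "t > 0" for t
    unfolding F_def[abs_def] by (intro test_functions_add test that)
  have Ckq: "Ck k (q t)" for k t
    unfolding q_def by (intro Ck_cmult Ck_diff Ck_const Ck_dist_square)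
  have F't: "F' t \<in> test_functions UNIV" if "t > 0" for t
  proof -
    have "(\<lambda>x. (- m * (norm (x - x0))\<^sup>2) * bump 3 (q t x)) \<in> test_functions UNIV"
      by (intro test_functions_mult test that Ck_cmult Ck_dist_square)
    then show ?thesis by (simp add: F'_def[abs_def])
  qed
  have intF: "integrable lebesgue (\<lambda>x. (g x \<bullet> i) * F t x)" "integrable lebesgue (\<lambda>x. (g x \<bullet> i) * F' t x)" if "t > 0" for t
    using integrable_inner_sq_int[OF gi sq_int_test(1)[OF Ft[OF that]]]
      integrable_inner_sq_int[OF gi sq_int_test(1)[OF F't[OF that]]] by simp_all
  have dq: "(q t has_derivative (\<lambda>h. - (2 * m * t) * ((x - x0) \<bullet> h))) (at x)" for t x
  proof -
    have "((\<lambda>x. m * (1 - t * ((x - x0) \<bullet> (x - x0)))) has_derivative (\<lambda>h. - (2 * m * t) * ((x - x0) \<bullet> h))) (at x)"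
      by (auto intro!: derivative_eq_intros simp: fun_eq_iff inner_commute algebra_simps)
    then show ?thesis by (simp add: q_def[abs_def] power2_norm_eq_inner)
  qed
  have dF: "(F t has_derivative (\<lambda>h. bump 3 (q t x) * (- (2 * m * t) * ((x - x0) \<bullet> h)))) (at x)" for t x
    using has_derivative_compose[OF dq bump_sum_deriv[unfolded has_field_derivative_def]]
    by (simp add: F_def[abs_def])
  have dFt: "((\<lambda>t. F t x) has_real_derivative F' t x) (at t)" for t x
  proof -
    have "((\<lambda>t. q t x) has_real_derivative - (m * (norm (x - x0))\<^sup>2)) (at t)"
      unfolding q_def by (auto intro!: derivative_eq_intros)
    from DERIV_chain2[OF bump_sum_deriv this] show ?thesis
      by (simp add: F_def[abs_def] F'_def mult.commute)
  qed
  have euler: "DIM('a) * M t + 2 * t * M' t = 0" if t: "t > 0" for t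
  proof -
    \<comment> \<open>The factor in front cancels the \<open>- (2 * m * t)\<close> that
      differentiating \<open>q\<close> produces.\<close>
    define \<Psi> where "\<Psi> x = - (1 / (2 * m * t)) * (q t x * bump 0 (q t x))" for x
    have \<Psi>: "\<Psi> \<in> test_functions UNIV"
      unfolding \<Psi>_def[abs_def] by (intro test_functions_mult test t Ckq Ck_const)
    have "(\<Psi> has_derivative (\<lambda>h. - (1 / (2 * m * t)) * ((bump 0 (q t x) + bump 1 (q t x)) * (- (2 * m * t) * ((x - x0) \<bullet> h))))) (at x)" for x
      unfolding \<Psi>_def[abs_def]
      by (intro has_derivative_mult_right has_derivative_compose[OF dq bump_primitive_deriv[unfolded has_field_derivative_def]])
    then have d\<Psi>: "(\<Psi> has_derivative (\<lambda>h. F t x * ((x - x0) \<bullet> h))) (at x)" for x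
      by (rule has_derivative_eq_rhs) (use m t in \<open>simp add: fun_eq_iff F_def\<close>)
    have fd: "frechet_derivative \<Psi> (at x) h = F t x * ((x - x0) \<bullet> h)" for x h
      using fun_cong[OF frechet_derivative_at[OF d\<Psi>, symmetric]] .
    have lap: "(\<Sum>j\<in>Basis. frechet_derivative (\<lambda>y. frechet_derivative \<Psi> (at y) j) (at x) j) = DIM('a) * F t x + 2 * t * F' t x" for x
    proof -
      have "((\<lambda>y. F t y * ((y - x0) \<bullet> j)) has_derivative
          (\<lambda>h. F t x * (h \<bullet> j) + (bump 3 (q t x) * (- (2 * m * t) * ((x - x0) \<bullet> h))) * ((x - x0) \<bullet> j))) (at x)" for j
        by (rule has_derivative_mult[OF dF]) (auto intro!: derivative_eq_intros)
      from fun_cong[OF frechet_derivative_at[OF this, symmetric]]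
      have "frechet_derivative (\<lambda>y. frechet_derivative \<Psi> (at y) j) (at x) j =
          F t x * (j \<bullet> j) + (- (2 * m * t) * bump 3 (q t x)) * (((x - x0) \<bullet> j) * ((x - x0) \<bullet> j))" for j
        by (simp add: fd mult.commute mult.left_commute mult.assoc)
      then have "(\<Sum>j\<in>Basis. frechet_derivative (\<lambda>y. frechet_derivative \<Psi> (at y) j) (at x) j) =
          (\<Sum>j\<in>Basis. F t x * (j \<bullet> j) + (- (2 * m * t) * bump 3 (q t x)) * (((x - x0) \<bullet> j) * ((x - x0) \<bullet> j)))"
        by simp
      also have "\<dots> = (\<Sum>j\<in>(Basis::'a set). F t x) + (- (2 * m * t) * bump 3 (q t x)) * (\<Sum>j\<in>Basis. ((x - x0) \<bullet> j) * ((x - x0) \<bullet> j))"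
        by (simp only: sum.distrib sum_distrib_left) (simp add: inner_same_Basis)
      also have "(\<Sum>j\<in>Basis. ((x - x0) \<bullet> j) * ((x - x0) \<bullet> j)) = (norm (x - x0))\<^sup>2"
        by (simp only: power2_norm_eq_inner euclidean_inner[of "x - x0" "x - x0"])
      finally show ?thesis by (simp add: F'_def)
    qed
    have "(LINT x|lebesgue. (g x \<bullet> i) * (DIM('a) * F t x + 2 * t * F' t x)) = 0"
      using weakly_harmonic[OF g div \<Psi> i] unfolding lap .
    moreover have "(\<lambda>x. (g x \<bullet> i) * (DIM('a) * F t x + 2 * t * F' t x)) = (\<lambda>x. DIM('a) * ((g x \<bullet> i) * F t x) + (2 * t) * ((g x \<bullet> i) * F' t x))"
      by (simp add: fun_eq_iff algebra_simps)
    moreover have "(LINT x|lebesgue. DIM('a) * ((g x \<bullet> i) * F t x) + (2 * t) * ((g x \<bullet> i) * F' t x)) = DIM('a) * M t + (2 * t) * M' t"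
      unfolding M_def M'_def using intF[OF t] by (subst Bochner_Integration.integral_add) auto
    ultimately show ?thesis by simp
  qed
  have "bounded (bump 3 ` {0..m})"
    by (intro compact_imp_bounded compact_continuous_image continuous_at_imp_continuous_on ballI DERIV_isCont[OF bump_deriv] compact_Icc)
  then obtain C where "\<forall>y\<in>bump 3 ` {0..m}. norm y \<le> C"
    unfolding bounded_iff by blast
  then have C: "\<bar>bump 3 s\<bar> \<le> C" if "s \<in> {0..m}" for s
    using that by simp
  have C0: "0 \<le> C" by (rule order_trans[OF abs_ge_zero C[of 0]]) (use m in simp)
  have supp: "x \<in> cball x0 (1 / sqrt t)" if t: "t > 0" and q: "q t x > 0" for t x
  proof -
    have "t * (norm (x - x0))\<^sup>2 < 1"
      using q m by (simp add: q_def zero_less_mult_iff)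
    then have "(norm (x - x0))\<^sup>2 \<le> (1 / sqrt t)\<^sup>2"
      using t by (simp add: power_divide field_simps)
    then have "norm (x - x0) \<le> 1 / sqrt t"
      by (rule power2_le_imp_le) (use t in simp)
    then show ?thesis by (simp add: dist_norm norm_minus_commute)
  qed
  have dM: "(M has_real_derivative M' t) (at t)" if t: "t > 0" for t
  proof -
    \<comment> \<open>For \<open>s > t / 2\<close> every support lies in the ball belonging to
      \<open>t / 2\<close>, where the squared distance is at most \<open>2 / t\<close>;
      \<open>C\<close> bounds \<open>bump 3\<close> on the interval from \<open>0\<close> to
      \<open>m\<close>, which contains all positive values of \<open>q s\<close>.\<close>
    let ?c = "m * (2 / t) * C" and ?ball = "cball x0 (1 / sqrt (t / 2))"
    show ?thesis
      unfolding M_def[abs_def] M'_def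
    proof (rule has_real_derivative_integral[where S="{t/2<..}" and B="\<lambda>x. norm (g x \<bullet> i) * norm (if x \<in> ?ball then ?c else 0)"])
      show "integrable lebesgue (\<lambda>x. norm (g x \<bullet> i) * norm (if x \<in> ?ball then ?c else 0))"
        by (intro integrable_norm_mult gi sq_int_indicator) (auto intro: compact_in_lebesgue)
      show "(\<lambda>x. (g x \<bullet> i) * F' t x) \<in> borel_measurable lebesgue"
        by (rule borel_measurable_integrable[OF intF(2)[OF t]])
      fix s assume s: "s \<in> {t/2<..}"
      then have s0: "s > 0" using t by simp
      show "integrable lebesgue (\<lambda>x. (g x \<bullet> i) * F s x)"
        by (rule intF(1)[OF s0])
      fix x
      show "((\<lambda>s. (g x \<bullet> i) * F s x) has_real_derivative (g x \<bullet> i) * F' s x) (at s)"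
        by (rule DERIV_cmult[OF dFt])
      show "\<bar>(g x \<bullet> i) * F' s x\<bar> \<le> norm (g x \<bullet> i) * norm (if x \<in> ?ball then ?c else 0)"
      proof (cases "q s x > 0")
        case True
        have "s * (norm (x - x0))\<^sup>2 < 1"
          using True m by (simp add: q_def zero_less_mult_iff)
        then have n: "(norm (x - x0))\<^sup>2 \<le> 1 / s"
          using s0 by (simp add: field_simps)
        also have "1 / s \<le> 2 / t"
          using s t by (simp add: field_simps)
        finally have n: "(norm (x - x0))\<^sup>2 \<le> 2 / t" .
        have "1 / sqrt s \<le> 1 / sqrt (t / 2)"
          using s t by (intro divide_left_mono mult_pos_pos) auto
        then have b: "x \<in> ?ball"
          using supp[OF s0 True] by auto
        have "q s x \<le> m"
          using m s0 by (simp add: q_def mult_le_cancel_left1)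
        then have "\<bar>bump 3 (q s x)\<bar> \<le> C"
          using True by (intro C) simp
        then have "\<bar>F' s x\<bar> \<le> ?c"
          unfolding F'_def abs_mult abs_minus_cancel using m n C0 t
          by (intro mult_mono) (auto simp: abs_mult intro!: mult_left_mono)
        then have "\<bar>g x \<bullet> i\<bar> * \<bar>F' s x\<bar> \<le> \<bar>g x \<bullet> i\<bar> * \<bar>?c\<bar>"
          by (rule mult_left_mono[OF order_trans[OF _ abs_ge_self]]) simp
        then show ?thesis using b by (simp add: abs_mult)
      next
        case False
        then have "F' s x = 0" by (simp add: F'_def bump_def)
        then show ?thesis by simp
      qed
    qed (use t in auto)
  qed
  \<comment> \<open>The differential equation makes \<open>M\<close> proportional to the power
    \<open>- d / 2\<close> of \<open>t\<close>; squaring turns the first integral into an expression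
    with an integer exponent.\<close>
  define N where "N t = (M t)\<^sup>2 * t ^ DIM('a)" for t
  have dN: "(N has_real_derivative 0) (at t)" if t: "t > 0" for t
  proof -
    let ?d = "2 * M t * M' t * t ^ DIM('a) + (M t)\<^sup>2 * (DIM('a) * t ^ (DIM('a) - Suc 0))"
    have "(N has_real_derivative ?d) (at t)"
      unfolding N_def[abs_def] by (auto intro!: derivative_eq_intros dM[OF t])
    moreover have "?d = 0"
    proof -
      have "t * (t ^ (DIM('a) - Suc 0)) = t ^ DIM('a)"
        using DIM_positive[where 'a='a] by (cases "DIM('a)") auto
      then have "t * ?d = t ^ DIM('a) * M t * (DIM('a) * M t + 2 * t * M' t)"
        by (simp add: algebra_simps power2_eq_square)
      then show ?thesis using euler[OF t] t by simp
    qed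
    ultimately show ?thesis by simp
  qed
  obtain c where c: "\<And>t. t > 0 \<Longrightarrow> N t = c"
  proof -
    have "\<exists>c. \<forall>t\<in>{0<..}. N t = c"
      by (rule has_field_derivative_zero_constant) (auto intro: has_field_derivative_at_within dN)
    then show thesis using that by auto
  qed
  define A where "A = (l2 lebesgue (\<lambda>x. g x \<bullet> i))\<^sup>2 * unit_ball_vol DIM('a)"
  have bound: "N t \<le> A * sqrt t ^ DIM('a)" if t: "t > 0" for t
  proof -
    let ?I = "\<lambda>x. if x \<in> cball x0 (1 / sqrt t) then 1 else (0::real)"
    have sI: "sq_int lebesgue ?I" by (intro sq_int_indicator) (auto intro: compact_in_lebesgue)
    have "F t x = 0" if "x \<notin> cball x0 (1 / sqrt t)" for x
      using supp[OF t, of x] that by (auto simp: F_def bump_def)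
    then have le: "l2 lebesgue (F t) \<le> l2 lebesgue ?I"
      using bump_sum_bounds by (intro l2_mono sI sq_intD(1)[OF sq_int_test(1)[OF Ft[OF t]]] AE_I2) (auto simp: F_def)
    have "(l2 lebesgue ?I)\<^sup>2 = unit_ball_vol DIM('a) * (1 / sqrt t) ^ DIM('a)"
    proof -
      have "(\<lambda>x. (norm (?I x))\<^sup>2) = indicator (cball x0 (1 / sqrt t))"
        by (auto simp: indicator_def)
      then show ?thesis
        unfolding l2_square using t by (simp add: content_cball)
    qed
    then have F2: "(l2 lebesgue (F t))\<^sup>2 \<le> unit_ball_vol DIM('a) * (1 / sqrt t) ^ DIM('a)"
      using power_mono[OF le l2_nonneg, of 2] by simp
    have "\<bar>M t\<bar> \<le> l2 lebesgue (\<lambda>x. g x \<bullet> i) * l2 lebesgue (F t)"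
      using abs_integral_inner_le[OF gi sq_int_test(1)[OF Ft[OF t]]] by (simp add: M_def)
    then have M2: "\<bar>M t\<bar>\<^sup>2 \<le> (l2 lebesgue (\<lambda>x. g x \<bullet> i) * l2 lebesgue (F t))\<^sup>2"
      by (rule power_mono) simp
    have "(M t)\<^sup>2 \<le> (l2 lebesgue (\<lambda>x. g x \<bullet> i))\<^sup>2 * (unit_ball_vol DIM('a) * (1 / sqrt t) ^ DIM('a))"
      by (rule order_trans[OF M2[unfolded power_mult_distrib power2_abs] mult_left_mono[OF F2]]) simp
    then have "N t \<le> A * ((1 / sqrt t) ^ DIM('a) * t ^ DIM('a))"
      unfolding N_def A_def using t by (simp add: mult_right_mono flip: mult.assoc)
    also have "(1 / sqrt t) ^ DIM('a) * t ^ DIM('a) = sqrt t ^ DIM('a)"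
      using t by (simp add: real_div_sqrt flip: power_mult_distrib)
    finally show ?thesis .
  qed
  have "((\<lambda>t. A * sqrt t ^ DIM('a)) \<longlongrightarrow> A * sqrt 0 ^ DIM('a)) (at_right 0)"
    by (intro tendsto_intros)
  then have lim: "((\<lambda>t. A * sqrt t ^ DIM('a)) \<longlongrightarrow> 0) (at_right 0)"
    using DIM_positive[where 'a='a] by (simp add: power_0_left)
  have "eventually (\<lambda>t. c \<le> A * sqrt t ^ DIM('a)) (at_right 0)"
    using eventually_at_right_less[of 0] 
  proof eventually_elim
    case (elim t)
    then show ?case using bound[of t] c[of t] by simp
  qed
  then have "c \<le> 0"
    by (rule tendsto_lowerbound[OF lim]) simp
  then have "(M t1)\<^sup>2 * t1 ^ DIM('a) \<le> 0"
    using c[OF t1] by (simp add: N_def)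
  moreover have "0 < t1 ^ DIM('a)" using t1 by simp
  ultimately have "M t1 = 0"
    by (simp add: mult_le_0_iff)
  then show ?thesis by (simp add: M_def F_def q_def)
qed

text \<open>As the steepness grows, the radial profiles converge to the indicator of the ball, so
  every component of \<open>g\<close> has vanishing integral over every ball.\<close>

lemma curl_div_free_eq_0:
  fixes g :: "'a::euclidean_space \<Rightarrow> 'a"
  assumes g: "sq_int lebesgue g" "curl_free g"
    and div: "\<And>\<theta>. \<theta> \<in> test_functions UNIV \<Longrightarrow> (LINT x|lebesgue. g x \<bullet> grad \<theta> x) = 0"
  shows "AE x in lebesgue. g x = 0"
proof -
  have "AE x in lebesgue. g x \<bullet> i = 0" if i: "i \<in> Basis" for i
  proof -
    note gi = sq_int_inner_Basis[OF g(1) i]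
    have gi': "sq_int (lebesgue_on UNIV) (\<lambda>x. g x \<bullet> i)"
      using gi unfolding lebesgue_on_UNIV_eq .
    have "AE x in lebesgue_on UNIV. g x \<bullet> i = 0"
    proof (rule AE_eq_0_if_ball_integrals_eq_0[OF open_UNIV sq_int_imp_L1_loc[OF gi']])
      fix x0 :: 'a and r :: real assume r: "0 < r"
      let ?q = "\<lambda>k x. real (Suc k) * (1 - (1 / r\<^sup>2) * (norm (x - x0))\<^sup>2)"
      have zero: "(LINT x|lebesgue. (g x \<bullet> i) * (bump 0 (?q k x) + bump 1 (?q k x))) = 0" for k
        by (rule radial_average_eq_0[OF g div i]) (use r in auto)
      let ?I = "\<lambda>x. if x \<in> cball x0 r then 1 else (0::real)"
      have t: "(\<lambda>x. bump n (?q k x)) \<in> test_functions (cball x0 r)" for k n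
        by (rule radial_test_function) (use r in \<open>auto simp: real_sqrt_divide\<close>)
      have off: "bump n (?q k x) = 0" if x: "x \<notin> cball x0 r" for k n x
      proof -
        obtain S where "S \<subseteq> cball x0 r" "\<And>x. x \<notin> S \<Longrightarrow> bump n (?q k x) = 0"
          by (rule test_functionsE[OF t[of n k]]) blast
        then show ?thesis using x by blast
      qed
      have "(\<lambda>k. LINT x|lebesgue. (g x \<bullet> i) * (bump 0 (?q k x) + bump 1 (?q k x)))
          \<longlonglongrightarrow> (LINT x|lebesgue. (g x \<bullet> i) * indicator (ball x0 r) x)"
      proof (rule integral_dominated_convergence)
        show "(\<lambda>x. (g x \<bullet> i) * indicator (ball x0 r) x) \<in> borel_measurable lebesgue"
          by (intro borel_measurable_times sq_intD(1)[OF gi] borel_measurable_indicator open_in_lebesgue open_ball)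
        show "(\<lambda>x. (g x \<bullet> i) * (bump 0 (?q k x) + bump 1 (?q k x))) \<in> borel_measurable lebesgue" for k
          by (intro borel_measurable_times borel_measurable_add sq_intD(1)[OF gi] sq_intD(1)[OF sq_int_test(1)[OF t]])
        show "integrable lebesgue (\<lambda>x. norm (g x \<bullet> i) * norm (?I x))"
          by (intro integrable_norm_mult gi sq_int_indicator) (auto intro: compact_in_lebesgue)
        show "AE x in lebesgue. (\<lambda>k. (g x \<bullet> i) * (bump 0 (?q k x) + bump 1 (?q k x))) \<longlonglongrightarrow> (g x \<bullet> i) * indicator (ball x0 r) x"
          by (intro AE_I2 tendsto_mult tendsto_const bump_sum_tendsto_indicator r)
        show "AE x in lebesgue. norm ((g x \<bullet> i) * (bump 0 (?q k x) + bump 1 (?q k x))) \<le> norm (g x \<bullet> i) * norm (?I x)" for k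
        proof (rule AE_I2)
          fix x
          have "\<bar>bump 0 (?q k x) + bump 1 (?q k x)\<bar> \<le> ?I x"
            using bump_sum_bounds[of "?q k x"] off[of x 0 k] off[of x 1 k] by (cases "x \<in> cball x0 r") simp_all
          then have "norm (bump 0 (?q k x) + bump 1 (?q k x)) \<le> norm (?I x)" by simp
          then show "norm ((g x \<bullet> i) * (bump 0 (?q k x) + bump 1 (?q k x))) \<le> norm (g x \<bullet> i) * norm (?I x)"
            unfolding norm_mult by (rule mult_left_mono) simp
        qed
      qed
      then have "(LINT x|lebesgue. (g x \<bullet> i) * indicator (ball x0 r) x) = 0"
        unfolding zero by (simp add: LIMSEQ_const_iff)
      moreover have "(\<lambda>x. (g x \<bullet> i) * indicator (ball x0 r) x) = (\<lambda>x. if x \<in> ball x0 r then g x \<bullet> i else 0)"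
        by (simp add: fun_eq_iff indicator_def)
      ultimately show "(LINT y|lebesgue_on (ball x0 r). g y \<bullet> i) = 0"
        using Lebesgue_Measure.integral_restrict_UNIV[OF open_in_lebesgue[OF open_ball[of x0 r]], of "\<lambda>x. g x \<bullet> i"]
        by (simp del: mem_ball)
    qed simp
    then show ?thesis unfolding lebesgue_on_UNIV_eq .
  qed
  then have "AE x in lebesgue. \<forall>i\<in>Basis. g x \<bullet> i = 0"
    by (simp add: AE_finite_all)
  then show ?thesis
    by eventually_elim (simp add: euclidean_all_zero_iff)
qed

section \<open>Approximation of weak gradients by a minimising sequence\<close>

lemma grad_add_scaled_test:
  assumes "\<phi> \<in> test_functions D" "\<psi> \<in> test_functions D"
  shows "(\<lambda>x. \<phi> x + c * \<psi> x) \<in> test_functions D"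
    "grad (\<lambda>x. \<phi> x + c * \<psi> x) x = grad \<phi> x + c *\<^sub>R grad \<psi> x"
proof -
  show "(\<lambda>x. \<phi> x + c * \<psi> x) \<in> test_functions D"
    by (intro test_functions_add test_functions_mult assms Ck_const)
  show "grad (\<lambda>x. \<phi> x + c * \<psi> x) x = grad \<phi> x + c *\<^sub>R grad \<psi> x"
  proof (rule grad_eqI)
    show "((\<lambda>x. \<phi> x + c * \<psi> x) has_derivative (\<lambda>h. (grad \<phi> x + c *\<^sub>R grad \<psi> x) \<bullet> h)) (at x)"
      unfolding inner_add_left inner_scaleR_left
      by (intro has_derivative_add has_derivative_mult_right test_functions_has_grad[OF assms(1)]
          test_functions_has_grad[OF assms(2)])
  qed
qed

text \<open>The residuals of a minimising sequence form a Cauchy sequence whose limit is curl free and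
  orthogonal to all gradients of test functions; by the Liouville argument above it vanishes.\<close>

theorem gradients_of_test_functions_dense:
  fixes u :: "'a::euclidean_space \<Rightarrow> real"
  assumes u: "is_weak_gradient UNIV u g" and g: "sq_int lebesgue g" and e: "e > 0"
  obtains \<psi> where "\<psi> \<in> test_functions UNIV" "l2 lebesgue (\<lambda>x. g x - grad \<psi> x) < e"
proof -
  let ?T = "test_functions UNIV :: ('a \<Rightarrow> real) set"
  define E where "E \<psi> = (l2 lebesgue (\<lambda>x. g x - grad \<psi> x))\<^sup>2" for \<psi>
  define m where "m = Inf (E ` ?T)"
  have bdd: "bdd_below (E ` ?T)"
    by (rule bdd_belowI[of _ 0]) (auto simp: E_def)
  have zero: "(\<lambda>_. 0) \<in> ?T"
    by (rule test_functionsI[of _ "{}"]) (auto intro: Ck_const)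
  have mle: "m \<le> E \<psi>" if "\<psi> \<in> ?T" for \<psi>
    unfolding m_def using that bdd by (intro cInf_lower) auto
  define h where "h n = inverse (real (Suc n))" for n
  have h: "h n > 0" for n by (simp add: h_def)
  have h0: "h \<longlonglongrightarrow> 0" unfolding h_def by (rule LIMSEQ_inverse_real_of_nat)
  have "\<forall>n. \<exists>\<psi>. \<psi> \<in> ?T \<and> E \<psi> < m + h n"
  proof
    fix n
    have "Inf (E ` ?T) < m + h n" using h[of n] by (simp add: m_def)
    then obtain y where "y \<in> E ` ?T" "y < m + h n"
      using cInf_lessD[of "E ` ?T" "m + h n"] zero by blast
    then show "\<exists>\<psi>. \<psi> \<in> ?T \<and> E \<psi> < m + h n" by blast
  qed
  then obtain \<psi> where \<psi>: "\<And>n. \<psi> n \<in> ?T" "\<And>n. E (\<psi> n) < m + h n"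
    unfolding choice_iff by blast
  define r where "r n x = g x - grad (\<psi> n) x" for n x
  have r: "sq_int lebesgue (r n)" for n
    unfolding r_def[abs_def] by (intro sq_int_diff g sq_int_test[OF \<psi>(1)])
  \<comment> \<open>Moving \<open>\<psi> n\<close> along \<open>\<theta>\<close> lowers the energy
    by at most \<open>h n\<close>. So a quadratic polynomial with constant term \<open>h n\<close>
    is nonnegative, and its discriminant bounds the linear coefficient: the residuals are
    asymptotically orthogonal to gradients.\<close>
  have small: "\<bar>LINT x|lebesgue. r n x \<bullet> grad \<theta> x\<bar> \<le> l2 lebesgue (grad \<theta>) * sqrt (h n)"
    if \<theta>: "\<theta> \<in> ?T" for \<theta> n
  proof -
    have "\<bar>LINT x|lebesgue. r n x \<bullet> grad \<theta> x\<bar> \<le> sqrt ((l2 lebesgue (grad \<theta>))\<^sup>2) * sqrt (h n)"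
    proof (rule quadratic_nonneg_discriminant)
      fix t :: real
      note s = sq_int_scaleR[OF sq_int_test(2)[OF \<theta>], of t]
      have "m \<le> E (\<lambda>x. \<psi> n x + (- t) * \<theta> x)"
        by (rule mle[OF grad_add_scaled_test(1)[OF \<psi>(1) \<theta>]])
      also have "E (\<lambda>x. \<psi> n x + (- t) * \<theta> x) = (l2 lebesgue (\<lambda>x. r n x + t *\<^sub>R grad \<theta> x))\<^sup>2"
        unfolding E_def grad_add_scaled_test(2)[OF \<psi>(1) \<theta>] r_def by (simp add: algebra_simps)
      also have "\<dots> = E (\<psi> n) + 2 * (LINT x|lebesgue. r n x \<bullet> (t *\<^sub>R grad \<theta> x)) + (l2 lebesgue (\<lambda>x. t *\<^sub>R grad \<theta> x))\<^sup>2"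
        unfolding l2_square_add[OF r s] by (simp add: E_def r_def[abs_def])
      also have "\<dots> = E (\<psi> n) + 2 * (LINT x|lebesgue. r n x \<bullet> grad \<theta> x) * t + (l2 lebesgue (grad \<theta>))\<^sup>2 * t\<^sup>2"
        by (simp add: power_mult_distrib)
      finally show "0 \<le> (l2 lebesgue (grad \<theta>))\<^sup>2 * t\<^sup>2 + 2 * (LINT x|lebesgue. r n x \<bullet> grad \<theta> x) * t + h n"
        using \<psi>(2)[of n] by linarith
    qed (use h[of n] in simp_all)
    then show ?thesis by simp
  qed
  \<comment> \<open>The difference of two residuals is itself the gradient of a test function, so
    the near orthogonality just shown applies to it as the second factor.\<close>
  have cauchy: "l2 lebesgue (\<lambda>x. r j x - r k x) \<le> sqrt (h j) + sqrt (h k)" for j k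
  proof -
    define \<theta> where "\<theta> x = \<psi> k x + (- 1) * \<psi> j x" for x
    have \<theta>: "\<theta> \<in> ?T" unfolding \<theta>_def[abs_def] by (rule grad_add_scaled_test(1)[OF \<psi>(1) \<psi>(1)])
    have "grad \<theta> x = grad (\<psi> k) x + (- 1) *\<^sub>R grad (\<psi> j) x" for x
      unfolding \<theta>_def[abs_def] by (rule grad_add_scaled_test(2)[OF \<psi>(1) \<psi>(1)])
    then have gr: "(\<lambda>x. r j x - r k x) = grad \<theta>"
      by (simp add: r_def fun_eq_iff)
    let ?b = "l2 lebesgue (grad \<theta>)"
    note st = sq_int_test(2)[OF \<theta>]
    have "?b\<^sup>2 = (LINT x|lebesgue. (r j x - r k x) \<bullet> grad \<theta> x)"
      unfolding l2_square using fun_cong[OF gr] by (simp add: power2_norm_eq_inner)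
    also have "\<dots> = (LINT x|lebesgue. r j x \<bullet> grad \<theta> x) - (LINT x|lebesgue. r k x \<bullet> grad \<theta> x)"
      unfolding inner_diff_left by (rule Bochner_Integration.integral_diff) (intro integrable_inner_sq_int r st)+
    also have "\<dots> \<le> ?b * sqrt (h j) + ?b * sqrt (h k)"
      using small[OF \<theta>, of j] small[OF \<theta>, of k] by linarith
    finally have "?b * ?b \<le> ?b * (sqrt (h j) + sqrt (h k))"
      by (simp add: power2_eq_square distrib_left)
    moreover have "0 \<le> sqrt (h j) + sqrt (h k)" using h[of j] h[of k] by simp
    ultimately have "?b \<le> sqrt (h j) + sqrt (h k)"
      using l2_nonneg[of lebesgue "grad \<theta>"] mult_le_cancel_left_pos[of ?b ?b "sqrt (h j) + sqrt (h k)"] by linarith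
    then show ?thesis unfolding gr .
  qed
  have sh0: "(\<lambda>n. sqrt (h n)) \<longlonglongrightarrow> 0"
    using tendsto_real_sqrt[OF h0] by simp
  obtain \<rho> where \<rho>: "sq_int lebesgue \<rho>" "(\<lambda>n. l2 lebesgue (\<lambda>x. r n x - \<rho> x)) \<longlonglongrightarrow> 0"
  proof (rule l2_complete[OF r])
    fix e :: real assume e: "e > 0"
    then obtain N where N: "\<And>n. n \<ge> N \<Longrightarrow> norm (sqrt (h n) - 0) < e / 2"
      using LIMSEQ_D[OF sh0, of "e / 2"] by auto
    have "l2 lebesgue (\<lambda>x. r j x - r k x) \<le> e" if "j \<ge> N" "k \<ge> N" for j k
      using cauchy[of j k] N[OF that(1)] N[OF that(2)] h[of j] h[of k] by simp
    then show "\<exists>N. \<forall>m\<ge>N. \<forall>n\<ge>N. l2 lebesgue (\<lambda>x. r m x - r n x) \<le> e" by blast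
  qed blast
  have "AE x in lebesgue. \<rho> x = 0"
  proof (rule curl_div_free_eq_0[OF \<rho>(1)])
    show "curl_free \<rho>"
      unfolding curl_free_def
    proof (intro ballI)
      fix \<theta> :: "'a \<Rightarrow> real" and i j :: 'a
      assume \<theta>: "\<theta> \<in> ?T" and i: "i \<in> Basis" and j: "j \<in> Basis"
      have lim: "(\<lambda>n. LINT x|lebesgue. (r n x \<bullet> k) * frechet_derivative \<theta> (at x) l)
          \<longlonglongrightarrow> (LINT x|lebesgue. (\<rho> x \<bullet> k) * frechet_derivative \<theta> (at x) l)" if l: "l \<in> Basis" for k l
      proof -
        note st = sq_int_test(1)[OF test_functions_partial[OF \<theta> l]]
        have "sq_int lebesgue (\<lambda>x. frechet_derivative \<theta> (at x) l *\<^sub>R k)"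
          by (rule sq_int_bound[OF st, of _ "norm k"]) (use sq_intD(1)[OF st] in auto)
        from tendsto_integral_inner[OF r \<rho> this] show ?thesis by (simp add: mult.commute)
      qed
      have "is_weak_gradient UNIV (\<lambda>x. u x - \<psi> n x) (r n)" for n
        using is_weak_gradient_lincomb[OF open_UNIV u zero_trace_weak_gradient[OF open_UNIV zero_trace_test[OF _ \<psi>(1)]], of 1 "-1" n]
        by (simp add: r_def[abs_def])
      then have "curl_free (r n)" for n
        by (rule weak_gradient_curl_free)
      then have eq: "(LINT x|lebesgue. (r n x \<bullet> i) * frechet_derivative \<theta> (at x) j)
          = (LINT x|lebesgue. (r n x \<bullet> j) * frechet_derivative \<theta> (at x) i)" for n
        using \<theta> i j unfolding curl_free_def by blast
      show "(LINT x|lebesgue. (\<rho> x \<bullet> i) * frechet_derivative \<theta> (at x) j)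
          = (LINT x|lebesgue. (\<rho> x \<bullet> j) * frechet_derivative \<theta> (at x) i)"
        by (rule LIMSEQ_unique[OF lim[OF j, of i] lim[OF i, of j, folded eq]])
    qed
    fix \<theta> assume \<theta>: "\<theta> \<in> ?T"
    have "(\<lambda>n. LINT x|lebesgue. r n x \<bullet> grad \<theta> x) \<longlonglongrightarrow> 0"
    proof (rule tendsto_zero_bound)
      show "norm (LINT x|lebesgue. r n x \<bullet> grad \<theta> x) \<le> l2 lebesgue (grad \<theta>) * sqrt (h n)" for n
        using small[OF \<theta>, of n] by simp
      show "(\<lambda>n. l2 lebesgue (grad \<theta>) * sqrt (h n)) \<longlonglongrightarrow> 0"
        by (rule tendsto_mult_right_zero[OF sh0])
    qed
    then show "(LINT x|lebesgue. \<rho> x \<bullet> grad \<theta> x) = 0"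
      using tendsto_integral_inner[OF r \<rho> sq_int_test(2)[OF \<theta>]] LIMSEQ_unique by blast
  qed
  then have "AE x in lebesgue. (norm (\<rho> x))\<^sup>2 = 0"
    by eventually_elim simp
  then have "l2 lebesgue \<rho> = 0"
    unfolding l2_def by (simp add: integral_eq_zero_AE)
  then have "(\<lambda>n. l2 lebesgue (r n)) \<longlonglongrightarrow> 0"
    using tendsto_l2[OF r \<rho>] by simp
  then obtain n where "l2 lebesgue (r n) < e"
    using LIMSEQ_D[of "\<lambda>n. l2 lebesgue (r n)" 0 e] e by fastforce
  then show thesis
    using that[OF \<psi>(1)[of n]] by (simp add: r_def[abs_def])
qed

subsection \<open>Monotone fluxes\<close>

lemma flux_has_derivative:
  "admissible_flux c1 c2 c3 a \<Longrightarrow> (a has_derivative frechet_derivative a (at x)) (at x)"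
  by (simp add: admissible_flux_def frechet_derivative_works[symmetric])

lemma flux_lipschitz:
  "admissible_flux c1 c2 c3 a \<Longrightarrow> norm (a x - a y) \<le> c2 * norm (x - y)"
  by (simp add: admissible_flux_def)

lemma flux_monotone:
  "admissible_flux c1 c2 c3 a \<Longrightarrow> c1 * (norm (x - y))\<^sup>2 \<le> (a x - a y) \<bullet> (x - y)"
  by (simp add: admissible_flux_def)

lemma flux_deriv_linear:
  "admissible_flux c1 c2 c3 a \<Longrightarrow> bounded_linear (frechet_derivative a (at x))"
  by (rule has_derivative_bounded_linear[OF flux_has_derivative])

lemma flux_line_deriv:
  fixes a :: "'a::euclidean_space \<Rightarrow> 'a"
  assumes a: "admissible_flux c1 c2 c3 a"
  shows "((\<lambda>t. a (x + t *\<^sub>R v)) has_vector_derivative frechet_derivative a (at (x + t *\<^sub>R v)) v) (at t)"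
proof -
  have "((\<lambda>t. a (x + t *\<^sub>R v)) has_derivative (\<lambda>s. frechet_derivative a (at (x + t *\<^sub>R v)) (s *\<^sub>R v))) (at t)"
    by (rule has_derivative_compose[OF _ flux_has_derivative[OF a]]) (auto intro!: derivative_eq_intros)
  then show ?thesis
    using linear_cmul[OF bounded_linear.linear[OF flux_deriv_linear[OF a]]]
    by (simp add: has_vector_derivative_def)
qed

text \<open>The Lipschitz bound passes to the limit in the difference quotient along
  \<open>v\<close>, paired with the derivative vector itself; one factor of its norm is then
  cancelled.\<close>

lemma flux_deriv_bound:
  fixes a :: "'a::euclidean_space \<Rightarrow> 'a"
  assumes a: "admissible_flux c1 c2 c3 a"
  shows "norm (frechet_derivative a (at x) v) \<le> c2 * norm v"
proof -
  let ?y = "frechet_derivative a (at x) v"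
  have "((\<lambda>t. a (x + t *\<^sub>R v)) has_derivative (\<lambda>t. t *\<^sub>R ?y)) (at 0)"
    using flux_line_deriv[OF a, of x v 0] by (simp add: has_vector_derivative_def)
  from has_derivative_inner_left[OF this, of ?y]
  have "((\<lambda>t. a (x + t *\<^sub>R v) \<bullet> ?y) has_real_derivative ?y \<bullet> ?y) (at 0)"
    by (simp add: has_field_derivative_def mult_commute_abs)
  then have lim: "((\<lambda>t. (a (x + t *\<^sub>R v) \<bullet> ?y - a x \<bullet> ?y) / t) \<longlongrightarrow> ?y \<bullet> ?y) (at 0)"
    by (simp add: DERIV_def)
  have bd: "norm ((a (x + t *\<^sub>R v) \<bullet> ?y - a x \<bullet> ?y) / t) \<le> c2 * norm v * norm ?y" if "t \<noteq> 0" for t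
  proof -
    have "\<bar>(a (x + t *\<^sub>R v) - a x) \<bullet> ?y\<bar> \<le> norm (a (x + t *\<^sub>R v) - a x) * norm ?y"
      by (rule Cauchy_Schwarz_ineq2)
    also have "\<dots> \<le> (c2 * (\<bar>t\<bar> * norm v)) * norm ?y"
      using flux_lipschitz[OF a, of "x + t *\<^sub>R v" x] by (intro mult_right_mono) simp_all
    finally show ?thesis
      using that by (simp add: inner_diff_left pos_divide_le_eq algebra_simps)
  qed
  have "norm (?y \<bullet> ?y) \<le> c2 * norm v * norm ?y"
    by (rule Lim_norm_ubound[OF _ lim]) (use bd in \<open>simp_all add: eventually_at_filter\<close>)
  then have "norm ?y * norm ?y \<le> (c2 * norm v) * norm ?y"
    by (simp add: power2_eq_square flip: power2_norm_eq_inner)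
  \<comment> \<open>The sign is read off the Lipschitz estimate between \<open>v\<close> and
    \<open>0\<close>.\<close>
  moreover have "0 \<le> c2 * norm v"
    using order_trans[OF norm_ge_zero flux_lipschitz[OF a, of v 0]] by simp
  ultimately show ?thesis
    by (cases "norm ?y = 0") (simp_all add: mult_le_cancel_right)
qed

lemma flux_deriv_lipschitz:
  fixes a :: "'a::euclidean_space \<Rightarrow> 'a"
  assumes a: "admissible_flux c1 c2 c3 a"
  shows "norm (frechet_derivative a (at x) v - frechet_derivative a (at y) v) \<le> c3 * norm (x - y) * norm v"
proof -
  have "norm (frechet_derivative a (at x) v - frechet_derivative a (at y) v)
      \<le> onorm (\<lambda>v. frechet_derivative a (at x) v - frechet_derivative a (at y) v) * norm v"
    by (rule onorm) (intro bounded_linear_sub flux_deriv_linear[OF a])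
  also have "\<dots> \<le> c3 * norm (x - y) * norm v"
    using a by (intro mult_right_mono) (simp_all add: admissible_flux_def)
  finally show ?thesis .
qed

definition remainder :: "('a::euclidean_space \<Rightarrow> 'a) \<Rightarrow> 'a \<Rightarrow> 'a \<Rightarrow> 'a" where
  "remainder a x v = a (x + v) - a x - frechet_derivative a (at x) v"

lemma remainder_has_derivative:
  fixes a :: "'a::euclidean_space \<Rightarrow> 'a"
  assumes a: "admissible_flux c1 c2 c3 a"
  shows "(remainder a x has_derivative (\<lambda>h. frechet_derivative a (at (x + z)) h - frechet_derivative a (at x) h)) (at z within S)"
proof -
  have "((\<lambda>v. a (x + v)) has_derivative (\<lambda>h. frechet_derivative a (at (x + z)) h)) (at z)"
    by (rule has_derivative_compose[OF _ flux_has_derivative[OF a]]) (auto intro!: derivative_eq_intros)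
  moreover have "((\<lambda>v. frechet_derivative a (at x) v) has_derivative frechet_derivative a (at x)) (at z)"
    by (rule bounded_linear_imp_has_derivative[OF flux_deriv_linear[OF a]])
  ultimately have "((\<lambda>v. a (x + v) - a x - frechet_derivative a (at x) v) has_derivative
      (\<lambda>h. frechet_derivative a (at (x + z)) h - 0 - frechet_derivative a (at x) h)) (at z)"
    by (intro has_derivative_diff has_derivative_const)
  then show ?thesis
    by (simp add: remainder_def[abs_def] has_derivative_at_withinI)
qed

text \<open>In its last argument the remainder has derivative \<open>a'(x + z) - a'(x)\<close>, of
  norm at most \<open>c3 * norm z\<close>. The segment from \<open>v\<close> to \<open>w\<close>
  stays in the ball of radius \<open>norm v + norm w\<close>, so the mean value inequality
  applies.\<close>

lemma remainder_diff_bound: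
  fixes a :: "'a::euclidean_space \<Rightarrow> 'a"
  assumes a: "admissible_flux c1 c2 c3 a" and c3: "c3 \<ge> 0"
  shows "norm (remainder a x v - remainder a x w) \<le> c3 * (norm v + norm w) * norm (v - w)"
proof (rule differentiable_bound[OF convex_closed_segment remainder_has_derivative[OF a]])
  fix z assume z: "z \<in> closed_segment v w"
  have "closed_segment v w \<subseteq> cball 0 (norm v + norm w)"
    by (rule closed_segment_subset) auto
  then have "norm z \<le> norm v + norm w" using z by auto
  then have le: "c3 * norm z \<le> c3 * (norm v + norm w)"
    using c3 by (rule mult_left_mono)
  show "onorm (\<lambda>h. frechet_derivative a (at (x + z)) h - frechet_derivative a (at x) h) \<le> c3 * (norm v + norm w)"
  proof (rule onorm_le)
    fix h
    have "norm (frechet_derivative a (at (x + z)) h - frechet_derivative a (at x) h) \<le> c3 * norm z * norm h"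
      using flux_deriv_lipschitz[OF a, of "x + z" h x] by simp
    also have "\<dots> \<le> c3 * (norm v + norm w) * norm h"
      using le by (rule mult_right_mono) simp
    finally show "norm (frechet_derivative a (at (x + z)) h - frechet_derivative a (at x) h) \<le> c3 * (norm v + norm w) * norm h" .
  qed
qed auto

lemma remainder_bound:
  fixes a :: "'a::euclidean_space \<Rightarrow> 'a"
  assumes a: "admissible_flux c1 c2 c3 a" and c3: "c3 \<ge> 0"
  shows "norm (remainder a x v) \<le> c3 * (norm v)\<^sup>2"
proof -
  have "remainder a x 0 = 0"
    using linear_0[OF bounded_linear.linear[OF flux_deriv_linear[OF a]]] by (simp add: remainder_def)
  then show ?thesis
    using remainder_diff_bound[OF a c3, of x v 0] by (simp add: power2_eq_square)
qed

lemma flux_continuous: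
  fixes a :: "'a::euclidean_space \<Rightarrow> 'a"
  assumes a: "admissible_flux c1 c2 c3 a"
  shows "continuous_on UNIV a"
  by (meson continuous_at_imp_continuous_on has_derivative_continuous flux_has_derivative[OF a])

lemma flux_deriv_tendsto:
  fixes a :: "'a::euclidean_space \<Rightarrow> 'a"
  assumes a: "admissible_flux c1 c2 c3 a" and X: "(X \<longlongrightarrow> x) F"
  shows "((\<lambda>n. frechet_derivative a (at (X n)) v) \<longlongrightarrow> frechet_derivative a (at x) v) F"
proof -
  have "((\<lambda>n. c3 * norm (X n - x) * norm v) \<longlongrightarrow> c3 * norm (x - x) * norm v) F"
    by (intro tendsto_intros X)
  then have "((\<lambda>n. frechet_derivative a (at (X n)) v - frechet_derivative a (at x) v) \<longlongrightarrow> 0) F"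
    by (intro Lim_null_comparison[OF always_eventually[OF allI[OF flux_deriv_lipschitz[OF a]]]]) simp
  then show ?thesis by (rule LIM_zero_cancel)
qed

text \<open>Expanding the direction in the basis reduces the joint dependence on \<open>U\<close>
  and \<open>V\<close> to the maps taking a point to the derivative in a fixed direction, which are
  continuous.\<close>

lemma measurable_flux_deriv:
  fixes a :: "'a::euclidean_space \<Rightarrow> 'a"
  assumes a: "admissible_flux c1 c2 c3 a" and U: "U \<in> borel_measurable M" and V: "V \<in> borel_measurable M"
  shows "(\<lambda>x. frechet_derivative a (at (U x)) (V x)) \<in> borel_measurable M"
proof -
  have eq: "frechet_derivative a (at y) v = (\<Sum>i\<in>Basis. (v \<bullet> i) *\<^sub>R frechet_derivative a (at y) i)" for y v
  proof -
    have lin: "linear (frechet_derivative a (at y))"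
      by (rule bounded_linear.linear[OF flux_deriv_linear[OF a]])
    have "frechet_derivative a (at y) v = frechet_derivative a (at y) (\<Sum>i\<in>Basis. (v \<bullet> i) *\<^sub>R i)"
      by (simp add: euclidean_representation)
    then show ?thesis by (simp add: linear_sum[OF lin] linear_cmul[OF lin])
  qed
  have m: "(\<lambda>x. frechet_derivative a (at (U x)) i) \<in> borel_measurable M" for i
  proof -
    have "continuous_on UNIV (\<lambda>y. frechet_derivative a (at y) i)"
      unfolding continuous_on_def by (intro ballI flux_deriv_tendsto[OF a] tendsto_ident_at)
    then show ?thesis
      using measurable_compose[OF U borel_measurable_continuous_onI] by blast
  qed
  have "(\<lambda>x. frechet_derivative a (at (U x)) (V x)) = (\<lambda>x. \<Sum>i\<in>Basis. (V x \<bullet> i) *\<^sub>R frechet_derivative a (at (U x)) i)"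
    by (rule ext) (rule eq)
  moreover have "(\<lambda>x. \<Sum>i\<in>Basis. (V x \<bullet> i) *\<^sub>R frechet_derivative a (at (U x)) i) \<in> borel_measurable M"
    by (intro borel_measurable_sum borel_measurable_scaleR borel_measurable_inner borel_measurable_const V m)
  ultimately show ?thesis by (simp only:)
qed

lemma measurable_flux_comp:
  fixes a :: "'a::euclidean_space \<Rightarrow> 'a"
  assumes a: "admissible_flux c1 c2 c3 a" and U: "U \<in> borel_measurable M"
  shows "(\<lambda>x. a (U x)) \<in> borel_measurable M"
  by (rule measurable_compose[OF U borel_measurable_continuous_onI[OF flux_continuous[OF a]]])

text \<open>For fixed \<open>x\<close> the flux is one of the two laws, so every pointwise estimate
  holds with the same constants on both sides of the interface and needs no case
  distinction.\<close>

lemma admissible_flux_flux: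
  assumes "admissible_flux c1 c2 c3 a1" "admissible_flux c1 c2 c3 a2"
  shows "admissible_flux c1 c2 c3 (flux a1 a2 A x)"
proof -
  have "flux a1 a2 A x = (if x \<in> A then a1 else a2)"
    by (simp add: flux_def fun_eq_iff)
  then show ?thesis using assms by simp
qed

lemma flux_deriv_eq_frechet:
  "flux_deriv a1 a2 A x y v = frechet_derivative (flux a1 a2 A x) (at y) v"
  by (simp add: flux_deriv_def)

lemma flux_deriv_eq:
  "flux_deriv a1 a2 A x y v = (if x \<in> A then frechet_derivative a1 (at y) v else frechet_derivative a2 (at y) v)"
proof -
  have "flux a1 a2 A x = (if x \<in> A then a1 else a2)"
    by (simp add: flux_def fun_eq_iff)
  then show ?thesis by (simp add: flux_deriv_eq_frechet)
qed

lemma measurable_flux: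
  assumes a: "admissible_flux c1 c2 c3 a1" "admissible_flux c1 c2 c3 a2"
    and A: "{x \<in> space M. x \<in> A} \<in> sets M" and U: "U \<in> borel_measurable M"
  shows "(\<lambda>x. flux a1 a2 A x (U x)) \<in> borel_measurable M"
  unfolding flux_def by (intro measurable_If measurable_flux_comp[OF a(1)] measurable_flux_comp[OF a(2)] U A)

lemma measurable_flux_deriv2:
  assumes a: "admissible_flux c1 c2 c3 a1" "admissible_flux c1 c2 c3 a2"
    and A: "{x \<in> space M. x \<in> A} \<in> sets M" and U: "U \<in> borel_measurable M" "V \<in> borel_measurable M"
  shows "(\<lambda>x. flux_deriv a1 a2 A x (U x) (V x)) \<in> borel_measurable M"
  unfolding flux_deriv_eq
  by (intro measurable_If measurable_flux_deriv[OF a(1)] measurable_flux_deriv[OF a(2)] U A)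

lemma flux_set_measurable:
  assumes "A \<in> sets lebesgue" "D \<in> sets lebesgue"
  shows "{x \<in> space (lebesgue_on D). x \<in> A} \<in> sets (lebesgue_on D)"
proof -
  have "{x \<in> space (lebesgue_on D). x \<in> A} = D \<inter> A"
    unfolding space_lebesgue_on by blast
  then show ?thesis using assms by (simp add: sets_restrict_space_iff)
qed

text \<open>The flux may have a nonzero value at \<open>0\<close>, so the constant part of the
  majorant relies on the bounded set. On the whole space only differences of fluxes are
  used.\<close>

lemma sq_int_flux:
  assumes a: "admissible_flux c1 c2 c3 a1" "admissible_flux c1 c2 c3 a2"
    and D: "bounded D" "D \<in> sets lebesgue" and A: "A \<in> sets lebesgue"
    and U: "sq_int (lebesgue_on D) U"
  shows "sq_int (lebesgue_on D) (\<lambda>x. flux a1 a2 A x (U x))"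
proof -
  have s: "sq_int (lebesgue_on D) (\<lambda>x. (norm (a1 0) + norm (a2 0)) + \<bar>c2\<bar> *\<^sub>R norm (U x))"
    by (intro sq_int_add sq_int_const_on D sq_int_scaleR sq_int_norm U)
  show ?thesis
  proof (rule sq_int_bound[OF s, of _ 1])
    show "(\<lambda>x. flux a1 a2 A x (U x)) \<in> borel_measurable (lebesgue_on D)"
      by (rule measurable_flux[OF a flux_set_measurable[OF A D(2)] sq_intD(1)[OF U]])
    show "AE x in lebesgue_on D. norm (flux a1 a2 A x (U x)) \<le> 1 * norm ((norm (a1 0) + norm (a2 0)) + \<bar>c2\<bar> *\<^sub>R norm (U x))"
    proof (rule AE_I2)
      fix x
      have "norm (flux a1 a2 A x (U x)) \<le> norm (flux a1 a2 A x 0) + norm (flux a1 a2 A x (U x) - flux a1 a2 A x 0)"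
        using norm_triangle_ineq[of "flux a1 a2 A x 0" "flux a1 a2 A x (U x) - flux a1 a2 A x 0"] by simp
      also have "norm (flux a1 a2 A x (U x) - flux a1 a2 A x 0) \<le> c2 * norm (U x)"
        using flux_lipschitz[OF admissible_flux_flux[OF a], of A x "U x" 0] by simp
      also have "c2 * norm (U x) \<le> \<bar>c2\<bar> * norm (U x)"
        by (rule mult_right_mono) auto
      also have "norm (flux a1 a2 A x 0) \<le> norm (a1 0) + norm (a2 0)"
        by (simp add: flux_def)
      finally show "norm (flux a1 a2 A x (U x)) \<le> 1 * norm ((norm (a1 0) + norm (a2 0)) + \<bar>c2\<bar> *\<^sub>R norm (U x))"
        by simp
    qed
  qed
qed

subsection \<open>The Lagrangian\<close>

lemma integral_FTC_unit:
  fixes F f :: "real \<Rightarrow> real"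
  assumes "\<And>s. (F has_real_derivative f s) (at s)" "\<And>s. isCont f s"
  shows "(LINT s|lebesgue_on {0..1}. f s) = F 1 - F 0"
proof -
  have m: "f \<in> borel_measurable borel"
    by (rule borel_measurable_continuous_onI) (use assms(2) in \<open>simp add: continuous_at_imp_continuous_on\<close>)
  have "(LINT s|lebesgue_on {0..1}. f s) = (LINT s|lebesgue. (if s \<in> {0..1} then f s else 0))"
    by (rule Lebesgue_Measure.integral_restrict_UNIV[symmetric]) (intro sets_completionI_sets, simp)
  also have "(\<lambda>s. if s \<in> {0..1} then f s else 0) = (\<lambda>s. f s * indicator {0..1} s)"
    by (auto simp: indicator_def)
  also have "(LINT s|lebesgue. f s * indicator {0..1} s) = (LINT s|lborel. f s * indicator {0..1} s)"
    by (rule integral_completion) (use m in measurable)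
  also have "\<dots> = F 1 - F 0"
    by (rule integral_FTC_Icc_real) (use assms in auto)
  finally show ?thesis .
qed

lemma zero_trace_AE_wgrad:
  assumes D: "open D" and u: "zero_trace D u g"
  shows "AE x in lebesgue_on D. wgrad D u x = g x" "wgrad D u \<in> borel_measurable (lebesgue_on D)"
    "g \<in> borel_measurable (lebesgue_on D)"
proof -
  show "AE x in lebesgue_on D. wgrad D u x = g x" by (rule zero_traceD(2)[OF D u])
  have "zero_trace D u (wgrad D u)"
    using zero_traceD(1)[OF D u] H1_0_iff_zero_trace[OF D] by blast
  then show "wgrad D u \<in> borel_measurable (lebesgue_on D)"
    using zero_trace_sq_int(2) sq_intD(1) by blast
  show "g \<in> borel_measurable (lebesgue_on D)"
    using zero_trace_sq_int(2)[OF u] sq_intD(1) by blast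
qed

lemma integral_norm_wgrad_eq:
  assumes D: "open D" and u: "zero_trace D u g"
  shows "(LINT x|lebesgue_on D. (norm (wgrad D u x))\<^sup>2) = (l2 (lebesgue_on D) g)\<^sup>2"
  unfolding l2_square[symmetric]
  by (rule arg_cong[where f="\<lambda>z. z\<^sup>2"]) (rule l2_cong_AE[OF zero_trace_AE_wgrad(2,3,1)[OF D u]])

lemma cost_eq:
  assumes D: "open D" and u: "zero_trace D u g" and d: "zero_trace D ud gd"
  shows "cost D ud a b u = a * (l2 (lebesgue_on D) (\<lambda>x. u x - ud x))\<^sup>2 + b * (l2 (lebesgue_on D) (\<lambda>x. g x - gd x))\<^sup>2"
proof -
  have "zero_trace D (\<lambda>x. u x - ud x) (\<lambda>x. g x - gd x)"
    using zero_trace_lincomb[OF open_in_lebesgue[OF D] u d, of 1 "-1"] by simp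
  from integral_norm_wgrad_eq[OF D this] show ?thesis
    unfolding cost_def using l2_square[of "lebesgue_on D" "\<lambda>x. u x - ud x"] by simp
qed

lemma integral_flux_wgrad_eq:
  assumes D: "open D" and a: "admissible_flux c1 c2 c3 a1" "admissible_flux c1 c2 c3 a2" and A: "A \<in> sets lebesgue"
    and u: "zero_trace D u g" and p: "zero_trace D p h"
  shows "(LINT x|lebesgue_on D. flux a1 a2 A x (wgrad D u x) \<bullet> wgrad D p x)
    = (LINT x|lebesgue_on D. flux a1 a2 A x (g x) \<bullet> h x)"
proof (rule integral_cong_AE)
  note Am = flux_set_measurable[OF A open_in_lebesgue[OF D]]
  show "(\<lambda>x. flux a1 a2 A x (wgrad D u x) \<bullet> wgrad D p x) \<in> borel_measurable (lebesgue_on D)"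
    by (intro borel_measurable_inner measurable_flux[OF a Am] zero_trace_AE_wgrad(2)[OF D u] zero_trace_AE_wgrad(2)[OF D p])
  show "(\<lambda>x. flux a1 a2 A x (g x) \<bullet> h x) \<in> borel_measurable (lebesgue_on D)"
    by (intro borel_measurable_inner measurable_flux[OF a Am] zero_trace_AE_wgrad(3)[OF D u] zero_trace_AE_wgrad(3)[OF D p])
  show "AE x in lebesgue_on D. flux a1 a2 A x (wgrad D u x) \<bullet> wgrad D p x = flux a1 a2 A x (g x) \<bullet> h x"
    using zero_trace_AE_wgrad(1)[OF D u] zero_trace_AE_wgrad(1)[OF D p] by eventually_elim simp
qed

lemma Lagrangian_eq:
  assumes D: "open D" and a: "admissible_flux c1 c2 c3 a1" "admissible_flux c1 c2 c3 a2"
    and A: "perturbed \<Omega> \<omega> \<epsilon> \<in> sets lebesgue"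
    and u: "zero_trace D u g" and d: "zero_trace D ud gd" and p: "zero_trace D p h"
  shows "Lagrangian D f ud a b a1 a2 \<Omega> \<omega> \<epsilon> u p = cost D ud a b u
     + (LINT x|lebesgue_on D. flux a1 a2 (perturbed \<Omega> \<omega> \<epsilon>) x (g x) \<bullet> h x) - (LINT x|lebesgue_on D. f x * p x)"
  unfolding Lagrangian_def cost_def integral_flux_wgrad_eq[OF D a A u p] by simp

lemma is_state_eq:
  assumes D: "open D" and a: "admissible_flux c1 c2 c3 a1" "admissible_flux c1 c2 c3 a2" and A: "A \<in> sets lebesgue"
    and s: "is_state D f a1 a2 A u" and u: "zero_trace D u g" and \<phi>: "zero_trace D \<phi> h"
  shows "(LINT x|lebesgue_on D. flux a1 a2 A x (g x) \<bullet> h x) = (LINT x|lebesgue_on D. f x * \<phi> x)"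
  using s zero_traceD(1)[OF D \<phi>] unfolding is_state_def integral_flux_wgrad_eq[OF D a A u \<phi>, symmetric] by blast

text \<open>Both equations are tested with \<open>u - v\<close>: strong monotonicity controls the
  gradients and the Poincare inequality the functions. This frees \<open>shape_cost\<close> from the
  choice it makes.\<close>

lemma is_state_unique:
  assumes D: "open D" "bounded D" and a: "admissible_flux c1 c2 c3 a1" "admissible_flux c1 c2 c3 a2" and c1: "c1 > 0"
    and A: "A \<in> sets lebesgue"
    and u: "is_state D f a1 a2 A u" "zero_trace D u g" and v: "is_state D f a1 a2 A v" "zero_trace D v h"
  shows "l2 (lebesgue_on D) (\<lambda>x. g x - h x) = 0" "l2 (lebesgue_on D) (\<lambda>x. u x - v x) = 0"
proof -
  note mD = open_in_lebesgue[OF D(1)]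
  note s = zero_trace_sq_int[OF u(2)] zero_trace_sq_int[OF v(2)]
  have w: "zero_trace D (\<lambda>x. u x - v x) (\<lambda>x. g x - h x)"
    using zero_trace_lincomb[OF mD u(2) v(2), of 1 "-1"] by simp
  note sw = zero_trace_sq_int[OF w]
  note sf = sq_int_flux[OF a D(2) mD A s(2)] sq_int_flux[OF a D(2) mD A s(4)]
  note i = integrable_inner_sq_int[OF sf(1) sw(2)] integrable_inner_sq_int[OF sf(2) sw(2)]
  have "c1 * (l2 (lebesgue_on D) (\<lambda>x. g x - h x))\<^sup>2 = (LINT x|lebesgue_on D. c1 * (norm (g x - h x))\<^sup>2)"
    by (simp add: l2_square)
  also have "\<dots> \<le> (LINT x|lebesgue_on D. flux a1 a2 A x (g x) \<bullet> (g x - h x) - flux a1 a2 A x (h x) \<bullet> (g x - h x))"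
  proof (rule integral_mono)
    show "integrable (lebesgue_on D) (\<lambda>x. c1 * (norm (g x - h x))\<^sup>2)"
      by (intro integrable_mult_right sq_intD(2)[OF sw(2)])
    show "c1 * (norm (g x - h x))\<^sup>2 \<le> flux a1 a2 A x (g x) \<bullet> (g x - h x) - flux a1 a2 A x (h x) \<bullet> (g x - h x)" for x
      using flux_monotone[OF admissible_flux_flux[OF a]] by (simp add: inner_diff_left)
  qed (intro Bochner_Integration.integrable_diff i)
  also have "\<dots> = 0"
    using i is_state_eq[OF D(1) a A u w] is_state_eq[OF D(1) a A v w] by simp
  finally have "(l2 (lebesgue_on D) (\<lambda>x. g x - h x))\<^sup>2 \<le> 0"
    using c1 by (simp add: mult_le_0_iff)
  then show g0: "l2 (lebesgue_on D) (\<lambda>x. g x - h x) = 0" by simp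
  obtain R where "\<forall>x\<in>D. norm x \<le> R"
    using D(2) unfolding bounded_iff by blast
  then have "D \<subseteq> cball 0 R" by auto
  from Poincare[OF D(1) this w] show "l2 (lebesgue_on D) (\<lambda>x. u x - v x) = 0"
    unfolding g0 using l2_nonneg[of "lebesgue_on D" "\<lambda>x. u x - v x"] by simp
qed

lemma l2_eq_of_diff_0:
  assumes "sq_int M f" "sq_int M g" "l2 M (\<lambda>x. f x - g x) = 0"
  shows "l2 M f = l2 M g"
  using l2_triangle_sub[OF assms(1,2)] l2_triangle_sub[OF assms(2,1)] assms(3)
  by (simp add: l2_minus_commute[of M g f])

lemma shape_cost_eq:
  assumes D: "open D" "bounded D" and a: "admissible_flux c1 c2 c3 a1" "admissible_flux c1 c2 c3 a2" and c1: "c1 > 0"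
    and A: "A \<in> sets lebesgue" and ud: "ud \<in> H1_0 D" and u: "is_state D f a1 a2 A u"
  shows "shape_cost D f ud a b a1 a2 A = cost D ud a b u"
proof -
  define v where "v = (SOME u. is_state D f a1 a2 A u)"
  have v: "is_state D f a1 a2 A v"
    unfolding v_def by (rule someI[of "is_state D f a1 a2 A" u]) (rule u)
  have H: "u \<in> H1_0 D" "v \<in> H1_0 D"
    using u v by (simp_all add: is_state_def)
  note I = H1_0_iff_zero_trace[OF D(1), THEN iffD1]
  note zu = I[OF H(1)] and zv = I[OF H(2)] and zd = I[OF ud]
  note s = zero_trace_sq_int[OF zu] zero_trace_sq_int[OF zv] zero_trace_sq_int[OF zd]
  note un = is_state_unique[OF D a c1 A v zv u zu]
  have "l2 (lebesgue_on D) (\<lambda>x. v x - ud x) = l2 (lebesgue_on D) (\<lambda>x. u x - ud x)"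
    by (rule l2_eq_of_diff_0) (intro sq_int_diff s, intro sq_int_diff s, use un(2) in simp)
  moreover have "l2 (lebesgue_on D) (\<lambda>x. wgrad D v x - wgrad D ud x) = l2 (lebesgue_on D) (\<lambda>x. wgrad D u x - wgrad D ud x)"
    by (rule l2_eq_of_diff_0) (intro sq_int_diff s, intro sq_int_diff s, use un(1) in simp)
  ultimately show ?thesis
    unfolding shape_cost_def v_def[symmetric] cost_eq[OF D(1) zu zd] cost_eq[OF D(1) zv zd] by simp
qed

text \<open>The averaged adjoint equation tested with \<open>u1 - u0\<close> is the fundamental theorem of calculus
  along the segment from \<open>u0\<close> to \<open>u1\<close>.\<close>

lemma averaged_adjoint_identity:
  fixes D \<Omega> \<omega> :: "'a::euclidean_space set"
  assumes G_def: "G = Lagrangian D f ud a b a1 a2 \<Omega> \<omega>" and D: "open D" "bounded D" and a: "admissible_flux c1 c2 c3 a1" "admissible_flux c1 c2 c3 a2"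
    and A: "perturbed \<Omega> \<omega> \<epsilon> \<in> sets lebesgue" and ud: "ud \<in> H1_0 D" and u: "u0 \<in> H1_0 D" "u1 \<in> H1_0 D"
    and p: "is_averaged_adjoint D G \<epsilon> u0 u1 p"
  shows "G \<epsilon> u1 p = G \<epsilon> u0 p"
proof -
  note mD = open_in_lebesgue[OF D(1)]
  let ?A = "perturbed \<Omega> \<omega> \<epsilon>" and ?M = "lebesgue_on D"
  have pH: "p \<in> H1_0 D" using p by (simp add: is_averaged_adjoint_def)
  note I = H1_0_iff_zero_trace[OF D(1), THEN iffD1]
  note z = I[OF ud] I[OF u(1)] I[OF u(2)] I[OF pH]
  define w where "w x = u1 x - u0 x" for x
  define g0 where "g0 = wgrad D u0"
  define g where "g x = wgrad D u1 x - wgrad D u0 x" for x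
  define h where "h = wgrad D p"
  have zw: "zero_trace D w g"
    using zero_trace_lincomb[OF mD z(3,2), of 1 "-1"] by (simp add: w_def[abs_def] g_def[abs_def])
  have zs: "zero_trace D (\<lambda>x. u0 x + s * w x) (\<lambda>x. g0 x + s *\<^sub>R g x)" for s
    using zero_trace_lincomb[OF mD z(2) zw, of 1 s] by (simp add: g0_def)
  note sq = zero_trace_sq_int[OF z(2)] zero_trace_sq_int[OF zw] zero_trace_sq_int[OF z(4)] zero_trace_sq_int[OF z(1)]
  define l where "l s = G \<epsilon> (\<lambda>x. u0 x + s * w x) p" for s
  define T where "T s = (LINT x|?M. flux a1 a2 ?A x (g0 x + s *\<^sub>R g x) \<bullet> h x)" for s
  define T' where "T' s = (LINT x|?M. flux_deriv a1 a2 ?A x (g0 x + s *\<^sub>R g x) (g x) \<bullet> h x)" for s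
  note Am = flux_set_measurable[OF A mD]
  have sg: "sq_int ?M (\<lambda>x. g0 x + s *\<^sub>R g x)" for s
    using zero_trace_sq_int(2)[OF zs] .
  have sh: "sq_int ?M h" and sgg: "sq_int ?M g"
    using sq by (simp_all add: h_def)
  have mder: "(\<lambda>x. flux_deriv a1 a2 ?A x (g0 x + s *\<^sub>R g x) (g x) \<bullet> h x) \<in> borel_measurable ?M" for s
    by (intro borel_measurable_inner measurable_flux_deriv2[OF a Am] sq_intD(1)[OF sg] sq_intD(1)[OF sgg] sq_intD(1)[OF sh])
  have iB: "integrable ?M (\<lambda>x. norm (c2 *\<^sub>R g x) * norm (h x))"
    by (intro integrable_norm_mult sq_int_scaleR sgg sh)
  have bder: "\<bar>flux_deriv a1 a2 ?A x (g0 x + s *\<^sub>R g x) (g x) \<bullet> h x\<bar> \<le> norm (c2 *\<^sub>R g x) * norm (h x)" for s x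
  proof -
    have "norm (flux_deriv a1 a2 ?A x (g0 x + s *\<^sub>R g x) (g x)) \<le> c2 * norm (g x)"
      unfolding flux_deriv_eq_frechet by (rule flux_deriv_bound[OF admissible_flux_flux[OF a]])
    also have "\<dots> \<le> norm (c2 *\<^sub>R g x)"
      by (simp add: mult_right_mono)
    finally have "norm (flux_deriv a1 a2 ?A x (g0 x + s *\<^sub>R g x) (g x)) * norm (h x) \<le> norm (c2 *\<^sub>R g x) * norm (h x)"
      by (rule mult_right_mono) simp
    then show ?thesis
      by (rule order_trans[OF Cauchy_Schwarz_ineq2])
  qed
  have dT: "(T has_real_derivative T' s) (at s)" for s
    unfolding T_def[abs_def] T'_def
  proof (rule has_real_derivative_integral[OF open_UNIV convex_UNIV UNIV_I _ mder _ iB bder])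
    show "integrable ?M (\<lambda>x. flux a1 a2 ?A x (g0 x + s *\<^sub>R g x) \<bullet> h x)" for s
      by (intro integrable_inner_sq_int sq_int_flux[OF a D(2) mD A] sg sh)
    show "((\<lambda>s. flux a1 a2 ?A x (g0 x + s *\<^sub>R g x) \<bullet> h x) has_real_derivative
        flux_deriv a1 a2 ?A x (g0 x + s *\<^sub>R g x) (g x) \<bullet> h x) (at s)" for s x
    proof -
      have "((\<lambda>s. flux a1 a2 ?A x (g0 x + s *\<^sub>R g x)) has_derivative
          (\<lambda>t. t *\<^sub>R flux_deriv a1 a2 ?A x (g0 x + s *\<^sub>R g x) (g x))) (at s)"
        using flux_line_deriv[OF admissible_flux_flux[OF a], of ?A x "g0 x" "g x" s]
        by (simp add: has_vector_derivative_def flux_deriv_eq_frechet)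
      from has_derivative_inner_left[OF this, of "h x"] show ?thesis
        by (simp add: has_field_derivative_def mult_commute_abs)
    qed
  qed
  have cT': "isCont T' s" for s
    unfolding isCont_def T'_def
  proof (rule integral_tendsto_at[OF open_UNIV UNIV_I mder mder iB])
    show "norm (flux_deriv a1 a2 ?A x (g0 x + t *\<^sub>R g x) (g x) \<bullet> h x) \<le> norm (c2 *\<^sub>R g x) * norm (h x)" for t x
      using bder by simp
    show "((\<lambda>t. flux_deriv a1 a2 ?A x (g0 x + t *\<^sub>R g x) (g x) \<bullet> h x) \<longlongrightarrow>
        flux_deriv a1 a2 ?A x (g0 x + s *\<^sub>R g x) (g x) \<bullet> h x) (at s)" for x
      unfolding flux_deriv_eq_frechet
      by (intro tendsto_inner tendsto_const flux_deriv_tendsto[OF admissible_flux_flux[OF a]] tendsto_intros)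
  qed
  \<comment> \<open>Along the segment the cost is a quadratic polynomial in \<open>s\<close> with
    these coefficients; only the flux term \<open>T\<close> needs differentiation under the
    integral.\<close>
  define A1 A2 B1 B2 where "A1 = (LINT x|?M. (u0 x - ud x) \<bullet> w x)" and "A2 = (l2 ?M w)\<^sup>2"
    and "B1 = (LINT x|?M. (g0 x - wgrad D ud x) \<bullet> g x)" and "B2 = (l2 ?M g)\<^sup>2"
  define c where "c = a * (l2 ?M (\<lambda>x. u0 x - ud x))\<^sup>2 + b * (l2 ?M (\<lambda>x. g0 x - wgrad D ud x))\<^sup>2
    - (LINT x|?M. f x * p x)"
  have l: "l s = c + a * (2 * s * A1 + s\<^sup>2 * A2) + b * (2 * s * B1 + s\<^sup>2 * B2) + T s" for s
  proof -
    have d1: "sq_int ?M (\<lambda>x. u0 x - ud x)" and d2: "sq_int ?M (\<lambda>x. g0 x - wgrad D ud x)"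
      unfolding g0_def by (intro sq_int_diff sq)+
    have 1: "(l2 ?M (\<lambda>x. (u0 x + s * w x) - ud x))\<^sup>2 = (l2 ?M (\<lambda>x. u0 x - ud x))\<^sup>2 + 2 * s * A1 + s\<^sup>2 * A2"
    proof -
      have "(\<lambda>x. (u0 x + s * w x) - ud x) = (\<lambda>x. (u0 x - ud x) + s *\<^sub>R w x)"
        by (simp add: fun_eq_iff)
      then show ?thesis
        unfolding A1_def A2_def using l2_square_add[OF d1 sq_int_scaleR[OF sq(3), of s]]
        by (simp only: l2_scaleR inner_scaleR_right integral_mult_right_zero power_mult_distrib power2_abs)
    qed
    have 2: "(l2 ?M (\<lambda>x. (g0 x + s *\<^sub>R g x) - wgrad D ud x))\<^sup>2 = (l2 ?M (\<lambda>x. g0 x - wgrad D ud x))\<^sup>2 + 2 * s * B1 + s\<^sup>2 * B2"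
    proof -
      have "(\<lambda>x. (g0 x + s *\<^sub>R g x) - wgrad D ud x) = (\<lambda>x. (g0 x - wgrad D ud x) + s *\<^sub>R g x)"
        by (simp add: fun_eq_iff)
      then show ?thesis
        unfolding B1_def B2_def using l2_square_add[OF d2 sq_int_scaleR[OF sgg, of s]]
        by (simp only: l2_scaleR inner_scaleR_right integral_mult_right_zero power_mult_distrib power2_abs)
    qed
    show ?thesis
      unfolding l_def G_def Lagrangian_eq[OF D(1) a A zs z(1,4)] cost_eq[OF D(1) zs z(1)] 1 2 c_def T_def h_def
      by (simp add: algebra_simps)
  qed
  define l' where "l' s = a * (2 * A1 + 2 * s * A2) + b * (2 * B1 + 2 * s * B2) + T' s" for s
  have dl: "(l has_real_derivative l' s) (at s)" for s
    unfolding l'_def l[abs_def] by (auto intro!: derivative_eq_intros dT)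
  have cl: "isCont l' s" for s
    unfolding l'_def[abs_def] by (intro continuous_intros cT')
  \<comment> \<open>Moving in direction \<open>w = u1 - u0\<close> from the point with parameter
    \<open>s\<close> is a shift of the parameter, so the Gateaux derivative at that point is the
    ordinary derivative of \<open>l\<close> at \<open>s\<close>.\<close>
  have dd: "dir_deriv (\<lambda>v. G \<epsilon> v p) (\<lambda>x. s * u1 x + (1 - s) * u0 x) w = l' s" for s
  proof -
    have "(\<lambda>t. G \<epsilon> (\<lambda>x. (s * u1 x + (1 - s) * u0 x) + t * w x) p) = (\<lambda>t. l (t + s))"
      unfolding l_def w_def by (simp add: algebra_simps)
    moreover have "((\<lambda>t. l (t + s)) has_real_derivative l' s) (at 0)"
      using dl[of "0 + s"] unfolding DERIV_shift by simp
    ultimately show ?thesis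
      unfolding dir_deriv_def by (simp add: DERIV_imp_deriv)
  qed
  have "w \<in> H1_0 D" by (rule zero_traceD(1)[OF D(1) zw])
  then have "(LINT s|lebesgue_on {0..1}. dir_deriv (\<lambda>v. G \<epsilon> v p) (\<lambda>x. s * u1 x + (1 - s) * u0 x) w) = 0"
    using p unfolding is_averaged_adjoint_def by blast
  then have "(LINT s|lebesgue_on {0..1}. l' s) = 0"
    unfolding dd .
  then have "l 1 = l 0"
    using integral_FTC_unit[OF dl cl] by simp
  then show ?thesis
    by (simp add: l_def w_def)
qed

subsection \<open>Representatives of gradients near the origin\<close>

text \<open>The classical gradient near the origin provides continuity at \<open>0\<close>, and the
  value zero outside \<open>D\<close> lets integrals over \<open>D\<close> be written over the whole
  space.\<close>

definition grad_rep :: "'a::euclidean_space set \<Rightarrow> real \<Rightarrow> ('a \<Rightarrow> real) \<Rightarrow> 'a \<Rightarrow> 'a" where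
  "grad_rep D \<delta> u x = (if x \<in> ball 0 \<delta> then grad u x else if x \<in> D then wgrad D u x else 0)"

lemma C1_Hoelder_closure_imp_C1_closure: "u \<in> C1_Hoelder_closure \<alpha> S \<Longrightarrow> u \<in> C1_closure S"
  unfolding C1_Hoelder_closure_def C1_closure_def by blast

text \<open>On the ball the classical gradient is continuous, hence also a weak gradient, and
  uniqueness identifies it with \<open>wgrad\<close> almost everywhere there.\<close>

lemma grad_rep_properties:
  fixes u :: "'a::euclidean_space \<Rightarrow> real"
  assumes D: "open D" and \<delta>: "\<delta> > 0" "cball 0 \<delta> \<subseteq> D" and u: "u \<in> H1_0 D" "u \<in> C1_closure (ball 0 \<delta>)"
  shows grad_rep_zero_trace: "zero_trace D u (grad_rep D \<delta> u)"
    and grad_rep_isCont: "isCont (grad_rep D \<delta> u) 0"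
    and grad_rep_0: "grad_rep D \<delta> u 0 = grad u 0"
    and grad_rep_bounded: "\<exists>B. \<forall>x\<in>ball 0 \<delta>. norm (grad_rep D \<delta> u x) \<le> B"
    and grad_rep_outside: "\<And>x. x \<notin> D \<Longrightarrow> grad_rep D \<delta> u x = 0"
    and grad_rep_AE: "AE x in lebesgue_on D. wgrad D u x = grad_rep D \<delta> u x"
proof -
  note mD = open_in_lebesgue[OF D]
  let ?B = "ball (0::'a) \<delta>"
  have BD: "?B \<subseteq> D" using \<delta>(2) ball_subset_cball by blast
  have zu: "zero_trace D u (wgrad D u)" using u(1) H1_0_iff_zero_trace[OF D] by blast
  have "closure ?B = cball 0 \<delta>" using \<delta>(1) by simp
  then obtain g where g: "continuous_on (cball 0 \<delta>) g" "\<forall>x\<in>?B. GDERIV u x :> g x"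
    using u(2) unfolding C1_closure_def by auto
  have der: "(u has_derivative (\<lambda>h. g x \<bullet> h)) (at x)" if "x \<in> ?B" for x
    using g(2) that by (simp add: gderiv_def inner_commute)
  have gg: "grad u x = g x" if "x \<in> ?B" for x
    by (rule grad_eqI[OF der[OF that]])
  have gB: "continuous_on ?B g"
    using g(1) ball_subset_cball by (rule continuous_on_subset)
  have wB: "is_weak_gradient ?B u (wgrad D u)"
    by (rule is_weak_gradient_subset[OF D open_ball BD zero_trace_weak_gradient[OF D zu]])
  have "AE x in lebesgue_on ?B. wgrad D u x = g x"
    by (rule is_weak_gradient_unique[OF open_ball wB is_weak_gradient_classical[OF open_ball bounded_ball der gB]]) auto
  then have ae: "AE x in lebesgue. x \<in> ?B \<longrightarrow> wgrad D u x = g x"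
    using open_in_lebesgue[OF open_ball[of "0::'a" \<delta>]] by (subst (asm) AE_restrict_space_iff) auto
  have "AE x in lebesgue. x \<in> D \<longrightarrow> wgrad D u x = grad_rep D \<delta> u x"
    using ae by eventually_elim (auto simp: grad_rep_def gg)
  then show AE: "AE x in lebesgue_on D. wgrad D u x = grad_rep D \<delta> u x"
    using mD by (subst AE_restrict_space_iff) auto
  show "zero_trace D u (grad_rep D \<delta> u)"
  proof (rule zero_trace_cong[OF zu _ AE])
    have "g \<in> borel_measurable (lebesgue_on ?B)"
      by (rule continuous_imp_measurable_on_sets_lebesgue[OF gB open_in_lebesgue[OF open_ball]])
    then have m1: "(\<lambda>x. if x \<in> ?B then g x else 0) \<in> borel_measurable (lebesgue_on D)"
      by (rule measurable_restrict_space1[OF borel_measurable_if_I[OF _ open_in_lebesgue[OF open_ball]]])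
    have m2: "(\<lambda>x. if x \<in> ?B then 0 else wgrad D u x) \<in> borel_measurable (lebesgue_on D)"
      by (intro measurable_If borel_measurable_const sq_intD(1)[OF zero_trace_sq_int(2)[OF zu]]
          flux_set_measurable open_in_lebesgue open_ball mD)
    have "(\<lambda>x. (if x \<in> ?B then g x else 0) + (if x \<in> ?B then 0 else wgrad D u x)) \<in> borel_measurable (lebesgue_on D)"
      by (rule borel_measurable_add[OF m1 m2])
    moreover have "grad_rep D \<delta> u x = (if x \<in> ?B then g x else 0) + (if x \<in> ?B then 0 else wgrad D u x)"
      if "x \<in> space (lebesgue_on D)" for x
      using that gg[of x] by (simp add: grad_rep_def)
    ultimately show "grad_rep D \<delta> u \<in> borel_measurable (lebesgue_on D)"
      by (subst measurable_cong) auto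
  qed
  show "grad_rep D \<delta> u 0 = grad u 0"
    using \<delta>(1) by (simp add: grad_rep_def)
  show "isCont (grad_rep D \<delta> u) 0"
  proof -
    have "isCont g 0"
      using gB \<delta>(1) by (simp add: continuous_on_eq_continuous_at)
    moreover have "eventually (\<lambda>x. x \<in> ?B) (nhds 0)"
      using \<delta>(1) by (intro eventually_nhds_in_open) auto
    then have "eventually (\<lambda>x. grad_rep D \<delta> u x = g x) (nhds 0)"
      by eventually_elim (simp only: grad_rep_def if_True gg)
    ultimately show ?thesis by (simp add: isCont_cong)
  qed
  have "bounded (g ` cball 0 \<delta>)"
    by (intro compact_imp_bounded compact_continuous_image g compact_cball)
  then obtain B where "\<forall>y\<in>g ` cball 0 \<delta>. norm y \<le> B"
    unfolding bounded_iff by blast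
  then have "\<forall>x\<in>?B. norm (grad_rep D \<delta> u x) \<le> B"
    using gg ball_subset_cball[of "0::'a" \<delta>] by (auto simp: grad_rep_def simp del: mem_ball mem_cball)
  then show "\<exists>B. \<forall>x\<in>?B. norm (grad_rep D \<delta> u x) \<le> B" ..
  show "grad_rep D \<delta> u x = 0" if "x \<notin> D" for x
    using that BD by (auto simp: grad_rep_def simp del: mem_ball)
qed

lemma test_functions_shrink:
  assumes "\<phi> \<in> test_functions UNIV" "compact C" "C \<subseteq> D" "\<And>x. x \<notin> C \<Longrightarrow> \<phi> x = 0"
  shows "\<phi> \<in> test_functions D"
  by (rule test_functionsI[of _ C]) (use assms in \<open>auto simp: test_functions_def\<close>)

subsection \<open>Convergence of the rescaled states to the corrector\<close>

text \<open>The parameter \<open>\<epsilon>\<close> is replaced by an arbitrary null sequence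
  \<open>e\<close>, with \<open>v n\<close> the state at \<open>e n\<close>, because dominated
  convergence is sequential.\<close>

locale perturbation =
  fixes D \<Omega> \<omega> :: "'a::euclidean_space set"
    and f u0 K :: "'a \<Rightarrow> real" and v :: "nat \<Rightarrow> 'a \<Rightarrow> real"
    and a1 a2 :: "'a \<Rightarrow> 'a" and U0 :: 'a and c1 c2 c3 \<tau> \<delta> :: real and e :: "nat \<Rightarrow> real"
  assumes D: "open D" "bounded D"
    and \<Omega>: "open \<Omega>" "0 \<in> D - closure \<Omega>"
    and \<omega>: "open \<omega>" "bounded \<omega>" "0 \<in> \<omega>"
    and \<tau>: "\<forall>\<epsilon>\<in>{0..\<tau>}. compactly_contained (scaled \<omega> \<epsilon>) (D - closure \<Omega>)"
    and c: "c1 > 0" "c2 > 0" "c3 > 0"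
    and fluxes: "admissible_flux c1 c2 c3 a1" "admissible_flux c1 c2 c3 a2"
    and u0: "is_state D f a1 a2 \<Omega> u0"
    and \<delta>: "\<delta> > 0" "cball 0 \<delta> \<subseteq> D" and u0_C1: "u0 \<in> C1_closure (ball 0 \<delta>)"
    and U0: "U0 = grad u0 0"
    and K: "is_corrector a1 a2 \<omega> U0 K"
    and e: "\<And>n. 0 < e n" "\<And>n. e n \<le> \<tau>" "e \<longlonglongrightarrow> 0"
    and v: "\<And>n. is_state D f a1 a2 (perturbed \<Omega> \<omega> (e n)) (v n)"
begin

definition U :: "'a \<Rightarrow> 'a" where "U = grad_rep D \<delta> u0"
text \<open>A representative of the gradient of \<open>w n\<close>. Subtracting \<open>U\<close>
  instead of \<open>wgrad D u0\<close> makes \<open>U x + W n x\<close> equal to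
  \<open>wgrad D (v n) x\<close> at every point of \<open>D\<close>.\<close>

definition W :: "nat \<Rightarrow> 'a \<Rightarrow> 'a" where "W n x = (if x \<in> D then wgrad D (v n) x - U x else 0)"
definition w :: "nat \<Rightarrow> 'a \<Rightarrow> real" where "w n x = v n x - u0 x"
definition S :: "nat \<Rightarrow> 'a set" where "S n = scaled \<omega> (e n)"
definition k :: "'a \<Rightarrow> 'a" where "k = wgrad UNIV K"
text \<open>The factor by which the \<open>L2\<close> norm grows when a fixed profile is composed
  with division by \<open>e n\<close>. Squared norms of this order are exactly those that survive
  division by the volume of the inclusion.\<close>

definition \<nu> :: "nat \<Rightarrow> real" where "\<nu> n = sqrt (e n ^ DIM('a))"

lemmas mD = open_in_lebesgue[OF D(1)]

lemma u0_H: "u0 \<in> H1_0 D" using u0 by (simp add: is_state_def)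
lemma v_H: "v n \<in> H1_0 D" using v by (simp add: is_state_def)

lemmas U_props = grad_rep_properties[OF D(1) \<delta> u0_H u0_C1, folded U_def]

lemma U_zero_trace: "zero_trace D u0 U" by (rule U_props)

lemma \<nu>_pos: "\<nu> n > 0" using e(1) by (simp add: \<nu>_def)

lemma mem_S: "x \<in> S n \<longleftrightarrow> inverse (e n) *\<^sub>R x \<in> \<omega>"
proof
  assume "inverse (e n) *\<^sub>R x \<in> \<omega>"
  then have "e n *\<^sub>R (inverse (e n) *\<^sub>R x) \<in> S n"
    unfolding S_def scaled_def by blast
  then show "x \<in> S n" using e(1)[of n] by simp
next
  assume "x \<in> S n"
  then obtain y where "y \<in> \<omega>" "x = e n *\<^sub>R y"
    unfolding S_def scaled_def by blast
  then show "inverse (e n) *\<^sub>R x \<in> \<omega>" using e(1)[of n] by simp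
qed

lemma S_sub: "S n \<subseteq> D - closure \<Omega>"
proof -
  have "compactly_contained (S n) (D - closure \<Omega>)"
    unfolding S_def using \<tau> e(1,2) by (simp add: less_imp_le)
  then show ?thesis unfolding compactly_contained_def using closure_subset by blast
qed

lemma S_D: "x \<in> S n \<Longrightarrow> x \<in> D" and S_\<Omega>: "x \<in> S n \<Longrightarrow> x \<notin> \<Omega>"
  using S_sub[of n] closure_subset[of \<Omega>] by blast+

lemma S_open: "open (S n)"
  unfolding S_def scaled_def using e(1)[of n] \<omega>(1) by (intro open_scaling) auto

lemma S_bounded: "bounded (S n)"
  unfolding S_def scaled_def using \<omega>(2) by (rule bounded_scaling)

lemmas mS = open_in_lebesgue[OF S_open]

lemma perturbed_eq: "perturbed \<Omega> \<omega> (e n) = \<Omega> \<union> S n"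
  using e(1)[of n] by (simp add: perturbed_def S_def)

lemma m\<Omega>S: "\<Omega> \<union> S n \<in> sets lebesgue"
  by (intro open_in_lebesgue open_Un \<Omega>(1) S_open)

lemma flux_S: "flux a1 a2 (S n) x y = flux a1 a2 \<omega> (inverse (e n) *\<^sub>R x) y"
  by (simp add: flux_def mem_S)

lemma UW_zero_trace: "zero_trace D (v n) (\<lambda>x. U x + W n x)"
proof -
  have z: "zero_trace D (v n) (wgrad D (v n))"
    using v_H H1_0_iff_zero_trace[OF D(1)] by blast
  have eq: "wgrad D (v n) x = U x + W n x" if "x \<in> space (lebesgue_on D)" for x
    using that by (simp add: W_def)
  show ?thesis
  proof (rule zero_trace_cong[OF z])
    show "(\<lambda>x. U x + W n x) \<in> borel_measurable (lebesgue_on D)"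
      using sq_intD(1)[OF zero_trace_sq_int(2)[OF z]] measurable_cong[of "lebesgue_on D" "wgrad D (v n)", OF eq] by blast
  qed (rule AE_I2[OF eq])
qed

lemma W_zero_trace: "zero_trace D (w n) (W n)"
  using zero_trace_lincomb[OF mD UW_zero_trace[of n] U_zero_trace, of 1 "-1"]
  by (simp add: w_def[abs_def])

lemma W_outside: "x \<notin> D \<Longrightarrow> W n x = 0" by (simp add: W_def)

lemma sq_int_extend:
  assumes "sq_int (lebesgue_on D) g" "\<And>x. x \<notin> D \<Longrightarrow> g x = 0"
  shows "sq_int lebesgue g"
proof -
  have "(\<lambda>x. if x \<in> D then g x else 0) = g"
    using assms(2) by (auto simp: fun_eq_iff)
  then show ?thesis using assms(1) by (simp add: sq_int_on_iff[OF mD])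
qed

lemma sq_int_U: "sq_int lebesgue U"
  by (rule sq_int_extend[OF zero_trace_sq_int(2)[OF U_zero_trace]]) (rule U_props(5))

lemma sq_int_W: "sq_int lebesgue (W n)"
  by (rule sq_int_extend[OF zero_trace_sq_int(2)[OF W_zero_trace]]) (rule W_outside)

lemma K_BL: "K \<in> BL" using K by (simp add: is_corrector_def)

lemma sq_int_k: "sq_int lebesgue k"
  unfolding k_def by (rule BLD(2)[OF K_BL])

lemma l2_rescale:
  fixes h :: "'a \<Rightarrow> 'b::euclidean_space"
  assumes "sq_int lebesgue h"
  shows "sq_int lebesgue (\<lambda>x. h (inverse (e n) *\<^sub>R x))" "l2 lebesgue (\<lambda>x. h (inverse (e n) *\<^sub>R x)) = \<nu> n * l2 lebesgue h"
proof -
  have p: "inverse (e n) > 0" using e(1)[of n] by simp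
  show "sq_int lebesgue (\<lambda>x. h (inverse (e n) *\<^sub>R x))"
    by (rule l2_scale(1)[OF p assms])
  have "(l2 lebesgue (\<lambda>x. h (inverse (e n) *\<^sub>R x)))\<^sup>2 = (\<nu> n * l2 lebesgue h)\<^sup>2"
    unfolding l2_scale(2)[OF p assms] \<nu>_def using e(1)[of n]
    by (simp add: power_mult_distrib power_inverse divide_inverse mult.commute)
  then show "l2 lebesgue (\<lambda>x. h (inverse (e n) *\<^sub>R x)) = \<nu> n * l2 lebesgue h"
    using \<nu>_pos[of n] by (simp add: power2_eq_iff_nonneg)
qed

lemma measurable_flux_leb:
  assumes "A \<in> sets lebesgue" "h \<in> borel_measurable lebesgue"
  shows "(\<lambda>x. flux a1 a2 A x (h x)) \<in> borel_measurable lebesgue"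
  by (rule measurable_flux[OF fluxes]) (use assms in auto)

lemma sq_int_flux_diff:
  assumes A: "A \<in> sets lebesgue" and h: "h \<in> borel_measurable lebesgue" "g \<in> borel_measurable lebesgue"
    and d: "sq_int lebesgue (\<lambda>x. h x - g x)"
  shows "sq_int lebesgue (\<lambda>x. flux a1 a2 A x (h x) - flux a1 a2 A x (g x))"
proof (rule sq_int_bound[OF d])
  show "(\<lambda>x. flux a1 a2 A x (h x) - flux a1 a2 A x (g x)) \<in> borel_measurable lebesgue"
    by (intro borel_measurable_diff measurable_flux_leb A h)
  show "AE x in lebesgue. norm (flux a1 a2 A x (h x) - flux a1 a2 A x (g x)) \<le> c2 * norm (h x - g x)"
    by (intro AE_I2 flux_lipschitz[OF admissible_flux_flux[OF fluxes]])
qed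

lemma sq_int_jump: "sq_int lebesgue (\<lambda>x. if x \<in> S n then a1 (U x) - a2 (U x) else 0)"
proof -
  \<comment> \<open>With the sets \<open>UNIV\<close> and \<open>{}\<close> the flux reduces to
    \<open>a1\<close> and \<open>a2\<close>, so the square integrability of fluxes covers the two
    laws separately.\<close>
  have "sq_int (lebesgue_on D) (\<lambda>x. flux a1 a2 UNIV x (U x) - flux a1 a2 {} x (U x))"
    by (intro sq_int_diff sq_int_flux[OF fluxes D(2) mD] zero_trace_sq_int(2)[OF U_zero_trace]) auto
  then have "sq_int (lebesgue_on (S n)) (\<lambda>x. flux a1 a2 UNIV x (U x) - flux a1 a2 {} x (U x))"
    by (rule sq_int_subset[OF _ mD mS]) (use S_D in blast)
  then have "sq_int lebesgue (\<lambda>x. if x \<in> S n then flux a1 a2 UNIV x (U x) - flux a1 a2 {} x (U x) else 0)"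
    unfolding sq_int_on_iff[OF mS] .
  moreover have "(\<lambda>x. if x \<in> S n then flux a1 a2 UNIV x (U x) - flux a1 a2 {} x (U x) else 0)
      = (\<lambda>x. if x \<in> S n then a1 (U x) - a2 (U x) else 0)"
    by (rule ext) (simp add: flux_def)
  ultimately show ?thesis by (simp only:)
qed

lemma sq_int_jump0: "sq_int lebesgue (\<lambda>x. if x \<in> S n then a1 U0 - a2 U0 else 0)"
  by (rule sq_int_indicator[OF S_bounded mS])

text \<open>Both states have the same right-hand side, so the equations can be subtracted. At
  \<open>U\<close> the perturbed and unperturbed fluxes differ only on \<open>S n\<close>, which
  lies outside \<open>\<Omega>\<close>.\<close>

lemma state_difference:
  assumes \<phi>: "zero_trace D \<phi> g" and g0: "\<And>x. x \<notin> D \<Longrightarrow> g x = 0"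
  shows "(LINT x|lebesgue. (flux a1 a2 (\<Omega> \<union> S n) x (U x + W n x) - flux a1 a2 (\<Omega> \<union> S n) x (U x)) \<bullet> g x)
    = - (LINT x|lebesgue. (if x \<in> S n then a1 (U x) - a2 (U x) else 0) \<bullet> g x)"
proof -
  let ?A = "\<Omega> \<union> S n" and ?M = "lebesgue_on D"
  note sg = zero_trace_sq_int(2)[OF \<phi>]
  note m\<Omega> = open_in_lebesgue[OF \<Omega>(1)]
  note sU = zero_trace_sq_int(2)[OF U_zero_trace] and sUW = zero_trace_sq_int(2)[OF UW_zero_trace[of n]]
  note i1 = integrable_inner_sq_int[OF sq_int_flux[OF fluxes D(2) mD m\<Omega>S[of n] sUW] sg]
  note i2 = integrable_inner_sq_int[OF sq_int_flux[OF fluxes D(2) mD m\<Omega>S[of n] sU] sg]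
  note i3 = integrable_inner_sq_int[OF sq_int_flux[OF fluxes D(2) mD m\<Omega> sU] sg]
  have "(LINT x|?M. flux a1 a2 ?A x (U x + W n x) \<bullet> g x) = (LINT x|?M. f x * \<phi> x)"
    by (rule is_state_eq[OF D(1) fluxes m\<Omega>S v[of n, unfolded perturbed_eq] UW_zero_trace \<phi>])
  moreover have "(LINT x|?M. flux a1 a2 \<Omega> x (U x) \<bullet> g x) = (LINT x|?M. f x * \<phi> x)"
    by (rule is_state_eq[OF D(1) fluxes m\<Omega> u0 U_zero_trace \<phi>])
  ultimately have "(LINT x|?M. flux a1 a2 ?A x (U x + W n x) \<bullet> g x - flux a1 a2 ?A x (U x) \<bullet> g x)
      = - (LINT x|?M. flux a1 a2 ?A x (U x) \<bullet> g x - flux a1 a2 \<Omega> x (U x) \<bullet> g x)"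
    using i1 i2 i3 by simp
  moreover have "flux a1 a2 ?A x (U x) \<bullet> g x - flux a1 a2 \<Omega> x (U x) \<bullet> g x = (if x \<in> S n then a1 (U x) - a2 (U x) else 0) \<bullet> g x" for x
    using S_\<Omega>[of x n] by (simp add: flux_def inner_diff_left)
  ultimately have eq: "(LINT x|?M. (flux a1 a2 ?A x (U x + W n x) - flux a1 a2 ?A x (U x)) \<bullet> g x)
      = - (LINT x|?M. (if x \<in> S n then a1 (U x) - a2 (U x) else 0) \<bullet> g x)"
    by (simp add: inner_diff_left)
  have r: "(LINT x|?M. h x \<bullet> g x) = (LINT x|lebesgue. h x \<bullet> g x)" for h
    by (rule integral_on_support[OF order_refl mD]) (simp add: g0)
  show ?thesis using eq unfolding r .
qed

text \<open>The field \<open>g(e n y)\<close> is the gradient of a rescaled element of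
  \<open>BL\<close> and thus admissible in the corrector equation; undoing the change of variables
  multiplies both sides by the same power of \<open>e n\<close>.\<close>

lemma corrector_scaled:
  assumes \<phi>: "zero_trace D \<phi> g" and g0: "\<And>x. x \<notin> D \<Longrightarrow> g x = 0"
  shows "(LINT x|lebesgue. (flux a1 a2 (S n) x (k (inverse (e n) *\<^sub>R x) + U0) - flux a1 a2 (S n) x U0) \<bullet> g x)
    = - (LINT x|lebesgue. (if x \<in> S n then a1 U0 - a2 U0 else 0) \<bullet> g x)"
proof -
  let ?c = "inverse (e n)"
  have en: "e n > 0" "e n \<noteq> 0" using e(1)[of n] by auto
  have gext: "(\<lambda>x. if x \<in> D then g x else 0) = g" using g0 by (auto simp: fun_eq_iff)
  note z = zero_trace_scale[OF zero_trace_extend[OF D(1) \<phi>, unfolded gext] en(1)]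
  note sg = zero_trace_sq_int(2)[OF zero_trace_extend[OF D(1) \<phi>, unfolded gext], unfolded lebesgue_on_UNIV_eq]
  define \<Phi> where "\<Phi> = (\<lambda>x. inverse (e n) * (if e n *\<^sub>R x \<in> D then \<phi> (e n *\<^sub>R x) else 0))"
  have BL: "\<Phi> \<in> BL" and ae: "AE x in lebesgue. wgrad UNIV \<Phi> x = g (e n *\<^sub>R x)"
    unfolding \<Phi>_def by (rule zero_trace_BL(1)[OF z], rule zero_trace_BL(2)[OF z])
  define F where "F x = (flux a1 a2 (S n) x (k (?c *\<^sub>R x) + U0) - flux a1 a2 (S n) x U0) \<bullet> g x" for x
  define H where "H x = (if x \<in> S n then a1 U0 - a2 U0 else 0) \<bullet> g x" for x
  have mkU: "(\<lambda>x. k (?c *\<^sub>R x) + U0) \<in> borel_measurable lebesgue"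
    by (intro borel_measurable_add borel_measurable_const sq_intD(1)[OF l2_rescale(1)[OF sq_int_k]])
  have iF: "integrable lebesgue F"
    unfolding F_def by (intro integrable_inner_sq_int sg sq_int_flux_diff mS mkU borel_measurable_const)
       (use l2_rescale(1)[OF sq_int_k] in simp)
  have iH: "integrable lebesgue H"
    unfolding H_def by (intro integrable_inner_sq_int sg sq_int_jump0)
  have Fe: "F (e n *\<^sub>R x) = (flux a1 a2 \<omega> x (k x + U0) - flux a1 a2 \<omega> x U0) \<bullet> g (e n *\<^sub>R x)" for x
    using en by (simp add: F_def flux_S)
  have He: "H (e n *\<^sub>R x) = (if x \<in> \<omega> then (a1 U0 - a2 U0) \<bullet> g (e n *\<^sub>R x) else 0)" for x
    using en by (simp add: H_def mem_S)
  have mg: "(\<lambda>x. g (e n *\<^sub>R x)) \<in> borel_measurable lebesgue"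
    using borel_measurable_affine[OF en(2) sq_intD(1)[OF sg], of 0] by simp
  have m\<Phi>: "wgrad UNIV \<Phi> \<in> borel_measurable lebesgue"
    by (rule sq_intD(1)[OF BLD(2)[OF BL]])
  note m\<omega> = open_in_lebesgue[OF \<omega>(1)]
  have mfl: "(\<lambda>x. flux a1 a2 \<omega> x (k x + U0) - flux a1 a2 \<omega> x U0) \<in> borel_measurable lebesgue"
    by (intro borel_measurable_diff measurable_flux_leb m\<omega> borel_measurable_add borel_measurable_const sq_intD(1)[OF sq_int_k])
  have l: "(LINT x|lebesgue. (flux a1 a2 \<omega> x (k x + U0) - flux a1 a2 \<omega> x U0) \<bullet> wgrad UNIV \<Phi> x) = (LINT x|lebesgue. F (e n *\<^sub>R x))"
    unfolding Fe
  proof (rule integral_cong_AE)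
    show "AE x in lebesgue. (flux a1 a2 \<omega> x (k x + U0) - flux a1 a2 \<omega> x U0) \<bullet> wgrad UNIV \<Phi> x
        = (flux a1 a2 \<omega> x (k x + U0) - flux a1 a2 \<omega> x U0) \<bullet> g (e n *\<^sub>R x)"
      using ae by eventually_elim simp
  qed (intro borel_measurable_inner mfl m\<Phi> mg)+
  have r: "(LINT x|lebesgue_on \<omega>. (a1 U0 - a2 U0) \<bullet> wgrad UNIV \<Phi> x) = (LINT x|lebesgue. H (e n *\<^sub>R x))"
    unfolding He Lebesgue_Measure.integral_restrict_UNIV[OF m\<omega>]
  proof (rule integral_cong_AE)
    have "AE x in lebesgue. x \<in> \<omega> \<longrightarrow> (a1 U0 - a2 U0) \<bullet> wgrad UNIV \<Phi> x = (a1 U0 - a2 U0) \<bullet> g (e n *\<^sub>R x)"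
      using ae by eventually_elim simp
    then show "AE x in lebesgue_on \<omega>. (a1 U0 - a2 U0) \<bullet> wgrad UNIV \<Phi> x = (a1 U0 - a2 U0) \<bullet> g (e n *\<^sub>R x)"
      using m\<omega> by (subst AE_restrict_space_iff) auto
  qed (intro measurable_restrict_space1 borel_measurable_inner borel_measurable_const m\<Phi> mg)+
  have cor: "(LINT x|lebesgue. (flux a1 a2 \<omega> x (k x + U0) - flux a1 a2 \<omega> x U0) \<bullet> wgrad UNIV \<Phi> x)
      = - (LINT x|lebesgue_on \<omega>. (a1 U0 - a2 U0) \<bullet> wgrad UNIV \<Phi> x)"
    using K BL unfolding is_corrector_def k_def by blast
  have "(LINT x|lebesgue. F (e n *\<^sub>R x)) = integral\<^sup>L lebesgue F /\<^sub>R \<bar>e n\<bar> ^ DIM('a)"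
    "(LINT x|lebesgue. H (e n *\<^sub>R x)) = integral\<^sup>L lebesgue H /\<^sub>R \<bar>e n\<bar> ^ DIM('a)"
    using has_bochner_integral_affine[OF en(2) iF, of 0] has_bochner_integral_affine[OF en(2) iH, of 0]
    by (simp_all add: has_bochner_integral_iff)
  then have "integral\<^sup>L lebesgue F /\<^sub>R \<bar>e n\<bar> ^ DIM('a) = - (integral\<^sup>L lebesgue H /\<^sub>R \<bar>e n\<bar> ^ DIM('a))"
    using cor unfolding l r by simp
  then have "integral\<^sup>L lebesgue F = - integral\<^sup>L lebesgue H"
    using en by (simp add: field_simps)
  then show ?thesis by (simp add: F_def[abs_def] H_def[abs_def])
qed

lemma eventually_small: "r > 0 \<Longrightarrow> eventually (\<lambda>n. e n * M < r) sequentially"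
proof -
  assume r: "r > 0"
  have "(\<lambda>n. e n * M) \<longlonglongrightarrow> 0 * M" by (intro tendsto_mult e(3) tendsto_const)
  then show ?thesis using r by (simp add: order_tendstoD(2))
qed

lemma far_from_\<Omega>: obtains r where "r > 0" "\<And>x. norm x < r \<Longrightarrow> x \<notin> \<Omega>"
proof -
  have "open (- closure \<Omega>)" "0 \<in> - closure \<Omega>" using \<Omega>(2) by auto
  then obtain r where r: "r > 0" "ball 0 r \<subseteq> - closure \<Omega>"
    unfolding open_contains_ball by blast
  have "x \<notin> \<Omega>" if "norm x < r" for x
  proof -
    have "x \<in> ball 0 r" using that by simp
    then show ?thesis using r(2) closure_subset[of \<Omega>] by blast
  qed
  with r(1) show thesis by (rule that)
qed

lemma scaled_test:
  assumes \<psi>: "\<psi> \<in> test_functions UNIV" "\<And>x. norm x > M \<Longrightarrow> \<psi> x = 0" and small: "e n * M < \<delta>"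
  shows "(\<lambda>x. e n * \<psi> (inverse (e n) *\<^sub>R x)) \<in> test_functions D"
    "grad (\<lambda>x. e n * \<psi> (inverse (e n) *\<^sub>R x)) x = grad \<psi> (inverse (e n) *\<^sub>R x)"
proof -
  have c0: "inverse (e n) \<noteq> 0" using e(1)[of n] by simp
  note g = grad_scale[OF c0 \<psi>(1), unfolded inverse_inverse_eq]
  show "grad (\<lambda>x. e n * \<psi> (inverse (e n) *\<^sub>R x)) x = grad \<psi> (inverse (e n) *\<^sub>R x)"
    by (rule g(2))
  show "(\<lambda>x. e n * \<psi> (inverse (e n) *\<^sub>R x)) \<in> test_functions D"
  proof (rule test_functions_shrink[OF g(1)])
    show "compact (cball (0::'a) (e n * M))" by (rule compact_cball)
    have "cball 0 (e n * M) \<subseteq> cball (0::'a) \<delta>" using small by auto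
    then show "cball 0 (e n * M) \<subseteq> D" using \<delta>(2) by blast
    show "e n * \<psi> (inverse (e n) *\<^sub>R x) = 0" if "x \<notin> cball 0 (e n * M)" for x
    proof -
      have "norm (inverse (e n) *\<^sub>R x) > M"
        using that e(1)[of n] by (simp add: field_simps)
      then show ?thesis using \<psi>(2) by simp
    qed
  qed
qed

text \<open>Testing the difference of the state equations and the rescaled corrector equation with the
  same function \<open>w n - \<psi>\<^sub>n\<close> leaves only the error of replacing \<open>k\<close> by \<open>grad \<psi>\<close> and the oscillation
  of \<open>U\<close> on a ball of radius of order \<open>e n\<close>.\<close>

lemma energy_estimate:
  assumes \<psi>: "\<psi> \<in> test_functions UNIV" "\<And>x. norm x > M \<Longrightarrow> \<psi> x = 0"
    and \<omega>M: "\<And>x. x \<in> \<omega> \<Longrightarrow> norm x \<le> M"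
    and small: "e n * M < \<delta>" and far: "\<And>x. norm x \<le> e n * M \<Longrightarrow> x \<notin> \<Omega>"
    and osc: "\<And>x. norm x \<le> e n * M \<Longrightarrow> norm (U x - U0) \<le> \<eta>" and \<eta>: "\<eta> \<ge> 0"
  shows "c1 * l2 lebesgue (\<lambda>x. W n x - grad \<psi> (inverse (e n) *\<^sub>R x))
    \<le> \<nu> n * (c2 * l2 lebesgue (\<lambda>x. k x - grad \<psi> x) + 4 * c2 * \<eta> * l2 lebesgue (\<lambda>x::'a. if x \<in> cball 0 M then 1 else (0::real)))"
    "\<And>R. D \<subseteq> cball 0 R \<Longrightarrow> l2 (lebesgue_on D) (\<lambda>x. w n x - e n * \<psi> (inverse (e n) *\<^sub>R x))
      \<le> 2 * R * l2 lebesgue (\<lambda>x. W n x - grad \<psi> (inverse (e n) *\<^sub>R x))"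
proof -
  let ?i = "inverse (e n)" and ?A = "\<Omega> \<union> S n"
  define q where "q x = grad \<psi> (?i *\<^sub>R x)" for x
  have en: "e n > 0" using e(1) .
  note t = scaled_test[OF \<psi> small]
  define g where "g x = W n x - q x" for x
  have q0: "q x = 0" if "x \<notin> D" for x
  proof -
    define h where "h = (\<lambda>x. e n * \<psi> (?i *\<^sub>R x))"
    have h: "h \<in> test_functions D" unfolding h_def by (rule t(1))
    obtain T where "T \<subseteq> D" "\<And>x. x \<notin> T \<Longrightarrow> grad h x = 0"
      by (rule grad_test_support[OF h]) blast
    then have "grad h x = 0" using that by blast
    moreover have "grad h x = q x" unfolding h_def q_def by (rule t(2))
    ultimately show ?thesis by simp
  qed
  have q0': "q x = 0" if "norm x > e n * M" for x
  proof -
    have "norm (?i *\<^sub>R x) > M" using that en by (simp add: field_simps)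
    then have "?i *\<^sub>R x \<notin> cball 0 M" by simp
    moreover have "\<psi> z = 0" if "z \<notin> cball 0 M" for z using \<psi>(2) that by simp
    ultimately have "frechet_derivative \<psi> (at (?i *\<^sub>R x)) = (\<lambda>_. 0)"
      by (intro frechet_derivative_eq_0[OF closed_cball])
    then show ?thesis by (simp add: q_def grad_def)
  qed
  have g0: "g x = 0" if "x \<notin> D" for x using that q0 W_outside by (simp add: g_def)
  have zg: "zero_trace D (\<lambda>x. w n x - e n * \<psi> (?i *\<^sub>R x)) g"
    using zero_trace_lincomb[OF mD W_zero_trace[of n] zero_trace_test[OF mD t(1)], of 1 "-1"]
    by (simp add: t(2) g_def[abs_def] q_def)
  have sg: "sq_int lebesgue g" by (rule sq_int_extend[OF zero_trace_sq_int(2)[OF zg] g0])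
  have sq: "sq_int lebesgue q"
    unfolding q_def[abs_def] by (rule l2_rescale(1)[OF sq_int_test(2)[OF \<psi>(1)]])
  have gD: "l2 (lebesgue_on D) g = l2 lebesgue g"
  proof -
    have "(\<lambda>x. if x \<in> D then g x else 0) = g" by (rule ext) (simp add: g0)
    then show ?thesis by (simp add: l2_on_eq[OF mD])
  qed
  show "l2 (lebesgue_on D) (\<lambda>x. w n x - e n * \<psi> (?i *\<^sub>R x)) \<le> 2 * R * l2 lebesgue (\<lambda>x. W n x - grad \<psi> (?i *\<^sub>R x))"
    if "D \<subseteq> cball 0 R" for R
    using Poincare[OF D(1) that zg] unfolding gD by (simp add: g_def[abs_def] q_def)
  define E1 where "E1 x = flux a1 a2 ?A x (U x + W n x) - flux a1 a2 ?A x (U x)" for x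
  define E2 where "E2 x = flux a1 a2 ?A x (U x + q x) - flux a1 a2 ?A x (U x)" for x
  define E3 where "E3 x = flux a1 a2 (S n) x (k (?i *\<^sub>R x) + U0) - flux a1 a2 (S n) x U0" for x
  define J where "J x = (if x \<in> S n then a1 (U x) - a2 (U x) else 0)" for x
  define J0 where "J0 x = (if x \<in> S n then a1 U0 - a2 U0 else 0)" for x
  note mU = sq_intD(1)[OF sq_int_U]
  note ski = l2_rescale(1)[OF sq_int_k, of n]
  have s: "sq_int lebesgue E1" "sq_int lebesgue E2" "sq_int lebesgue E3" "sq_int lebesgue J" "sq_int lebesgue J0"
  proof -
    show "sq_int lebesgue E1" unfolding E1_def[abs_def]
      by (intro sq_int_flux_diff m\<Omega>S borel_measurable_add mU sq_intD(1)[OF sq_int_W]) (use sq_int_W in simp)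
    show "sq_int lebesgue E2" unfolding E2_def[abs_def]
      by (intro sq_int_flux_diff m\<Omega>S borel_measurable_add mU sq_intD(1)[OF sq]) (use sq in simp)
    show "sq_int lebesgue E3" unfolding E3_def[abs_def]
      by (intro sq_int_flux_diff mS borel_measurable_add borel_measurable_const sq_intD(1)[OF ski]) (use ski in simp)
    show "sq_int lebesgue J" unfolding J_def[abs_def] by (rule sq_int_jump)
    show "sq_int lebesgue J0" unfolding J0_def[abs_def] by (rule sq_int_jump0)
  qed
  note i = integrable_inner_sq_int[OF s(1) sg] integrable_inner_sq_int[OF s(2) sg] integrable_inner_sq_int[OF s(3) sg]
    integrable_inner_sq_int[OF s(4) sg] integrable_inner_sq_int[OF s(5) sg]
  have 1: "(LINT x|lebesgue. E1 x \<bullet> g x) = - (LINT x|lebesgue. J x \<bullet> g x)"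
    unfolding E1_def J_def by (rule state_difference[OF zg g0])
  have 3: "(LINT x|lebesgue. E3 x \<bullet> g x) = - (LINT x|lebesgue. J0 x \<bullet> g x)"
    unfolding E3_def J0_def by (rule corrector_scaled[OF zg g0])
  \<comment> \<open>Both equations enter here: integrated against \<open>g\<close>, the sum
    \<open>E3 + J0\<close> vanishes and \<open>E1\<close> equals \<open>- J\<close>. So
    \<open>E1 - E2\<close> has the same pairing with \<open>g\<close> as \<open>E\<close>, and
    unlike \<open>E1\<close> the field \<open>E\<close> is pointwise small.\<close>
  define E where "E x = ((E3 x + J0 x) - J x) - E2 x" for x
  have sE: "sq_int lebesgue E"
    unfolding E_def[abs_def] by (intro sq_int_diff sq_int_add s)
  have "c1 * (l2 lebesgue g)\<^sup>2 = (LINT x|lebesgue. c1 * (norm (g x))\<^sup>2)"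
    by (simp add: l2_square)
  also have "\<dots> \<le> (LINT x|lebesgue. E1 x \<bullet> g x - E2 x \<bullet> g x)"
  proof (rule integral_mono)
    show "integrable lebesgue (\<lambda>x. c1 * (norm (g x))\<^sup>2)"
      by (intro integrable_mult_right sq_intD(2)[OF sg])
    show "c1 * (norm (g x))\<^sup>2 \<le> E1 x \<bullet> g x - E2 x \<bullet> g x" for x
      using flux_monotone[OF admissible_flux_flux[OF fluxes], of "U x + W n x" "U x + q x" ?A x]
      by (simp add: E1_def E2_def g_def inner_diff_left)
  qed (intro Bochner_Integration.integrable_diff i)
  also have "\<dots> = (LINT x|lebesgue. E x \<bullet> g x)"
    unfolding E_def inner_diff_left inner_add_left using i 1 3 by simp
  also have "\<dots> \<le> l2 lebesgue E * l2 lebesgue g"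
    using abs_integral_inner_le[OF sE sg] by linarith
  finally have le: "c1 * (l2 lebesgue g)\<^sup>2 \<le> l2 lebesgue E * l2 lebesgue g" .
  \<comment> \<open>Of the four multiples of \<open>c2 * \<eta>\<close>, two come from exchanging
    \<open>U\<close> and \<open>U0\<close> inside the flux and two from the same exchange in the
    jump.\<close>
  define F where "F y = c2 * norm (k y - grad \<psi> y) + 4 * c2 * \<eta> * (if y \<in> cball 0 M then 1 else (0::real))" for y
  let ?I = "\<lambda>y::'a. if y \<in> cball 0 M then 1 else (0::real)"
  have sI: "sq_int lebesgue ?I"
    by (intro sq_int_indicator bounded_cball compact_in_lebesgue compact_cball)
  have skd: "sq_int lebesgue (\<lambda>y. k y - grad \<psi> y)"
    by (intro sq_int_diff sq_int_k sq_int_test(2)[OF \<psi>(1)])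
  have sF': "sq_int lebesgue (\<lambda>y. c2 *\<^sub>R norm (k y - grad \<psi> y) + (4 * c2 * \<eta>) *\<^sub>R ?I y)"
    by (intro sq_int_add sq_int_scaleR sq_int_norm skd sI)
  then have sF: "sq_int lebesgue F" by (simp add: F_def[abs_def])
  have EF: "norm (E x) \<le> F (?i *\<^sub>R x)" for x
  \<comment> \<open>Outside this ball \<open>\<psi>\<close> and the inclusion are absent: only
    \<open>E3\<close> is left, bounded by \<open>k\<close>, which there equals
    \<open>k - grad \<psi>\<close>. Inside the ball \<open>\<Omega>\<close> is avoided, so both
    equations involve the same law \<open>A\<close>.\<close>
  proof (cases "norm x \<le> e n * M")
    case False
    then have x: "x \<notin> S n"
    proof -
      have "norm (?i *\<^sub>R x) > M" using False en by (simp add: field_simps)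
      then show ?thesis using \<omega>M[of "?i *\<^sub>R x"] by (auto simp: mem_S)
    qed
    have "norm (E x) = norm (E3 x)"
      using x q0' False by (simp add: E_def E2_def J_def J0_def)
    also have "\<dots> \<le> c2 * norm (k (?i *\<^sub>R x))"
      unfolding E3_def using flux_lipschitz[OF admissible_flux_flux[OF fluxes], of "S n" x "k (?i *\<^sub>R x) + U0" U0] by simp
    also have "\<dots> = c2 * norm (k (?i *\<^sub>R x) - grad \<psi> (?i *\<^sub>R x))"
      using q0' False by (simp add: q_def)
    also have "\<dots> \<le> F (?i *\<^sub>R x)"
      using c(2) \<eta> by (simp add: F_def)
    finally show ?thesis .
  next
    case True
    then have xA: "?i *\<^sub>R x \<in> cball 0 M" using en by (simp add: field_simps)
    have x\<Omega>: "x \<notin> \<Omega>" by (rule far[OF True])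
    define A where "A = (if x \<in> S n then a1 else a2)"
    have A: "admissible_flux c1 c2 c3 A" using fluxes by (simp add: A_def)
    have fA: "flux a1 a2 ?A x = A" "flux a1 a2 (S n) x = A"
      using x\<Omega> by (simp_all add: A_def flux_def fun_eq_iff)
    let ?k = "k (?i *\<^sub>R x)"
    have o: "norm (U x - U0) \<le> \<eta>" by (rule osc[OF True])
    have lip: "norm (B y - B z) \<le> c2 * \<eta>" if B: "admissible_flux c1 c2 c3 B" and yz: "norm (y - z) \<le> \<eta>" for B :: "'a \<Rightarrow> 'a" and y z
      by (rule order_trans[OF flux_lipschitz[OF B] mult_left_mono[OF yz]]) (use c(2) in simp)
    have o': "norm (U0 - U x) \<le> \<eta>" using o by (simp add: norm_minus_commute)
    have n1: "norm (A (?k + U0) - A (q x + U0)) \<le> c2 * norm (?k - q x)"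
      using flux_lipschitz[OF A, of "?k + U0" "q x + U0"] by simp
    have n2: "norm (A (q x + U0) - A (U x + q x)) \<le> c2 * \<eta>"
      by (rule lip[OF A]) (use o' in \<open>simp add: algebra_simps\<close>)
    have n3: "norm (A (U x) - A U0) \<le> c2 * \<eta>"
      by (rule lip[OF A o])
    have n4: "norm (J0 x - J x) \<le> 2 * (c2 * \<eta>)"
    proof (cases "x \<in> S n")
      case True
      have "J0 x - J x = (a1 U0 - a1 (U x)) - (a2 U0 - a2 (U x))" using True by (simp add: J0_def J_def)
      also have "norm \<dots> \<le> norm (a1 U0 - a1 (U x)) + norm (a2 U0 - a2 (U x))" by (rule norm_triangle_ineq4)
      also have "\<dots> \<le> c2 * \<eta> + c2 * \<eta>" by (intro add_mono lip fluxes o')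
      finally show ?thesis by (simp only: mult_2)
    qed (use c(2) \<eta> in \<open>simp add: J0_def J_def\<close>)
    have "E x = (A (?k + U0) - A (q x + U0)) + (A (q x + U0) - A (U x + q x)) + (A (U x) - A U0) + (J0 x - J x)"
      by (simp add: E_def E2_def E3_def fA)
    also have "norm \<dots> \<le> norm (A (?k + U0) - A (q x + U0)) + norm (A (q x + U0) - A (U x + q x)) + norm (A (U x) - A U0) + norm (J0 x - J x)"
      by (intro norm_triangle_le add_mono order_refl)
    also have "\<dots> \<le> c2 * norm (?k - q x) + 4 * c2 * \<eta>"
      using n1 n2 n3 n4 by linarith
    also have "\<dots> = F (?i *\<^sub>R x)"
      using xA by (simp add: F_def q_def del: mem_cball)
    finally show ?thesis .
  qed
  have EF': "norm (E x) \<le> norm (F (?i *\<^sub>R x))" for x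
    unfolding real_norm_def by (rule order_trans[OF EF abs_ge_self])
  have "l2 lebesgue E \<le> l2 lebesgue (\<lambda>x. F (?i *\<^sub>R x))"
    by (intro l2_mono l2_rescale(1)[OF sF] sq_intD(1)[OF sE] AE_I2 EF')
  also have "\<dots> = \<nu> n * l2 lebesgue F"
    by (rule l2_rescale(2)[OF sF])
  also have "l2 lebesgue F \<le> l2 lebesgue (\<lambda>y. c2 *\<^sub>R norm (k y - grad \<psi> y)) + l2 lebesgue (\<lambda>y. (4 * c2 * \<eta>) *\<^sub>R ?I y)"
    using l2_triangle[OF sq_int_scaleR[OF sq_int_norm[OF skd], of c2] sq_int_scaleR[OF sI, of "4 * c2 * \<eta>"]]
    by (simp add: F_def[abs_def])
  also have "\<dots> = c2 * l2 lebesgue (\<lambda>y. k y - grad \<psi> y) + 4 * c2 * \<eta> * l2 lebesgue ?I"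
    unfolding l2_scaleR l2_norm using c(2) \<eta> by simp
  finally have E: "l2 lebesgue E \<le> \<nu> n * (c2 * l2 lebesgue (\<lambda>y. k y - grad \<psi> y) + 4 * c2 * \<eta> * l2 lebesgue ?I)"
    using \<nu>_pos[of n] by simp
  have "c1 * l2 lebesgue g \<le> l2 lebesgue E"
  proof (cases "l2 lebesgue g = 0")
    case False
    then have "l2 lebesgue g > 0" using l2_nonneg[of lebesgue g] by linarith
    then show ?thesis using le by (simp add: power2_eq_square flip: mult.assoc)
  qed simp
  also note E
  finally show "c1 * l2 lebesgue (\<lambda>x. W n x - grad \<psi> (?i *\<^sub>R x))
    \<le> \<nu> n * (c2 * l2 lebesgue (\<lambda>x. k x - grad \<psi> x) + 4 * c2 * \<eta> * l2 lebesgue ?I)"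
    by (simp add: g_def[abs_def] q_def)
qed

text \<open>The parameters are fixed in the order \<open>\<psi>\<close>, \<open>M\<close>,
  \<open>\<eta>2\<close>, \<open>n\<close>: the radius depends on the approximating function, the
  tolerated oscillation of \<open>U\<close> on the volume of that ball, and only then is
  \<open>n\<close> taken large.\<close>

lemma corrector_approx:
  assumes \<eta>: "\<eta> > 0"
  shows "eventually (\<lambda>n. l2 lebesgue (\<lambda>x. W n x - k (inverse (e n) *\<^sub>R x)) \<le> \<eta> * \<nu> n \<and>
    l2 (lebesgue_on D) (w n) \<le> \<eta> * \<nu> n) sequentially"
proof -
  obtain R0 where "\<forall>x\<in>D. norm x \<le> R0" using D(2) unfolding bounded_iff by blast
  then have R: "D \<subseteq> cball 0 \<bar>R0\<bar>" by force
  define R where "R = \<bar>R0\<bar>"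
  have R0: "0 \<le> R" by (simp add: R_def)
  \<comment> \<open>The tolerance is split into thirds, for the approximation by
    \<open>\<psi>\<close>, the oscillation of \<open>U\<close> and the norm of the rescaled
    \<open>\<psi>\<close>. The factor \<open>1 + 2 * R\<close> covers the gradient estimate and the
    Poincare estimate together; the final \<open>1\<close> pays for replacing
    \<open>grad \<psi>\<close> by \<open>k\<close>.\<close>
  define C where "C = (1 + 2 * R) * (c2 / c1) + 1"
  have C: "C > 0" using R0 c by (simp add: C_def add_nonneg_pos)
  define \<eta>1 where "\<eta>1 = \<eta> / (3 * C)"
  have \<eta>1: "\<eta>1 > 0" using \<eta> C by (simp add: \<eta>1_def)
  obtain \<psi> where \<psi>: "\<psi> \<in> test_functions UNIV" "l2 lebesgue (\<lambda>x. k x - grad \<psi> x) < \<eta>1"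
    using gradients_of_test_functions_dense[OF BLD[OF K_BL] \<eta>1] unfolding k_def by blast
  obtain T where T: "compact T" "\<And>x. x \<notin> T \<Longrightarrow> \<psi> x = 0"
    by (rule test_functionsE[OF \<psi>(1)]) blast
  obtain M1 where M1: "\<forall>x\<in>T. norm x \<le> M1"
    using compact_imp_bounded[OF T(1)] unfolding bounded_iff by blast
  obtain M2 where M2: "\<forall>x\<in>\<omega>. norm x \<le> M2"
    using \<omega>(2) unfolding bounded_iff by blast
  define M where "M = max M1 M2"
  have \<psi>M: "\<psi> x = 0" if "norm x > M" for x
    using T(2)[of x] M1 that by (force simp: M_def)
  have \<omega>M: "norm x \<le> M" if "x \<in> \<omega>" for x
    using M2 that by (force simp: M_def)
  define B where "B = l2 lebesgue (\<lambda>x::'a. if x \<in> cball 0 M then 1 else (0::real))"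
  have B: "0 \<le> B" by (simp add: B_def)
  \<comment> \<open>The summand \<open>1\<close> only secures a positive denominator, since the rest
    may vanish.\<close>
  define Z where "Z = (1 + 2 * R) * (4 * c2 / c1) * B + 1"
  define \<eta>2 where "\<eta>2 = \<eta> / (3 * Z)"
  have den: "Z > 0"
    unfolding Z_def using R0 c B by (intro add_nonneg_pos mult_nonneg_nonneg) auto
  have \<eta>2: "\<eta>2 > 0" using \<eta> den by (simp add: \<eta>2_def)
  obtain r where r: "r > 0" "\<And>x. norm x < r \<Longrightarrow> x \<notin> \<Omega>" by (rule far_from_\<Omega>) blast
  have "eventually (\<lambda>x. dist (U x) (U 0) < \<eta>2) (nhds 0)"
    using tendstoD[OF U_props(2)[unfolded isCont_def] \<eta>2] \<eta>2 by (simp add: eventually_nhds_conv_at)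
  then obtain s where s: "s > 0" "\<And>x. dist x 0 < s \<Longrightarrow> dist (U x) (U 0) < \<eta>2"
    unfolding eventually_nhds_metric by blast
  have U0': "U 0 = U0" using U_props(3) U0 by simp
  \<comment> \<open>The conditions place the rescaled support in \<open>D\<close>, keep it away from
    \<open>\<Omega>\<close>, limit the oscillation of \<open>U\<close> there, and bound the rescaled
    \<open>\<psi>\<close> by its third of the tolerance.\<close>
  have "eventually (\<lambda>n. e n * M < \<delta> \<and> e n * M < r \<and> e n * M < s \<and> e n * (3 * l2 lebesgue \<psi>) < \<eta>) sequentially"
    by (intro eventually_conj eventually_small \<delta>(1) r(1) s(1) \<eta>)
  then show ?thesis
  proof eventually_elim
    case (elim n)
    let ?i = "inverse (e n)"
    let ?X = "l2 lebesgue (\<lambda>x. W n x - grad \<psi> (?i *\<^sub>R x))"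
    have far: "x \<notin> \<Omega>" if "norm x \<le> e n * M" for x
      using r(2)[of x] that elim by linarith
    have osc: "norm (U x - U0) \<le> \<eta>2" if "norm x \<le> e n * M" for x
      using s(2)[of x] that elim by (simp add: dist_norm U0')
    have small: "e n * M < \<delta>" using elim by simp
    note est = energy_estimate[OF \<psi>(1) \<psi>M \<omega>M small far osc less_imp_le[OF \<eta>2]]
    have est2: "l2 (lebesgue_on D) (\<lambda>x. w n x - e n * \<psi> (?i *\<^sub>R x)) \<le> 2 * \<bar>R0\<bar> * ?X"
      by (rule est(2)[OF _ _ _ _ R])
    have X: "?X \<le> \<nu> n * ((c2 / c1) * \<eta>1 + (4 * c2 / c1) * B * \<eta>2)"
    proof -
      have "c1 * ?X \<le> \<nu> n * (c2 * l2 lebesgue (\<lambda>x. k x - grad \<psi> x) + 4 * c2 * \<eta>2 * B)"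
        unfolding B_def by (rule est(1))
      also have "\<dots> \<le> \<nu> n * (c2 * \<eta>1 + 4 * c2 * \<eta>2 * B)"
        using \<psi>(2) c(2) \<nu>_pos[of n] by (intro mult_left_mono add_right_mono) auto
      finally have "?X \<le> (\<nu> n * (c2 * \<eta>1 + 4 * c2 * \<eta>2 * B)) / c1"
        using c(1) by (simp add: pos_le_divide_eq mult.commute)
      also have "\<dots> = \<nu> n * ((c2 / c1) * \<eta>1 + (4 * c2 / c1) * B * \<eta>2)"
        using c(1) by (simp add: field_simps)
      finally show ?thesis .
    qed
    have key: "(1 + 2 * R) * ((c2 / c1) * \<eta>1 + (4 * c2 / c1) * B * \<eta>2) + \<eta>1 \<le> 2 * \<eta> / 3"
    proof -
      have "(1 + 2 * R) * (c2 / c1) * \<eta>1 + \<eta>1 = C * \<eta>1" by (simp add: C_def algebra_simps)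
      also have "\<dots> = \<eta> / 3" using C by (simp add: \<eta>1_def)
      finally have k1: "(1 + 2 * R) * (c2 / c1) * \<eta>1 + \<eta>1 = \<eta> / 3" .
      have "(1 + 2 * R) * (4 * c2 / c1) * B * \<eta>2 \<le> Z * \<eta>2"
        using \<eta>2 by (intro mult_right_mono) (simp_all add: Z_def)
      also have "\<dots> = \<eta> / 3" using den by (simp add: \<eta>2_def)
      finally have k2: "(1 + 2 * R) * (4 * c2 / c1) * B * \<eta>2 \<le> \<eta> / 3" .
      have "(1 + 2 * R) * ((c2 / c1) * \<eta>1 + (4 * c2 / c1) * B * \<eta>2) + \<eta>1
          = ((1 + 2 * R) * (c2 / c1) * \<eta>1 + \<eta>1) + (1 + 2 * R) * (4 * c2 / c1) * B * \<eta>2"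
        by (simp only: distrib_left mult.assoc)
      then show ?thesis using k1 k2 by linarith
    qed
    define Y where "Y = (c2 / c1) * \<eta>1 + (4 * c2 / c1) * B * \<eta>2"
    have Y0: "0 \<le> Y" using c B \<eta>1 \<eta>2 by (simp add: Y_def)
    have RY: "0 \<le> R * Y" using R0 Y0 by simp
    have keyY: "Y + 2 * (R * Y) + \<eta>1 \<le> 2 * \<eta> / 3"
      using key unfolding Y_def[symmetric] by (simp add: algebra_simps)
    have sW: "sq_int lebesgue (\<lambda>x. W n x - grad \<psi> (?i *\<^sub>R x))"
      by (intro sq_int_diff sq_int_W l2_rescale(1)[OF sq_int_test(2)[OF \<psi>(1)]])
    have skd: "sq_int lebesgue (\<lambda>x. k x - grad \<psi> x)"
      by (intro sq_int_diff sq_int_k sq_int_test(2)[OF \<psi>(1)])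
    have "l2 lebesgue (\<lambda>x. W n x - k (?i *\<^sub>R x)) \<le> ?X + l2 lebesgue (\<lambda>x. k (?i *\<^sub>R x) - grad \<psi> (?i *\<^sub>R x))"
      using l2_triangle_diff[OF sW l2_rescale(1)[OF skd, of n]] by simp
    also have "\<dots> = ?X + \<nu> n * l2 lebesgue (\<lambda>x. k x - grad \<psi> x)"
      using l2_rescale(2)[OF skd, of n] by simp
    also have "\<dots> \<le> \<nu> n * Y + \<nu> n * \<eta>1"
      using X \<psi>(2) \<nu>_pos[of n] unfolding Y_def[symmetric] by (intro add_mono mult_left_mono) auto
    also have "\<dots> = \<nu> n * (Y + \<eta>1)" by (simp add: distrib_left)
    also have "\<dots> \<le> \<nu> n * \<eta>"
      using keyY RY \<eta> \<nu>_pos[of n] by (intro mult_left_mono) auto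
    finally have r1: "l2 lebesgue (\<lambda>x. W n x - k (?i *\<^sub>R x)) \<le> \<eta> * \<nu> n" by (simp add: mult.commute)
    define \<psi>' where "\<psi>' x = e n *\<^sub>R \<psi> (?i *\<^sub>R x)" for x
    have s\<psi>: "sq_int lebesgue \<psi>'"
      unfolding \<psi>'_def[abs_def] by (intro sq_int_scaleR l2_rescale(1)[OF sq_int_test(1)[OF \<psi>(1)]])
    have t: "\<psi>' \<in> test_functions D"
      using scaled_test(1)[OF \<psi>(1) \<psi>M small] by (simp add: \<psi>'_def[abs_def])
    have s\<psi>D: "sq_int (lebesgue_on D) \<psi>'" by (rule sq_int_restrict[OF s\<psi> mD])
    have "l2 (lebesgue_on D) \<psi>' \<le> l2 lebesgue \<psi>'"
      unfolding l2_on_eq[OF mD]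
      by (rule l2_mono[OF s\<psi> borel_measurable_if_I[OF sq_intD(1)[OF s\<psi>D] mD] AE_I2]) simp
    also have "\<dots> = e n * (\<nu> n * l2 lebesgue \<psi>)"
      unfolding \<psi>'_def[abs_def] l2_scaleR l2_rescale(2)[OF sq_int_test(1)[OF \<psi>(1)]] using e(1)[of n] by simp
    finally have n\<psi>: "l2 (lebesgue_on D) \<psi>' \<le> \<nu> n * (e n * l2 lebesgue \<psi>)" by (simp add: mult.left_commute)
    have "l2 (lebesgue_on D) (w n) \<le> l2 (lebesgue_on D) \<psi>' + l2 (lebesgue_on D) (\<lambda>x. w n x - \<psi>' x)"
      by (rule l2_triangle_sub[OF zero_trace_sq_int(1)[OF W_zero_trace] s\<psi>D])
    also have "l2 (lebesgue_on D) (\<lambda>x. w n x - \<psi>' x) \<le> 2 * R * ?X"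
      using est2 by (simp add: \<psi>'_def R_def)
    also have "\<dots> \<le> 2 * R * (\<nu> n * Y)"
      using X R0 unfolding Y_def[symmetric] by (intro mult_left_mono) auto
    also have "l2 (lebesgue_on D) \<psi>' \<le> \<nu> n * (\<eta> / 3)"
      using elim \<nu>_pos[of n] by (intro order_trans[OF n\<psi>] mult_left_mono) auto
    finally have "l2 (lebesgue_on D) (w n) \<le> \<nu> n * (\<eta> / 3 + 2 * (R * Y))"
      by (simp add: algebra_simps)
    also have "\<dots> \<le> \<nu> n * \<eta>"
      using keyY Y0 \<eta>1 \<nu>_pos[of n] by (intro mult_left_mono) auto
    finally have "l2 (lebesgue_on D) (w n) \<le> \<eta> * \<nu> n" by (simp add: mult.commute)
    with r1 show ?case ..
  qed
qed

lemma w_converges: "(\<lambda>n. l2 (lebesgue_on D) (w n) / \<nu> n) \<longlonglongrightarrow> 0"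
proof (rule LIMSEQ_I)
  fix r :: real assume r: "r > 0"
  have "eventually (\<lambda>n. norm (l2 (lebesgue_on D) (w n) / \<nu> n - 0) < r) sequentially"
    using corrector_approx[OF half_gt_zero[OF r]]
  proof eventually_elim
    case (elim n)
    then have "l2 (lebesgue_on D) (w n) / \<nu> n \<le> r / 2"
      using \<nu>_pos[of n] by (simp add: pos_divide_le_eq)
    moreover have "0 \<le> l2 (lebesgue_on D) (w n) / \<nu> n"
      using \<nu>_pos[of n] by simp
    ultimately show ?case using r by (simp only: real_norm_def diff_0_right)
  qed
  then show "\<exists>no. \<forall>n\<ge>no. norm (l2 (lebesgue_on D) (w n) / \<nu> n - 0) < r"
    unfolding eventually_sequentially .
qed

lemma l2_blow_up:
  fixes h :: "'a \<Rightarrow> 'b::euclidean_space"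
  assumes "sq_int lebesgue h"
  shows "sq_int lebesgue (\<lambda>y. h (e n *\<^sub>R y))" "l2 lebesgue (\<lambda>y. h (e n *\<^sub>R y)) = l2 lebesgue h / \<nu> n"
proof -
  show s: "sq_int lebesgue (\<lambda>y. h (e n *\<^sub>R y))" by (rule l2_scale(1)[OF e(1) assms])
  show "l2 lebesgue (\<lambda>y. h (e n *\<^sub>R y)) = l2 lebesgue h / \<nu> n"
    using l2_rescale(2)[OF s, of n] e(1)[of n] \<nu>_pos[of n] by simp
qed

lemma W_converges: "(\<lambda>n. l2 lebesgue (\<lambda>y. W n (e n *\<^sub>R y) - k y)) \<longlonglongrightarrow> 0"
proof (rule LIMSEQ_I)
  fix r :: real assume r: "r > 0"
  have "eventually (\<lambda>n. norm (l2 lebesgue (\<lambda>y. W n (e n *\<^sub>R y) - k y) - 0) < r) sequentially"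
    using corrector_approx[OF half_gt_zero[OF r]]
  proof eventually_elim
    case (elim n)
    have "l2 lebesgue (\<lambda>y. W n (e n *\<^sub>R y) - k y) = l2 lebesgue (\<lambda>x. W n x - k (inverse (e n) *\<^sub>R x)) / \<nu> n"
      using l2_blow_up(2)[OF sq_int_diff[OF sq_int_W[of n] l2_rescale(1)[OF sq_int_k, of n]], of n] e(1)[of n] by simp
    also have "\<dots> \<le> r / 2"
      using elim \<nu>_pos[of n] by (simp add: pos_divide_le_eq)
    finally show ?case using r l2_nonneg[of lebesgue "\<lambda>y. W n (e n *\<^sub>R y) - k y"] by (simp only: real_norm_def diff_0_right)
  qed
  then show "\<exists>no. \<forall>n\<ge>no. norm (l2 lebesgue (\<lambda>y. W n (e n *\<^sub>R y) - k y) - 0) < r"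
    unfolding eventually_sequentially .
qed

end

text \<open>The Lipschitz constant of \<open>q n y\<close> grows linearly in its arguments, so
  replacing \<open>g n\<close> by \<open>k\<close> costs a product of a bounded and a vanishing
  \<open>L2\<close> norm. For the fixed \<open>k\<close> dominated convergence applies. The function
  \<open>h\<close> allows a part of \<open>q\<close> that is linear in \<open>v\<close>, such as the
  jump of the flux derivative on the inclusion.\<close>

lemma integral_nonlinear_tendsto:
  fixes q :: "nat \<Rightarrow> 'a \<Rightarrow> 'b::euclidean_space \<Rightarrow> real" and h :: "'a \<Rightarrow> real"
  assumes g: "\<And>n. sq_int M (g n)" "sq_int M k" "(\<lambda>n. l2 M (\<lambda>y. g n y - k y)) \<longlonglongrightarrow> 0"
    and h: "sq_int M h" and L: "L \<ge> 0"
    and m: "\<And>n. (\<lambda>y. q n y (g n y)) \<in> borel_measurable M" "\<And>n. (\<lambda>y. q n y (k y)) \<in> borel_measurable M"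
      "q' \<in> borel_measurable M"
    and bound: "\<And>n. AE y in M. \<forall>v v'. \<bar>q n y v - q n y v'\<bar> \<le> L * (norm (h y) + norm v + norm v') * norm (v - v')"
    and zero: "\<And>n. AE y in M. q n y 0 = 0"
    and lim: "AE y in M. (\<lambda>n. q n y (k y)) \<longlonglongrightarrow> q' y"
  shows "(\<lambda>n. LINT y|M. q n y (g n y)) \<longlonglongrightarrow> (LINT y|M. q' y)"
proof -
  let ?d = "\<lambda>n y. g n y - k y"
  have sd: "sq_int M (?d n)" for n by (intro sq_int_diff g)
  have i3: "integrable M (\<lambda>y. L * (norm (h y) * norm (x y) + norm (v y) * norm (x y) + norm (v' y) * norm (x y)))"
    if "sq_int M x" "sq_int M v" "sq_int M v'" for x v v' :: "'a \<Rightarrow> 'b"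
    by (intro integrable_mult_right Bochner_Integration.integrable_add integrable_norm_mult that h)
  have ik: "integrable M (\<lambda>y. q n y (k y))" for n
  proof (rule Bochner_Integration.integrable_bound[OF i3[OF g(2) g(2) sq_int_0] m(2)])
    show "AE y in M. norm (q n y (k y)) \<le> norm (L * (norm (h y) * norm (k y) + norm (k y) * norm (k y) + norm (0::'b) * norm (k y)))"
      using bound[of n] zero[of n]
    proof eventually_elim
      case (elim y)
      have "\<bar>q n y (k y)\<bar> \<le> L * (norm (h y) + norm (k y) + norm (0::'b)) * norm (k y)"
        using elim(1)[rule_format, of "k y" 0] elim(2) by simp
      then show ?case by (simp add: algebra_simps)
    qed
  qed
  have id: "integrable M (\<lambda>y. L * (norm (h y) * norm (?d n y) + norm (g n y) * norm (?d n y) + norm (k y) * norm (?d n y)))" for n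
    by (rule i3[OF sd g(1,2)])
  have dAE: "AE y in M. norm (q n y (g n y) - q n y (k y)) \<le> L * (norm (h y) * norm (?d n y) + norm (g n y) * norm (?d n y) + norm (k y) * norm (?d n y))" for n
    using bound[of n]
  proof eventually_elim
    case (elim y)
    show ?case using elim[rule_format, of "g n y" "k y"] by (simp add: algebra_simps)
  qed
  have idf: "integrable M (\<lambda>y. q n y (g n y) - q n y (k y))" for n
  proof (rule Bochner_Integration.integrable_bound[OF id[of n]])
    show "AE y in M. norm (q n y (g n y) - q n y (k y)) \<le> norm (L * (norm (h y) * norm (?d n y) + norm (g n y) * norm (?d n y) + norm (k y) * norm (?d n y)))"
      using dAE[of n]
    proof eventually_elim
      case (elim y)
      show ?case by (rule order_trans[OF elim]) (simp only: real_norm_def abs_ge_self)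
    qed
  qed (intro borel_measurable_diff m)
  have "(\<lambda>n. LINT y|M. q n y (g n y) - q n y (k y)) \<longlonglongrightarrow> 0"
  proof (rule tendsto_zero_bound)
    show "norm (LINT y|M. q n y (g n y) - q n y (k y)) \<le> L * ((l2 M h + l2 M (g n) + l2 M k) * l2 M (?d n))" for n
    proof -
      have "norm (LINT y|M. q n y (g n y) - q n y (k y)) \<le> (LINT y|M. norm (q n y (g n y) - q n y (k y)))"
        by (rule integral_norm_bound)
      also have "\<dots> \<le> (LINT y|M. L * (norm (h y) * norm (?d n y) + norm (g n y) * norm (?d n y) + norm (k y) * norm (?d n y)))"
        by (rule integral_mono_AE[OF integrable_norm[OF idf] id dAE])
      also have "\<dots> = L * ((LINT y|M. norm (h y) * norm (?d n y)) + (LINT y|M. norm (g n y) * norm (?d n y)) + (LINT y|M. norm (k y) * norm (?d n y)))"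
        using integrable_norm_mult[OF h sd[of n]] integrable_norm_mult[OF g(1)[of n] sd[of n]] integrable_norm_mult[OF g(2) sd[of n]]
        by simp
      also have "\<dots> \<le> L * (l2 M h * l2 M (?d n) + l2 M (g n) * l2 M (?d n) + l2 M k * l2 M (?d n))"
        by (intro mult_left_mono[OF _ L] add_mono integral_norm_mult_le h g sd)
      finally show ?thesis by (simp only: distrib_right)
    qed
    have "(\<lambda>n. L * ((l2 M h + l2 M (g n) + l2 M k) * l2 M (?d n))) \<longlonglongrightarrow> L * ((l2 M h + l2 M k + l2 M k) * 0)"
      by (intro tendsto_mult tendsto_add tendsto_const tendsto_l2[OF g] g(3))
    then show "(\<lambda>n. L * ((l2 M h + l2 M (g n) + l2 M k) * l2 M (?d n))) \<longlonglongrightarrow> 0" by simp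
  qed
  moreover have "(\<lambda>n. LINT y|M. q n y (k y)) \<longlonglongrightarrow> (LINT y|M. q' y)"
  proof (rule integral_dominated_convergence[OF m(3,2) i3[OF g(2) g(2) sq_int_0] lim])
    show "AE y in M. norm (q n y (k y)) \<le> L * (norm (h y) * norm (k y) + norm (k y) * norm (k y) + norm (0::'b) * norm (k y))" for n
      using bound[of n] zero[of n]
    proof eventually_elim
      case (elim y)
      have "\<bar>q n y (k y)\<bar> \<le> L * (norm (h y) + norm (k y) + norm (0::'b)) * norm (k y)"
        using elim(1)[rule_format, of "k y" 0] elim(2) by simp
      then show ?case by (simp add: algebra_simps)
    qed
  qed
  ultimately have "(\<lambda>n. (LINT y|M. q n y (g n y) - q n y (k y)) + (LINT y|M. q n y (k y))) \<longlonglongrightarrow> 0 + (LINT y|M. q' y)"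
    by (rule tendsto_add)
  moreover have "(LINT y|M. q n y (g n y) - q n y (k y)) + (LINT y|M. q n y (k y)) = (LINT y|M. q n y (g n y))" for n
    using Bochner_Integration.integral_add[OF idf[of n] ik[of n]] by simp
  ultimately show ?thesis by simp
qed

section \<open>Blow up of the terms that contain the adjoint state\<close>

locale perturbation_adjoint = perturbation +
  fixes p0 :: "'a \<Rightarrow> real" and P0 :: 'a
  assumes p0: "p0 \<in> H1_0 D" and p0_C1: "p0 \<in> C1_closure (ball 0 \<delta>)" and P0: "P0 = grad p0 0"
    and p0_Linf: "wgrad D p0 \<in> Linf D"
begin

definition P :: "'a \<Rightarrow> 'a" where "P = grad_rep D \<delta> p0"

lemmas P_props = grad_rep_properties[OF D(1) \<delta> p0 p0_C1, folded P_def]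

lemma sq_int_P: "sq_int lebesgue P"
  by (rule sq_int_extend[OF zero_trace_sq_int(2)[OF P_props(1)]]) (rule P_props(5))

lemma P_bounded: obtains B where "B \<ge> 0" "AE x in lebesgue. norm (P x) \<le> B"
proof -
  obtain B where B: "AE x in lebesgue_on D. norm (wgrad D p0 x) \<le> B"
    using p0_Linf unfolding Linf_def by blast
  have "AE x in lebesgue_on D. norm (P x) \<le> \<bar>B\<bar>"
    using B P_props(6) by eventually_elim simp
  then have "AE x in lebesgue. x \<in> D \<longrightarrow> norm (P x) \<le> \<bar>B\<bar>"
    using mD by (subst (asm) AE_restrict_space_iff) auto
  then have "AE x in lebesgue. norm (P x) \<le> \<bar>B\<bar>"
  proof eventually_elim
    case (elim x)
    then show ?case using P_props(5)[of x] by (cases "x \<in> D") auto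
  qed
  then show thesis by (intro that[of "\<bar>B\<bar>"]) auto
qed

lemma measurable_blow_up:
  fixes F :: "'a \<Rightarrow> real"
  shows "F \<in> borel_measurable lebesgue \<Longrightarrow> (\<lambda>y. F (e n *\<^sub>R y)) \<in> borel_measurable lebesgue"
  using borel_measurable_affine[of "e n" F 0] e(1)[of n] by simp

lemma shrinking: "(\<lambda>n. e n *\<^sub>R (y::'a)) \<longlonglongrightarrow> 0"
  using tendsto_scaleR[OF e(3) tendsto_const[of y]] by simp

lemma U_shrinking: "(\<lambda>n. U (e n *\<^sub>R y)) \<longlonglongrightarrow> U0"
  using isCont_tendsto_compose[OF U_props(2) shrinking[of y]] U_props(3) U0 by simp

lemma P_shrinking: "(\<lambda>n. P (e n *\<^sub>R y)) \<longlonglongrightarrow> P0"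
  using isCont_tendsto_compose[OF P_props(2) shrinking[of y]] P_props(3) P0 by simp

lemma flux_tendsto:
  assumes "admissible_flux c1 c2 c3 A" "X \<longlonglongrightarrow> x"
  shows "(\<lambda>n. A (X n)) \<longlonglongrightarrow> A x"
  by (rule isCont_tendsto_compose[OF has_derivative_continuous[OF flux_has_derivative[OF assms(1)]] assms(2)])

lemma integral_blow_up:
  fixes F :: "'a \<Rightarrow> real"
  assumes "integrable lebesgue F"
  shows "(LINT y|lebesgue. F (e n *\<^sub>R y)) = (LINT x|lebesgue. F x) / e n ^ DIM('a)"
proof -
  have "e n \<noteq> 0" "\<bar>e n\<bar> = e n" using e(1)[of n] by auto
  then show ?thesis
    using has_bochner_integral_affine[of "e n" F 0] assms
    by (simp add: has_bochner_integral_iff divide_inverse mult.commute)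
qed

lemma mem_S_scaled: "e n *\<^sub>R y \<in> S n \<longleftrightarrow> y \<in> \<omega>"
  using e(1)[of n] by (simp add: mem_S)

lemma integrable_jump: "integrable lebesgue (\<lambda>x. (if x \<in> S n then a1 (U x) - a2 (U x) else 0) \<bullet> P x)"
  by (rule integrable_inner_sq_int[OF sq_int_jump sq_int_P])

text \<open>After blow up the integrand lives on the fixed bounded set \<open>\<omega>\<close>, and
  continuity of \<open>U\<close> and \<open>P\<close> at the origin determines its pointwise
  limit.\<close>

lemma jump_limit:
  "(\<lambda>n. (LINT x|lebesgue. (if x \<in> S n then a1 (U x) - a2 (U x) else 0) \<bullet> P x) / e n ^ DIM('a))
    \<longlonglongrightarrow> measure lebesgue \<omega> * ((a1 U0 - a2 U0) \<bullet> P0)"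
proof -
  obtain M where M: "\<forall>x\<in>\<omega>. norm x \<le> M"
    using \<omega>(2) unfolding bounded_iff by blast
  \<comment> \<open>The bounds on \<open>U\<close> and \<open>P\<close> hold only in the ball of
    radius \<open>\<delta>\<close>, so domination starts once the rescaled inclusion fits into it;
    the limit is taken for the shifted sequence.\<close>
  obtain N where N: "\<And>n. n \<ge> N \<Longrightarrow> e n * M < \<delta>"
    using eventually_small[OF \<delta>(1), of M] unfolding eventually_sequentially by blast
  obtain B1 where B1: "\<forall>x\<in>ball 0 \<delta>. norm (U x) \<le> B1" using U_props(4) by blast
  obtain B2 where B2: "\<forall>x\<in>ball 0 \<delta>. norm (P x) \<le> B2" using P_props(4) by blast
  define C where "C = norm (a1 0 - a2 0) + c2 * B1 + c2 * B1"
  have m\<omega>: "\<omega> \<in> sets lebesgue" by (rule open_in_lebesgue[OF \<omega>(1)])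
  define F where "F n y = (if y \<in> \<omega> then (a1 (U (e n *\<^sub>R y)) - a2 (U (e n *\<^sub>R y))) \<bullet> P (e n *\<^sub>R y) else 0)" for n y
  have F: "F n y = (if e n *\<^sub>R y \<in> S n then a1 (U (e n *\<^sub>R y)) - a2 (U (e n *\<^sub>R y)) else 0) \<bullet> P (e n *\<^sub>R y)" for n y
    by (simp add: F_def mem_S_scaled)
  have mF: "F n \<in> borel_measurable lebesgue" for n
    unfolding F[abs_def] by (rule measurable_blow_up[OF borel_measurable_integrable[OF integrable_jump[of n]]])
  have bound: "norm (F (n + N) y) \<le> (if y \<in> \<omega> then C * B2 else 0)" for n y
  proof (cases "y \<in> \<omega>")
    case True
    let ?x = "e (n + N) *\<^sub>R y"
    have "norm ?x \<le> e (n + N) * M"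
      using M True e(1)[of "n + N"] by simp
    also have "\<dots> < \<delta>" by (rule N) simp
    finally have x: "?x \<in> ball 0 \<delta>" by simp
    have U: "norm (U ?x) \<le> B1" and P: "norm (P ?x) \<le> B2" using B1 B2 x by blast+
    have "norm (a1 (U ?x) - a2 (U ?x)) = norm ((a1 0 - a2 0) + (a1 (U ?x) - a1 0) + (a2 0 - a2 (U ?x)))" by simp
    also have "\<dots> \<le> norm (a1 0 - a2 0) + norm (a1 (U ?x) - a1 0) + norm (a2 0 - a2 (U ?x))"
      by (intro norm_triangle_le add_mono order_refl)
    also have "\<dots> \<le> norm (a1 0 - a2 0) + c2 * norm (U ?x) + c2 * norm (U ?x)"
      using flux_lipschitz[OF fluxes(1), of "U ?x" 0] flux_lipschitz[OF fluxes(2), of 0 "U ?x"]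
      by (intro add_mono order_refl) simp_all
    also have "\<dots> \<le> norm (a1 0 - a2 0) + c2 * B1 + c2 * B1"
      using U c(2) by (intro add_mono order_refl mult_left_mono) auto
    finally have n1: "norm (a1 (U ?x) - a2 (U ?x)) \<le> C" by (simp only: C_def)
    have "\<bar>(a1 (U ?x) - a2 (U ?x)) \<bullet> P ?x\<bar> \<le> norm (a1 (U ?x) - a2 (U ?x)) * norm (P ?x)"
      by (rule Cauchy_Schwarz_ineq2)
    also have "\<dots> \<le> C * B2"
      by (intro mult_mono n1 P) (use order_trans[OF norm_ge_zero n1] in auto)
    finally show ?thesis using True by (simp add: F_def)
  qed (simp add: F_def)
  have "(\<lambda>n. LINT y|lebesgue. F (n + N) y) \<longlonglongrightarrow> (LINT y|lebesgue. (if y \<in> \<omega> then (a1 U0 - a2 U0) \<bullet> P0 else 0))"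
  proof (rule integral_dominated_convergence[OF _ mF])
    have ind: "integrable lebesgue (\<lambda>y. if y \<in> \<omega> then c else 0)" for c :: real
      using sq_int_imp_integrable[OF sq_int_const_on[OF \<omega>(2) m\<omega>] \<omega>(2) m\<omega>]
      unfolding Lebesgue_Measure.integrable_restrict_UNIV[OF m\<omega>] .
    show "integrable lebesgue (\<lambda>y. if y \<in> \<omega> then C * B2 else 0)" by (rule ind)
    show "(\<lambda>y. if y \<in> \<omega> then (a1 U0 - a2 U0) \<bullet> P0 else 0) \<in> borel_measurable lebesgue"
      by (rule borel_measurable_integrable[OF ind])
    show "AE y in lebesgue. (\<lambda>n. F (n + N) y) \<longlonglongrightarrow> (if y \<in> \<omega> then (a1 U0 - a2 U0) \<bullet> P0 else 0)"
    proof (rule AE_I2)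
      fix y
      have "(\<lambda>n. F n y) \<longlonglongrightarrow> (if y \<in> \<omega> then (a1 U0 - a2 U0) \<bullet> P0 else 0)"
      proof (cases "y \<in> \<omega>")
        case True
        have "(\<lambda>n. (a1 (U (e n *\<^sub>R y)) - a2 (U (e n *\<^sub>R y))) \<bullet> P (e n *\<^sub>R y)) \<longlonglongrightarrow> (a1 U0 - a2 U0) \<bullet> P0"
          by (rule tendsto_inner[OF tendsto_diff[OF flux_tendsto[OF fluxes(1) U_shrinking] flux_tendsto[OF fluxes(2) U_shrinking]] P_shrinking])
        with True show ?thesis by (simp add: F_def)
      qed (simp add: F_def)
      then show "(\<lambda>n. F (n + N) y) \<longlonglongrightarrow> (if y \<in> \<omega> then (a1 U0 - a2 U0) \<bullet> P0 else 0)"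
        by (rule LIMSEQ_ignore_initial_segment)
    qed
    show "AE y in lebesgue. norm (F (n + N) y) \<le> (if y \<in> \<omega> then C * B2 else 0)" for n
      by (intro AE_I2 bound)
  qed
  then have "(\<lambda>n. LINT y|lebesgue. F n y) \<longlonglongrightarrow> (LINT y|lebesgue. (if y \<in> \<omega> then (a1 U0 - a2 U0) \<bullet> P0 else 0))"
    by (rule LIMSEQ_offset)
  moreover have "(LINT y|lebesgue. (if y \<in> \<omega> then (a1 U0 - a2 U0) \<bullet> P0 else 0)) = measure lebesgue \<omega> * ((a1 U0 - a2 U0) \<bullet> P0)"
    unfolding Lebesgue_Measure.integral_restrict_UNIV[OF m\<omega>] using m\<omega> by (simp add: measure_restrict_space)
  moreover have "(LINT y|lebesgue. F n y) = (LINT x|lebesgue. (if x \<in> S n then a1 (U x) - a2 (U x) else 0) \<bullet> P x) / e n ^ DIM('a)" for n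
    unfolding F by (rule integral_blow_up[OF integrable_jump])
  ultimately show ?thesis by simp
qed

text \<open>What the adjoint equation leaves of the flux terms. The derivative is taken for
  \<open>\<Omega>\<close>, the set to which \<open>p0\<close> belongs, and not for
  \<open>\<Omega> \<union> S n\<close>; on \<open>S n\<close> this leaves a term linear in
  \<open>z\<close>, the origin of the second integral in the limit.\<close>

definition T :: "nat \<Rightarrow> 'a \<Rightarrow> 'a \<Rightarrow> real" where
  "T n x z = (flux a1 a2 (\<Omega> \<union> S n) x (U x + z) - flux a1 a2 (\<Omega> \<union> S n) x (U x) - flux_deriv a1 a2 \<Omega> x (U x) z) \<bullet> P x"

lemma T_eq:
  "T n x z = remainder (flux a1 a2 (\<Omega> \<union> S n) x) (U x) z \<bullet> P x
    + (if x \<in> S n then (frechet_derivative a1 (at (U x)) z - frechet_derivative a2 (at (U x)) z) \<bullet> P x else 0)"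
proof -
  have "flux_deriv a1 a2 (\<Omega> \<union> S n) x (U x) z - flux_deriv a1 a2 \<Omega> x (U x) z
      = (if x \<in> S n then frechet_derivative a1 (at (U x)) z - frechet_derivative a2 (at (U x)) z else 0)"
    using S_\<Omega>[of x n] by (simp add: flux_deriv_eq)
  then have *: "flux_deriv a1 a2 \<Omega> x (U x) z = flux_deriv a1 a2 (\<Omega> \<union> S n) x (U x) z
      - (if x \<in> S n then frechet_derivative a1 (at (U x)) z - frechet_derivative a2 (at (U x)) z else 0)"
    by (simp add: algebra_simps)
  show ?thesis
    unfolding T_def * remainder_def flux_deriv_eq_frechet[symmetric] by (simp add: inner_diff_left)
qed

text \<open>The Taylor remainder gives the growth in \<open>z\<close> and \<open>z'\<close>, the
  linear jump the indicator of \<open>S n\<close>. A pointwise bound on \<open>P\<close> is used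
  because two square integrable factors already exhaust the integrability.\<close>

lemma T_lipschitz:
  assumes B: "norm (P x) \<le> B"
  shows "\<bar>T n x z - T n x z'\<bar> \<le> B * (c3 + 2 * c2) * (norm (if x \<in> S n then 1 else (0::real)) + norm z + norm z') * norm (z - z')"
proof -
  let ?R = "remainder (flux a1 a2 (\<Omega> \<union> S n) x) (U x)"
  let ?A = "\<lambda>z. if x \<in> S n then frechet_derivative a1 (at (U x)) z - frechet_derivative a2 (at (U x)) z else 0"
  let ?s = "if x \<in> S n then 1 else (0::real)"
  have "T n x z - T n x z' = ((?R z - ?R z') + (?A z - ?A z')) \<bullet> P x"
    by (simp add: T_eq inner_diff_left inner_add_left)
  then have "\<bar>T n x z - T n x z'\<bar> = \<bar>((?R z - ?R z') + (?A z - ?A z')) \<bullet> P x\<bar>"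
    by (rule arg_cong)
  also have "\<dots> \<le> norm ((?R z - ?R z') + (?A z - ?A z')) * norm (P x)"
    by (rule Cauchy_Schwarz_ineq2)
  also have "\<dots> \<le> ((c3 * (norm z + norm z') + 2 * c2 * ?s) * norm (z - z')) * B"
  proof (rule mult_mono[OF _ B])
    have r: "norm (?R z - ?R z') \<le> c3 * (norm z + norm z') * norm (z - z')"
      by (rule remainder_diff_bound[OF admissible_flux_flux[OF fluxes] less_imp_le[OF c(3)]])
    have lin: "frechet_derivative a (at y) z - frechet_derivative a (at y) z' = frechet_derivative a (at y) (z - z')"
      if "admissible_flux c1 c2 c3 a" for a :: "'a \<Rightarrow> 'a" and y
      by (rule linear_diff[OF bounded_linear.linear[OF flux_deriv_linear[OF that]], symmetric])
    have "norm (?A z - ?A z') \<le> 2 * c2 * ?s * norm (z - z')"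
    proof (cases "x \<in> S n")
      case True
      then have "?A z - ?A z' = (frechet_derivative a1 (at (U x)) z - frechet_derivative a1 (at (U x)) z')
          - (frechet_derivative a2 (at (U x)) z - frechet_derivative a2 (at (U x)) z')"
        by simp
      also have "\<dots> = frechet_derivative a1 (at (U x)) (z - z') - frechet_derivative a2 (at (U x)) (z - z')"
        by (simp only: lin[OF fluxes(1)] lin[OF fluxes(2)])
      also have "norm \<dots> \<le> norm (frechet_derivative a1 (at (U x)) (z - z')) + norm (frechet_derivative a2 (at (U x)) (z - z'))"
        by (rule norm_triangle_ineq4)
      also have "\<dots> \<le> c2 * norm (z - z') + c2 * norm (z - z')"
        by (intro add_mono flux_deriv_bound[OF fluxes(1)] flux_deriv_bound[OF fluxes(2)])
      finally show ?thesis using True by simp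
    qed simp
    with r show "norm ((?R z - ?R z') + (?A z - ?A z')) \<le> (c3 * (norm z + norm z') + 2 * c2 * ?s) * norm (z - z')"
      unfolding distrib_right by (intro norm_triangle_le add_mono)
  qed (use c in auto)
  also have "\<dots> \<le> (((c3 + 2 * c2) * (norm ?s + norm z + norm z')) * norm (z - z')) * B"
  proof (rule mult_right_mono[OF mult_right_mono])
    have nz: "0 \<le> norm z + norm z'" by simp
    have "c3 * (norm z + norm z') + 2 * c2 * ?s \<le> (c3 + 2 * c2) * (norm z + norm z') + (c3 + 2 * c2) * ?s"
      using c nz by (intro add_mono mult_right_mono) auto
    also have "\<dots> = (c3 + 2 * c2) * (norm ?s + norm z + norm z')"
      by (simp add: distrib_left)
    finally show "c3 * (norm z + norm z') + 2 * c2 * ?s \<le> (c3 + 2 * c2) * (norm ?s + norm z + norm z')" .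
  qed (use order_trans[OF norm_ge_zero B] in auto)
  also have "\<dots> = B * (c3 + 2 * c2) * (norm ?s + norm z + norm z') * norm (z - z')"
    by (simp only: mult.assoc mult.commute mult.left_commute)
  finally show ?thesis .
qed

lemma T_0: "T n x 0 = 0"
  using linear_0[OF bounded_linear.linear[OF flux_deriv_linear[OF admissible_flux_flux[OF fluxes, of \<Omega> x]]]]
  by (simp add: T_def flux_deriv_eq_frechet)

lemma measurable_T: "V \<in> borel_measurable lebesgue \<Longrightarrow> (\<lambda>x. T n x (V x)) \<in> borel_measurable lebesgue"
proof -
  assume V: "V \<in> borel_measurable lebesgue"
  note mU = sq_intD(1)[OF sq_int_U]
  have "(\<lambda>x. flux_deriv a1 a2 \<Omega> x (U x) (V x)) \<in> borel_measurable lebesgue"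
    by (rule measurable_flux_deriv2[OF fluxes _ mU V]) (use open_in_lebesgue[OF \<Omega>(1)] in simp)
  then show ?thesis
    unfolding T_def
    by (intro borel_measurable_inner borel_measurable_diff measurable_flux_leb m\<Omega>S borel_measurable_add mU V sq_intD(1)[OF sq_int_P])
qed

text \<open>The integrand of the first two integrals in the limit, with the integral over
  \<open>s\<close> already evaluated as a Taylor remainder.\<close>

definition limit_density :: "'a \<Rightarrow> real" where
  "limit_density y = remainder (flux a1 a2 \<omega> y) U0 (k y) \<bullet> P0
    + (if y \<in> \<omega> then (frechet_derivative a1 (at U0) (k y) - frechet_derivative a2 (at U0) (k y)) \<bullet> P0 else 0)"

text \<open>For fixed \<open>y\<close> the points \<open>e n *\<^sub>R y\<close> tend to the origin
  and so leave \<open>\<Omega>\<close> from some index on, depending on \<open>y\<close>. From then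
  on the perturbed flux at that point is the one of \<open>\<omega>\<close> at
  \<open>y\<close>.\<close>

lemma T_limit: "(\<lambda>n. T n (e n *\<^sub>R y) (k y)) \<longlonglongrightarrow> limit_density y"
proof -
  define A where "A = flux a1 a2 \<omega> y"
  have A: "admissible_flux c1 c2 c3 A" unfolding A_def by (rule admissible_flux_flux[OF fluxes])
  obtain r where r: "r > 0" "\<And>x. norm x < r \<Longrightarrow> x \<notin> \<Omega>" by (rule far_from_\<Omega>) blast
  let ?G = "\<lambda>n. (A (U (e n *\<^sub>R y) + k y) - A (U (e n *\<^sub>R y)) - frechet_derivative A (at (U (e n *\<^sub>R y))) (k y)) \<bullet> P (e n *\<^sub>R y)
    + (if y \<in> \<omega> then (frechet_derivative a1 (at (U (e n *\<^sub>R y))) (k y) - frechet_derivative a2 (at (U (e n *\<^sub>R y))) (k y)) \<bullet> P (e n *\<^sub>R y) else 0)"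
  have "eventually (\<lambda>n. e n * norm y < r) sequentially" by (rule eventually_small[OF r(1)])
  then have ev: "eventually (\<lambda>n. ?G n = T n (e n *\<^sub>R y) (k y)) sequentially"
  proof eventually_elim
    case (elim n)
    have "e n *\<^sub>R y \<notin> \<Omega>" using r(2)[of "e n *\<^sub>R y"] elim e(1)[of n] by simp
    then have "flux a1 a2 (\<Omega> \<union> S n) (e n *\<^sub>R y) = A"
      by (simp add: A_def flux_def fun_eq_iff mem_S_scaled)
    then show ?case by (simp add: T_eq mem_S_scaled remainder_def)
  qed
  have 1: "(\<lambda>n. (A (U (e n *\<^sub>R y) + k y) - A (U (e n *\<^sub>R y)) - frechet_derivative A (at (U (e n *\<^sub>R y))) (k y)) \<bullet> P (e n *\<^sub>R y))
      \<longlonglongrightarrow> remainder A U0 (k y) \<bullet> P0"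
    unfolding remainder_def
    by (rule tendsto_inner[OF tendsto_diff[OF tendsto_diff[OF flux_tendsto[OF A tendsto_add[OF U_shrinking tendsto_const]]
        flux_tendsto[OF A U_shrinking]] flux_deriv_tendsto[OF A U_shrinking]] P_shrinking])
  have 2: "(\<lambda>n. if y \<in> \<omega> then (frechet_derivative a1 (at (U (e n *\<^sub>R y))) (k y) - frechet_derivative a2 (at (U (e n *\<^sub>R y))) (k y)) \<bullet> P (e n *\<^sub>R y) else 0)
      \<longlonglongrightarrow> (if y \<in> \<omega> then (frechet_derivative a1 (at U0) (k y) - frechet_derivative a2 (at U0) (k y)) \<bullet> P0 else 0)"
  proof (cases "y \<in> \<omega>")
    case True
    have "(\<lambda>n. (frechet_derivative a1 (at (U (e n *\<^sub>R y))) (k y) - frechet_derivative a2 (at (U (e n *\<^sub>R y))) (k y)) \<bullet> P (e n *\<^sub>R y))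
        \<longlonglongrightarrow> (frechet_derivative a1 (at U0) (k y) - frechet_derivative a2 (at U0) (k y)) \<bullet> P0"
      by (rule tendsto_inner[OF tendsto_diff[OF flux_deriv_tendsto[OF fluxes(1) U_shrinking] flux_deriv_tendsto[OF fluxes(2) U_shrinking]] P_shrinking])
    with True show ?thesis by simp
  qed simp
  have "?G \<longlonglongrightarrow> limit_density y"
    unfolding limit_density_def A_def[symmetric] by (rule tendsto_add[OF 1 2])
  then show ?thesis using ev by (rule Lim_transform_eventually)
qed

lemma integrable_remainder: "integrable lebesgue (\<lambda>y. remainder (flux a1 a2 \<omega> y) U0 (k y) \<bullet> P0)"
proof (rule Bochner_Integration.integrable_bound)
  note m\<omega> = open_in_lebesgue[OF \<omega>(1)]
  note mk = sq_intD(1)[OF sq_int_k]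
  show "integrable lebesgue (\<lambda>y. c3 * (norm (k y))\<^sup>2 * norm P0)"
    by (intro integrable_mult_left integrable_mult_right sq_intD(2)[OF sq_int_k])
  show "(\<lambda>y. remainder (flux a1 a2 \<omega> y) U0 (k y) \<bullet> P0) \<in> borel_measurable lebesgue"
    unfolding remainder_def flux_deriv_eq_frechet[symmetric]
    by (intro borel_measurable_inner borel_measurable_diff measurable_flux_leb m\<omega> borel_measurable_add borel_measurable_const mk
        measurable_flux_deriv2[OF fluxes]) (use m\<omega> in simp)
  show "AE y in lebesgue. norm (remainder (flux a1 a2 \<omega> y) U0 (k y) \<bullet> P0) \<le> norm (c3 * (norm (k y))\<^sup>2 * norm P0)"
  proof (rule AE_I2)
    fix y
    have "\<bar>remainder (flux a1 a2 \<omega> y) U0 (k y) \<bullet> P0\<bar> \<le> norm (remainder (flux a1 a2 \<omega> y) U0 (k y)) * norm P0"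
      by (rule Cauchy_Schwarz_ineq2)
    also have "\<dots> \<le> c3 * (norm (k y))\<^sup>2 * norm P0"
      using c(3) by (intro mult_right_mono remainder_bound[OF admissible_flux_flux[OF fluxes]]) auto
    finally show "norm (remainder (flux a1 a2 \<omega> y) U0 (k y) \<bullet> P0) \<le> norm (c3 * (norm (k y))\<^sup>2 * norm P0)"
      using order_trans[OF _ abs_ge_self] by simp
  qed
qed

lemma integrable_deriv_jump:
  "integrable lebesgue (\<lambda>y. if y \<in> \<omega> then (frechet_derivative a1 (at U0) (k y) - frechet_derivative a2 (at U0) (k y)) \<bullet> P0 else 0)"
proof -
  note m\<omega> = open_in_lebesgue[OF \<omega>(1)]
  have "integrable (lebesgue_on \<omega>) k"
    by (rule sq_int_imp_integrable[OF sq_int_restrict[OF sq_int_k m\<omega>] \<omega>(2) m\<omega>])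
  then have "integrable (lebesgue_on \<omega>) (\<lambda>y. (frechet_derivative a1 (at U0) (k y) - frechet_derivative a2 (at U0) (k y)) \<bullet> P0)"
    by (intro integrable_inner_left Bochner_Integration.integrable_diff
        integrable_bounded_linear[OF flux_deriv_linear[OF fluxes(1)]] integrable_bounded_linear[OF flux_deriv_linear[OF fluxes(2)]])
  then show ?thesis unfolding Lebesgue_Measure.integrable_restrict_UNIV[OF m\<omega>] .
qed

lemma remainder_limit:
  "(\<lambda>n. (LINT x|lebesgue. T n x (W n x)) / e n ^ DIM('a)) \<longlonglongrightarrow> (LINT y|lebesgue. limit_density y)"
  "integrable lebesgue (\<lambda>x. T n x (W n x))"
proof -
  obtain B where B: "B \<ge> 0" "AE x in lebesgue. norm (P x) \<le> B" by (rule P_bounded)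
  note m\<omega> = open_in_lebesgue[OF \<omega>(1)]
  let ?h = "\<lambda>y. if y \<in> \<omega> then 1 else (0::real)"
  have sh: "sq_int lebesgue ?h" by (rule sq_int_indicator[OF \<omega>(2) m\<omega>])
  define L where "L = B * (c3 + 2 * c2)"
  have L: "L \<ge> 0" using B c by (simp add: L_def)
  have Be: "AE y in lebesgue. norm (P (e n *\<^sub>R y)) \<le> B" for n
    using AE_lebesgue_affine[of "e n" "\<lambda>x. norm (P x) \<le> B" 0] B(2) e(1)[of n] by simp
  have en0: "e n \<noteq> 0" for n using e(1)[of n] by simp
  have "(\<lambda>n. LINT y|lebesgue. T n (e n *\<^sub>R y) (W n (e n *\<^sub>R y))) \<longlonglongrightarrow> (LINT y|lebesgue. limit_density y)"
  proof (rule integral_nonlinear_tendsto[where q="\<lambda>n y z. T n (e n *\<^sub>R y) z", OF _ sq_int_k W_converges sh L])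
    show "sq_int lebesgue (\<lambda>y. W n (e n *\<^sub>R y))" for n by (rule l2_blow_up(1)[OF sq_int_W])
    show "(\<lambda>y. T n (e n *\<^sub>R y) (W n (e n *\<^sub>R y))) \<in> borel_measurable lebesgue" for n
      by (rule measurable_blow_up[OF measurable_T[OF sq_intD(1)[OF sq_int_W[of n]], of n]])
    show "(\<lambda>y. T n (e n *\<^sub>R y) (k y)) \<in> borel_measurable lebesgue" for n
      using measurable_blow_up[OF measurable_T[OF sq_intD(1)[OF l2_rescale(1)[OF sq_int_k, of n]], of n], of n] en0[of n] by simp
    show "limit_density \<in> borel_measurable lebesgue"
      unfolding limit_density_def[abs_def]
      by (intro borel_measurable_add borel_measurable_integrable integrable_remainder integrable_deriv_jump)
    show "AE y in lebesgue. \<forall>z z'. \<bar>T n (e n *\<^sub>R y) z - T n (e n *\<^sub>R y) z'\<bar> \<le> L * (norm (?h y) + norm z + norm z') * norm (z - z')" for n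
      using Be[of n]
    proof eventually_elim
      case (elim y)
      show ?case using T_lipschitz[OF elim, of n] unfolding mem_S_scaled L_def by blast
    qed
    show "AE y in lebesgue. T n (e n *\<^sub>R y) 0 = 0" for n by (simp add: T_0)
    show "AE y in lebesgue. (\<lambda>n. T n (e n *\<^sub>R y) (k y)) \<longlonglongrightarrow> limit_density y" by (intro AE_I2 T_limit)
  qed
  moreover have int: "integrable lebesgue (\<lambda>x. T n x (W n x))" for n
  proof (rule Bochner_Integration.integrable_bound)
    let ?s = "\<lambda>x. if x \<in> S n then 1 else (0::real)"
    have ss: "sq_int lebesgue ?s" by (rule sq_int_indicator[OF S_bounded mS])
    show "integrable lebesgue (\<lambda>x. L * (norm (?s x) * norm (W n x) + norm (W n x) * norm (W n x)))"
      by (intro integrable_mult_right Bochner_Integration.integrable_add integrable_norm_mult ss sq_int_W)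
    show "(\<lambda>x. T n x (W n x)) \<in> borel_measurable lebesgue"
      by (rule measurable_T[OF sq_intD(1)[OF sq_int_W]])
    show "AE x in lebesgue. norm (T n x (W n x)) \<le> norm (L * (norm (?s x) * norm (W n x) + norm (W n x) * norm (W n x)))"
      using B(2)
    proof eventually_elim
      case (elim x)
      have "\<bar>T n x (W n x)\<bar> \<le> L * (norm (?s x) + norm (W n x) + norm (0::'a)) * norm (W n x)"
        using T_lipschitz[OF elim, of n "W n x" 0] by (simp add: T_0 L_def)
      also have "\<dots> = L * (norm (?s x) * norm (W n x) + norm (W n x) * norm (W n x))"
        by (simp add: algebra_simps)
      finally show ?case using order_trans[OF _ abs_ge_self] by simp
    qed
  qed
  ultimately show "(\<lambda>n. (LINT x|lebesgue. T n x (W n x)) / e n ^ DIM('a)) \<longlonglongrightarrow> (LINT y|lebesgue. limit_density y)"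
    by (simp add: integral_blow_up[OF int])
  show "integrable lebesgue (\<lambda>x. T n x (W n x))" by (rule int)
qed

lemma integrable_flux_deriv_P: "integrable lebesgue (\<lambda>x. flux_deriv a1 a2 \<Omega> x (U x) (W n x) \<bullet> P x)"
proof (rule Bochner_Integration.integrable_bound)
  show "integrable lebesgue (\<lambda>x. norm (c2 *\<^sub>R W n x) * norm (P x))"
    by (intro integrable_norm_mult sq_int_scaleR sq_int_W sq_int_P)
  have "(\<lambda>x. flux_deriv a1 a2 \<Omega> x (U x) (W n x)) \<in> borel_measurable lebesgue"
    by (rule measurable_flux_deriv2[OF fluxes _ sq_intD(1)[OF sq_int_U] sq_intD(1)[OF sq_int_W]])
       (use open_in_lebesgue[OF \<Omega>(1)] in simp)
  then show "(\<lambda>x. flux_deriv a1 a2 \<Omega> x (U x) (W n x) \<bullet> P x) \<in> borel_measurable lebesgue"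
    by (intro borel_measurable_inner sq_intD(1)[OF sq_int_P])
  show "AE x in lebesgue. norm (flux_deriv a1 a2 \<Omega> x (U x) (W n x) \<bullet> P x) \<le> norm (norm (c2 *\<^sub>R W n x) * norm (P x))"
  proof (rule AE_I2)
    fix x
    have "\<bar>flux_deriv a1 a2 \<Omega> x (U x) (W n x) \<bullet> P x\<bar> \<le> norm (flux_deriv a1 a2 \<Omega> x (U x) (W n x)) * norm (P x)"
      by (rule Cauchy_Schwarz_ineq2)
    also have "\<dots> \<le> (c2 * norm (W n x)) * norm (P x)"
      unfolding flux_deriv_eq_frechet by (intro mult_right_mono flux_deriv_bound[OF admissible_flux_flux[OF fluxes]]) simp
    finally show "norm (flux_deriv a1 a2 \<Omega> x (U x) (W n x) \<bullet> P x) \<le> norm (norm (c2 *\<^sub>R W n x) * norm (P x))"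
      using c(2) by simp
  qed
qed

lemma integral_on_D:
  fixes h :: "'a \<Rightarrow> 'a"
  shows "(LINT x|lebesgue_on D. h x \<bullet> P x) = (LINT x|lebesgue. h x \<bullet> P x)"
  by (rule integral_on_support[OF order_refl mD]) (simp add: P_props(5))

lemma adjoint_equation:
  assumes adj: "is_adjoint_state D ud a b a1 a2 \<Omega> u0 p0" and ud: "ud \<in> H1_0 D"
  shows "(LINT x|lebesgue. flux_deriv a1 a2 \<Omega> x (U x) (W n x) \<bullet> P x)
    = - 2 * a * (LINT x|lebesgue_on D. (u0 x - ud x) \<bullet> w n x) - 2 * b * (LINT x|lebesgue_on D. (U x - wgrad D ud x) \<bullet> W n x)"
proof -
  let ?M = "lebesgue_on D"
  have zd: "zero_trace D ud (wgrad D ud)" using ud H1_0_iff_zero_trace[OF D(1)] by blast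
  have zud: "zero_trace D (\<lambda>x. u0 x - ud x) (\<lambda>x. U x - wgrad D ud x)"
    using zero_trace_lincomb[OF mD U_zero_trace zd, of 1 "-1"] by simp
  note aeU = zero_trace_AE_wgrad[OF D(1) U_zero_trace] and aeW = zero_trace_AE_wgrad[OF D(1) W_zero_trace[of n]]
    and aeP = zero_trace_AE_wgrad[OF D(1) P_props(1)] and aed = zero_trace_AE_wgrad[OF D(1) zud]
  note m\<Omega> = flux_set_measurable[OF open_in_lebesgue[OF \<Omega>(1)] mD]
  have "w n \<in> H1_0 D" by (rule zero_traceD(1)[OF D(1) W_zero_trace])
  then have "(LINT x|?M. flux_deriv a1 a2 \<Omega> x (wgrad D u0 x) (wgrad D (w n) x) \<bullet> wgrad D p0 x)
        = - 2 * a * (LINT x|?M. (u0 x - ud x) * w n x)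
          - 2 * b * (LINT x|?M. wgrad D (\<lambda>x. u0 x - ud x) x \<bullet> wgrad D (w n) x)"
    using adj unfolding is_adjoint_state_def by blast
  moreover have "(LINT x|?M. flux_deriv a1 a2 \<Omega> x (wgrad D u0 x) (wgrad D (w n) x) \<bullet> wgrad D p0 x)
      = (LINT x|?M. flux_deriv a1 a2 \<Omega> x (U x) (W n x) \<bullet> P x)"
  proof (rule integral_cong_AE)
    show "(\<lambda>x. flux_deriv a1 a2 \<Omega> x (wgrad D u0 x) (wgrad D (w n) x) \<bullet> wgrad D p0 x) \<in> borel_measurable ?M"
      by (intro borel_measurable_inner measurable_flux_deriv2[OF fluxes m\<Omega>] aeU(2) aeW(2) aeP(2))
    show "(\<lambda>x. flux_deriv a1 a2 \<Omega> x (U x) (W n x) \<bullet> P x) \<in> borel_measurable ?M"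
      by (intro borel_measurable_inner measurable_flux_deriv2[OF fluxes m\<Omega>] aeU(3) aeW(3) aeP(3))
    show "AE x in ?M. flux_deriv a1 a2 \<Omega> x (wgrad D u0 x) (wgrad D (w n) x) \<bullet> wgrad D p0 x
        = flux_deriv a1 a2 \<Omega> x (U x) (W n x) \<bullet> P x"
      using aeU(1) aeW(1) aeP(1) by eventually_elim simp
  qed
  moreover have "(LINT x|?M. wgrad D (\<lambda>x. u0 x - ud x) x \<bullet> wgrad D (w n) x) = (LINT x|?M. (U x - wgrad D ud x) \<bullet> W n x)"
  proof (rule integral_cong_AE)
    show "AE x in ?M. wgrad D (\<lambda>x. u0 x - ud x) x \<bullet> wgrad D (w n) x = (U x - wgrad D ud x) \<bullet> W n x"
      using aed(1) aeW(1) by eventually_elim simp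
  qed (intro borel_measurable_inner aed aeW)+
  ultimately show ?thesis
    unfolding integral_on_D by simp
qed

text \<open>The cost is quadratic, so its expansion around \<open>u0\<close> is exact. The linear
  terms are those of the adjoint equation tested with \<open>w n\<close>, and subtracting that
  equation turns the difference of fluxes into \<open>T\<close>.\<close>

lemma Lagrangian_difference:
  assumes adj: "is_adjoint_state D ud a b a1 a2 \<Omega> u0 p0" and ud: "ud \<in> H1_0 D"
  shows "Lagrangian D f ud a b a1 a2 \<Omega> \<omega> (e n) (v n) p0 - Lagrangian D f ud a b a1 a2 \<Omega> \<omega> (e n) u0 p0
    = a * (l2 (lebesgue_on D) (w n))\<^sup>2 + b * (l2 lebesgue (W n))\<^sup>2 + (LINT x|lebesgue. T n x (W n x))"
proof -
  let ?M = "lebesgue_on D" and ?A = "\<Omega> \<union> S n"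
  have zd: "zero_trace D ud (wgrad D ud)" using ud H1_0_iff_zero_trace[OF D(1)] by blast
  note sq = zero_trace_sq_int[OF U_zero_trace] zero_trace_sq_int[OF W_zero_trace[of n]] zero_trace_sq_int[OF zd]
    zero_trace_sq_int[OF P_props(1)] zero_trace_sq_int[OF UW_zero_trace[of n]]
  have d1: "sq_int ?M (\<lambda>x. u0 x - ud x)" and d2: "sq_int ?M (\<lambda>x. U x - wgrad D ud x)"
    by (intro sq_int_diff sq)+
  have c1: "(l2 ?M (\<lambda>x. v n x - ud x))\<^sup>2
      = (l2 ?M (\<lambda>x. u0 x - ud x))\<^sup>2 + 2 * (LINT x|?M. (u0 x - ud x) \<bullet> w n x) + (l2 ?M (w n))\<^sup>2"
    using l2_square_add[OF d1 sq(3)] by (simp add: w_def)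
  have c2: "(l2 ?M (\<lambda>x. U x + W n x - wgrad D ud x))\<^sup>2
      = (l2 ?M (\<lambda>x. U x - wgrad D ud x))\<^sup>2 + 2 * (LINT x|?M. (U x - wgrad D ud x) \<bullet> W n x) + (l2 ?M (W n))\<^sup>2"
    using l2_square_add[OF d2 sq(4)] by (simp add: algebra_simps)
  have lW: "l2 ?M (W n) = l2 lebesgue (W n)"
  proof -
    have "(\<lambda>x. if x \<in> D then W n x else 0) = W n" by (rule ext) (simp add: W_outside)
    then show ?thesis by (simp add: l2_on_eq[OF mD])
  qed
  have i: "integrable lebesgue (\<lambda>x. (flux a1 a2 ?A x (U x + W n x) - flux a1 a2 ?A x (U x)) \<bullet> P x)"
    by (intro integrable_inner_sq_int sq_int_P sq_int_flux_diff m\<Omega>S borel_measurable_add sq_intD(1)[OF sq_int_U] sq_intD(1)[OF sq_int_W])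
       (use sq_int_W in simp)
  have "(LINT x|lebesgue. T n x (W n x)) = (LINT x|lebesgue. (flux a1 a2 ?A x (U x + W n x) - flux a1 a2 ?A x (U x)) \<bullet> P x)
      - (LINT x|lebesgue. flux_deriv a1 a2 \<Omega> x (U x) (W n x) \<bullet> P x)"
    unfolding T_def inner_diff_left[of _ "flux_deriv a1 a2 \<Omega> _ _ _"]
    by (rule Bochner_Integration.integral_diff[OF i integrable_flux_deriv_P])
  moreover have "(LINT x|lebesgue. (flux a1 a2 ?A x (U x + W n x) - flux a1 a2 ?A x (U x)) \<bullet> P x)
      = (LINT x|?M. (flux a1 a2 ?A x (U x + W n x) - flux a1 a2 ?A x (U x)) \<bullet> P x)"
    by (rule integral_on_D[symmetric])
  moreover have "(LINT x|?M. (flux a1 a2 ?A x (U x + W n x) - flux a1 a2 ?A x (U x)) \<bullet> P x)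
      = (LINT x|?M. flux a1 a2 ?A x (U x + W n x) \<bullet> P x) - (LINT x|?M. flux a1 a2 ?A x (U x) \<bullet> P x)"
    unfolding inner_diff_left
    by (rule Bochner_Integration.integral_diff) (intro integrable_inner_sq_int sq_int_flux[OF fluxes D(2) mD m\<Omega>S] sq)+
  ultimately have T: "(LINT x|?M. flux a1 a2 ?A x (U x + W n x) \<bullet> P x) - (LINT x|?M. flux a1 a2 ?A x (U x) \<bullet> P x)
      = (LINT x|lebesgue. T n x (W n x)) + (LINT x|lebesgue. flux_deriv a1 a2 \<Omega> x (U x) (W n x) \<bullet> P x)" by simp
  have mA: "perturbed \<Omega> \<omega> (e n) \<in> sets lebesgue" unfolding perturbed_eq by (rule m\<Omega>S)
  have "Lagrangian D f ud a b a1 a2 \<Omega> \<omega> (e n) (v n) p0 - Lagrangian D f ud a b a1 a2 \<Omega> \<omega> (e n) u0 p0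
      = (cost D ud a b (v n) - cost D ud a b u0)
      + ((LINT x|?M. flux a1 a2 ?A x (U x + W n x) \<bullet> P x) - (LINT x|?M. flux a1 a2 ?A x (U x) \<bullet> P x))"
    unfolding Lagrangian_eq[OF D(1) fluxes mA UW_zero_trace zd P_props(1)] Lagrangian_eq[OF D(1) fluxes mA U_zero_trace zd P_props(1)]
      perturbed_eq by simp
  also have "\<dots> = a * (l2 ?M (w n))\<^sup>2 + b * (l2 lebesgue (W n))\<^sup>2 + (LINT x|lebesgue. T n x (W n x))"
    unfolding T adjoint_equation[OF adj ud] cost_eq[OF D(1) UW_zero_trace zd] cost_eq[OF D(1) U_zero_trace zd] c1 c2 lW
    by (simp add: algebra_simps)
  finally show ?thesis .
qed

section \<open>Limits of the difference quotients of the Lagrangian\<close>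

lemma vol_eq: "vol \<omega> (e n) = e n ^ DIM('a) * measure lebesgue \<omega>"
  unfolding vol_def scaled_def using measure_lebesgue_affine[of "e n" 0 \<omega>] e(1)[of n] by simp

lemma Lagrangian_difference_limit:
  assumes adj: "is_adjoint_state D ud a b a1 a2 \<Omega> u0 p0" and ud: "ud \<in> H1_0 D"
  shows "(\<lambda>n. (Lagrangian D f ud a b a1 a2 \<Omega> \<omega> (e n) (v n) p0 - Lagrangian D f ud a b a1 a2 \<Omega> \<omega> (e n) u0 p0) / vol \<omega> (e n))
    \<longlonglongrightarrow> (b * (l2 lebesgue k)\<^sup>2 + (LINT y|lebesgue. limit_density y)) / measure lebesgue \<omega>"
proof -
  have \<nu>2: "(\<nu> n)\<^sup>2 = e n ^ DIM('a)" for n using e(1)[of n] by (simp add: \<nu>_def)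
  have "(\<lambda>n. l2 lebesgue (\<lambda>y. W n (e n *\<^sub>R y))) \<longlonglongrightarrow> l2 lebesgue k"
    by (rule tendsto_l2[OF l2_blow_up(1)[OF sq_int_W] sq_int_k W_converges])
  then have W: "(\<lambda>n. l2 lebesgue (W n) / \<nu> n) \<longlonglongrightarrow> l2 lebesgue k"
    unfolding l2_blow_up(2)[OF sq_int_W] .
  have "(\<lambda>n. (a * (l2 (lebesgue_on D) (w n) / \<nu> n)\<^sup>2 + b * (l2 lebesgue (W n) / \<nu> n)\<^sup>2
      + (LINT x|lebesgue. T n x (W n x)) / e n ^ DIM('a)) * (1 / measure lebesgue \<omega>))
      \<longlonglongrightarrow> (a * 0\<^sup>2 + b * (l2 lebesgue k)\<^sup>2 + (LINT y|lebesgue. limit_density y)) * (1 / measure lebesgue \<omega>)"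
    by (intro tendsto_mult tendsto_add tendsto_power tendsto_const w_converges W remainder_limit(1))
  moreover have "(a * (l2 (lebesgue_on D) (w n) / \<nu> n)\<^sup>2 + b * (l2 lebesgue (W n) / \<nu> n)\<^sup>2
      + (LINT x|lebesgue. T n x (W n x)) / e n ^ DIM('a)) * (1 / measure lebesgue \<omega>)
      = (Lagrangian D f ud a b a1 a2 \<Omega> \<omega> (e n) (v n) p0 - Lagrangian D f ud a b a1 a2 \<Omega> \<omega> (e n) u0 p0) / vol \<omega> (e n)" for n
    unfolding Lagrangian_difference[OF adj ud] vol_eq power_divide \<nu>2 by (simp add: add_divide_distrib)
  ultimately show ?thesis by simp
qed

lemma Lagrangian_jump:
  assumes ud: "ud \<in> H1_0 D"
  shows "Lagrangian D f ud a b a1 a2 \<Omega> \<omega> (e n) u0 p0 - Lagrangian D f ud a b a1 a2 \<Omega> \<omega> 0 u0 p0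
    = (LINT x|lebesgue. (if x \<in> S n then a1 (U x) - a2 (U x) else 0) \<bullet> P x)"
proof -
  let ?M = "lebesgue_on D"
  have zd: "zero_trace D ud (wgrad D ud)" using ud H1_0_iff_zero_trace[OF D(1)] by blast
  note m\<Omega> = open_in_lebesgue[OF \<Omega>(1)]
  note sq = zero_trace_sq_int[OF U_zero_trace] zero_trace_sq_int[OF P_props(1)]
  have mA: "perturbed \<Omega> \<omega> (e n) \<in> sets lebesgue" unfolding perturbed_eq by (rule m\<Omega>S)
  have p0: "perturbed \<Omega> \<omega> 0 = \<Omega>" by (simp add: perturbed_def)
  have m0: "perturbed \<Omega> \<omega> 0 \<in> sets lebesgue" unfolding p0 by (rule m\<Omega>)
  have "Lagrangian D f ud a b a1 a2 \<Omega> \<omega> (e n) u0 p0 - Lagrangian D f ud a b a1 a2 \<Omega> \<omega> 0 u0 p0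
      = (LINT x|?M. flux a1 a2 (\<Omega> \<union> S n) x (U x) \<bullet> P x) - (LINT x|?M. flux a1 a2 \<Omega> x (U x) \<bullet> P x)"
    unfolding Lagrangian_eq[OF D(1) fluxes mA U_zero_trace zd P_props(1)] Lagrangian_eq[OF D(1) fluxes m0 U_zero_trace zd P_props(1)]
      perturbed_eq p0 by simp
  also have "\<dots> = (LINT x|?M. (flux a1 a2 (\<Omega> \<union> S n) x (U x) - flux a1 a2 \<Omega> x (U x)) \<bullet> P x)"
    unfolding inner_diff_left
    by (rule Bochner_Integration.integral_diff[symmetric])
       (intro integrable_inner_sq_int sq_int_flux[OF fluxes D(2) mD] m\<Omega>S m\<Omega> sq)+
  also have "(\<lambda>x. flux a1 a2 (\<Omega> \<union> S n) x (U x) - flux a1 a2 \<Omega> x (U x)) = (\<lambda>x. if x \<in> S n then a1 (U x) - a2 (U x) else 0)"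
    using S_\<Omega>[of _ n] by (auto simp: flux_def fun_eq_iff)
  finally show ?thesis unfolding integral_on_D .
qed

lemma measure_\<omega>_pos: "measure lebesgue \<omega> > 0"
proof -
  have "\<not> negligible \<omega>" by (rule open_not_negligible) (use \<omega> in auto)
  moreover have "\<omega> \<in> lmeasurable"
    by (rule bounded_set_imp_lmeasurable[OF \<omega>(2) open_in_lebesgue[OF \<omega>(1)]])
  ultimately have "measure lebesgue \<omega> \<noteq> 0"
    by (simp add: negligible_iff_measure)
  then show ?thesis using measure_nonneg[of lebesgue \<omega>] by linarith
qed

lemma Lagrangian_jump_limit:
  assumes ud: "ud \<in> H1_0 D"
  shows "(\<lambda>n. (Lagrangian D f ud a b a1 a2 \<Omega> \<omega> (e n) u0 p0 - Lagrangian D f ud a b a1 a2 \<Omega> \<omega> 0 u0 p0) / vol \<omega> (e n))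
    \<longlonglongrightarrow> (a1 U0 - a2 U0) \<bullet> P0"
proof -
  have "(\<lambda>n. (LINT x|lebesgue. (if x \<in> S n then a1 (U x) - a2 (U x) else 0) \<bullet> P x) / e n ^ DIM('a) / measure lebesgue \<omega>)
      \<longlonglongrightarrow> measure lebesgue \<omega> * ((a1 U0 - a2 U0) \<bullet> P0) / measure lebesgue \<omega>"
    by (intro tendsto_divide jump_limit tendsto_const) (use measure_\<omega>_pos in simp)
  then show ?thesis
    unfolding Lagrangian_jump[OF ud] vol_eq using measure_\<omega>_pos by simp
qed

text \<open>With the perturbed state in the second slot the terms containing the multiplier cancel
  by the state equation, so \<open>p\<close> and \<open>p0\<close> give the same value; the averaged
  adjoint equation carries this value from \<open>v n\<close> to \<open>u0\<close>.\<close>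

lemma averaged_difference_eq:
  assumes ud: "ud \<in> H1_0 D"
    and p: "is_averaged_adjoint D (Lagrangian D f ud a b a1 a2 \<Omega> \<omega>) (e n) u0 (v n) p"
  shows "Lagrangian D f ud a b a1 a2 \<Omega> \<omega> (e n) u0 p = Lagrangian D f ud a b a1 a2 \<Omega> \<omega> (e n) (v n) p0"
    and "Lagrangian D f ud a b a1 a2 \<Omega> \<omega> (e n) (v n) p0 = cost D ud a b (v n)"
proof -
  have zd: "zero_trace D ud (wgrad D ud)" using ud H1_0_iff_zero_trace[OF D(1)] by blast
  have mA: "perturbed \<Omega> \<omega> (e n) \<in> sets lebesgue" unfolding perturbed_eq by (rule m\<Omega>S)
  have state: "Lagrangian D f ud a b a1 a2 \<Omega> \<omega> (e n) (v n) q = cost D ud a b (v n)" if "q \<in> H1_0 D" for q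
  proof -
    have zq: "zero_trace D q (wgrad D q)" using that H1_0_iff_zero_trace[OF D(1)] by blast
    show ?thesis
      unfolding Lagrangian_eq[OF D(1) fluxes mA UW_zero_trace zd zq]
      using is_state_eq[OF D(1) fluxes mA v[of n] UW_zero_trace zq] by simp
  qed
  have "p \<in> H1_0 D" using p by (simp add: is_averaged_adjoint_def)
  then show "Lagrangian D f ud a b a1 a2 \<Omega> \<omega> (e n) u0 p = Lagrangian D f ud a b a1 a2 \<Omega> \<omega> (e n) (v n) p0"
    using averaged_adjoint_identity[OF refl D fluxes mA ud u0_H v_H p] state p0 by simp
  show "Lagrangian D f ud a b a1 a2 \<Omega> \<omega> (e n) (v n) p0 = cost D ud a b (v n)"
    by (rule state[OF p0])
qed

lemma Lagrangian_at_0: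
  assumes ud: "ud \<in> H1_0 D"
  shows "Lagrangian D f ud a b a1 a2 \<Omega> \<omega> 0 u0 p0 = cost D ud a b u0"
proof -
  have zd: "zero_trace D ud (wgrad D ud)" using ud H1_0_iff_zero_trace[OF D(1)] by blast
  note m\<Omega> = open_in_lebesgue[OF \<Omega>(1)]
  have p0: "perturbed \<Omega> \<omega> 0 = \<Omega>" by (simp add: perturbed_def)
  have m0: "perturbed \<Omega> \<omega> 0 \<in> sets lebesgue" unfolding p0 by (rule m\<Omega>)
  show ?thesis
    unfolding Lagrangian_eq[OF D(1) fluxes m0 U_zero_trace zd P_props(1)]
    unfolding p0 using is_state_eq[OF D(1) fluxes m\<Omega> u0 U_zero_trace P_props(1)] by simp
qed

text \<open>The integral form of the first order Taylor remainder along the segment from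
  \<open>x\<close> to \<open>x + z\<close>. It translates the computed limit into the double
  integral of the theorem.\<close>

lemma integral_remainder:
  assumes A: "admissible_flux c1 c2 c3 A"
  shows "(LINT s|lebesgue_on {0..1}. (frechet_derivative A (at (s *\<^sub>R z + x)) z - frechet_derivative A (at x) z) \<bullet> P0)
    = remainder A x z \<bullet> P0"
proof -
  let ?F = "\<lambda>s. A (x + s *\<^sub>R z) \<bullet> P0 - s * (frechet_derivative A (at x) z \<bullet> P0)"
  have "(LINT s|lebesgue_on {0..1}. (frechet_derivative A (at (s *\<^sub>R z + x)) z - frechet_derivative A (at x) z) \<bullet> P0) = ?F 1 - ?F 0"
  proof (rule integral_FTC_unit)
    fix s :: real
    have "((\<lambda>s. A (x + s *\<^sub>R z)) has_derivative (\<lambda>t. t *\<^sub>R frechet_derivative A (at (x + s *\<^sub>R z)) z)) (at s)"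
      using flux_line_deriv[OF A, of x z s] by (simp add: has_vector_derivative_def)
    from has_derivative_inner_left[OF this, of P0]
    have "((\<lambda>s. A (x + s *\<^sub>R z) \<bullet> P0) has_real_derivative frechet_derivative A (at (x + s *\<^sub>R z)) z \<bullet> P0) (at s)"
      by (simp add: has_field_derivative_def mult_commute_abs)
    moreover have "((\<lambda>s. s * (frechet_derivative A (at x) z \<bullet> P0)) has_real_derivative frechet_derivative A (at x) z \<bullet> P0) (at s)"
      by (auto intro!: derivative_eq_intros)
    ultimately have "(?F has_real_derivative frechet_derivative A (at (x + s *\<^sub>R z)) z \<bullet> P0 - frechet_derivative A (at x) z \<bullet> P0) (at s)"
      by (rule DERIV_diff)
    then show "(?F has_real_derivative (frechet_derivative A (at (s *\<^sub>R z + x)) z - frechet_derivative A (at x) z) \<bullet> P0) (at s)"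
      by (simp add: inner_diff_left add.commute)
    show "isCont (\<lambda>s. (frechet_derivative A (at (s *\<^sub>R z + x)) z - frechet_derivative A (at x) z) \<bullet> P0) s"
      unfolding isCont_def
      by (intro tendsto_inner tendsto_diff tendsto_const flux_deriv_tendsto[OF A] tendsto_intros)
  qed
  then show ?thesis by (simp add: remainder_def inner_diff_left)
qed

lemma integral_limit_density:
  "(LINT y|lebesgue. limit_density y) =
    (LINT x|lebesgue. (LINT s|lebesgue_on {0..1}.
       (flux_deriv a1 a2 \<omega> x (s *\<^sub>R wgrad UNIV K x + U0) (wgrad UNIV K x) - flux_deriv a1 a2 \<omega> x U0 (wgrad UNIV K x)) \<bullet> P0))
    + (LINT x|lebesgue_on \<omega>. (frechet_derivative a1 (at U0) (wgrad UNIV K x) - frechet_derivative a2 (at U0) (wgrad UNIV K x)) \<bullet> P0)"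
  unfolding limit_density_def flux_deriv_eq_frechet integral_remainder[OF admissible_flux_flux[OF fluxes]] k_def[symmetric]
    Lebesgue_Measure.integral_restrict_UNIV[OF open_in_lebesgue[OF \<omega>(1)], symmetric]
  by (rule Bochner_Integration.integral_add[OF integrable_remainder integrable_deriv_jump])

end

text \<open>Dropping finitely many terms brings any positive null sequence below
  \<open>\<tau>\<close>, where states and averaged adjoints are given.\<close>

lemma tendsto_at_right_0_sequentiallyI:
  fixes \<phi> :: "real \<Rightarrow> real"
  assumes \<tau>: "\<tau> > 0"
    and *: "\<And>e. (\<And>n. 0 < e n) \<Longrightarrow> (\<And>n. e n \<le> \<tau>) \<Longrightarrow> e \<longlonglongrightarrow> 0 \<Longrightarrow> (\<lambda>n. \<phi> (e n)) \<longlonglongrightarrow> L"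
  shows "(\<phi> \<longlongrightarrow> L) (at_right 0)"
  unfolding tendsto_at_iff_sequentially comp_def
proof (intro allI impI)
  fix X :: "nat \<Rightarrow> real" assume X: "\<forall>i. X i \<in> {0<..} - {0}" "X \<longlonglongrightarrow> 0"
  obtain N where N: "\<And>n. n \<ge> N \<Longrightarrow> X n < \<tau>"
    using order_tendstoD(2)[OF X(2) \<tau>] unfolding eventually_sequentially by blast
  have "(\<lambda>n. \<phi> (X (n + N))) \<longlonglongrightarrow> L"
  proof (rule *)
    show "0 < X (n + N)" for n using X(1) by auto
    show "X (n + N) \<le> \<tau>" for n using N[of "n + N"] by simp
    show "(\<lambda>n. X (n + N)) \<longlonglongrightarrow> 0" by (rule LIMSEQ_ignore_initial_segment[OF X(2)])
  qed
  then show "(\<lambda>n. \<phi> (X n)) \<longlonglongrightarrow> L" by (rule LIMSEQ_offset)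
qed

theorem mainTheorem12:
  fixes D \<Omega> \<omega> :: "'a::euclidean_space set"
    and f ud u0 p0 K :: "'a \<Rightarrow> real"
    and u p :: "real \<Rightarrow> 'a \<Rightarrow> real"
    and a1 a2 :: "'a \<Rightarrow> 'a"
    and U0 P0 :: 'a
    and a b c1 c2 c3 \<tau> \<delta> \<alpha> :: real
    and G :: "real \<Rightarrow> ('a \<Rightarrow> real) \<Rightarrow> ('a \<Rightarrow> real) \<Rightarrow> real"
  assumes D: "open D" "bounded D"
    and f: "f \<in> L2 D"
    and ud: "ud \<in> H1_0 D"
    and \<Omega>: "open \<Omega>" "compactly_contained \<Omega> D" "0 \<in> D - closure \<Omega>"
    and \<omega>: "open \<omega>" "bounded \<omega>" "0 \<in> \<omega>"
    and \<tau>: "\<tau> > 0" "\<forall>\<epsilon>\<in>{0..\<tau>}. compactly_contained (scaled \<omega> \<epsilon>) (D - closure \<Omega>)"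
    and c: "c1 > 0" "c2 > 0" "c3 > 0"
    and fluxes: "admissible_flux c1 c2 c3 a1" "admissible_flux c1 c2 c3 a2"
    and ab: "a \<ge> 0" "b \<ge> 0"
    and u0: "is_state D f a1 a2 \<Omega> u0"
    and p0: "is_adjoint_state D ud a b a1 a2 \<Omega> u0 p0"
    and regularity: "\<delta> > 0" "cball 0 \<delta> \<subseteq> D" "0 < \<alpha>" "\<alpha> < 1"
      "u0 \<in> C1_Hoelder_closure \<alpha> (ball 0 \<delta>)" "p0 \<in> C1_closure (ball 0 \<delta>)"
      "wgrad D p0 \<in> Linf D"
    and U0: "U0 = grad u0 0"
    and P0: "P0 = grad p0 0"
    and K: "is_corrector a1 a2 \<omega> U0 K"
    and G: "G = Lagrangian D f ud a b a1 a2 \<Omega> \<omega>"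
    and u: "\<forall>\<epsilon>\<in>{0<..\<tau>}. is_state D f a1 a2 (perturbed \<Omega> \<omega> \<epsilon>) (u \<epsilon>)"
    and p: "\<forall>\<epsilon>\<in>{0<..\<tau>}. is_averaged_adjoint D G \<epsilon> u0 (u \<epsilon>) (p \<epsilon>)"
  shows "\<exists>dG R.
    ((\<lambda>\<epsilon>. (G \<epsilon> u0 p0 - G 0 u0 p0) / vol \<omega> \<epsilon>) \<longlongrightarrow> dG) (at_right 0) \<and>
    ((\<lambda>\<epsilon>. (G \<epsilon> u0 (p \<epsilon>) - G \<epsilon> u0 p0) / vol \<omega> \<epsilon>) \<longlongrightarrow> R) (at_right 0) \<and>
    has_topological_derivative (shape_cost D f ud a b a1 a2) \<Omega> \<omega> (dG + R) \<and>
    dG = (a1 U0 - a2 U0) \<bullet> P0 \<and>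
    R = 1 / measure lebesgue \<omega> *
          (LINT x|lebesgue. (LINT s|lebesgue_on {0..1}.
             (flux_deriv a1 a2 \<omega> x (s *\<^sub>R wgrad UNIV K x + U0) (wgrad UNIV K x)
              - flux_deriv a1 a2 \<omega> x U0 (wgrad UNIV K x)) \<bullet> P0))
      + 1 / measure lebesgue \<omega> *
          (LINT x|lebesgue_on \<omega>.
             (frechet_derivative a1 (at U0) (wgrad UNIV K x)
              - frechet_derivative a2 (at U0) (wgrad UNIV K x)) \<bullet> P0)
      + b / measure lebesgue \<omega> * (LINT x|lebesgue. (norm (wgrad UNIV K x))\<^sup>2)"
proof -
  let ?R = "(b * (l2 lebesgue (wgrad UNIV K))\<^sup>2 + ((LINT x|lebesgue. (LINT s|lebesgue_on {0..1}.
       (flux_deriv a1 a2 \<omega> x (s *\<^sub>R wgrad UNIV K x + U0) (wgrad UNIV K x) - flux_deriv a1 a2 \<omega> x U0 (wgrad UNIV K x)) \<bullet> P0))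
    + (LINT x|lebesgue_on \<omega>. (frechet_derivative a1 (at U0) (wgrad UNIV K x) - frechet_derivative a2 (at U0) (wgrad UNIV K x)) \<bullet> P0)))
    / measure lebesgue \<omega>"
  let ?dG = "(a1 U0 - a2 U0) \<bullet> P0"
  \<comment> \<open>All three limits are shown along an arbitrary positive null sequence below
    \<open>\<tau>\<close>, so that the locale can be interpreted with the states
    \<open>u (e n)\<close>.\<close>
  have seq: "(\<lambda>n. (G (e n) u0 p0 - G 0 u0 p0) / vol \<omega> (e n)) \<longlonglongrightarrow> ?dG"
    "(\<lambda>n. (G (e n) u0 (p (e n)) - G (e n) u0 p0) / vol \<omega> (e n)) \<longlonglongrightarrow> ?R"
    "(\<lambda>n. (shape_cost D f ud a b a1 a2 (\<Omega> \<union> scaled \<omega> (e n)) - shape_cost D f ud a b a1 a2 \<Omega>)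
        / measure lebesgue (scaled \<omega> (e n))) \<longlonglongrightarrow> ?dG + ?R"
    if e: "\<And>n. 0 < e n" "\<And>n. e n \<le> \<tau>" "e \<longlonglongrightarrow> 0" for e :: "nat \<Rightarrow> real"
  proof -
    have en: "e n \<in> {0<..\<tau>}" for n using e(1,2) by simp
    have st: "is_state D f a1 a2 (perturbed \<Omega> \<omega> (e n)) (u (e n))" for n using u en by blast
    interpret X: perturbation_adjoint where D = D and \<Omega> = \<Omega> and \<omega> = \<omega> and f = f and u0 = u0 and K = K
      and v = "\<lambda>n. u (e n)" and a1 = a1 and a2 = a2 and U0 = U0 and c1 = c1 and c2 = c2 and c3 = c3 and \<tau> = \<tau>
      and \<delta> = \<delta> and e = e and p0 = p0 and P0 = P0
    proof
      show "u0 \<in> C1_closure (ball 0 \<delta>)"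
        by (rule C1_Hoelder_closure_imp_C1_closure[OF regularity(5)])
      show "p0 \<in> H1_0 D" using p0 by (simp add: is_adjoint_state_def)
    qed (fact D \<Omega>(1) \<Omega>(3) \<omega> \<tau>(2) c fluxes u0 regularity(1,2,6,7) U0 K P0 e st)+
    have pn: "is_averaged_adjoint D (Lagrangian D f ud a b a1 a2 \<Omega> \<omega>) (e n) u0 (u (e n)) (p (e n))" for n
      using p en unfolding G by blast
    show 1: "(\<lambda>n. (G (e n) u0 p0 - G 0 u0 p0) / vol \<omega> (e n)) \<longlonglongrightarrow> ?dG"
      unfolding G by (rule X.Lagrangian_jump_limit[OF ud])
    show 2: "(\<lambda>n. (G (e n) u0 (p (e n)) - G (e n) u0 p0) / vol \<omega> (e n)) \<longlonglongrightarrow> ?R"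
      unfolding G X.averaged_difference_eq(1)[OF ud pn]
      by (rule X.Lagrangian_difference_limit[OF p0 ud, unfolded X.integral_limit_density X.k_def])
    \<comment> \<open>Since the perturbed cost equals \<open>G (e n) u0 (p (e n))\<close> exactly,
      the cost quotient is the sum of the two Lagrangian quotients, without an error term.\<close>
    have c1: "shape_cost D f ud a b a1 a2 (\<Omega> \<union> scaled \<omega> (e n)) = G (e n) u0 (p (e n))" for n
      unfolding G X.averaged_difference_eq[OF ud pn] X.S_def[symmetric]
      by (rule shape_cost_eq[OF D fluxes c(1) X.m\<Omega>S ud st[of n, unfolded X.perturbed_eq]])
    have c2: "shape_cost D f ud a b a1 a2 \<Omega> = G 0 u0 p0"
      unfolding G X.Lagrangian_at_0[OF ud]
      by (rule shape_cost_eq[OF D fluxes c(1) open_in_lebesgue[OF \<Omega>(1)] ud u0])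
    have "(\<lambda>n. (G (e n) u0 p0 - G 0 u0 p0) / vol \<omega> (e n) + (G (e n) u0 (p (e n)) - G (e n) u0 p0) / vol \<omega> (e n)) \<longlonglongrightarrow> ?dG + ?R"
      by (rule tendsto_add[OF 1 2])
    then show "(\<lambda>n. (shape_cost D f ud a b a1 a2 (\<Omega> \<union> scaled \<omega> (e n)) - shape_cost D f ud a b a1 a2 \<Omega>)
        / measure lebesgue (scaled \<omega> (e n))) \<longlonglongrightarrow> ?dG + ?R"
      unfolding c1 c2 vol_def[symmetric] add_divide_distrib[symmetric] by simp
  qed
  have "((\<lambda>\<epsilon>. (G \<epsilon> u0 p0 - G 0 u0 p0) / vol \<omega> \<epsilon>) \<longlongrightarrow> ?dG) (at_right 0)"
    by (rule tendsto_at_right_0_sequentiallyI[OF \<tau>(1)]) (rule seq(1))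
  moreover have "((\<lambda>\<epsilon>. (G \<epsilon> u0 (p \<epsilon>) - G \<epsilon> u0 p0) / vol \<omega> \<epsilon>) \<longlongrightarrow> ?R) (at_right 0)"
    by (rule tendsto_at_right_0_sequentiallyI[OF \<tau>(1)]) (rule seq(2))
  moreover have "has_topological_derivative (shape_cost D f ud a b a1 a2) \<Omega> \<omega> (?dG + ?R)"
    unfolding has_topological_derivative_def
    by (rule tendsto_at_right_0_sequentiallyI[OF \<tau>(1)]) (rule seq(3))
  ultimately show ?thesis
    by (intro exI[of _ ?dG] exI[of _ ?R] conjI) (simp_all add: l2_square add_divide_distrib)
qed

end
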